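(* Let $L$ be a one-dimensional mixed-type Kimura operator on $[0,1]$, let $0<\gamma<1$, and let $L_\gamma:C^{2+\gamma}([0,1])\to\alpha\cdot\mathcal D^\gamma([0,1])$ be the operator defined by $L$ between the Hölder-type spaces described in the context. Then $L_\gamma$ is a Fredholm operator and its index is $$\mathrm{ind}(L_\gamma)=\kappa^++\kappa^-,$$ where $\kappa^+$ and $\kappa^-$ are the number of positive $b_+$ and of negative $b_-$, respectively (that is, $\kappa^+\in\{0,1\}$ is $1$ if and only if $b_+>0$, and $\kappa^-\in\{0,1\}$ is $1$ if and only if $b_-<0$).
   Context: Operator. $L=a(x)x^{m(0)}(1-x)^{m(1)}\frac{d^2}{dx^2}+b(x)x^{m(0)-1}(1-x)^{m(1)-1}\frac{d}{dx}$ on $[0,1]$, with $a,b\in C^\infty([0,1])$, $a>0$, $m(i)\in\{1,2\}$. The endpoint $i$ is Kimura if $m(i)=1$ and quadratic if $m(i)=2$. At Kimura endpoints $b\frac{d}{dx}$ is inward pointing ($b(0)\ge0$, resp. $b(1)\le0$). A quadratic endpoint $0$ (resp. $1$) is neutral if $b(0)/a(0)=1$ (resp. $b(1)/a(1)=-1$). Heat coordinates. Fix an increasing coordinate $t$, $x=\phi(t)$, such that over $[0,1/3]$ the operator is $t\partial_t^2+b(t)\partial_t$ with $t=0$ at $x=0$ if $0$ is Kimura, and $\partial_t^2+b(t)\partial_t$ with $t\to-\infty$ at $x=0$ if $0$ is quadratic. Similarly, over $[2/3,1]$ it is $(1-t)\partial_t^2+b(t)\partial_t$ with $t=1$ at $x=1$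 if $1$ is Kimura, and $\partial_t^2+b(t)\partial_t$ with $t\to+\infty$ at $x=1$ if $1$ is quadratic. ($b(t)$ denotes the first-order coefficient in heat coordinates.) Set $b_-=\lim_{x\to0}b$ and $b_+=\lim_{x\to1}b$, limits of the first-order coefficient in heat coordinates. Local spaces. $|\cdot|_{k+\gamma,U}$ is the usual Hölder norm. At a quadratic left end, $U=(-\infty,c]$: - $f\in\mathcal D^\gamma(U)$ if $f\in C^0(U)$ extends continuously to $-\infty$ and the following norm is finite: $\|f\|_{\gamma,U}=|f|_{\gamma,U}+\sup_{z_1\le z_2\le c}|\int_{z_1}^{z_2}f\,dz|$ if the endpoint is not neutral, with the additional term $\sup_{z_1\le z_2\le c}|\int_{z_1}^{z_2}\int_{-\infty}^zf(s)\,ds\,dz|$ if it is neutral. - $f\in C^{2+\gamma}(U)$ if $f\in C^2(U)$, $f,\partial_zf,\partial_z^2f$ extend continuously to $-\infty$, and $\|f\|_{2+\gamma,U}=|f|_{2+\gamma,U}+\|\partial_z^2f\|_{\gamma,U}<\infty$. At a Kimura left end, $U=(0,c]$: - $f\in\mathcal D^\gamma(U)$ if $f\in C^0(U)$, $xf$ extends continuously to $x=0$, and $\|f\|_{\gamma,U}=|xf|_{\gamma,U}<\infty$. - $f\in C^{2+\gamma}(U)$ if $f\in C^1(\overline U)\cap C^2(U)$, $x\partial_x^2f$ extends continuously to $x=0$ with value $0$, and $\|f\|_{2+\gamma,U}=|f|_{\gamma,U}+|\partial_xf|_{\gamma,U}+|x\partial_x^2f|_{\gamma,U}<\infty$. Right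 ends are treated symmetrically. Global spaces. Let $W_0,W_1$ be neighborhoods of the two ends covering $[0,1/3]$, $[2/3,1]$, let $W_2\subset\subset(0,1)$ cover the rest, and let $\varphi_0,\varphi_1,\varphi_2$ be a subordinate partition of unity. $C^{2+\gamma}([0,1])$ consists of $f$ with $(\varphi_if)\circ\phi\in C^{2+\gamma}(W_i)$ for each $i$ (usual Hölder space for $i=2$), with norm $\sum_i\|(\varphi_if)\circ\phi\|_{2+\gamma,W_i}$. The target space $\alpha\cdot\mathcal D^\gamma([0,1])$ consists of functions $g$ such that, in heat coordinates, $g$ belongs to $\mathcal D^\gamma(U)$ near a quadratic end, $g$ equals the distance to the end ($t$, resp. $1-t$) times an element of $\mathcal D^\gamma(U)$ near a Kimura end, and $g$ is $C^\gamma$ in the interior. Here $\alpha$ is the weight vanishing to first order at Kimura ends and not vanishing at quadratic ends. Its norm is the corresponding sum over the partition of unity. Equivalently, it is $\tilde a\cdot\mathcal D^\gamma([0,1])$ with $\tilde a=a x^{m(0)}(1-x)^{m(1)}$, where $f\in\mathcal D^\gamma([0,1])$ means $(\phi')^2(\varphi_if)\circ\phi\in\mathcal D^\gamma(W_i)$ for each $i$ (usual $C^\gamma$ for $i=2$).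
   Formalization: At a quadratic end the space D^γ also requires the integral of f (and, if neutral, the iterated integral) to converge at −∞, not only to be bounded; otherwise the cokernel is infinite-dimensional. The position of a right Kimura end in heat coordinates is arbitrary rather than fixed at t=1. *)

theory Defs
  imports "HOL-Analysis.Analysis" "HOL-Library.Function_Algebras"
begin

section \<open>Fredholm operators between spaces of functions\<close>

text \<open>Pointwise real vector space structure on functions, so that \<open>subspace\<close>, \<open>span\<close>
  and \<open>dim\<close> apply to sets of functions.\<close>

instantiation "fun" :: (type, real_vector) real_vector
begin

definition scaleR_fun :: "real \<Rightarrow> ('a \<Rightarrow> 'b) \<Rightarrow> 'a \<Rightarrow> 'b" where
  "scaleR_fun c f = (\<lambda>x. c *\<^sub>R f x)"

instance
  by standard (auto simp: scaleR_fun_def plus_fun_def scaleR_add_right scaleR_add_left)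

end

text \<open>\<open>B\<close> represents a finite basis of the quotient space \<open>Y / R\<close>.\<close>

definition quotient_basis :: "'v::real_vector set \<Rightarrow> 'v set \<Rightarrow> 'v set \<Rightarrow> bool" where
  "quotient_basis Y R B \<longleftrightarrow>
     finite B \<and> B \<subseteq> Y \<and>
     (\<forall>u. (\<Sum>v\<in>B. u v *\<^sub>R v) \<in> R \<longrightarrow> (\<forall>v\<in>B. u v = 0)) \<and>
     (\<forall>y\<in>Y. \<exists>u. y - (\<Sum>v\<in>B. u v *\<^sub>R v) \<in> R)"

definition codimension :: "'v::real_vector set \<Rightarrow> 'v set \<Rightarrow> nat" where
  "codimension Y R = (THE n. \<exists>B. quotient_basis Y R B \<and> card B = n)"

definition ker_on :: "'v set \<Rightarrow> ('v \<Rightarrow> 'w::zero) \<Rightarrow> 'v set" where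
  "ker_on X T = {f \<in> X. T f = 0}"

text \<open>The normed spaces are subspaces \<open>X\<close>, \<open>Y\<close> together with functions \<open>nX\<close>, \<open>nY\<close> that are
  the norms there; these may take the value \<open>\<infinity>\<close> off \<open>X\<close>, \<open>Y\<close>.\<close>

definition fredholm ::
  "'v::real_vector set \<Rightarrow> ('v \<Rightarrow> ennreal) \<Rightarrow> 'w::real_vector set \<Rightarrow> ('w \<Rightarrow> ennreal) \<Rightarrow> ('v \<Rightarrow> 'w) \<Rightarrow> bool" where
  "fredholm X nX Y nY T \<longleftrightarrow>
     subspace X \<and> subspace Y \<and> T ` X \<subseteq> Y \<and>
     (\<forall>f\<in>X. \<forall>g\<in>X. T (f + g) = T f + T g) \<and>
     (\<forall>c. \<forall>f\<in>X. T (c *\<^sub>R f) = c *\<^sub>R T f) \<and>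
     (\<exists>C::real. \<forall>f\<in>X. nY (T f) \<le> ennreal C * nX f) \<and>
     (\<exists>B. finite B \<and> ker_on X T \<subseteq> span B) \<and>
     (\<forall>f g. (\<forall>n::nat. f n \<in> X) \<and> g \<in> Y \<and> (\<lambda>n. nY (T (f n) - g)) \<longlonglongrightarrow> 0 \<longrightarrow> g \<in> T ` X) \<and>
     (\<exists>B. quotient_basis Y (T ` X) B)"

definition fredholm_index :: "'v::real_vector set \<Rightarrow> 'w::real_vector set \<Rightarrow> ('v \<Rightarrow> 'w) \<Rightarrow> int" where
  "fredholm_index X Y T = int (dim (ker_on X T)) - int (codimension Y (T ` X))"

section \<open>Mixed-type Kimura operators and heat coordinates\<close>

text \<open>Derivatives are taken within \<open>S\<close>, hence one-sided at boundary points belonging to \<open>S\<close>.\<close>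

definition smooth_on :: "real set \<Rightarrow> (real \<Rightarrow> real) \<Rightarrow> bool" where
  "smooth_on S f \<longleftrightarrow> (\<exists>D :: nat \<Rightarrow> real \<Rightarrow> real. (\<forall>x\<in>S. D 0 x = f x) \<and>
     (\<forall>n. \<forall>x\<in>S. (D n has_real_derivative D (Suc n) x) (at x within S)))"

record kimura_op =
  coef_a :: "real \<Rightarrow> real"
  coef_b :: "real \<Rightarrow> real"
  ord0 :: nat
  ord1 :: nat

definition mixed_kimura :: "kimura_op \<Rightarrow> bool" where
  "mixed_kimura K \<longleftrightarrow>
     smooth_on {0..1} (coef_a K) \<and> smooth_on {0..1} (coef_b K) \<and>
     (\<forall>x\<in>{0..1}. coef_a K x > 0) \<and>
     ord0 K \<in> {1, 2} \<and> ord1 K \<in> {1, 2} \<and>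
     (ord0 K = 1 \<longrightarrow> coef_b K 0 \<ge> 0) \<and>
     (ord1 K = 1 \<longrightarrow> coef_b K 1 \<le> 0)"

definition neutral0 :: "kimura_op \<Rightarrow> bool" where
  "neutral0 K \<longleftrightarrow> ord0 K = 2 \<and> coef_b K 0 / coef_a K 0 = 1"

definition neutral1 :: "kimura_op \<Rightarrow> bool" where
  "neutral1 K \<longleftrightarrow> ord1 K = 2 \<and> coef_b K 1 / coef_a K 1 = -1"

definition second_coef :: "kimura_op \<Rightarrow> real \<Rightarrow> real" where
  "second_coef K x = coef_a K x * x ^ ord0 K * (1 - x) ^ ord1 K"

definition first_coef :: "kimura_op \<Rightarrow> real \<Rightarrow> real" where
  "first_coef K x = coef_b K x * x ^ (ord0 K - 1) * (1 - x) ^ (ord1 K - 1)"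

text \<open>An element of one of the global function spaces below is determined by its restriction to
  the open interval \<open>(0,1)\<close>; it is represented by this restriction, extended by \<open>0\<close> to the reals.\<close>

definition kimura_L :: "kimura_op \<Rightarrow> (real \<Rightarrow> real) \<Rightarrow> real \<Rightarrow> real" where
  "kimura_L K f = (\<lambda>x. if x \<in> {0<..<1}
     then second_coef K x * deriv (deriv f) x + first_coef K x * deriv f x else 0)"

text \<open>A coordinate \<open>x = \<phi> t\<close>. The number \<open>right_end\<close> is the value of \<open>t\<close> at \<open>x = 1\<close> if that
  endpoint is Kimura (otherwise it is not used); the usual normalisation is
  \<open>right_end = 1\<close>. It is kept free because if both endpoints are Kimura, the conditions at the
  two ends fix \<open>t\<close> on \<open>[0,1/3]\<close> and \<open>right_end - t\<close> on \<open>[2/3,1]\<close>, and these two pieces fit into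
  one increasing coordinate only if \<open>right_end\<close> is large enough (for \<open>\<epsilon> x (1 - x) \<partial>\<^sub>x\<^sup>2\<close> with
  small \<open>\<epsilon>\<close>, the value 1 is too small).\<close>

record heat_chart =
  phi :: "real \<Rightarrow> real"
  right_end :: real

definition heat_domain :: "kimura_op \<Rightarrow> heat_chart \<Rightarrow> real set" where
  "heat_domain K H = {t. (ord0 K = 1 \<longrightarrow> 0 < t) \<and> (ord1 K = 1 \<longrightarrow> t < right_end H)}"

definition heat_inv :: "kimura_op \<Rightarrow> heat_chart \<Rightarrow> real \<Rightarrow> real" where
  "heat_inv K H = the_inv_into (heat_domain K H) (phi H)"

text \<open>The coefficients of the operator in the coordinate \<open>t\<close>. By the chain rule,
  \<open>\<partial>\<^sub>x = (1/\<phi>') \<partial>\<^sub>t\<close> and \<open>\<partial>\<^sub>x\<^sup>2 = (1/\<phi>'\<^sup>2) \<partial>\<^sub>t\<^sup>2 - (\<phi>''/\<phi>'\<^sup>3) \<partial>\<^sub>t\<close>.\<close>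

definition heat_second :: "kimura_op \<Rightarrow> heat_chart \<Rightarrow> real \<Rightarrow> real" where
  "heat_second K H t = second_coef K (phi H t) / (deriv (phi H) t)\<^sup>2"

definition heat_first :: "kimura_op \<Rightarrow> heat_chart \<Rightarrow> real \<Rightarrow> real" where
  "heat_first K H t = first_coef K (phi H t) / deriv (phi H) t
     - second_coef K (phi H t) * deriv (deriv (phi H)) t / (deriv (phi H) t) ^ 3"

definition heat_coordinate :: "kimura_op \<Rightarrow> heat_chart \<Rightarrow> bool" where
  "heat_coordinate K H \<longleftrightarrow>
     smooth_on (heat_domain K H) (phi H) \<and>
     bij_betw (phi H) (heat_domain K H) {0<..<1} \<and>
     (\<forall>t\<in>heat_domain K H. deriv (phi H) t > 0) \<and>
     (\<forall>t\<in>heat_domain K H. phi H t \<le> 1/3 \<longrightarrow>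
        heat_second K H t = (if ord0 K = 1 then t else 1)) \<and>
     (\<forall>t\<in>heat_domain K H. phi H t \<ge> 2/3 \<longrightarrow>
        heat_second K H t = (if ord1 K = 1 then right_end H - t else 1))"

definition b_minus :: "kimura_op \<Rightarrow> heat_chart \<Rightarrow> real" where
  "b_minus K H = Lim (at_right 0) (\<lambda>x. heat_first K H (heat_inv K H x))"

definition b_plus :: "kimura_op \<Rightarrow> heat_chart \<Rightarrow> real" where
  "b_plus K H = Lim (at_left 1) (\<lambda>x. heat_first K H (heat_inv K H x))"

section \<open>Local spaces at a left end\<close>

definition sup_norm :: "real set \<Rightarrow> (real \<Rightarrow> real) \<Rightarrow> ennreal" where
  "sup_norm U f = (SUP z\<in>U. ennreal \<bar>f z\<bar>)"

definition holder_seminorm :: "real \<Rightarrow> real set \<Rightarrow> (real \<Rightarrow> real) \<Rightarrow> ennreal" where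
  "holder_seminorm \<gamma> U f = (SUP y\<in>U. SUP z\<in>U - {y}. ennreal (\<bar>f y - f z\<bar> / \<bar>y - z\<bar> powr \<gamma>))"

definition holder_norm :: "real \<Rightarrow> real set \<Rightarrow> (real \<Rightarrow> real) \<Rightarrow> ennreal" where
  "holder_norm \<gamma> U f = sup_norm U f + holder_seminorm \<gamma> U f"

definition deriv_on :: "real set \<Rightarrow> (real \<Rightarrow> real) \<Rightarrow> real \<Rightarrow> real" where
  "deriv_on U f = (\<lambda>z. vector_derivative f (at z within U))"

definition C2_on :: "real set \<Rightarrow> (real \<Rightarrow> real) \<Rightarrow> bool" where
  "C2_on U f \<longleftrightarrow> f differentiable_on U \<and> deriv_on U f differentiable_on U \<and>
     continuous_on U (deriv_on U (deriv_on U f))"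

definition holder2_norm :: "real \<Rightarrow> real set \<Rightarrow> (real \<Rightarrow> real) \<Rightarrow> ennreal" where
  "holder2_norm \<gamma> U f = sup_norm U f + sup_norm U (deriv_on U f)
     + holder_norm \<gamma> U (deriv_on U (deriv_on U f))"

text \<open>Quadratic end, \<open>U = {..c}\<close>; the flag \<open>nt\<close> says whether the end is neutral.\<close>

definition quad_D_norm :: "bool \<Rightarrow> real \<Rightarrow> real \<Rightarrow> (real \<Rightarrow> real) \<Rightarrow> ennreal" where
  "quad_D_norm nt \<gamma> c f = holder_norm \<gamma> {..c} f
     + (SUP z2\<in>{..c}. SUP z1\<in>{..z2}. ennreal \<bar>integral {z1..z2} f\<bar>)
     + (if nt then SUP z2\<in>{..c}. SUP z1\<in>{..z2}.
                     ennreal \<bar>integral {z1..z2} (\<lambda>z. integral {..z} f)\<bar>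
        else 0)"

text \<open>The bounds \<open>z1 \<le> z2\<close> in the norm range over the closed end \<open>[-\<infinity>,c]\<close>, so the integrals have to
  converge at \<open>-\<infinity>\<close> (for continuous functions, Henstock-Kurzweil integrability on \<open>{..c}\<close> is
  convergence of the improper integral); the value of the supremum is the same with \<open>z1\<close> finite.
  Bounded but divergent integrals must be excluded: near a nonneutral end
  \<open>g z = cos (ln \<bar>z\<bar>) / \<bar>z\<bar>\<close> has bounded integrals, but for \<open>b > 0\<close> no bounded solution of
  \<open>f'' + b f' = g\<close> extends continuously to \<open>-\<infinity>\<close>.\<close>

definition quad_D :: "bool \<Rightarrow> real \<Rightarrow> real \<Rightarrow> (real \<Rightarrow> real) \<Rightarrow> bool" where
  "quad_D nt \<gamma> c f \<longleftrightarrow>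
     continuous_on {..c} f \<and> (\<exists>l. (f \<longlongrightarrow> l) at_bot) \<and>
     f integrable_on {..c} \<and>
     (nt \<longrightarrow> (\<lambda>z. integral {..z} f) integrable_on {..c}) \<and>
     quad_D_norm nt \<gamma> c f < \<infinity>"

definition quad_C2_norm :: "bool \<Rightarrow> real \<Rightarrow> real \<Rightarrow> (real \<Rightarrow> real) \<Rightarrow> ennreal" where
  "quad_C2_norm nt \<gamma> c f = holder2_norm \<gamma> {..c} f
     + quad_D_norm nt \<gamma> c (deriv_on {..c} (deriv_on {..c} f))"

definition quad_C2 :: "bool \<Rightarrow> real \<Rightarrow> real \<Rightarrow> (real \<Rightarrow> real) \<Rightarrow> bool" where
  "quad_C2 nt \<gamma> c f \<longleftrightarrow>
     C2_on {..c} f \<and>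
     (\<exists>l. (f \<longlongrightarrow> l) at_bot) \<and>
     (\<exists>l. (deriv_on {..c} f \<longlongrightarrow> l) at_bot) \<and>
     (\<exists>l. (deriv_on {..c} (deriv_on {..c} f) \<longlongrightarrow> l) at_bot) \<and>
     quad_C2_norm nt \<gamma> c f < \<infinity>"

text \<open>Kimura end, \<open>U = {0<..c}\<close>.\<close>

definition kim_D_norm :: "real \<Rightarrow> real \<Rightarrow> (real \<Rightarrow> real) \<Rightarrow> ennreal" where
  "kim_D_norm \<gamma> c f = holder_norm \<gamma> {0<..c} (\<lambda>z. z * f z)"

definition kim_D :: "real \<Rightarrow> real \<Rightarrow> (real \<Rightarrow> real) \<Rightarrow> bool" where
  "kim_D \<gamma> c f \<longleftrightarrow>
     continuous_on {0<..c} f \<and> (\<exists>l. ((\<lambda>z. z * f z) \<longlongrightarrow> l) (at_right 0)) \<and> kim_D_norm \<gamma> c f < \<infinity>"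

definition kim_C2_norm :: "real \<Rightarrow> real \<Rightarrow> (real \<Rightarrow> real) \<Rightarrow> ennreal" where
  "kim_C2_norm \<gamma> c f = holder_norm \<gamma> {0<..c} f + holder_norm \<gamma> {0<..c} (deriv_on {0<..c} f)
     + holder_norm \<gamma> {0<..c} (\<lambda>z. z * deriv_on {0<..c} (deriv_on {0<..c} f) z)"

definition kim_C2 :: "real \<Rightarrow> real \<Rightarrow> (real \<Rightarrow> real) \<Rightarrow> bool" where
  "kim_C2 \<gamma> c f \<longleftrightarrow>
     C2_on {0<..c} f \<and>
     (\<exists>l. (f \<longlongrightarrow> l) (at_right 0)) \<and>
     (\<exists>l. (deriv_on {0<..c} f \<longlongrightarrow> l) (at_right 0)) \<and>
     ((\<lambda>z. z * deriv_on {0<..c} (deriv_on {0<..c} f) z) \<longlongrightarrow> 0) (at_right 0) \<and>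
     kim_C2_norm \<gamma> c f < \<infinity>"

text \<open>Domain and target at a left end with vanishing order \<open>m\<close>. At a Kimura end the target
  consists of the functions \<open>F = t h\<close> with \<open>h\<close> in the local space, and \<open>F\<close> has the norm of \<open>h\<close>.\<close>

definition end_C2 :: "nat \<Rightarrow> bool \<Rightarrow> real \<Rightarrow> real \<Rightarrow> (real \<Rightarrow> real) \<Rightarrow> bool" where
  "end_C2 m nt \<gamma> c F = (if m = 1 then kim_C2 \<gamma> c F else quad_C2 nt \<gamma> c F)"

definition end_C2_norm :: "nat \<Rightarrow> bool \<Rightarrow> real \<Rightarrow> real \<Rightarrow> (real \<Rightarrow> real) \<Rightarrow> ennreal" where
  "end_C2_norm m nt \<gamma> c F = (if m = 1 then kim_C2_norm \<gamma> c F else quad_C2_norm nt \<gamma> c F)"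

definition end_aD :: "nat \<Rightarrow> bool \<Rightarrow> real \<Rightarrow> real \<Rightarrow> (real \<Rightarrow> real) \<Rightarrow> bool" where
  "end_aD m nt \<gamma> c F = (if m = 1 then kim_D \<gamma> c (\<lambda>t. F t / t) else quad_D nt \<gamma> c F)"

definition end_aD_norm :: "nat \<Rightarrow> bool \<Rightarrow> real \<Rightarrow> real \<Rightarrow> (real \<Rightarrow> real) \<Rightarrow> ennreal" where
  "end_aD_norm m nt \<gamma> c F =
     (if m = 1 then kim_D_norm \<gamma> c (\<lambda>t. F t / t) else quad_D_norm nt \<gamma> c F)"

section \<open>Global spaces\<close>

text \<open>The cover of \<open>[0,1]\<close> by \<open>W\<^sub>0 = [0,cov_p0]\<close>, \<open>W\<^sub>1 = [cov_p1,1]\<close>, \<open>W\<^sub>2 = [cov_q0,cov_q1]\<close> with a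
  subordinate partition of unity.\<close>

record cover =
  cov_p0 :: real
  cov_p1 :: real
  cov_q0 :: real
  cov_q1 :: real
  chi0 :: "real \<Rightarrow> real"
  chi1 :: "real \<Rightarrow> real"
  chi2 :: "real \<Rightarrow> real"

definition partition_cover :: "cover \<Rightarrow> bool" where
  "partition_cover P \<longleftrightarrow>
     1/3 \<le> cov_p0 P \<and> cov_p0 P < 1 \<and> 0 < cov_p1 P \<and> cov_p1 P \<le> 2/3 \<and>
     0 < cov_q0 P \<and> cov_q0 P < cov_q1 P \<and> cov_q1 P < 1 \<and>
     {0..1} \<subseteq> {0..cov_p0 P} \<union> {cov_p1 P..1} \<union> {cov_q0 P..cov_q1 P} \<and>
     smooth_on {0..1} (chi0 P) \<and> smooth_on {0..1} (chi1 P) \<and> smooth_on {0..1} (chi2 P) \<and>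
     (\<forall>x\<in>{0..1}. 0 \<le> chi0 P x \<and> 0 \<le> chi1 P x \<and> 0 \<le> chi2 P x \<and>
                  chi0 P x + chi1 P x + chi2 P x = 1) \<and>
     (\<forall>x\<in>{0..1} - {0..cov_p0 P}. chi0 P x = 0) \<and>
     (\<forall>x\<in>{0..1} - {cov_p1 P..1}. chi1 P x = 0) \<and>
     (\<forall>x\<in>{0..1} - {cov_q0 P..cov_q1 P}. chi2 P x = 0)"

definition loc :: "heat_chart \<Rightarrow> (real \<Rightarrow> real) \<Rightarrow> (real \<Rightarrow> real) \<Rightarrow> real \<Rightarrow> real" where
  "loc H \<eta> f = (\<lambda>t. \<eta> (phi H t) * f (phi H t))"

text \<open>A right end is turned into a left end by the reflection \<open>t \<mapsto> right_end - t\<close> (Kimura) or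
  \<open>t \<mapsto> - t\<close> (quadratic).\<close>

definition refl_pt :: "kimura_op \<Rightarrow> heat_chart \<Rightarrow> real \<Rightarrow> real" where
  "refl_pt K H t = (if ord1 K = 1 then right_end H - t else - t)"

definition loc_refl :: "kimura_op \<Rightarrow> heat_chart \<Rightarrow> (real \<Rightarrow> real) \<Rightarrow> (real \<Rightarrow> real) \<Rightarrow> real \<Rightarrow> real" where
  "loc_refl K H \<eta> f = (\<lambda>s. loc H \<eta> f (refl_pt K H s))"

definition mid_interval :: "kimura_op \<Rightarrow> heat_chart \<Rightarrow> cover \<Rightarrow> real set" where
  "mid_interval K H P = {heat_inv K H (cov_q0 P)..heat_inv K H (cov_q1 P)}"

definition C2_norm :: "kimura_op \<Rightarrow> heat_chart \<Rightarrow> cover \<Rightarrow> real \<Rightarrow> (real \<Rightarrow> real) \<Rightarrow> ennreal" where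
  "C2_norm K H P \<gamma> f =
     end_C2_norm (ord0 K) (neutral0 K) \<gamma> (heat_inv K H (cov_p0 P)) (loc H (chi0 P) f)
   + end_C2_norm (ord1 K) (neutral1 K) \<gamma> (refl_pt K H (heat_inv K H (cov_p1 P)))
       (loc_refl K H (chi1 P) f)
   + holder2_norm \<gamma> (mid_interval K H P) (loc H (chi2 P) f)"

definition C2_space :: "kimura_op \<Rightarrow> heat_chart \<Rightarrow> cover \<Rightarrow> real \<Rightarrow> (real \<Rightarrow> real) set" where
  "C2_space K H P \<gamma> = {f.
     (\<forall>x. x \<notin> {0<..<1} \<longrightarrow> f x = 0) \<and>
     end_C2 (ord0 K) (neutral0 K) \<gamma> (heat_inv K H (cov_p0 P)) (loc H (chi0 P) f) \<and>
     end_C2 (ord1 K) (neutral1 K) \<gamma> (refl_pt K H (heat_inv K H (cov_p1 P)))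
       (loc_refl K H (chi1 P) f) \<and>
     C2_on (mid_interval K H P) (loc H (chi2 P) f) \<and>
     holder2_norm \<gamma> (mid_interval K H P) (loc H (chi2 P) f) < \<infinity>}"

definition aD_norm :: "kimura_op \<Rightarrow> heat_chart \<Rightarrow> cover \<Rightarrow> real \<Rightarrow> (real \<Rightarrow> real) \<Rightarrow> ennreal" where
  "aD_norm K H P \<gamma> g =
     end_aD_norm (ord0 K) (neutral0 K) \<gamma> (heat_inv K H (cov_p0 P)) (loc H (chi0 P) g)
   + end_aD_norm (ord1 K) (neutral1 K) \<gamma> (refl_pt K H (heat_inv K H (cov_p1 P)))
       (loc_refl K H (chi1 P) g)
   + holder_norm \<gamma> (mid_interval K H P) (loc H (chi2 P) g)"

definition aD_space :: "kimura_op \<Rightarrow> heat_chart \<Rightarrow> cover \<Rightarrow> real \<Rightarrow> (real \<Rightarrow> real) set" where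
  "aD_space K H P \<gamma> = {g.
     (\<forall>x. x \<notin> {0<..<1} \<longrightarrow> g x = 0) \<and>
     end_aD (ord0 K) (neutral0 K) \<gamma> (heat_inv K H (cov_p0 P)) (loc H (chi0 P) g) \<and>
     end_aD (ord1 K) (neutral1 K) \<gamma> (refl_pt K H (heat_inv K H (cov_p1 P)))
       (loc_refl K H (chi1 P) g) \<and>
     holder_norm \<gamma> (mid_interval K H P) (loc H (chi2 P) g) < \<infinity>}"

definition kappa_plus :: "kimura_op \<Rightarrow> heat_chart \<Rightarrow> int" where
  "kappa_plus K H = (if b_plus K H > 0 then 1 else 0)"

definition kappa_minus :: "kimura_op \<Rightarrow> heat_chart \<Rightarrow> int" where
  "kappa_minus K H = (if b_minus K H < 0 then 1 else 0)"

end

theory Submission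
  imports Defs
begin

text \<open>In heat coordinates the equation \<open>L f = g\<close> reads \<open>A F'' + B F' = g\<close>, which is a first-order
  equation for \<open>u = F'\<close>: if \<open>E\<close> is the integrating factor, \<open>E' = E B / A\<close>, then
  \<open>(E u)' = E g / A\<close>. Near an end \<open>E\<close> is comparable to \<open>z powr b\<close> (Kimura) or \<open>exp (b z)\<close> (quadratic),
  where \<open>b\<close> is the limit of the first-order coefficient, taken with respect to the inward direction. If \<open>b > 0\<close>, or if
  \<open>b = 0\<close> at a quadratic end, the homogeneous solution \<open>1 / E\<close> is excluded from the space at that
  end, so that \<open>E u\<close> has to vanish there; otherwise every primitive \<open>E u\<close> of \<open>E g / A\<close> is admissible.
  If both ends impose such a condition, \<open>g\<close> has to satisfy \<open>\<integral> E g / A = 0\<close>. Moreover at a Kimura end with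
  \<open>b = 0\<close> the function \<open>L f\<close> vanishes, which is one more condition on \<open>g\<close>. These continuous
  functionals describe the range; the kernel consists of the constants and, if no end
  imposes a condition, of the primitive of \<open>1 / E\<close>.\<close>

section \<open>Hoelder bounds\<close>

text \<open>The index is a sum over the two ends. A quadratic end with inward coefficient
  \<open>b < 0\<close> costs nothing; every other end costs exactly one dimension, either by
  rejecting \<open>1 / E\<close> or, at a Kimura end with \<open>b = 0\<close>, by forcing
  \<open>g\<close> to vanish there. The first rejection lowers the kernel from 2 to 1, the second
  one raises the cokernel.

  All estimates at an end rest on the rate at which the coefficient \<open>B\<close> approaches
  \<open>b\<close>: O(z) at a Kimura end, O(exp (\<sigma> z)) at a quadratic one. It makes
  \<open>(B - b) / A\<close> integrable up to the end.

  At a quadratic end the delicate point is that \<open>F\<close> itself has to converge. The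
  equation integrates to \<open>F' + b F = G - H\<close> up to a constant, with primitives
  \<open>G\<close> of \<open>g\<close> and \<open>H\<close> of \<open>(B - b) F'\<close>. For
  \<open>b \<noteq> 0\<close> this gives the limit of \<open>F\<close>; for \<open>b = 0\<close> a
  second integration is needed. This is the origin of the two integral terms in the target norm.

  The norms involve a partition of unity and values in the extended reals. The analysis replaces
  them by bounds with one real constant on three adjacent pieces of the line, without
  cut-offs.\<close>

definition holder_bound :: "real \<Rightarrow> real set \<Rightarrow> real \<Rightarrow> (real \<Rightarrow> real) \<Rightarrow> bool" where
  "holder_bound \<gamma> U M f \<longleftrightarrow> (\<forall>z\<in>U. \<bar>f z\<bar> \<le> M) \<and> (\<forall>y\<in>U. \<forall>z\<in>U. \<bar>f y - f z\<bar> \<le> M * \<bar>y - z\<bar> powr \<gamma>)"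

lemma holder_boundI:
  assumes "\<And>z. z \<in> U \<Longrightarrow> \<bar>f z\<bar> \<le> M"
    and "\<And>y z. y \<in> U \<Longrightarrow> z \<in> U \<Longrightarrow> \<bar>f y - f z\<bar> \<le> M * \<bar>y - z\<bar> powr \<gamma>"
  shows "holder_bound \<gamma> U M f"
  using assms by (simp add: holder_bound_def)

lemma holder_boundI_less:
  assumes "\<And>z. z \<in> U \<Longrightarrow> \<bar>f z\<bar> \<le> M"
    and "\<And>y z. y \<in> U \<Longrightarrow> z \<in> U \<Longrightarrow> z < y \<Longrightarrow> \<bar>f y - f z\<bar> \<le> M * (y - z) powr \<gamma>"
  shows "holder_bound \<gamma> U M f"
proof (rule holder_boundI)
  fix y z assume yz: "y \<in> U" "z \<in> U"
  consider "y = z" | "z < y" | "y < z" by linarith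
  then show "\<bar>f y - f z\<bar> \<le> M * \<bar>y - z\<bar> powr \<gamma>"
  proof cases
    case 2 then show ?thesis using assms(2)[of y z] yz by simp
  next
    case 3 then show ?thesis using assms(2)[of z y] yz by (simp add: abs_minus_commute)
  qed simp
qed (use assms in auto)

lemma holder_boundD:
  assumes "holder_bound \<gamma> U M f"
  shows "z \<in> U \<Longrightarrow> \<bar>f z\<bar> \<le> M"
    and "y \<in> U \<Longrightarrow> z \<in> U \<Longrightarrow> \<bar>f y - f z\<bar> \<le> M * \<bar>y - z\<bar> powr \<gamma>"
  using assms by (auto simp: holder_bound_def)

lemma holder_bound_nonneg: "holder_bound \<gamma> U M f \<Longrightarrow> z \<in> U \<Longrightarrow> 0 \<le> M"
  by (metis abs_ge_zero holder_boundD(1) order_trans)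

lemma holder_bound_mono:
  assumes "holder_bound \<gamma> U M f" "V \<subseteq> U" "M \<le> N"
  shows "holder_bound \<gamma> V N f"
proof (rule holder_boundI)
  show "\<bar>f z\<bar> \<le> N" if "z \<in> V" for z
    using assms holder_boundD(1)[OF assms(1), of z] that by auto
  show "\<bar>f y - f z\<bar> \<le> N * \<bar>y - z\<bar> powr \<gamma>" if "y \<in> V" "z \<in> V" for y z
  proof -
    have "\<bar>f y - f z\<bar> \<le> M * \<bar>y - z\<bar> powr \<gamma>"
      using holder_boundD(2)[OF assms(1), of y z] that assms by auto
    also have "\<dots> \<le> N * \<bar>y - z\<bar> powr \<gamma>" using assms by (intro mult_right_mono) auto
    finally show ?thesis .
  qed
qed

lemma holder_bound_cong:
  "(\<And>z. z \<in> U \<Longrightarrow> f z = g z) \<Longrightarrow> holder_bound \<gamma> U M f \<longleftrightarrow> holder_bound \<gamma> U M g"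
  by (simp add: holder_bound_def)

lemma holder_bound_add:
  assumes "holder_bound \<gamma> U M f" "holder_bound \<gamma> U N g"
  shows "holder_bound \<gamma> U (M + N) (\<lambda>z. f z + g z)"
proof (rule holder_boundI)
  show "\<bar>f z + g z\<bar> \<le> M + N" if "z \<in> U" for z
    using holder_boundD(1)[OF assms(1) that] holder_boundD(1)[OF assms(2) that] by linarith
  show "\<bar>f y + g y - (f z + g z)\<bar> \<le> (M + N) * \<bar>y - z\<bar> powr \<gamma>" if "y \<in> U" "z \<in> U" for y z
    using holder_boundD(2)[OF assms(1) that] holder_boundD(2)[OF assms(2) that]
    by (simp add: distrib_right)
qed

lemma holder_bound_cmult:
  assumes "holder_bound \<gamma> U M f"
  shows "holder_bound \<gamma> U (\<bar>c\<bar> * M) (\<lambda>z. c * f z)"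
proof (rule holder_boundI)
  show "\<bar>c * f z\<bar> \<le> \<bar>c\<bar> * M" if "z \<in> U" for z
    using holder_boundD(1)[OF assms that] by (simp add: abs_mult mult_left_mono)
  show "\<bar>c * f y - c * f z\<bar> \<le> \<bar>c\<bar> * M * \<bar>y - z\<bar> powr \<gamma>" if "y \<in> U" "z \<in> U" for y z
    using mult_left_mono[OF holder_boundD(2)[OF assms that], of "\<bar>c\<bar>"]
    by (simp add: abs_mult[symmetric] algebra_simps)
qed

lemma holder_bound_minus: "holder_bound \<gamma> U M f \<Longrightarrow> holder_bound \<gamma> U M (\<lambda>z. - f z)"
  using holder_bound_cmult[of \<gamma> U M f "-1"] by simp

lemma holder_bound_diff:
  assumes "holder_bound \<gamma> U M f" "holder_bound \<gamma> U N g"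
  shows "holder_bound \<gamma> U (M + N) (\<lambda>z. f z - g z)"
  using holder_bound_add[OF assms(1) holder_bound_minus[OF assms(2)]] by simp

lemma holder_bound_mult:
  assumes "holder_bound \<gamma> U M f" "holder_bound \<gamma> U N g"
  shows "holder_bound \<gamma> U (2 * M * N) (\<lambda>z. f z * g z)"
proof (rule holder_boundI)
  fix z assume z: "z \<in> U"
  have "0 \<le> M" "0 \<le> N" using assms z by (auto intro: holder_bound_nonneg)
  moreover have "\<bar>f z * g z\<bar> \<le> M * N"
    using holder_boundD(1)[OF assms(1) z] holder_boundD(1)[OF assms(2) z]
    by (simp add: abs_mult mult_mono')
  moreover have "0 \<le> M * N" using \<open>0 \<le> M\<close> \<open>0 \<le> N\<close> by simp
  ultimately show "\<bar>f z * g z\<bar> \<le> 2 * M * N" by linarith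
  fix y assume y: "y \<in> U"
  let ?d = "\<bar>y - z\<bar> powr \<gamma>"
  have "\<bar>f y * g y - f z * g z\<bar> = \<bar>f y * (g y - g z) + g z * (f y - f z)\<bar>"
    by (simp add: algebra_simps)
  also have "\<dots> \<le> \<bar>f y\<bar> * \<bar>g y - g z\<bar> + \<bar>g z\<bar> * \<bar>f y - f z\<bar>"
    by (metis abs_mult abs_triangle_ineq)
  also have "\<dots> \<le> M * (N * ?d) + N * (M * ?d)"
    using holder_boundD(1)[OF assms(1) y] holder_boundD(1)[OF assms(2) z]
      holder_boundD(2)[OF assms(1) y z] holder_boundD(2)[OF assms(2) y z]
    by (intro add_mono mult_mono') auto
  finally show "\<bar>f y * g y - f z * g z\<bar> \<le> 2 * M * N * ?d" by (simp add: algebra_simps)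
qed

text \<open>For points on different sides of the common point \<open>b\<close> the difference is
  split at \<open>b\<close>. Either part spans at most the distance of the two points, so the
  constants simply add.\<close>

lemma holder_bound_paste:
  assumes f: "holder_bound \<gamma> U M f" "holder_bound \<gamma> V N f" and "0 < \<gamma>"
    and b: "b \<in> U" "b \<in> V" and UV: "U \<subseteq> {..b}" "V \<subseteq> {b..}"
  shows "holder_bound \<gamma> (U \<union> V) (M + N) f"
proof (rule holder_boundI_less)
  have MN: "0 \<le> M" "0 \<le> N" using assms by (auto intro: holder_bound_nonneg)
  show "\<bar>f z\<bar> \<le> M + N" if "z \<in> U \<union> V" for z
    using that MN holder_boundD(1)[OF f(1), of z] holder_boundD(1)[OF f(2), of z] by auto
  show "\<bar>f y - f z\<bar> \<le> (M + N) * (y - z) powr \<gamma>" if yz: "y \<in> U \<union> V" "z \<in> U \<union> V" "z < y" for y z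
  proof -
    have *: "\<bar>f y' - f z'\<bar> \<le> M * (y - z) powr \<gamma>" if "y' \<in> U" "z' \<in> U" "\<bar>y' - z'\<bar> \<le> y - z" for y' z'
      using holder_boundD(2)[OF f(1) that(1,2)] that MN \<open>0 < \<gamma>\<close>
      by (smt (verit) mult_left_mono powr_mono2)
    have **: "\<bar>f y' - f z'\<bar> \<le> N * (y - z) powr \<gamma>" if "y' \<in> V" "z' \<in> V" "\<bar>y' - z'\<bar> \<le> y - z" for y' z'
      using holder_boundD(2)[OF f(2) that(1,2)] that MN \<open>0 < \<gamma>\<close>
      by (smt (verit) mult_left_mono powr_mono2)
    have d0: "0 \<le> M * (y - z) powr \<gamma>" "0 \<le> N * (y - z) powr \<gamma>" using MN by auto
    consider "y \<in> U" "z \<in> U" | "y \<in> V" "z \<in> V" | "y \<in> V" "z \<in> U" | "y \<in> U" "z \<in> V" using yz by auto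
    then show ?thesis
    proof cases
      case 1 then show ?thesis using *[of y z] d0 yz by (simp add: distrib_right)
    next
      case 2 then show ?thesis using **[of y z] d0 yz by (simp add: distrib_right)
    next
      case 3
      then have "z \<le> b" "b \<le> y" using UV by auto
      then show ?thesis using **[of y b] *[of b z] 3 b by (simp add: distrib_right)
    next
      case 4
      then have "b \<le> z" "y \<le> b" using UV by auto
      then show ?thesis using yz by simp
    qed
  qed
qed

lemma holder_bound_const: "holder_bound \<gamma> U \<bar>c\<bar> (\<lambda>_. c)"
  by (rule holder_boundI) auto

text \<open>At distance at most 1 the Lipschitz bound is the stronger one because
  \<open>\<gamma> \<le> 1\<close>; at larger distance the sup bound is used at both points, which is
  where the 2 comes from.\<close>

lemma holder_bound_lipschitz:
  assumes b: "\<And>z. z \<in> U \<Longrightarrow> \<bar>f z\<bar> \<le> K"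
    and l: "\<And>y z. y \<in> U \<Longrightarrow> z \<in> U \<Longrightarrow> z < y \<Longrightarrow> \<bar>f y - f z\<bar> \<le> K * (y - z)"
    and \<gamma>: "0 < \<gamma>" "\<gamma> \<le> 1"
  shows "holder_bound \<gamma> U (2 * K) f"
proof (rule holder_boundI_less)
  fix z assume z: "z \<in> U"
  have K: "0 \<le> K" using b[OF z] by linarith
  show "\<bar>f z\<bar> \<le> 2 * K" using b[OF z] K by linarith
  fix y assume y: "y \<in> U" "z < y"
  show "\<bar>f y - f z\<bar> \<le> 2 * K * (y - z) powr \<gamma>"
  proof (cases "y - z \<le> 1")
    case True
    have "(y - z) powr 1 \<le> (y - z) powr \<gamma>" using True y \<gamma> by (intro powr_mono') auto
    then have "y - z \<le> (y - z) powr \<gamma>" using y by simp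
    then have "K * (y - z) \<le> K * (y - z) powr \<gamma>" using K by (rule mult_left_mono)
    moreover have "0 \<le> K * (y - z) powr \<gamma>" using K by simp
    ultimately show ?thesis using l[OF y(1) z y(2)] by simp
  next
    case False
    have "1 \<le> (y - z) powr \<gamma>" using False \<gamma> by (intro ge_one_powr_ge_zero) auto
    then have "2 * K * 1 \<le> 2 * K * (y - z) powr \<gamma>" using K by (intro mult_left_mono) auto
    then show ?thesis using b[OF z] b[OF y(1)] by linarith
  qed
qed

section \<open>Hoelder bounds from bounds on derivatives\<close>

lemma lipschitz_of_deriv:
  fixes f :: "real \<Rightarrow> real"
  assumes U: "is_interval U"
    and f: "\<And>z. z \<in> U \<Longrightarrow> (f has_real_derivative f' z) (at z within U)"
    and b: "\<And>z. z \<in> U \<Longrightarrow> \<bar>f' z\<bar> \<le> K"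
    and yz: "y \<in> U" "z \<in> U"
  shows "\<bar>f y - f z\<bar> \<le> K * \<bar>y - z\<bar>"
proof -
  have "norm (f y - f z) \<le> K * norm (y - z)"
  proof (rule field_differentiable_bound[of U])
    show "convex U" using U by (simp add: is_interval_convex)
  qed (use assms in auto)
  then show ?thesis by simp
qed

lemma holder_bound_deriv:
  assumes "is_interval U"
    and "\<And>z. z \<in> U \<Longrightarrow> (f has_real_derivative f' z) (at z within U)"
    and "\<And>z. z \<in> U \<Longrightarrow> \<bar>f' z\<bar> \<le> K"
    and "\<And>z. z \<in> U \<Longrightarrow> \<bar>f z\<bar> \<le> K"
    and "0 < \<gamma>" "\<gamma> \<le> 1"
  shows "holder_bound \<gamma> U (2 * K) f"
proof (rule holder_bound_lipschitz)
  show "\<bar>f y - f z\<bar> \<le> K * (y - z)" if "y \<in> U" "z \<in> U" "z < y" for y z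
    using lipschitz_of_deriv[OF assms(1-3) that(1,2)] that by simp
qed (use assms in auto)

lemma continuous_on_compact_bound:
  fixes f :: "real \<Rightarrow> real"
  assumes "continuous_on {a..b} f"
  obtains K where "0 \<le> K" "\<And>z. z \<in> {a..b} \<Longrightarrow> \<bar>f z\<bar> \<le> K"
proof -
  have "bounded (f ` {a..b})" using assms compact_Icc compact_continuous_image compact_imp_bounded by blast
  then obtain K where "\<forall>x\<in>f ` {a..b}. norm x \<le> K" by (auto simp: bounded_iff)
  then show ?thesis by (intro that[of "max 0 K"]) force+
qed

lemma holder_bound_C1_compact:
  fixes f :: "real \<Rightarrow> real"
  assumes f: "\<And>z. z \<in> {a..b} \<Longrightarrow> (f has_real_derivative f' z) (at z within {a..b})"
    and f': "continuous_on {a..b} f'" and \<gamma>: "0 < \<gamma>" "\<gamma> \<le> 1"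
  obtains K where "0 \<le> K" "holder_bound \<gamma> {a..b} K f"
proof -
  have "continuous_on {a..b} f"
    using f by (meson DERIV_continuous continuous_on_eq_continuous_within)
  then obtain K1 where K1: "0 \<le> K1" "\<And>z. z \<in> {a..b} \<Longrightarrow> \<bar>f z\<bar> \<le> K1"
    using continuous_on_compact_bound by blast
  obtain K2 where K2: "0 \<le> K2" "\<And>z. z \<in> {a..b} \<Longrightarrow> \<bar>f' z\<bar> \<le> K2"
    using f' continuous_on_compact_bound by blast
  have "holder_bound \<gamma> {a..b} (2 * (K1 + K2)) f"
    using f K1 K2 \<gamma> by (intro holder_bound_deriv[where f'=f']) (auto simp: is_interval_cc intro: add_increasing add_increasing2)
  then show ?thesis using K1 K2 by (intro that[of "2 * (K1 + K2)"]) auto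
qed

lemma holder_bound_continuous:
  assumes "holder_bound \<gamma> U M f" "0 < \<gamma>"
  shows "uniformly_continuous_on U f"
  unfolding uniformly_continuous_on_def
proof (intro allI impI)
  fix e :: real assume e: "0 < e"
  \<comment> \<open>Chosen such that \<open>M * d powr \<gamma> < e\<close>; the summand 1 covers
    \<open>M = 0\<close> and makes the inequality strict.\<close>
  define d where "d = (e / (\<bar>M\<bar> + 1)) powr (1 / \<gamma>)"
  have d: "0 < d" using e by (simp add: d_def)
  show "\<exists>d>0. \<forall>x'\<in>U. \<forall>x\<in>U. dist x x' < d \<longrightarrow> dist (f x) (f x') < e"
  proof (intro exI[of _ d] conjI ballI impI)
    fix x x' assume x: "x \<in> U" "x' \<in> U" "dist x x' < d"
    have "\<bar>f x - f x'\<bar> \<le> M * \<bar>x - x'\<bar> powr \<gamma>" using assms(1) x by (intro holder_boundD)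
    also have "\<dots> \<le> M * d powr \<gamma>"
      using x assms holder_bound_nonneg[OF assms(1) x(1)]
      by (intro mult_left_mono powr_mono2) (auto simp: dist_real_def)
    also have "d powr \<gamma> = e / (\<bar>M\<bar> + 1)" using e assms(2) by (simp add: d_def powr_powr)
    also have "M * (e / (\<bar>M\<bar> + 1)) < e"
    proof -
      have "M * e < (\<bar>M\<bar> + 1) * e" using e by (intro mult_strict_right_mono) auto
      then show ?thesis using e by (simp add: divide_less_eq mult.commute)
    qed
    finally show "dist (f x) (f x') < e" by (simp add: dist_real_def)
  qed (use d in auto)
qed

lemma holder_bound_continuous_on: "holder_bound \<gamma> U M f \<Longrightarrow> 0 < \<gamma> \<Longrightarrow> continuous_on U f"
  by (simp add: holder_bound_continuous uniformly_continuous_imp_continuous)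

section \<open>Extended real norms against real bounds\<close>

lemma sup_norm_le_iff: "0 \<le> M \<Longrightarrow> sup_norm U f \<le> ennreal M \<longleftrightarrow> (\<forall>z\<in>U. \<bar>f z\<bar> \<le> M)"
  by (auto simp: sup_norm_def SUP_le_iff)

lemma holder_seminorm_le_iff:
  assumes "0 \<le> M"
  shows "holder_seminorm \<gamma> U f \<le> ennreal M \<longleftrightarrow> (\<forall>y\<in>U. \<forall>z\<in>U. \<bar>f y - f z\<bar> \<le> M * \<bar>y - z\<bar> powr \<gamma>)"
proof -
  have "(\<bar>f y - f z\<bar> / \<bar>y - z\<bar> powr \<gamma> \<le> M) \<longleftrightarrow> \<bar>f y - f z\<bar> \<le> M * \<bar>y - z\<bar> powr \<gamma>" if "z \<noteq> y" for y z
    using that by (simp add: pos_divide_le_eq)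
  moreover have "\<bar>f y - f y\<bar> \<le> M * \<bar>y - y\<bar> powr \<gamma>" for y by simp
  ultimately show ?thesis using assms
    unfolding holder_seminorm_def
    by (simp add: SUP_le_iff) (metis Diff_iff cancel_comm_monoid_add_class.diff_cancel abs_0 powr_0 mult_zero_right order_refl singletonD)
qed

text \<open>One real constant for both the supremum and the difference quotient loses only a factor
  2 against the sum of the two, as this lemma and its converse show, and keeps the later algebra out
  of the extended reals.\<close>

lemma holder_norm_le_imp_bound:
  assumes "holder_norm \<gamma> U f \<le> ennreal M" "0 \<le> M"
  shows "holder_bound \<gamma> U M f"
proof -
  have "sup_norm U f \<le> holder_norm \<gamma> U f" "holder_seminorm \<gamma> U f \<le> holder_norm \<gamma> U f"
    by (auto simp: holder_norm_def)
  then have "sup_norm U f \<le> ennreal M" "holder_seminorm \<gamma> U f \<le> ennreal M" using assms by auto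
  then show ?thesis using assms(2) by (simp add: holder_bound_def sup_norm_le_iff holder_seminorm_le_iff)
qed

lemma holder_bound_imp_norm_le:
  assumes "holder_bound \<gamma> U M f" "0 \<le> M"
  shows "holder_norm \<gamma> U f \<le> ennreal (2 * M)"
proof -
  have "sup_norm U f \<le> ennreal M" "holder_seminorm \<gamma> U f \<le> ennreal M" using assms
    by (auto simp: holder_bound_def sup_norm_le_iff holder_seminorm_le_iff)
  then have "holder_norm \<gamma> U f \<le> ennreal M + ennreal M" unfolding holder_norm_def by (rule add_mono)
  then show ?thesis using assms(2) by (simp add: ennreal_plus[symmetric])
qed

text \<open>The functions \<open>k + f\<close> and \<open>k - f\<close> have nonnegative derivative
  and hence increase. With an explicit \<open>k\<close> this does the work of estimating the
  integral of \<open>f'\<close> by that of \<open>k'\<close>, without any question of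
  integrability.\<close>

lemma deriv_dominated:
  fixes f k :: "real \<Rightarrow> real"
  assumes U: "is_interval U"
    and f: "\<And>z. z \<in> U \<Longrightarrow> (f has_real_derivative f' z) (at z within U)"
    and k: "\<And>z. z \<in> U \<Longrightarrow> (k has_real_derivative k' z) (at z within U)"
    and le: "\<And>z. z \<in> U \<Longrightarrow> \<bar>f' z\<bar> \<le> k' z"
    and yz: "y \<in> U" "z \<in> U" "z \<le> y"
  shows "\<bar>f y - f z\<bar> \<le> k y - k z"
proof -
  have sub: "{z..y} \<subseteq> U" using U yz by (meson atLeastAtMost_iff mem_is_interval_1_I subsetI)
  \<comment> \<open>Strictly between \<open>z\<close> and \<open>y\<close> the derivative within
    \<open>U\<close> is two-sided; at the two points themselves continuity suffices.\<close>
  have int: "at x within U = at x" if "z < x" "x < y" for x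
  proof (rule at_within_nhd[where S = "{z<..<y}"])
    show "U \<inter> {z<..<y} - {x} = UNIV \<inter> {z<..<y} - {x}" using sub by auto
  qed (use that in auto)
  have mono: "h z \<le> h y" if h: "\<And>x. x \<in> U \<Longrightarrow> (h has_real_derivative h' x) (at x within U)"
      and h': "\<And>x. x \<in> U \<Longrightarrow> 0 \<le> h' x" for h h' :: "real \<Rightarrow> real"
  proof (rule DERIV_nonneg_imp_increasing_open[where f = h and a = z and b = y])
    show "\<exists>D. DERIV h x :> D \<and> D \<ge> 0" if "z < x" "x < y" for x
    proof -
      have "x \<in> U" using sub that by auto
      then show ?thesis using h[of x] h'[of x] int[OF that] by auto
    qed
    have "continuous_on U h" using h by (meson DERIV_continuous continuous_on_eq_continuous_within)
    then show "continuous_on {z..y} h" using sub by (rule continuous_on_subset)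
  qed (use yz in auto)
  have "k z + f z \<le> k y + f y"
  proof (rule mono[of "\<lambda>x. k x + f x" "\<lambda>x. k' x + f' x"])
    show "0 \<le> k' x + f' x" if "x \<in> U" for x using le[OF that] by linarith
  qed (auto intro!: DERIV_add f k)
  moreover have "k z - f z \<le> k y - f y"
  proof (rule mono[of "\<lambda>x. k x - f x" "\<lambda>x. k' x - f' x"])
    show "0 \<le> k' x - f' x" if "x \<in> U" for x using le[OF that] by linarith
  qed (auto intro!: DERIV_diff f k)
  ultimately show ?thesis by linarith
qed

text \<open>The estimate transfers the Cauchy property from \<open>k\<close> to \<open>f\<close>. A
  limit \<open>l\<close> is found along a sequence with \<open>k (s n)\<close> close to
  \<open>k0\<close>; inserting this sequence for one of the two points gives the bound with
  \<open>l\<close>, and that bound yields convergence along the whole filter.\<close>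

lemma dominated_tendsto:
  fixes f k :: "real \<Rightarrow> real"
  assumes dom: "\<And>y z. y \<in> U \<Longrightarrow> z \<in> U \<Longrightarrow> \<bar>f y - f z\<bar> \<le> \<bar>k y - k z\<bar>"
    and k: "(k \<longlongrightarrow> k0) F" and U: "eventually (\<lambda>z. z \<in> U) F" and F: "F \<noteq> bot"
  obtains l where "(f \<longlongrightarrow> l) F" "\<And>z. z \<in> U \<Longrightarrow> \<bar>f z - l\<bar> \<le> \<bar>k z - k0\<bar>"
proof -
  have "\<exists>s. \<forall>n. s n \<in> U \<and> \<bar>k (s n) - k0\<bar> < 1 / Suc n"
  proof (rule choice, rule allI)
    fix n :: nat
    have "eventually (\<lambda>z. z \<in> U \<and> dist (k z) k0 < 1 / Suc n) F"
      using U tendstoD[OF k, of "1 / Suc n"] by (intro eventually_conj) auto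
    then show "\<exists>z. z \<in> U \<and> \<bar>k z - k0\<bar> < 1 / Suc n"
      using eventually_happens'[OF F] by (fastforce simp: dist_real_def)
  qed
  then obtain s where s: "\<And>n. s n \<in> U" "\<And>n. \<bar>k (s n) - k0\<bar> < 1 / Suc n" by blast
  have ks: "(\<lambda>n. k (s n)) \<longlonglongrightarrow> k0"
  proof (rule Lim_null[THEN iffD2], rule Lim_null_comparison)
    show "\<forall>\<^sub>F n in sequentially. norm (k (s n) - k0) \<le> 1 / Suc n"
      using s(2) by (auto intro!: always_eventually less_imp_le)
    show "(\<lambda>n. 1 / real (Suc n)) \<longlonglongrightarrow> 0" using LIMSEQ_inverse_real_of_nat by (simp add: inverse_eq_divide)
  qed
  have "Cauchy (\<lambda>n. f (s n))"
  proof (rule metric_CauchyI)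
    fix e :: real assume "0 < e"
    then obtain N where "\<And>m n. N \<le> m \<Longrightarrow> N \<le> n \<Longrightarrow> dist (k (s m)) (k (s n)) < e"
      using LIMSEQ_imp_Cauchy[OF ks] metric_CauchyD by blast
    then show "\<exists>N. \<forall>m\<ge>N. \<forall>n\<ge>N. dist (f (s m)) (f (s n)) < e"
      using dom s(1) by (metis dist_real_def order_le_less_trans)
  qed
  then obtain l where l: "(\<lambda>n. f (s n)) \<longlonglongrightarrow> l" using Cauchy_convergent convergent_def by blast
  have le: "\<bar>f z - l\<bar> \<le> \<bar>k z - k0\<bar>" if z: "z \<in> U" for z
  proof (rule tendsto_le[OF sequentially_bot])
    show "(\<lambda>n. \<bar>f z - f (s n)\<bar>) \<longlonglongrightarrow> \<bar>f z - l\<bar>" "(\<lambda>n. \<bar>k z - k (s n)\<bar>) \<longlonglongrightarrow> \<bar>k z - k0\<bar>"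
      by (intro tendsto_intros l ks)+
    show "\<forall>\<^sub>F n in sequentially. \<bar>f z - f (s n)\<bar> \<le> \<bar>k z - k (s n)\<bar>" using dom z s(1) by auto
  qed
  have "(f \<longlongrightarrow> l) F"
  proof (rule Lim_null[THEN iffD2], rule Lim_null_comparison)
    show "\<forall>\<^sub>F z in F. norm (f z - l) \<le> \<bar>k z - k0\<bar>" using U by eventually_elim (use le in auto)
    show "((\<lambda>z. \<bar>k z - k0\<bar>) \<longlongrightarrow> 0) F" using k by (simp add: LIM_zero tendsto_rabs_zero)
  qed
  then show ?thesis using le that by blast
qed

section \<open>Ends of the line\<close>

text \<open>One pair of notions, \<open>end_int\<close> and \<open>end_filter\<close>, covers both
  types of left end, so that most estimates are stated once. Every \<open>m\<close> other than 1
  counts as quadratic.\<close>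

definition end_int :: "nat \<Rightarrow> real \<Rightarrow> real set" where
  "end_int m c = (if m = 1 then {0<..c} else {..c})"

definition end_filter :: "nat \<Rightarrow> real filter" where
  "end_filter m = (if m = 1 then at_right 0 else at_bot)"

lemma is_interval_end_int [simp]: "is_interval (end_int m c)"
  unfolding end_int_def is_interval_1 by auto

lemma end_filter_neq_bot [simp]: "end_filter m \<noteq> bot"
  by (simp add: end_filter_def)

lemma eventually_end_filter_less: "(m = 1 \<Longrightarrow> 0 < c) \<Longrightarrow> eventually (\<lambda>z. z \<in> end_int m c \<and> z < c) (end_filter m)"
proof (cases "m = 1")
  case True
  moreover assume "m = 1 \<Longrightarrow> 0 < c"
  ultimately show ?thesis
    by (auto simp: end_int_def end_filter_def eventually_at_right_field intro!: exI[of _ c])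
next
  case False
  then show ?thesis by (auto simp: end_int_def end_filter_def eventually_at_bot_dense intro!: exI[of _ c])
qed

lemma eventually_end_filter: "(m = 1 \<Longrightarrow> 0 < c) \<Longrightarrow> eventually (\<lambda>z. z \<in> end_int m c) (end_filter m)"
  using eventually_end_filter_less by (rule eventually_mono) auto

lemma eventually_end_filterE:
  assumes "eventually P (end_filter m)" "m = 1 \<Longrightarrow> 0 < c"
  obtains d where "d \<in> end_int m c" "d < c" "\<And>z. z \<in> end_int m d \<Longrightarrow> P z"
proof (cases "m = 1")
  case True
  then obtain b where b: "b > 0" "\<And>y. 0 < y \<Longrightarrow> y < b \<Longrightarrow> P y"
    using assms by (auto simp: end_filter_def eventually_at_right_field)
  show ?thesis using True b assms(2) by (intro that[of "min (b/2) (c/2)"]) (auto simp: end_int_def)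
next
  case False
  then obtain b where b: "\<And>y. y \<le> b \<Longrightarrow> P y"
    using assms by (auto simp: end_filter_def eventually_at_bot_linorder)
  show ?thesis using False b by (intro that[of "min b (c - 1)"]) (auto simp: end_int_def)
qed

lemma end_int_mono: "c \<le> d \<Longrightarrow> end_int m c \<subseteq> end_int m d"
  by (auto simp: end_int_def)

lemma end_int_self: "(m = 1 \<Longrightarrow> 0 < c) \<Longrightarrow> c \<in> end_int m c"
  by (auto simp: end_int_def)

lemma end_int_le: "z \<in> end_int m c \<Longrightarrow> z \<le> c"
  by (auto simp: end_int_def split: if_splits)

lemma end_int_sub: "d \<in> end_int m c \<Longrightarrow> end_int m d \<subseteq> end_int m c"
  by (auto simp: end_int_def split: if_splits)

lemma end_int_Un: "d \<in> end_int m c \<Longrightarrow> end_int m c = end_int m d \<union> {d..c}"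
  by (auto simp: end_int_def split: if_splits)

text \<open>The antiderivative theorem is applied on an open interval: \<open>h\<close> is continued
  beyond \<open>c\<close> by its value there, as \<open>h (min z c)\<close>, and the primitive of
  the continuation is restricted again. At \<open>c\<close> this leaves a one-sided
  derivative.\<close>

lemma ex_primitive_end:
  assumes "continuous_on (end_int m c) h"
  obtains H where "\<And>z. z \<in> end_int m c \<Longrightarrow> (H has_real_derivative h z) (at z within end_int m c)"
proof -
  define a :: ereal where "a = (if m = 1 then 0 else -\<infinity>)"
  have min: "min z c \<in> end_int m c" if "a < ereal z" "m = 1 \<longrightarrow> 0 < c" for z
    using that by (auto simp: a_def end_int_def zero_ereal_def split: if_splits)
  show ?thesis
  proof (cases "m = 1 \<longrightarrow> 0 < c")
    case True
    have "isCont (\<lambda>z. h (min z c)) x" if "a < ereal x" for x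
    proof -
      have "continuous_on {z. a < ereal z} (\<lambda>z. h (min z c))"
        using min True by (intro continuous_on_compose2[OF assms] continuous_intros) auto
      moreover have "open {z. a < ereal z}"
        by (cases "m = 1") (auto simp: a_def zero_ereal_def greaterThan_def[symmetric])
      ultimately show ?thesis using that by (simp add: continuous_on_eq_continuous_at)
    qed
    then obtain H where H: "\<And>x. a < ereal x \<Longrightarrow> (H has_vector_derivative h (min x c)) (at x)"
      using einterval_antiderivative[of a \<infinity> "\<lambda>z. h (min z c)"]
      by (cases "m = 1") (auto simp: a_def)
    show ?thesis
    proof (rule that)
      fix z assume z: "z \<in> end_int m c"
      then have "a < ereal z" "min z c = z" by (auto simp: a_def end_int_def split: if_splits)
      then show "(H has_real_derivative h z) (at z within end_int m c)"
        using H[of z] by (simp add: has_real_derivative_iff_has_vector_derivative has_vector_derivative_at_within)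
    qed
  next
    case False
    then have "end_int m c = {}" by (auto simp: end_int_def)
    then show ?thesis using that by blast
  qed
qed

text \<open>Subtracting the limit at the end, which exists because \<open>k\<close> converges, makes
  \<open>H z\<close> the integral from the end up to \<open>z\<close>. It is bounded by
  \<open>k\<close>, because \<open>k\<close> vanishes at the end as well.\<close>

lemma dominated_primitive:
  assumes h: "continuous_on (end_int m c) h" and c: "m = 1 \<Longrightarrow> 0 < c"
    and k: "\<And>z. z \<in> end_int m c \<Longrightarrow> (k has_real_derivative k' z) (at z within end_int m c)"
    and le: "\<And>z. z \<in> end_int m c \<Longrightarrow> \<bar>h z\<bar> \<le> k' z"
    and k0: "(k \<longlongrightarrow> 0) (end_filter m)"
  obtains H where "\<And>z. z \<in> end_int m c \<Longrightarrow> (H has_real_derivative h z) (at z within end_int m c)"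
    and "(H \<longlongrightarrow> 0) (end_filter m)" and "\<And>z. z \<in> end_int m c \<Longrightarrow> \<bar>H z\<bar> \<le> \<bar>k z\<bar>"
proof -
  obtain H where H: "\<And>z. z \<in> end_int m c \<Longrightarrow> (H has_real_derivative h z) (at z within end_int m c)"
    using ex_primitive_end[OF h] by blast
  have dom: "\<bar>H y - H z\<bar> \<le> \<bar>k y - k z\<bar>" if "y \<in> end_int m c" "z \<in> end_int m c" for y z
    using deriv_dominated[OF is_interval_end_int H k le, of y z] deriv_dominated[OF is_interval_end_int H k le, of z y] that
    by (cases "z \<le> y") (auto simp: abs_minus_commute)
  obtain l where l: "(H \<longlongrightarrow> l) (end_filter m)" "\<And>z. z \<in> end_int m c \<Longrightarrow> \<bar>H z - l\<bar> \<le> \<bar>k z - 0\<bar>"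
    using dominated_tendsto[OF dom k0 eventually_end_filter[OF c] end_filter_neq_bot] by blast
  show ?thesis
  proof (rule that[of "\<lambda>z. H z - l"])
    show "((\<lambda>z. H z - l) has_real_derivative h z) (at z within end_int m c)" if "z \<in> end_int m c" for z
      using DERIV_diff[OF H[OF that] DERIV_const] by simp
  qed (use l in \<open>auto simp: LIM_zero\<close>)
qed

lemma dominated_deriv_tendsto:
  assumes H: "\<And>z. z \<in> end_int m c \<Longrightarrow> (H has_real_derivative h z) (at z within end_int m c)"
    and c: "m = 1 \<Longrightarrow> 0 < c"
    and k: "\<And>z. z \<in> end_int m c \<Longrightarrow> (k has_real_derivative k' z) (at z within end_int m c)"
    and le: "\<And>z. z \<in> end_int m c \<Longrightarrow> \<bar>h z\<bar> \<le> k' z"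
    and k0: "(k \<longlongrightarrow> 0) (end_filter m)"
  obtains l where "(H \<longlongrightarrow> l) (end_filter m)" and "\<And>z. z \<in> end_int m c \<Longrightarrow> \<bar>H z - l\<bar> \<le> \<bar>k z\<bar>"
proof -
  have dom: "\<bar>H y - H z\<bar> \<le> \<bar>k y - k z\<bar>" if "y \<in> end_int m c" "z \<in> end_int m c" for y z
    using deriv_dominated[OF is_interval_end_int H k le, of y z] deriv_dominated[OF is_interval_end_int H k le, of z y] that
    by (cases "z \<le> y") (auto simp: abs_minus_commute)
  show ?thesis
    using dominated_tendsto[OF dom k0 eventually_end_filter[OF c] end_filter_neq_bot] that by auto
qed

section \<open>Explicit dominating primitives at the two types of end\<close>

lemma exp_primitive:
  fixes \<sigma> :: real
  assumes "0 < \<sigma>"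
  shows "((\<lambda>z. K / \<sigma> * exp (\<sigma> * z)) has_real_derivative K * exp (\<sigma> * z)) (at z within S)"
    and "((\<lambda>z. K / \<sigma> * exp (\<sigma> * z)) \<longlongrightarrow> 0) at_bot"
proof -
  show "((\<lambda>z. K / \<sigma> * exp (\<sigma> * z)) has_real_derivative K * exp (\<sigma> * z)) (at z within S)"
    using assms by (auto intro!: derivative_eq_intros)
  have "filterlim (\<lambda>z. \<sigma> * z) at_bot at_bot"
    using assms by (simp add: filterlim_tendsto_pos_mult_at_bot[OF tendsto_const] filterlim_ident)
  then have "((\<lambda>z. exp (\<sigma> * z)) \<longlongrightarrow> 0) at_bot" using exp_at_bot filterlim_compose by blast
  then show "((\<lambda>z. K / \<sigma> * exp (\<sigma> * z)) \<longlongrightarrow> 0) at_bot" using tendsto_mult_right_zero by blast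
qed

lemma powr_primitive:
  fixes p :: real
  assumes "0 < p"
  shows "z > 0 \<Longrightarrow> ((\<lambda>z. K / p * z powr p) has_real_derivative K * z powr (p - 1)) (at z within S)"
    and "((\<lambda>z. K / p * z powr p) \<longlongrightarrow> 0) (at_right 0)"
proof -
  show "((\<lambda>z. K / p * z powr p) has_real_derivative K * z powr (p - 1)) (at z within S)" if "z > 0"
    using assms that by (auto intro!: derivative_eq_intros)
  have "((\<lambda>z. z powr p) \<longlongrightarrow> 0) (at_right 0)"
  proof (rule tendsto_zero_powrI[OF tendsto_ident_at tendsto_const _ assms])
    show "\<forall>\<^sub>F x::real in at_right 0. 0 \<le> x"
      by (auto simp: eventually_at_right_field intro!: exI[of _ 1])
  qed
  then show "((\<lambda>z. K / p * z powr p) \<longlongrightarrow> 0) (at_right 0)" using tendsto_mult_right_zero by blast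
qed

text \<open>\<open>G z\<close> is the improper integral of \<open>g\<close> up to \<open>z\<close>.
  Expressing it by a derivative and a limit lets the iterated integral of the neutral norm be
  handled by rules of differentiation: it is a vanishing primitive of a vanishing primitive.\<close>

definition vanishing_primitive :: "real \<Rightarrow> real \<Rightarrow> (real \<Rightarrow> real) \<Rightarrow> (real \<Rightarrow> real) \<Rightarrow> bool" where
  "vanishing_primitive c M g G \<longleftrightarrow>
     (\<forall>z\<in>{..c}. (G has_real_derivative g z) (at z within {..c})) \<and> (G \<longlongrightarrow> 0) at_bot \<and> (\<forall>z\<in>{..c}. \<bar>G z\<bar> \<le> M)"

text \<open>By \<open>has_integral_alt'\<close> the integral is a limit over large boxes
  \<open>[a, b]\<close>. As soon as such a box contains \<open>c\<close>, its upper end is cut off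
  there and only \<open>a\<close> matters, which leaves the improper integral.\<close>

lemma has_integral_atMost_iff:
  fixes f :: "real \<Rightarrow> real"
  assumes f: "continuous_on {..c} f"
  shows "(f has_integral y) {..c} \<longleftrightarrow> ((\<lambda>a. integral {a..c} f) \<longlongrightarrow> y) at_bot"
proof -
  let ?f = "\<lambda>x. if x \<in> {..c} then f x else 0"
  have Int: "{..c} \<inter> {a..b} = {a..min b c}" for a b by auto
  have int: "?f integrable_on cbox a b" for a b
  proof -
    have "f integrable_on {a..min b c}"
      using f by (intro integrable_continuous_real continuous_on_subset[OF f]) auto
    then show ?thesis unfolding box_real integrable_restrict_Int Int .
  qed
  have eq: "integral (cbox a b) ?f = integral {a..min b c} f" for a b
    unfolding box_real integral_restrict_Int Int ..
  have "(f has_integral y) {..c} \<longleftrightarrow>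
     (\<forall>e>0. \<exists>B>0. \<forall>a b. ball 0 B \<subseteq> cbox a b \<longrightarrow> \<bar>integral {a..min b c} f - y\<bar> < e)"
    unfolding has_integral_alt'[of f y] eq using int by simp
  also have "\<dots> \<longleftrightarrow> ((\<lambda>a. integral {a..c} f) \<longlongrightarrow> y) at_bot"
  proof
    assume L: "\<forall>e>0. \<exists>B>0. \<forall>a b. ball 0 B \<subseteq> cbox a b \<longrightarrow> \<bar>integral {a..min b c} f - y\<bar> < e"
    show "((\<lambda>a. integral {a..c} f) \<longlongrightarrow> y) at_bot"
    proof (rule tendstoI)
      fix e :: real assume "0 < e"
      then obtain B where B: "B > 0" "\<And>a b. ball 0 B \<subseteq> cbox a b \<Longrightarrow> \<bar>integral {a..min b c} f - y\<bar> < e"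
        using L by blast
      have "dist (integral {a..c} f) y < e" if "a \<le> - B" for a
      proof -
        have "ball 0 B \<subseteq> cbox a (max B c)" using that by (auto simp: dist_real_def abs_less_iff)
        then show ?thesis using B(2)[of a "max B c"] by (simp add: dist_real_def)
      qed
      then show "\<forall>\<^sub>F a in at_bot. dist (integral {a..c} f) y < e"
        by (auto simp: eventually_at_bot_linorder)
    qed
  next
    assume R: "((\<lambda>a. integral {a..c} f) \<longlongrightarrow> y) at_bot"
    show "\<forall>e>0. \<exists>B>0. \<forall>a b. ball 0 B \<subseteq> cbox a b \<longrightarrow> \<bar>integral {a..min b c} f - y\<bar> < e"
    proof (intro allI impI)
      fix e :: real assume "0 < e"
      then obtain N where N: "\<And>a. a \<le> N \<Longrightarrow> \<bar>integral {a..c} f - y\<bar> < e"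
        using tendstoD[OF R] by (auto simp: eventually_at_bot_linorder dist_real_def)
      \<comment> \<open>Large enough that \<open>- \<bar>N\<bar>\<close> and
        \<open>\<bar>c\<bar>\<close> lie in the ball, hence in the box; this forces
        \<open>a \<le> N\<close> and \<open>c \<le> b\<close>.\<close>
      define B where "B = \<bar>N\<bar> + \<bar>c\<bar> + 1"
      have "\<bar>integral {a..min b c} f - y\<bar> < e" if ab: "ball 0 B \<subseteq> cbox a b" for a b
      proof -
        have "- B < x \<Longrightarrow> x < B \<Longrightarrow> a \<le> x \<and> x \<le> b" for x using ab by (auto simp: subset_iff dist_real_def)
        from this[of "- \<bar>N\<bar>"] this[of "\<bar>c\<bar>"] have "a \<le> - \<bar>N\<bar>" "\<bar>c\<bar> \<le> b" by (auto simp: B_def)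
        then have "a \<le> N" "min b c = c" by auto
        then show ?thesis using N by simp
      qed
      then show "\<exists>B>0. \<forall>a b. ball 0 B \<subseteq> cbox a b \<longrightarrow> \<bar>integral {a..min b c} f - y\<bar> < e"
        by (intro exI[of _ B]) (auto simp: B_def)
    qed
  qed
  finally show ?thesis .
qed

lemma integral_primitive:
  fixes G :: "real \<Rightarrow> real"
  assumes "\<And>z. z \<in> {..c} \<Longrightarrow> (G has_real_derivative g z) (at z within {..c})" "a \<le> z" "z \<le> c"
  shows "(g has_integral (G z - G a)) {a..z}"
proof (rule fundamental_theorem_of_calculus)
  fix x assume "x \<in> {a..z}"
  then show "(G has_vector_derivative g x) (at x within {a..z})"
    using has_vector_derivative_within_subset[of G "g x" x "{..c}" "{a..z}"] assms(1)[of x] assms(3)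
    by (auto simp: has_real_derivative_iff_has_vector_derivative)
qed (use assms in auto)

lemma has_integral_atMost_primitive:
  fixes G :: "real \<Rightarrow> real"
  assumes G: "\<And>z. z \<in> {..c} \<Longrightarrow> (G has_real_derivative g z) (at z within {..c})" and "z \<le> c"
    and g: "continuous_on {..c} g"
  shows "(g has_integral y) {..z} \<longleftrightarrow> (G \<longlongrightarrow> G z - y) at_bot"
proof -
  have "continuous_on {..z} g" using g assms(2) continuous_on_subset by fastforce
  then have "(g has_integral y) {..z} \<longleftrightarrow> ((\<lambda>a. integral {a..z} g) \<longlongrightarrow> y) at_bot"
    by (rule has_integral_atMost_iff)
  also have "\<dots> \<longleftrightarrow> ((\<lambda>a. G z - G a) \<longlongrightarrow> y) at_bot"
  proof (rule tendsto_cong)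
    have "integral {a..z} g = G z - G a" if "a \<le> z" for a
      using integral_primitive[OF G that assms(2)] by blast
    then show "\<forall>\<^sub>F a in at_bot. integral {a..z} g = G z - G a" by (auto simp: eventually_at_bot_linorder)
  qed
  also have "\<dots> \<longleftrightarrow> (G \<longlongrightarrow> G z - y) at_bot"
    using tendsto_diff[OF tendsto_const, of "\<lambda>a. G z - G a" y at_bot "G z"] tendsto_diff[OF tendsto_const, of G "G z - y" at_bot "G z"] by auto
  finally show ?thesis .
qed

lemma vanishing_primitive_has_integral:
  assumes "vanishing_primitive c M g G" "continuous_on {..c} g" "z \<le> c"
  shows "(g has_integral G z) {..z}"
  using assms by (subst has_integral_atMost_primitive[where c=c and G=G]) (auto simp: vanishing_primitive_def)

text \<open>The supremum bounds integrals over bounded intervals \<open>{z1..z2}\<close> only.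
  Integrability provides the limit for \<open>z1\<close> tending to minus infinity, and the bound
  survives this limit.\<close>

lemma integrable_imp_vanishing_primitive:
  assumes g: "continuous_on {..c} g" and int: "g integrable_on {..c}" and M: "0 \<le> M"
    and le: "(SUP z2\<in>{..c}. SUP z1\<in>{..z2}. ennreal \<bar>integral {z1..z2} g\<bar>) \<le> ennreal M"
  shows "vanishing_primitive c M g (\<lambda>z. integral {..z} g)"
proof -
  obtain H where H: "\<And>z. z \<in> {..c} \<Longrightarrow> (H has_real_derivative g z) (at z within {..c})"
    using ex_primitive_end[of 2 c g] g by (auto simp: end_int_def)
  obtain y where "(g has_integral y) {..c}" using int by blast
  then have lim: "(H \<longlongrightarrow> H c - y) at_bot" using has_integral_atMost_primitive[of c H g c y] H g by auto
  define l where "l = H c - y"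
  have eq: "integral {..z} g = H z - l" if "z \<le> c" for z
  proof (rule integral_unique)
    show "(g has_integral (H z - l)) {..z}"
      using has_integral_atMost_primitive[of c H g z "H z - l"] H g that lim by (auto simp: l_def)
  qed
  have bound: "\<bar>H z - l\<bar> \<le> M" if z: "z \<le> c" for z
  proof (rule tendsto_upperbound)
    show "((\<lambda>a. \<bar>H z - H a\<bar>) \<longlongrightarrow> \<bar>H z - l\<bar>) at_bot" unfolding l_def by (intro tendsto_intros lim)
    have "\<bar>H z - H a\<bar> \<le> M" if "a \<le> z" for a
    proof -
      have "integral {a..z} g = H z - H a" using integral_primitive[OF H that z] by blast
      moreover have "\<bar>integral {a..z} g\<bar> \<le> M" using le z that M by (simp add: SUP_le_iff)
      ultimately show ?thesis by simp
    qed
    then show "\<forall>\<^sub>F a in at_bot. \<bar>H z - H a\<bar> \<le> M" by (auto simp: eventually_at_bot_linorder)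
  qed simp
  show ?thesis unfolding vanishing_primitive_def
  proof (intro conjI ballI)
    fix z assume z: "z \<in> {..c}"
    have "((\<lambda>z. H z - l) has_real_derivative g z) (at z within {..c})"
      using DERIV_diff[OF H[OF z] DERIV_const] by simp
    then show "((\<lambda>z. integral {..z} g) has_real_derivative g z) (at z within {..c})"
      by (rule has_field_derivative_transform_within[where d=1]) (use z eq in auto)
    show "\<bar>integral {..z} g\<bar> \<le> M" using eq bound z by simp
  next
    have "((\<lambda>z. H z - l) \<longlongrightarrow> 0) at_bot" using lim by (simp add: l_def LIM_zero)
    then show "((\<lambda>z. integral {..z} g) \<longlongrightarrow> 0) at_bot"
      by (rule Lim_transform_eventually) (auto simp: eq eventually_at_bot_linorder intro!: exI[of _ c])
  qed
qed

lemma vanishing_primitive_SUP_le: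
  assumes "vanishing_primitive c M g G" "0 \<le> M"
  shows "(SUP z2\<in>{..c}. SUP z1\<in>{..z2}. ennreal \<bar>integral {z1..z2} g\<bar>) \<le> ennreal (2 * M)"
proof -
  have "\<bar>integral {z1..z2} g\<bar> \<le> 2 * M" if "z2 \<le> c" "z1 \<le> z2" for z1 z2
  proof -
    have "integral {z1..z2} g = G z2 - G z1"
      using assms(1) that by (intro integral_unique integral_primitive[where c=c]) (auto simp: vanishing_primitive_def)
    moreover have "\<bar>G z2\<bar> \<le> M" "\<bar>G z1\<bar> \<le> M" using assms(1) that by (auto simp: vanishing_primitive_def)
    ultimately show ?thesis by linarith
  qed
  then show ?thesis using assms(2) by (simp add: SUP_le_iff)
qed

text \<open>The local target space with its norm, with a real constant: by the next two lemmas this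
  is the same up to the factor 6. At a Kimura end the factor \<open>t\<close> of the target and the
  weight in the norm of \<open>F t / t\<close> cancel, so that a plain Hoelder bound
  remains.\<close>

definition end_target :: "nat \<Rightarrow> bool \<Rightarrow> real \<Rightarrow> real \<Rightarrow> real \<Rightarrow> (real \<Rightarrow> real) \<Rightarrow> bool" where
  "end_target m nt \<gamma> c M g \<longleftrightarrow> holder_bound \<gamma> (end_int m c) M g \<and> (\<exists>l. (g \<longlongrightarrow> l) (end_filter m)) \<and>
     (m \<noteq> 1 \<longrightarrow> (\<exists>G. vanishing_primitive c M g G \<and> (nt \<longrightarrow> (\<exists>GG. vanishing_primitive c M G GG))))"

lemma holder_norm_cong: "(\<And>z. z \<in> U \<Longrightarrow> f z = g z) \<Longrightarrow> holder_norm \<gamma> U f = holder_norm \<gamma> U g"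
  unfolding holder_norm_def sup_norm_def holder_seminorm_def
  by (intro arg_cong2[where f = "(+)"] SUP_cong) auto

lemma end_aD_imp_end_target:
  assumes D: "end_aD m nt \<gamma> c g" and n: "end_aD_norm m nt \<gamma> c g \<le> ennreal M" and M: "0 \<le> M" and c: "m = 1 \<Longrightarrow> 0 < c"
  shows "end_target m nt \<gamma> c M g"
proof (cases "m = 1")
  case True
  have "holder_norm \<gamma> {0<..c} (\<lambda>z. z * (g z / z)) = holder_norm \<gamma> {0<..c} g"
    by (intro holder_norm_cong) auto
  then have "holder_bound \<gamma> {0<..c} M g"
    using n M True by (intro holder_norm_le_imp_bound) (auto simp: end_aD_norm_def kim_D_norm_def)
  moreover obtain l where "((\<lambda>z. z * (g z / z)) \<longlongrightarrow> l) (at_right 0)"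
    using D True by (auto simp: end_aD_def kim_D_def)
  then have "(g \<longlongrightarrow> l) (at_right 0)"
    by (rule Lim_transform_eventually) (auto simp: eventually_at_right_field intro!: exI[of _ 1])
  ultimately show ?thesis using True by (auto simp: end_target_def end_int_def end_filter_def)
next
  case False
  then have D: "quad_D nt \<gamma> c g" and n: "quad_D_norm nt \<gamma> c g \<le> ennreal M"
    using D n by (auto simp: end_aD_def end_aD_norm_def)
  have "holder_norm \<gamma> {..c} g \<le> quad_D_norm nt \<gamma> c g" unfolding quad_D_norm_def add.assoc by (rule le_iff_add[THEN iffD2]) auto
  then have hb: "holder_bound \<gamma> {..c} M g" using n M by (intro holder_norm_le_imp_bound) auto
  have g: "continuous_on {..c} g" "g integrable_on {..c}" using D by (auto simp: quad_D_def)
  have "(SUP z2\<in>{..c}. SUP z1\<in>{..z2}. ennreal \<bar>integral {z1..z2} g\<bar>) \<le> quad_D_norm nt \<gamma> c g"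
    unfolding quad_D_norm_def by (simp add: add_increasing add_increasing2)
  then have v: "vanishing_primitive c M g (\<lambda>z. integral {..z} g)"
    using n g M by (intro integrable_imp_vanishing_primitive) auto
  have "vanishing_primitive c M (\<lambda>z. integral {..z} g) (\<lambda>z. integral {..z} (\<lambda>z. integral {..z} g))" if nt
  proof (rule integrable_imp_vanishing_primitive)
    show "continuous_on {..c} (\<lambda>z. integral {..z} g)"
      using v unfolding vanishing_primitive_def by (meson DERIV_continuous continuous_on_eq_continuous_within)
    show "(\<lambda>z. integral {..z} g) integrable_on {..c}" using D that by (auto simp: quad_D_def)
    have "(SUP z2\<in>{..c}. SUP z1\<in>{..z2}. ennreal \<bar>integral {z1..z2} (\<lambda>z. integral {..z} g)\<bar>) \<le> quad_D_norm nt \<gamma> c g"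
      unfolding quad_D_norm_def using that by (simp add: add_increasing)
    then show "(SUP z2\<in>{..c}. SUP z1\<in>{..z2}. ennreal \<bar>integral {z1..z2} (\<lambda>z. integral {..z} g)\<bar>) \<le> ennreal M"
      using n by auto
  qed (rule M)
  then show ?thesis using hb v D False unfolding end_target_def quad_D_def
    by (auto simp: end_int_def end_filter_def)
qed

lemma end_target_imp_end_aD:
  assumes t: "end_target m nt \<gamma> c M g" and M: "0 \<le> M" and \<gamma>: "0 < \<gamma>"
  shows "end_aD m nt \<gamma> c g" "end_aD_norm m nt \<gamma> c g \<le> ennreal (6 * M)"
proof -
  have "end_aD m nt \<gamma> c g \<and> end_aD_norm m nt \<gamma> c g \<le> ennreal (6 * M)"
  proof (cases "m = 1")
    case True
    have hb: "holder_bound \<gamma> {0<..c} M g" using t True by (simp add: end_target_def end_int_def)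
    have "holder_norm \<gamma> {0<..c} (\<lambda>z. z * (g z / z)) = holder_norm \<gamma> {0<..c} g"
      by (intro holder_norm_cong) auto
    then have n: "kim_D_norm \<gamma> c (\<lambda>t. g t / t) \<le> ennreal (2 * M)"
      using holder_bound_imp_norm_le[OF hb M] by (simp add: kim_D_norm_def)
    obtain l where "(g \<longlongrightarrow> l) (at_right 0)" using t True by (auto simp: end_target_def end_filter_def)
    then have "((\<lambda>z. z * (g z / z)) \<longlongrightarrow> l) (at_right 0)"
      by (rule Lim_transform_eventually) (auto simp: eventually_at_right_field intro!: exI[of _ 1])
    moreover have "continuous_on {0<..c} (\<lambda>t. g t / t)"
      using holder_bound_continuous_on[OF hb \<gamma>] by (intro continuous_intros) auto
    ultimately have "kim_D \<gamma> c (\<lambda>t. g t / t)" using le_less_trans[OF n ennreal_less_top] unfolding kim_D_def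
      by auto
    moreover have "ennreal (2 * M) \<le> ennreal (6 * M)" using M by (intro ennreal_leI) auto
    ultimately show ?thesis using n True by (auto simp: end_aD_def end_aD_norm_def)
  next
    case False
    have hb: "holder_bound \<gamma> {..c} M g" using t False by (simp add: end_target_def end_int_def)
    note g = holder_bound_continuous_on[OF hb \<gamma>]
    obtain G where G: "vanishing_primitive c M g G" "nt \<longrightarrow> (\<exists>GG. vanishing_primitive c M G GG)"
      using t False by (auto simp: end_target_def)
    have Gc: "continuous_on {..c} G"
      using G(1) unfolding vanishing_primitive_def by (meson DERIV_continuous continuous_on_eq_continuous_within)
    have eq: "integral {..z} g = G z" if "z \<le> c" for z
      using vanishing_primitive_has_integral[OF G(1) g that] by blast
    have 1: "g integrable_on {..c}" using vanishing_primitive_has_integral[OF G(1) g order_refl] by blast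
    have 2: "(\<lambda>z. integral {..z} g) integrable_on {..c} \<and>
      (SUP z2\<in>{..c}. SUP z1\<in>{..z2}. ennreal \<bar>integral {z1..z2} (\<lambda>z. integral {..z} g)\<bar>) \<le> ennreal (2 * M)" if nt: nt
    proof -
      obtain GG where GG: "vanishing_primitive c M G GG" using G(2) nt by blast
      have "G integrable_on {..c}" using vanishing_primitive_has_integral[OF GG Gc order_refl] by blast
      then have "(\<lambda>z. integral {..z} g) integrable_on {..c}"
        by (rule integrable_spike[where S="{}"]) (use eq in auto)
      moreover have "(SUP z2\<in>{..c}. SUP z1\<in>{..z2}. ennreal \<bar>integral {z1..z2} (\<lambda>z. integral {..z} g)\<bar>)
          = (SUP z2\<in>{..c}. SUP z1\<in>{..z2}. ennreal \<bar>integral {z1..z2} G\<bar>)"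
      proof (intro SUP_cong refl)
        fix z2 z1 assume "z2 \<in> {..c}"
        then have "integral {z1..z2} (\<lambda>z. integral {..z} g) = integral {z1..z2} G"
          by (intro integral_cong) (use eq in auto)
        then show "ennreal \<bar>integral {z1..z2} (\<lambda>z. integral {..z} g)\<bar> = ennreal \<bar>integral {z1..z2} G\<bar>" by simp
      qed
      ultimately show ?thesis using vanishing_primitive_SUP_le[OF GG M] by auto
    qed
    \<comment> \<open>Each of the three summands contributes \<open>2 * M\<close>: the Hoelder norm
      by \<open>holder_bound_imp_norm_le\<close>, the integrals as differences of two values of a
      primitive.\<close>
    have "quad_D_norm nt \<gamma> c g \<le> ennreal (2 * M) + ennreal (2 * M) + ennreal (2 * M)"
      unfolding quad_D_norm_def
      using holder_bound_imp_norm_le[OF hb M] vanishing_primitive_SUP_le[OF G(1) M] 2 by (intro add_mono) auto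
    also have "\<dots> = ennreal (6 * M)" using M by (simp add: ennreal_plus[symmetric] del: ennreal_plus)
    finally have n: "quad_D_norm nt \<gamma> c g \<le> ennreal (6 * M)" .
    then have "quad_D_norm nt \<gamma> c g < \<infinity>" using le_less_trans[OF _ ennreal_less_top] by simp
    then have "quad_D nt \<gamma> c g" unfolding quad_D_def
      using g 1 2 t False by (auto simp: end_target_def end_filter_def)
    then show ?thesis using n False by (auto simp: end_aD_def end_aD_norm_def)
  qed
  then show "end_aD m nt \<gamma> c g" "end_aD_norm m nt \<gamma> c g \<le> ennreal (6 * M)" by auto
qed

section \<open>Fredholm operators with a range cut out by functionals\<close>

text \<open>Steinitz exchange modulo \<open>R\<close>. Every \<open>w\<close> in \<open>B'\<close>
  is congruent modulo \<open>R\<close> to some \<open>p w\<close> in the span of \<open>B\<close>. A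
  linear relation among the \<open>p w\<close> would be one among the \<open>w\<close> modulo
  \<open>R\<close>, so \<open>p\<close> is injective on \<open>B'\<close> with independent
  image.\<close>

lemma quotient_basis_card_le:
  fixes R :: "'v::real_vector set"
  assumes R: "subspace R" and B: "quotient_basis Y R B" and B': "quotient_basis Y R B'"
  shows "card B' \<le> card B"
proof -
  have fin: "finite B" "finite B'" "B' \<subseteq> Y" using B B' by (auto simp: quotient_basis_def)
  have indep: "\<And>u. (\<Sum>v\<in>B'. u v *\<^sub>R v) \<in> R \<Longrightarrow> \<forall>v\<in>B'. u v = 0" using B' by (auto simp: quotient_basis_def)
  have "\<forall>w\<in>B'. \<exists>u. w - (\<Sum>v\<in>B. u v *\<^sub>R v) \<in> R" using B fin by (auto simp: quotient_basis_def)
  then obtain u where u: "\<And>w. w \<in> B' \<Longrightarrow> w - (\<Sum>v\<in>B. u w v *\<^sub>R v) \<in> R" by metis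
  define p where "p w = (\<Sum>v\<in>B. u w v *\<^sub>R v)" for w
  have p: "p w \<in> span B" for w unfolding p_def by (intro span_sum span_scale span_base)
  have zero: "\<forall>w\<in>B'. a w = 0" if "(\<Sum>w\<in>B'. a w *\<^sub>R p w) = 0" for a
  proof (rule indep)
    have "(\<Sum>w\<in>B'. a w *\<^sub>R (w - p w)) \<in> R"
      using u R by (intro subspace_sum subspace_scale) (auto simp: p_def)
    then show "(\<Sum>w\<in>B'. a w *\<^sub>R w) \<in> R"
      using that by (simp add: scaleR_diff_right sum_subtractf)
  qed
  have inj: "inj_on p B'"
  proof (rule inj_onI, rule ccontr)
    fix x y assume xy: "x \<in> B'" "y \<in> B'" "p x = p y" "x \<noteq> y"
    \<comment> \<open>If \<open>p x = p y\<close>, these coefficients, 1 at \<open>x\<close> and -1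
      at \<open>y\<close>, give a nontrivial relation.\<close>
    define a :: "'v \<Rightarrow> real" where "a w = (if w = x then 1 else 0) - (if w = y then 1 else 0)" for w
    have "(\<Sum>w\<in>B'. a w *\<^sub>R p w) = (\<Sum>w\<in>B'. (if w = x then p w else 0) - (if w = y then p w else 0))"
      by (intro sum.cong) (auto simp: a_def)
    also have "\<dots> = 0" using xy fin by (simp add: sum_subtractf)
    finally have "a x = 0" using zero xy by blast
    then show False using xy by (simp add: a_def)
  qed
  have "independent (p ` B')"
  proof (subst dependent_finite)
    show "\<not> (\<exists>a. (\<exists>v\<in>p ` B'. a v \<noteq> 0) \<and> (\<Sum>v\<in>p ` B'. a v *\<^sub>R v) = 0)"
    proof
      assume "\<exists>a. (\<exists>v\<in>p ` B'. a v \<noteq> 0) \<and> (\<Sum>v\<in>p ` B'. a v *\<^sub>R v) = 0"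
      then obtain a v where "v \<in> B'" "a (p v) \<noteq> 0" "(\<Sum>v\<in>B'. a (p v) *\<^sub>R p v) = 0"
        by (auto simp: sum.reindex[OF inj])
      then show False using zero[of "\<lambda>v. a (p v)"] by blast
    qed
  qed (use fin in auto)
  then have "card (p ` B') \<le> card B" using independent_span_bound[of B "p ` B'"] fin p by auto
  then show ?thesis by (simp add: card_image[OF inj])
qed

lemma codimension_eq:
  assumes "subspace R" "quotient_basis Y R B"
  shows "codimension Y R = card B"
  unfolding codimension_def
  using assms quotient_basis_card_le by (intro the_equality) (blast intro: le_antisym)+

text \<open>Linearity is known only for arguments in \<open>Y\<close>, so the induction has to carry
  the membership of the partial sums along.\<close>

lemma linear_on_sum:
  fixes L :: "'v::real_vector \<Rightarrow> real"
  assumes Y: "subspace Y" and L: "\<And>g h c. g \<in> Y \<Longrightarrow> h \<in> Y \<Longrightarrow> L (g + c *\<^sub>R h) = L g + c * L h"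
    and F: "finite F" "F \<subseteq> Y"
  shows "L (\<Sum>v\<in>F. u v *\<^sub>R v) = (\<Sum>v\<in>F. u v * L v)"
  using F
proof (induction F rule: finite_induct)
  case empty
  have "0 \<in> Y" using Y by (rule subspace_0)
  then have "L (0 + 1 *\<^sub>R 0) = L 0 + 1 * L 0" using L by blast
  then show ?case by simp
next
  case (insert x F)
  have "(\<Sum>v\<in>F. u v *\<^sub>R v) \<in> Y" using Y insert by (intro subspace_sum subspace_scale) auto
  then have "L ((\<Sum>v\<in>F. u v *\<^sub>R v) + u x *\<^sub>R x) = L (\<Sum>v\<in>F. u v *\<^sub>R v) + u x * L x"
    using L insert by blast
  then show ?case using insert by (simp add: add.commute)
qed

text \<open>A biorthogonal system: modulo the common kernel \<open>R\<close>, the coefficient of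
  \<open>e i\<close> in \<open>y\<close> is \<open>L i y\<close>. This gives independence and
  generation at once.\<close>

lemma quotient_basis_dual:
  fixes L :: "'i \<Rightarrow> 'v::real_vector \<Rightarrow> real"
  assumes Y: "subspace Y" and S: "finite S" and e: "\<And>i. i \<in> S \<Longrightarrow> e i \<in> Y"
    and L: "\<And>i g h c. i \<in> S \<Longrightarrow> g \<in> Y \<Longrightarrow> h \<in> Y \<Longrightarrow> L i (g + c *\<^sub>R h) = L i g + c * L i h"
    and dual: "\<And>i j. i \<in> S \<Longrightarrow> j \<in> S \<Longrightarrow> L i (e j) = (if i = j then 1 else 0)"
  defines "R \<equiv> {g\<in>Y. \<forall>i\<in>S. L i g = 0}"
  shows "subspace R" "quotient_basis Y R (e ` S)" "card (e ` S) = card S"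
proof -
  have 0: "0 \<in> Y" using Y by (rule subspace_0)
  have L0: "L i 0 = 0" if "i \<in> S" for i using L[OF that 0 0, of 1] by simp
  have Lsc: "L i (c *\<^sub>R h) = c * L i h" if "i \<in> S" "h \<in> Y" for i c h
    using L[OF that(1) 0 that(2), of c] L0[OF that(1)] by simp
  show "subspace R"
  proof (rule subspaceI)
    show "x + y \<in> R" if "x \<in> R" "y \<in> R" for x y
      using that L[of _ x y 1] Y by (auto simp: R_def subspace_add)
  qed (use Y L0 Lsc in \<open>auto simp: R_def subspace_0 subspace_scale\<close>)
  have inj: "inj_on e S"
  proof (rule inj_onI)
    fix i j assume "i \<in> S" "j \<in> S" "e i = e j"
    then show "i = j" using dual[of i i] dual[of i j] by (auto split: if_splits)
  qed
  then show "card (e ` S) = card S" by (rule card_image)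
  have Ls: "L i (\<Sum>v\<in>e ` S. u v *\<^sub>R v) = u (e i)" if "i \<in> S" for i u
  proof -
    have "L i (\<Sum>v\<in>e ` S. u v *\<^sub>R v) = (\<Sum>v\<in>e ` S. u v * L i v)"
      using L[OF that] Y S e by (intro linear_on_sum[where Y = Y]) auto
    also have "\<dots> = (\<Sum>j\<in>S. u (e j) * L i (e j))" by (simp add: sum.reindex[OF inj])
    also have "\<dots> = (\<Sum>j\<in>S. if i = j then u (e j) else 0)" using dual that by (intro sum.cong) auto
    finally show ?thesis using S that by simp
  qed
  have sumY: "(\<Sum>v\<in>e ` S. u v *\<^sub>R v) \<in> Y" for u using Y e by (intro subspace_sum subspace_scale) auto
  show "quotient_basis Y R (e ` S)"
    unfolding quotient_basis_def
  proof (intro conjI allI impI ballI)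
    fix u v assume "(\<Sum>v\<in>e ` S. u v *\<^sub>R v) \<in> R" "v \<in> e ` S"
    then show "u v = 0" using Ls by (auto simp: R_def)
  next
    fix y assume y: "y \<in> Y"
    define u where "u v = L (inv_into S e v) y" for v
    have "y - (\<Sum>v\<in>e ` S. u v *\<^sub>R v) \<in> R"
      unfolding R_def
    proof (intro CollectI conjI ballI)
      show "y - (\<Sum>v\<in>e ` S. u v *\<^sub>R v) \<in> Y" using Y y sumY by (intro subspace_diff) auto
      fix i assume i: "i \<in> S"
      have "L i (y + (-1) *\<^sub>R (\<Sum>v\<in>e ` S. u v *\<^sub>R v)) = L i y + (-1) * u (e i)"
        using L[OF i y sumY] Ls[OF i] by metis
      then show "L i (y - (\<Sum>v\<in>e ` S. u v *\<^sub>R v)) = 0" using i inj by (simp add: u_def)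
    qed
    then show "\<exists>u. y - (\<Sum>v\<in>e ` S. u v *\<^sub>R v) \<in> R" by blast
  qed (use S e in auto)
qed

text \<open>The range is closed because it is the common kernel of functionals bounded in the sense
  of \<open>cont\<close>; the dual vectors \<open>e i\<close> give the cokernel its basis.
  Boundedness is phrased with a real \<open>M\<close> above the norm, since the norm is extended
  real.\<close>

lemma fredholm_by_functionals:
  fixes X :: "'v::real_vector set" and Y :: "'w::real_vector set" and L :: "'i \<Rightarrow> 'w \<Rightarrow> real"
  assumes X: "subspace X" and Y: "subspace Y" and T: "T ` X \<subseteq> Y"
    and add: "\<And>f g. f \<in> X \<Longrightarrow> g \<in> X \<Longrightarrow> T (f + g) = T f + T g"
    and sc: "\<And>c f. f \<in> X \<Longrightarrow> T (c *\<^sub>R f) = c *\<^sub>R T f"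
    and bounded: "\<exists>C::real. \<forall>f\<in>X. nY (T f) \<le> ennreal C * nX f"
    and ker: "ker_on X T = span B" "finite B" "independent B"
    and S: "finite S" and e: "\<And>i. i \<in> S \<Longrightarrow> e i \<in> Y"
    and L: "\<And>i g h c. i \<in> S \<Longrightarrow> g \<in> Y \<Longrightarrow> h \<in> Y \<Longrightarrow> L i (g + c *\<^sub>R h) = L i g + c * L i h"
    and dual: "\<And>i j. i \<in> S \<Longrightarrow> j \<in> S \<Longrightarrow> L i (e j) = (if i = j then 1 else 0)"
    and cont: "\<And>i. i \<in> S \<Longrightarrow> \<exists>C. \<forall>g\<in>Y. \<forall>M>0. nY g \<le> ennreal M \<longrightarrow> \<bar>L i g\<bar> \<le> C * M"
    and range: "T ` X = {g\<in>Y. \<forall>i\<in>S. L i g = 0}"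
  shows "fredholm X nX Y nY T" "fredholm_index X Y T = int (card B) - int (card S)"
proof -
  note q = quotient_basis_dual[where Y=Y and S=S and e=e and L=L, OF Y S e L dual, folded range]
  have closed: "g \<in> T ` X" if f: "\<And>n::nat. f n \<in> X" and g: "g \<in> Y" and lim: "(\<lambda>n. nY (T (f n) - g)) \<longlonglongrightarrow> 0" for f g
    unfolding range
  proof (intro CollectI conjI ballI g)
    fix i assume i: "i \<in> S"
    obtain C where C: "\<And>g M. g \<in> Y \<Longrightarrow> 0 < M \<Longrightarrow> nY g \<le> ennreal M \<Longrightarrow> \<bar>L i g\<bar> \<le> C * M" using cont[OF i] by blast
    have le: "\<bar>L i g\<bar> \<le> C * M" if M: "0 < M" for M
    proof -
      have "\<forall>\<^sub>F n in sequentially. nY (T (f n) - g) < ennreal M"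
        using lim M by (intro order_tendstoD(2)[OF lim]) auto
      then obtain n where n: "nY (T (f n) - g) \<le> ennreal M" by (auto simp: eventually_sequentially intro: less_imp_le)
      have Tf: "T (f n) \<in> T ` X" using f by auto
      then have Y': "T (f n) \<in> Y" "L i (T (f n)) = 0" using i by (auto simp: range)
      have "L i (T (f n) + (-1) *\<^sub>R g) = - L i g" using L[OF i Y'(1) g, of "-1"] Y' by simp
      then have "L i (T (f n) - g) = - L i g" by simp
      moreover have "T (f n) - g \<in> Y" using Y Y' g by (intro subspace_diff)
      ultimately show ?thesis using C[OF _ M n] by simp
    qed
    show "L i g = 0"
    proof (rule ccontr)
      assume "L i g \<noteq> 0"
      then have pos: "0 < \<bar>L i g\<bar>" by simp
      have C0: "0 < C" using le[of 1] pos by linarith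
      \<comment> \<open>With this \<open>M\<close> the right-hand side is half of the left-hand
        side.\<close>
      have "\<bar>L i g\<bar> \<le> C * (\<bar>L i g\<bar> / (2 * C))" using pos C0 by (intro le) auto
      then show False using C0 pos by simp
    qed
  qed
  have "ker_on X T \<subseteq> span B" using ker by simp
  then show "fredholm X nX Y nY T"
    unfolding fredholm_def using X Y T add sc bounded ker(2) closed q(2) by blast
  show "fredholm_index X Y T = int (card B) - int (card S)"
    unfolding fredholm_index_def ker(1) using ker q by (simp add: codimension_eq dim_eq_card_independent)
qed

section \<open>The model operator near an end\<close>

text \<open>Near the end the limit bounds \<open>u\<close> by \<open>\<bar>l\<bar> + 1\<close>, and
  the rest of the interval is compact.\<close>

lemma end_int_bounded:
  fixes u :: "real \<Rightarrow> real"
  assumes u: "continuous_on (end_int m c) u" and l: "(u \<longlongrightarrow> l) (end_filter m)" and c: "m = 1 \<Longrightarrow> 0 < c"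
  obtains M where "0 \<le> M" "\<And>z. z \<in> end_int m c \<Longrightarrow> \<bar>u z\<bar> \<le> M"
proof -
  have "eventually (\<lambda>z. dist (u z) l < 1) (end_filter m)" using l by (rule tendstoD) simp
  then obtain d where d: "d \<in> end_int m c" "\<And>z. z \<in> end_int m d \<Longrightarrow> dist (u z) l < 1"
    using c by (auto elim: eventually_end_filterE[where c = c])
  have "{d..c} \<subseteq> end_int m c" using end_int_Un[OF d(1)] by blast
  then have "continuous_on {d..c} u" using u continuous_on_subset by blast
  then obtain K where K: "0 \<le> K" "\<And>z. z \<in> {d..c} \<Longrightarrow> \<bar>u z\<bar> \<le> K" using continuous_on_compact_bound by blast
  have "\<bar>u z\<bar> \<le> K + (\<bar>l\<bar> + 1)" if "z \<in> end_int m c" for z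
  proof -
    from that consider "z \<in> end_int m d" | "z \<in> {d..c}" using end_int_Un[OF d(1)] by blast
    then show ?thesis
    proof cases
      case 1 then show ?thesis using d(2)[of z] K(1) by (simp add: dist_real_def)
    next
      case 2 then show ?thesis using K(2)[of z] by simp
    qed
  qed
  then show ?thesis using K(1) by (intro that[of "K + (\<bar>l\<bar> + 1)"]) auto
qed

lemma deriv_zero_const:
  fixes f :: "real \<Rightarrow> real"
  assumes "is_interval U" "\<And>z. z \<in> U \<Longrightarrow> (f has_real_derivative 0) (at z within U)" "y \<in> U" "z \<in> U"
  shows "f y = f z"
  using deriv_dominated[of U f "\<lambda>_. 0" "\<lambda>_. 0" "\<lambda>_. 0" y z] deriv_dominated[of U f "\<lambda>_. 0" "\<lambda>_. 0" "\<lambda>_. 0" z y] assms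
  by (cases "z \<le> y") auto

lemma deriv_continuous_on:
  fixes f :: "real \<Rightarrow> real"
  assumes "\<And>z. z \<in> U \<Longrightarrow> (f has_real_derivative f' z) (at z within U)"
  shows "continuous_on U f"
  using assms by (meson DERIV_continuous continuous_on_eq_continuous_within)

text \<open>Subadditivity of the concave power: the fractions \<open>z / y\<close> and
  \<open>(y - z) / y\<close> add up to 1, and neither exceeds its own power
  \<open>\<gamma>\<close>.\<close>

lemma powr_diff_le:
  fixes y z :: real
  assumes "0 < z" "z \<le> y" "0 < \<gamma>" "\<gamma> \<le> 1"
  shows "y powr \<gamma> - z powr \<gamma> \<le> (y - z) powr \<gamma>"
proof -
  have *: "x / y \<le> (x / y) powr \<gamma>" if "0 \<le> x" "x \<le> y" for x
  proof (cases "x = 0")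
    case False
    have "(x / y) powr 1 \<le> (x / y) powr \<gamma>" using that False assms by (intro powr_mono') auto
    then show ?thesis using that False assms by simp
  qed simp
  have "z / y + (y - z) / y = 1" using assms by (simp add: field_simps)
  then have "1 \<le> (z / y) powr \<gamma> + ((y - z) / y) powr \<gamma>" using *[of z] *[of "y - z"] assms by linarith
  then have "y powr \<gamma> * 1 \<le> y powr \<gamma> * ((z / y) powr \<gamma> + ((y - z) / y) powr \<gamma>)" by (intro mult_left_mono) auto
  also have "\<dots> = z powr \<gamma> + (y - z) powr \<gamma>" using assms by (simp add: powr_divide distrib_left)
  finally show ?thesis by simp
qed

text \<open>The increment \<open>G y - G (y - 1)\<close> is the mean of \<open>g\<close> over a unit
  interval. It tends to \<open>l\<close> because \<open>g\<close> does, and to 0 because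
  \<open>G\<close> does.\<close>

lemma vanishing_primitive_limit_zero:
  assumes G: "vanishing_primitive c M g G" and l: "(g \<longlongrightarrow> l) at_bot"
  shows "l = 0"
proof -
  have "\<bar>l\<bar> \<le> e" if e: "0 < e" for e
  proof -
    have "eventually (\<lambda>z. dist (g z) l < e) at_bot" using l e by (rule tendstoD)
    then obtain T where T: "\<And>z. z \<le> T \<Longrightarrow> dist (g z) l < e" by (auto simp: eventually_at_bot_linorder)
    let ?U = "{..min T c}"
    have "\<bar>G y - G (y - 1) - l\<bar> \<le> e" if y: "y \<in> ?U" for y
    proof -
      have "\<bar>(G y - l * y) - (G (y - 1) - l * (y - 1))\<bar> \<le> e * y - e * (y - 1)"
      proof (rule deriv_dominated[of ?U "\<lambda>z. G z - l * z" "\<lambda>z. g z - l" "\<lambda>z. e * z" "\<lambda>_. e"])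
        show "((\<lambda>z. G z - l * z) has_real_derivative g z - l) (at z within ?U)" if "z \<in> ?U" for z
        proof -
          have "(G has_real_derivative g z) (at z within {..c})" using G that by (auto simp: vanishing_primitive_def)
          then have "(G has_real_derivative g z) (at z within ?U)" by (rule DERIV_subset) auto
          then show ?thesis by (auto intro!: derivative_eq_intros)
        qed
        show "\<bar>g z - l\<bar> \<le> e" if "z \<in> ?U" for z using T[of z] that by (simp add: dist_real_def)
        show "is_interval ?U" by (auto simp: is_interval_1)
      qed (use y in \<open>auto intro!: derivative_eq_intros\<close>)
      then show ?thesis by (simp add: algebra_simps)
    qed
    then have ev: "\<forall>\<^sub>F y in at_bot. \<bar>G y - G (y - 1) - l\<bar> \<le> e" by (auto simp: eventually_at_bot_linorder intro!: exI[of _ "min T c"])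
    have G0: "(G \<longlongrightarrow> 0) at_bot" using G by (simp add: vanishing_primitive_def)
    have "filterlim (\<lambda>y::real. y - 1) at_bot at_bot"
      unfolding filterlim_at_bot eventually_at_bot_linorder
    proof
      fix Z :: real
      show "\<exists>N. \<forall>n\<le>N. n - 1 \<le> Z" by (intro exI[of _ Z]) auto
    qed
    then have "((\<lambda>y. G (y - 1)) \<longlongrightarrow> 0) at_bot" using G0 filterlim_compose by blast
    then have "((\<lambda>y. \<bar>G y - G (y - 1) - l\<bar>) \<longlongrightarrow> \<bar>0 - 0 - l\<bar>) at_bot" by (intro tendsto_intros G0)
    then show ?thesis using tendsto_upperbound[OF _ ev] by simp
  qed
  then show ?thesis using field_le_epsilon[of "\<bar>l\<bar>" 0] by simp
qed

text \<open>In the quadratic case no integral condition on \<open>F2\<close> is needed: if \<open>F1\<close> and \<open>F2\<close> are the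
  derivatives of \<open>F\<close>, then \<open>F1\<close> and \<open>F\<close> minus its limit are vanishing primitives of \<open>F2\<close> and
  \<open>F1\<close>, and they are bounded.\<close>

definition end_domain :: "nat \<Rightarrow> real \<Rightarrow> real \<Rightarrow> real \<Rightarrow> (real \<Rightarrow> real) \<Rightarrow> (real \<Rightarrow> real) \<Rightarrow> (real \<Rightarrow> real) \<Rightarrow> bool" where
  "end_domain m \<gamma> c M F F1 F2 \<longleftrightarrow>
     (\<exists>l. (F \<longlongrightarrow> l) (end_filter m)) \<and>
     (if m = 1 then holder_bound \<gamma> (end_int m c) M F \<and> holder_bound \<gamma> (end_int m c) M F1
         \<and> holder_bound \<gamma> (end_int m c) M (\<lambda>z. z * F2 z)
         \<and> (\<exists>l. (F1 \<longlongrightarrow> l) (end_filter m)) \<and> ((\<lambda>z. z * F2 z) \<longlongrightarrow> 0) (end_filter m)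
      else (\<forall>z\<in>end_int m c. \<bar>F z\<bar> \<le> M \<and> \<bar>F1 z\<bar> \<le> M) \<and> holder_bound \<gamma> (end_int m c) M F2
         \<and> (F1 \<longlongrightarrow> 0) (end_filter m) \<and> (\<exists>l. (F2 \<longlongrightarrow> l) (end_filter m)))"

text \<open>The operator \<open>A F'' + B F'\<close> at a left end, where \<open>A\<close> has its
  normal form. \<open>B_lipschitz\<close> serves the Hoelder estimates, \<open>B_near\<close> is the
  rate that makes \<open>(B - b) / A\<close> integrable. \<open>E\<close> is any positive
  integrating factor; no normalisation is imposed, so that one global \<open>E\<close> can serve
  both ends. A right end is an instance after reflection.\<close>

locale end_model =
  fixes m :: nat and \<gamma> c b K \<sigma> :: real and A B E :: "real \<Rightarrow> real"
  assumes c: "m = 1 \<Longrightarrow> 0 < c" and \<gamma>: "0 < \<gamma>" "\<gamma> < 1"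
    and A: "z \<in> end_int m c \<Longrightarrow> A z = (if m = 1 then z else 1)"
    and K: "0 \<le> K" and \<sigma>: "0 < \<sigma>"
    and B_lipschitz: "y \<in> end_int m c \<Longrightarrow> z \<in> end_int m c \<Longrightarrow> \<bar>B y - B z\<bar> \<le> K * \<bar>y - z\<bar>"
    and B_near: "z \<in> end_int m c \<Longrightarrow> \<bar>B z - b\<bar> \<le> K * (if m = 1 then z else exp (\<sigma> * z))"
    and b: "m = 1 \<Longrightarrow> 0 \<le> b"
    and E: "z \<in> end_int m c \<Longrightarrow> (E has_real_derivative E z * B z / A z) (at z within end_int m c)"
    and E_pos: "z \<in> end_int m c \<Longrightarrow> 0 < E z"
begin

abbreviation W where "W \<equiv> end_int m c"

text \<open>An end is rejecting if \<open>1 / E\<close> is not the derivative of an element of the domain.\<close>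

definition neutral where "neutral \<longleftrightarrow> m \<noteq> 1 \<and> b = 0"
definition rejecting where "rejecting \<longleftrightarrow> (if m = 1 then 0 < b else 0 \<le> b)"

text \<open>The integrating factor of the model in which \<open>B\<close> is the constant
  \<open>b\<close>.\<close>

definition weight where "weight z = (if m = 1 then z powr b else exp (b * z))"
definition small where "small z = (if m = 1 then z else exp (\<sigma> * z))"
text \<open>The primitive of \<open>small / A\<close> that vanishes at the end; at a Kimura end the
  integrand is 1.\<close>

definition small_int where "small_int z = (if m = 1 then z else exp (\<sigma> * z) / \<sigma>)"

section \<open>The coefficient \<open>B\<close> and the size of the integrating factor\<close>

lemma W_pos: "z \<in> W \<Longrightarrow> m = 1 \<Longrightarrow> 0 < z"
  by (simp add: end_int_def)

lemma eventually_W: "eventually (\<lambda>z. z \<in> W) (end_filter m)"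
  using c by (rule eventually_end_filter)

lemma A_pos: "z \<in> W \<Longrightarrow> 0 < A z"
  using A[of z] W_pos[of z] by (metis zero_less_one)

lemma small_mono: "z \<in> W \<Longrightarrow> small z \<le> small c" "z \<in> W \<Longrightarrow> small_int z \<le> small_int c"
  using \<sigma> end_int_le[of z m c] by (auto simp: small_def small_int_def divide_right_mono)

lemma small_nonneg: "z \<in> W \<Longrightarrow> 0 \<le> small z" "z \<in> W \<Longrightarrow> 0 \<le> small_int z" "0 \<le> small c" "0 \<le> small_int c"
  using \<sigma> W_pos c by (auto simp: small_def small_int_def less_imp_le)

lemma small_int_deriv: "z \<in> W \<Longrightarrow> ((\<lambda>z. N * small_int z) has_real_derivative N * small z / A z) (at z within W)"
  using \<sigma> W_pos[of z] A[of z] by (auto simp: small_int_def small_def intro!: derivative_eq_intros)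

lemma small_tendsto: "(small \<longlongrightarrow> 0) (end_filter m)" "((\<lambda>z. N * small_int z) \<longlongrightarrow> 0) (end_filter m)"
proof -
  have s: "((\<lambda>z. 1 / \<sigma> * exp (\<sigma> * z)) \<longlongrightarrow> 0) at_bot" by (rule exp_primitive(2)[OF \<sigma>])
  show "((\<lambda>z. N * small_int z) \<longlongrightarrow> 0) (end_filter m)"
    using tendsto_mult_left[OF s, of N] unfolding small_int_def[abs_def] end_filter_def
    by (auto intro!: tendsto_eq_intros)
  show "(small \<longlongrightarrow> 0) (end_filter m)"
    using tendsto_mult_left[OF s, of \<sigma>] \<sigma> unfolding small_def[abs_def] end_filter_def
    by (auto intro!: tendsto_eq_intros)
qed

lemma B_near': "z \<in> W \<Longrightarrow> \<bar>B z - b\<bar> \<le> K * small z"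
  using B_near by (simp add: small_def)

lemma B_tendsto: "(B \<longlongrightarrow> b) (end_filter m)"
proof (rule Lim_null[THEN iffD2], rule Lim_null_comparison)
  show "\<forall>\<^sub>F z in end_filter m. norm (B z - b) \<le> K * small z"
    using eventually_W by eventually_elim (use B_near' in simp)
  show "((\<lambda>z. K * small z) \<longlongrightarrow> 0) (end_filter m)" using small_tendsto(1) tendsto_mult_right_zero by blast
qed

text \<open>A Hoelder constant of \<open>B\<close>: its sup bound plus its Lipschitz constant,
  doubled by \<open>holder_bound_lipschitz\<close>.\<close>

definition \<beta> where "\<beta> = 2 * (\<bar>b\<bar> + K * small c + K)"

lemma \<beta>_nonneg: "0 \<le> \<beta>" using K small_nonneg by (simp add: \<beta>_def)

lemma B_le: assumes "z \<in> W" shows "\<bar>B z\<bar> \<le> \<bar>b\<bar> + K * small c"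
proof -
  have "K * small z \<le> K * small c" using K small_mono assms by (intro mult_left_mono) auto
  then show ?thesis using B_near'[OF assms] by linarith
qed

lemma B_holder: "holder_bound \<gamma> W \<beta> B"
  unfolding \<beta>_def
proof (rule holder_bound_lipschitz)
  show "\<bar>B z\<bar> \<le> \<bar>b\<bar> + K * small c + K" if "z \<in> W" for z using B_le[OF that] K by simp
  fix y z assume yz: "y \<in> W" "z \<in> W" "z < y"
  have "\<bar>B y - B z\<bar> \<le> K * (y - z)" using B_lipschitz[OF yz(1,2)] yz by simp
  also have "\<dots> \<le> (\<bar>b\<bar> + K * small c + K) * (y - z)"
    using yz K small_nonneg by (intro mult_right_mono) auto
  finally show "\<bar>B y - B z\<bar> \<le> (\<bar>b\<bar> + K * small c + K) * (y - z)" .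
qed (use \<gamma> in auto)

lemma B_cont: "continuous_on W B" using B_holder \<gamma>(1) by (rule holder_bound_continuous_on)

lemma E_cont: "continuous_on W E" by (rule deriv_continuous_on) (rule E)

text \<open>The logarithm of \<open>E / weight\<close> has derivative \<open>(B - b) / A\<close>,
  which \<open>K * small / A\<close> dominates. So it converges at the end and stays within a fixed
  distance \<open>q\<close> of 0; \<open>Q\<close> is \<open>exp q\<close>.\<close>

lemma E_weight: "\<exists>Q>0. \<forall>z\<in>W. E z \<le> Q * weight z \<and> weight z \<le> Q * E z"
proof -
  define base where "base z = (if m = 1 then b * ln z else b * z)" for z
  have weight: "weight z = exp (base z)" if "z \<in> W" for z
    using W_pos[OF that] by (auto simp: weight_def base_def powr_def)
  obtain l where l: "\<And>z. z \<in> W \<Longrightarrow> \<bar>(ln (E z) - base z) - l\<bar> \<le> \<bar>K * small_int z\<bar>"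
  proof (rule dominated_deriv_tendsto[of m c "\<lambda>z. ln (E z) - base z" "\<lambda>z. (B z - b) / A z" "\<lambda>z. K * small_int z" "\<lambda>z. K * small z / A z"])
    fix z assume z: "z \<in> W"
    have "(base has_real_derivative b / A z) (at z within W)"
      unfolding base_def using A[OF z] W_pos[OF z] by (auto intro!: derivative_eq_intros)
    then show "((\<lambda>z. ln (E z) - base z) has_real_derivative (B z - b) / A z) (at z within W)"
      using E[OF z] E_pos[OF z] by (auto intro!: derivative_eq_intros simp: diff_divide_distrib)
    show "\<bar>(B z - b) / A z\<bar> \<le> K * small z / A z"
      using B_near'[OF z] A_pos[OF z] by (simp add: divide_right_mono)
    show "((\<lambda>z. K * small_int z) has_real_derivative K * small z / A z) (at z within W)" using z by (rule small_int_deriv)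
  qed (use c small_tendsto in auto)
  define q where "q = \<bar>l\<bar> + K * small_int c"
  have q: "\<bar>ln (E z) - base z\<bar> \<le> q" if z: "z \<in> W" for z
  proof -
    have "\<bar>K * small_int z\<bar> \<le> K * small_int c" using K small_mono[OF z] small_nonneg(2)[OF z] by (simp add: mult_left_mono)
    then show ?thesis using l[OF z] by (simp add: q_def)
  qed
  show ?thesis
  proof (intro exI[of _ "exp q"] conjI ballI)
    fix z assume z: "z \<in> W"
    have "E z = exp (ln (E z))" using E_pos[OF z] by simp
    also have "\<dots> \<le> exp (q + base z)" using q[OF z] by simp
    also have "\<dots> = exp q * weight z" by (simp add: exp_add weight[OF z])
    finally show "E z \<le> exp q * weight z" .
    have "weight z \<le> exp (q + ln (E z))" using q[OF z] by (simp add: weight[OF z])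
    also have "\<dots> = exp q * E z" using E_pos[OF z] by (simp add: exp_add)
    finally show "weight z \<le> exp q * E z" .
  qed simp
qed

lemma weight_pos: "z \<in> W \<Longrightarrow> 0 < weight z" using W_pos by (auto simp: weight_def)

lemma weight_tendsto: assumes "0 < b" shows "(weight \<longlongrightarrow> 0) (end_filter m)"
proof (cases "m = 1")
  case True
  then show ?thesis using tendsto_mult_left[OF powr_primitive(2)[OF assms, of 1], of b] assms
    unfolding end_filter_def weight_def[abs_def] by simp
next
  case False
  then show ?thesis using tendsto_mult_left[OF exp_primitive(2)[OF assms, of 1], of b] assms
    unfolding end_filter_def weight_def[abs_def] by simp
qed

lemma E_tendsto: assumes "0 < b" shows "(E \<longlongrightarrow> 0) (end_filter m)"
proof -
  obtain Q where Q: "\<forall>z\<in>W. E z \<le> Q * weight z" using E_weight by blast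
  show ?thesis
  proof (rule Lim_null_comparison)
    show "\<forall>\<^sub>F z in end_filter m. norm (E z) \<le> Q * weight z"
      using eventually_W by eventually_elim (use Q E_pos in \<open>auto simp: less_imp_le abs_of_pos\<close>)
    show "((\<lambda>z. Q * weight z) \<longlongrightarrow> 0) (end_filter m)" using weight_tendsto[OF assms] tendsto_mult_right_zero by blast
  qed
qed

text \<open>This is how error terms with the factor \<open>B - b\<close> are integrated from the
  end.\<close>

lemma primitive_small:
  assumes h: "continuous_on W h" and le: "\<And>z. z \<in> W \<Longrightarrow> \<bar>h z\<bar> \<le> N * small z / A z" and N: "0 \<le> N"
  obtains H where "\<And>z. z \<in> W \<Longrightarrow> (H has_real_derivative h z) (at z within W)" "(H \<longlongrightarrow> 0) (end_filter m)"
    "\<And>z. z \<in> W \<Longrightarrow> \<bar>H z\<bar> \<le> N * small_int z"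
proof -
  obtain H where H: "\<And>z. z \<in> W \<Longrightarrow> (H has_real_derivative h z) (at z within W)" "(H \<longlongrightarrow> 0) (end_filter m)"
    "\<And>z. z \<in> W \<Longrightarrow> \<bar>H z\<bar> \<le> \<bar>N * small_int z\<bar>"
    using dominated_primitive[OF h c small_int_deriv le small_tendsto(2)] by blast
  show ?thesis
  proof (rule that[of H])
    show "\<bar>H z\<bar> \<le> N * small_int z" if "z \<in> W" for z using H(3)[OF that] N small_nonneg(2)[OF that] by simp
  qed (use H in auto)
qed

text \<open>In the Kimura domain \<open>z * F2 z\<close> tends to 0, so only the first-order term
  survives in the limit. For \<open>b = 0\<close> nothing survives, which is the pointwise condition
  on the range.\<close>

lemma operator_tendsto_kimura:
  assumes "m = 1" and d: "end_domain m \<gamma> c M F F1 F2" and l: "(F1 \<longlongrightarrow> l) (end_filter m)"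
  shows "((\<lambda>z. A z * F2 z + B z * F1 z) \<longlongrightarrow> b * l) (end_filter m)"
proof -
  have "((\<lambda>z. z * F2 z + B z * F1 z) \<longlongrightarrow> 0 + b * l) (end_filter m)"
    using d \<open>m = 1\<close> by (intro tendsto_intros B_tendsto l) (auto simp: end_domain_def)
  then have "((\<lambda>z. z * F2 z + B z * F1 z) \<longlongrightarrow> b * l) (end_filter m)" by simp
  then show ?thesis
  proof (rule Lim_transform_eventually)
    show "\<forall>\<^sub>F z in end_filter m. z * F2 z + B z * F1 z = A z * F2 z + B z * F1 z"
      using eventually_W by eventually_elim (use A \<open>m = 1\<close> in simp)
  qed
qed

lemma operator_zero_at_end:
  assumes "m = 1" "b = 0" "end_domain m \<gamma> c M F F1 F2"
  shows "((\<lambda>z. A z * F2 z + B z * F1 z) \<longlongrightarrow> 0) (end_filter m)"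
proof -
  obtain l where "(F1 \<longlongrightarrow> l) (end_filter m)" using assms by (auto simp: end_domain_def)
  then show ?thesis using operator_tendsto_kimura[OF assms(1,3)] assms(2) by fastforce
qed

text \<open>A common upper bound for the constants of the separate estimates in
  \<open>operator_maps\<close>; \<open>op_bound_ge\<close> lists them.\<close>

definition op_bound where "op_bound = 3 + 6 * \<beta> + 2 * \<bar>b\<bar> + K * small_int c + K / \<sigma> * small_int c"

lemma op_bound_ge: "0 \<le> op_bound" "1 + 4 * \<beta> \<le> op_bound" "1 + 2 * \<bar>b\<bar> + K * small_int c \<le> op_bound"
  "2 + K / \<sigma> * small_int c \<le> op_bound"
proof -
  have "0 \<le> K * small_int c" "0 \<le> K / \<sigma> * small_int c" using K \<sigma> small_nonneg by auto
  then show "0 \<le> op_bound" "1 + 4 * \<beta> \<le> op_bound" "1 + 2 * \<bar>b\<bar> + K * small_int c \<le> op_bound"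
  "2 + K / \<sigma> * small_int c \<le> op_bound"
    using \<beta>_nonneg by (auto simp: op_bound_def)
qed

text \<open>Only the integral terms at a quadratic end need an idea. There
  \<open>F2 + B * F1\<close> is the derivative of \<open>F1 + b * (F - L) + H\<close>, where
  \<open>L\<close> is the limit of \<open>F\<close> and \<open>H\<close> the primitive of
  \<open>(B - b) * F1\<close>, which is exponentially small. If \<open>b = 0\<close> this can be
  integrated once more.\<close>

lemma operator_maps:
  assumes d: "end_domain m \<gamma> c M F F1 F2" and M: "0 \<le> M"
    and F: "\<And>z. z \<in> W \<Longrightarrow> (F has_real_derivative F1 z) (at z within W)"
    and F1: "\<And>z. z \<in> W \<Longrightarrow> (F1 has_real_derivative F2 z) (at z within W)"
  shows "end_target m neutral \<gamma> c (op_bound * M) (\<lambda>z. A z * F2 z + B z * F1 z)"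
proof (cases "m = 1")
  case True
  have "holder_bound \<gamma> W (M + 2 * \<beta> * M) (\<lambda>z. z * F2 z + B z * F1 z)"
    using d True by (intro holder_bound_add holder_bound_mult B_holder) (auto simp: end_domain_def)
  then have "holder_bound \<gamma> W (M + 2 * \<beta> * M) (\<lambda>z. A z * F2 z + B z * F1 z)"
    using A True by (subst holder_bound_cong[where g = "\<lambda>z. z * F2 z + B z * F1 z"]) auto
  moreover have "M + 2 * \<beta> * M \<le> op_bound * M"
    using op_bound_ge(2) M mult_right_mono[of "1 + 2 * \<beta>" op_bound M] \<beta>_nonneg by (simp add: distrib_right)
  ultimately have "holder_bound \<gamma> W (op_bound * M) (\<lambda>z. A z * F2 z + B z * F1 z)"
    by (rule holder_bound_mono[OF _ subset_refl])
  moreover obtain l where "(F1 \<longlongrightarrow> l) (end_filter m)" using d True by (auto simp: end_domain_def)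
  then have "((\<lambda>z. A z * F2 z + B z * F1 z) \<longlongrightarrow> b * l) (end_filter m)"
    using operator_tendsto_kimura[OF True d] by blast
  ultimately show ?thesis using True by (auto simp: end_target_def)
next
  case False
  have bounds: "\<And>z. z \<in> W \<Longrightarrow> \<bar>F z\<bar> \<le> M" "\<And>z. z \<in> W \<Longrightarrow> \<bar>F1 z\<bar> \<le> M" "holder_bound \<gamma> W M F2"
    and lim: "(F1 \<longlongrightarrow> 0) (end_filter m)" using d False by (auto simp: end_domain_def)
  obtain L where L: "(F \<longlongrightarrow> L) (end_filter m)" using d by (auto simp: end_domain_def)
  obtain L2 where L2: "(F2 \<longlongrightarrow> L2) (end_filter m)" using d False by (auto simp: end_domain_def)
  have W: "W = {..c}" and ef: "end_filter m = at_bot" using False by (auto simp: end_int_def end_filter_def)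
  have F1h: "holder_bound \<gamma> W (2 * M) F1"
    using bounds F1 \<gamma> by (intro holder_bound_deriv[where f' = F2]) (auto dest: holder_boundD(1))
  have "holder_bound \<gamma> W (M + 2 * \<beta> * (2 * M)) (\<lambda>z. F2 z + B z * F1 z)"
    by (intro holder_bound_add holder_bound_mult B_holder bounds F1h)
  then have "holder_bound \<gamma> W (M + 2 * \<beta> * (2 * M)) (\<lambda>z. A z * F2 z + B z * F1 z)"
    using A False by (subst holder_bound_cong[where g = "\<lambda>z. F2 z + B z * F1 z"]) auto
  moreover have "M + 2 * \<beta> * (2 * M) \<le> op_bound * M"
    using mult_right_mono[OF op_bound_ge(2) M] by (simp add: distrib_right)
  ultimately have hb: "holder_bound \<gamma> W (op_bound * M) (\<lambda>z. A z * F2 z + B z * F1 z)"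
    by (rule holder_bound_mono[OF _ subset_refl])
  have "((\<lambda>z. F2 z + B z * F1 z) \<longlongrightarrow> L2 + b * 0) (end_filter m)" by (intro tendsto_intros L2 B_tendsto lim)
  then have lim2: "((\<lambda>z. A z * F2 z + B z * F1 z) \<longlongrightarrow> L2 + b * 0) (end_filter m)"
  proof (rule Lim_transform_eventually)
    show "\<forall>\<^sub>F z in end_filter m. F2 z + B z * F1 z = A z * F2 z + B z * F1 z"
      using eventually_W by eventually_elim (use A False in simp)
  qed
  have F1c: "continuous_on W F1" using F1 by (rule deriv_continuous_on)
  obtain H where H: "\<And>z. z \<in> W \<Longrightarrow> (H has_real_derivative (B z - b) * F1 z) (at z within W)" "(H \<longlongrightarrow> 0) (end_filter m)"
    "\<And>z. z \<in> W \<Longrightarrow> \<bar>H z\<bar> \<le> K * M * small_int z"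
  proof (rule primitive_small)
    show "continuous_on W (\<lambda>z. (B z - b) * F1 z)" by (intro continuous_intros B_cont F1c)
    fix z assume z: "z \<in> W"
    have "\<bar>(B z - b) * F1 z\<bar> \<le> K * small z * M"
      unfolding abs_mult using B_near'[OF z] bounds(2)[OF z] K small_nonneg(1)[OF z] by (intro mult_mono) auto
    then show "\<bar>(B z - b) * F1 z\<bar> \<le> K * M * small z / A z" using A[OF z] False by (simp add: mult.assoc mult.commute[of M])
  qed (use K M in auto)
  have Lb: "\<bar>L\<bar> \<le> M"
  proof (rule tendsto_upperbound)
    show "((\<lambda>z. \<bar>F z\<bar>) \<longlongrightarrow> \<bar>L\<bar>) (end_filter m)" by (intro tendsto_intros L)
    show "\<forall>\<^sub>F z in end_filter m. \<bar>F z\<bar> \<le> M" using eventually_W by eventually_elim (rule bounds)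
  qed simp
  define P where "P z = F1 z + b * (F z - L) + H z" for z
  have PV: "vanishing_primitive c (op_bound * M) (\<lambda>z. A z * F2 z + B z * F1 z) P"
    unfolding vanishing_primitive_def
  proof (intro conjI ballI)
    fix z assume "z \<in> {..c}"
    then have z: "z \<in> W" by (simp add: W)
    have "(P has_real_derivative A z * F2 z + B z * F1 z) (at z within W)"
      unfolding P_def using F[OF z] F1[OF z] H(1)[OF z] A[OF z] False
      by (auto intro!: derivative_eq_intros simp: algebra_simps)
    then show "(P has_real_derivative A z * F2 z + B z * F1 z) (at z within {..c})" by (simp add: W)
    have "\<bar>b * (F z - L)\<bar> \<le> \<bar>b\<bar> * (2 * M)" unfolding abs_mult using Lb bounds(1)[OF z] by (intro mult_left_mono) auto
    moreover have "\<bar>H z\<bar> \<le> K * M * small_int c"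
      using H(3)[OF z] mult_left_mono[OF small_mono(2)[OF z], of "K * M"] K M by auto
    ultimately have "\<bar>P z\<bar> \<le> M + \<bar>b\<bar> * (2 * M) + K * M * small_int c" using bounds(2)[OF z] unfolding P_def by linarith
    also have "\<dots> = (1 + 2 * \<bar>b\<bar> + K * small_int c) * M" by (simp add: algebra_simps)
    also have "\<dots> \<le> op_bound * M" using M op_bound_ge(3) by (rule mult_right_mono[rotated])
    finally show "\<bar>P z\<bar> \<le> op_bound * M" .
  next
    have "(P \<longlongrightarrow> 0 + b * (L - L) + 0) (end_filter m)"
      unfolding P_def by (intro tendsto_intros lim L H)
    then show "(P \<longlongrightarrow> 0) at_bot" by (simp add: ef)
  qed
  have "\<exists>GG. vanishing_primitive c (op_bound * M) P GG" if neutral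
  proof -
    have b0: "b = 0" using that by (simp add: neutral_def)
    have Hc: "continuous_on W H" using H(1) by (rule deriv_continuous_on)
    obtain HH where HH: "\<And>z. z \<in> W \<Longrightarrow> (HH has_real_derivative H z) (at z within W)" "(HH \<longlongrightarrow> 0) (end_filter m)"
      "\<And>z. z \<in> W \<Longrightarrow> \<bar>HH z\<bar> \<le> K * M / \<sigma> * small_int z"
    proof (rule primitive_small[OF Hc])
      show "\<bar>H z\<bar> \<le> K * M / \<sigma> * small z / A z" if "z \<in> W" for z
        using H(3)[OF that] A[OF that] False by (simp add: small_int_def small_def)
    qed (use K M \<sigma> in auto)
    \<comment> \<open>For \<open>b = 0\<close> the primitive \<open>P\<close> is
      \<open>F1 + H\<close>, and \<open>H\<close> is still of exponential size, so it has a
      vanishing primitive \<open>HH\<close>.\<close>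
    define GG where "GG z = F z - L + HH z" for z
    have "vanishing_primitive c (op_bound * M) P GG"
      unfolding vanishing_primitive_def
    proof (intro conjI ballI)
      fix z assume "z \<in> {..c}"
      then have z: "z \<in> W" by (simp add: W)
      have "(GG has_real_derivative P z) (at z within W)"
        unfolding GG_def P_def using F[OF z] HH(1)[OF z] b0 by (auto intro!: derivative_eq_intros)
      then show "(GG has_real_derivative P z) (at z within {..c})" by (simp add: W)
      have "K * M / \<sigma> * small_int z \<le> K * M / \<sigma> * small_int c"
        using small_mono(2)[OF z] K M \<sigma> by (intro mult_left_mono) auto
      then have "\<bar>GG z\<bar> \<le> M + M + K * M / \<sigma> * small_int c"
        using Lb bounds(1)[OF z] HH(3)[OF z] unfolding GG_def by linarith
      also have "\<dots> = (2 + K / \<sigma> * small_int c) * M" by (simp add: algebra_simps)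
      also have "\<dots> \<le> op_bound * M" using M op_bound_ge(4) by (rule mult_right_mono[rotated])
      finally show "\<bar>GG z\<bar> \<le> op_bound * M" .
    next
      have "(GG \<longlongrightarrow> L - L + 0) (end_filter m)" unfolding GG_def by (intro tendsto_intros L HH)
      then show "(GG \<longlongrightarrow> 0) at_bot" by (simp add: ef)
    qed
    then show ?thesis by blast
  qed
  then show ?thesis using hb lim2 PV False unfolding end_target_def by blast
qed

text \<open>Two different reasons: if \<open>b > 0\<close>, then \<open>E\<close> tends to 0 and
  \<open>F1\<close> is bounded; if \<open>b = 0\<close> at a quadratic end, then \<open>E\<close> is
  bounded and \<open>F1\<close> tends to 0.\<close>

lemma rejecting_deriv_tendsto:
  assumes rejecting and d: "end_domain m \<gamma> c M F F1 F2"
  shows "((\<lambda>z. E z * F1 z) \<longlongrightarrow> 0) (end_filter m)"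
proof (cases "0 < b")
  case True
  show ?thesis
  proof (rule Lim_null_comparison)
    show "\<forall>\<^sub>F z in end_filter m. norm (E z * F1 z) \<le> M * E z"
      using eventually_W
    proof eventually_elim
      case (elim z)
      have "\<bar>F1 z\<bar> \<le> M" using d elim by (auto simp: end_domain_def split: if_splits dest: holder_boundD(1))
      then show ?case using E_pos[OF elim] by (simp add: abs_mult mult.commute mult_right_mono)
    qed
    show "((\<lambda>z. M * E z) \<longlongrightarrow> 0) (end_filter m)" using E_tendsto[OF True] tendsto_mult_right_zero by blast
  qed
next
  case False
  then have b0: "b = 0" "m \<noteq> 1" using \<open>rejecting\<close> by (auto simp: rejecting_def split: if_splits)
  obtain Q where "0 < Q" "\<forall>z\<in>W. E z \<le> Q * weight z" using E_weight by blast
  then have Q: "0 < Q" "\<And>z. z \<in> W \<Longrightarrow> E z \<le> Q * weight z" by auto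
  show ?thesis
  proof (rule Lim_null_comparison)
    show "\<forall>\<^sub>F z in end_filter m. norm (E z * F1 z) \<le> Q * \<bar>F1 z\<bar>"
      using eventually_W
    proof eventually_elim
      case (elim z)
      have "E z \<le> Q" using Q(2)[OF elim] unfolding weight_def using b0 by simp
      then show ?case using E_pos[OF elim] by (simp add: abs_mult mult_right_mono)
    qed
    have "(F1 \<longlongrightarrow> 0) (end_filter m)" using d b0 by (simp add: end_domain_def)
    then show "((\<lambda>z. Q * \<bar>F1 z\<bar>) \<longlongrightarrow> 0) (end_filter m)" using tendsto_mult_right_zero tendsto_rabs_zero by blast
  qed
qed

text \<open>The constant must not depend on \<open>g\<close>: it makes the functional on the range
  continuous. For \<open>b > 0\<close> the integrand is dominated by \<open>weight / A\<close>,
  which is integrable. For \<open>b = 0\<close> at a quadratic end \<open>E\<close> is not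
  integrable, and convergence comes from the primitive \<open>G\<close> of \<open>g\<close> by
  partial integration: \<open>E * g\<close> is the derivative of \<open>E * G\<close> minus
  \<open>E * B * G\<close>, and \<open>B\<close> is exponentially small.\<close>

lemma rejecting_primitive_tendsto:
  assumes rejecting
  shows "\<exists>C\<ge>0. \<forall>M g P. 0 \<le> M \<longrightarrow> end_target m neutral \<gamma> c M g \<longrightarrow>
    (\<forall>z\<in>W. (P has_real_derivative E z * g z / A z) (at z within W)) \<longrightarrow>
    (\<exists>l. (P \<longlongrightarrow> l) (end_filter m) \<and> (\<forall>z\<in>W. \<bar>P z - l\<bar> \<le> C * M))"
proof (cases "0 < b")
  case True
  obtain Q where "0 < Q" "\<forall>z\<in>W. E z \<le> Q * weight z" using E_weight by blast
  then have Q: "0 < Q" "\<And>z. z \<in> W \<Longrightarrow> E z \<le> Q * weight z" by auto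
  \<comment> \<open>For \<open>b > 0\<close> the primitive of \<open>weight / A\<close> at both
    types of end is \<open>weight / b\<close>.\<close>
  define k where "k N z = N / b * weight z" for N z
  have k: "(k N has_real_derivative N * weight z / A z) (at z within W)" if z: "z \<in> W" for N z
  proof (cases "m = 1")
    case m1: True
    have "(k N has_real_derivative N * z powr (b - 1)) (at z within W)"
      unfolding k_def weight_def using powr_primitive(1)[OF True, of z N W] W_pos[OF z] m1 by simp
    moreover have "z powr (b - 1) = weight z / A z"
      unfolding weight_def using A[OF z] W_pos[OF z] m1 by (simp add: powr_diff)
    ultimately show ?thesis by simp
  next
    case m1: False
    then show ?thesis
      unfolding k_def weight_def using exp_primitive(1)[OF True, of N z W] A[OF z] by simp
  qed
  have k0: "(k N \<longlongrightarrow> 0) (end_filter m)" for N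
    unfolding k_def using tendsto_mult_right_zero weight_tendsto[OF True] by blast
  have wc: "weight z \<le> weight c" if "z \<in> W" for z
    using end_int_le[OF that] True W_pos[OF that] by (auto simp: weight_def intro: powr_mono2)
  have C: "\<exists>l. (P \<longlongrightarrow> l) (end_filter m) \<and> (\<forall>z\<in>W. \<bar>P z - l\<bar> \<le> Q / b * weight c * M)"
    if M: "0 \<le> M" and g: "end_target m neutral \<gamma> c M g"
      and P: "\<And>z. z \<in> W \<Longrightarrow> (P has_real_derivative E z * g z / A z) (at z within W)" for M g P
  proof -
    obtain l where l: "(P \<longlongrightarrow> l) (end_filter m)" "\<And>z. z \<in> W \<Longrightarrow> \<bar>P z - l\<bar> \<le> \<bar>k (Q * M) z\<bar>"
    proof (rule dominated_deriv_tendsto[of m c P "\<lambda>z. E z * g z / A z" "k (Q * M)" "\<lambda>z. Q * M * weight z / A z"])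
      fix z assume z: "z \<in> W"
      have "\<bar>g z\<bar> \<le> M" using g z by (auto simp: end_target_def dest: holder_boundD(1))
      then have "E z * \<bar>g z\<bar> \<le> Q * weight z * M"
        using Q(2)[OF z] E_pos[OF z] by (intro mult_mono) auto
      then show "\<bar>E z * g z / A z\<bar> \<le> Q * M * weight z / A z"
        using E_pos[OF z] A_pos[OF z] by (simp add: abs_mult divide_right_mono mult_ac)
    qed (use c k k0 P in auto)
    have "\<bar>P z - l\<bar> \<le> Q / b * weight c * M" if z: "z \<in> W" for z
    proof -
      have "\<bar>k (Q * M) z\<bar> = Q * M / b * weight z" using Q True M weight_pos[OF z] by (simp add: k_def)
      also have "\<dots> \<le> Q * M / b * weight c" using wc[OF z] Q True M by (intro mult_left_mono) auto
      finally show ?thesis using l(2)[OF z] by (simp add: mult_ac)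
    qed
    then show ?thesis using l(1) by blast
  qed
  have "0 \<le> Q / b * weight c"
    using Q True by (auto simp: weight_def)
  then show ?thesis using C by blast
next
  case False
  then have b0: "b = 0" "m \<noteq> 1" using \<open>rejecting\<close> by (auto simp: rejecting_def split: if_splits)
  have W: "W = {..c}" and ef: "end_filter m = at_bot" using b0 by (auto simp: end_int_def end_filter_def)
  obtain Q where "0 < Q" "\<forall>z\<in>W. E z \<le> Q * weight z" using E_weight by blast
  then have Q: "0 < Q" "\<And>z. z \<in> W \<Longrightarrow> E z \<le> Q * weight z" by auto
  have EQ: "E z \<le> Q" if "z \<in> W" for z using Q(2)[OF that] unfolding weight_def using b0 by simp
  have C: "\<exists>l. (P \<longlongrightarrow> l) (end_filter m) \<and> (\<forall>z\<in>W. \<bar>P z - l\<bar> \<le> (Q + Q * K * small_int c) * M)"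
    if M: "0 \<le> M" and g: "end_target m neutral \<gamma> c M g"
      and P: "\<And>z. z \<in> W \<Longrightarrow> (P has_real_derivative E z * g z / A z) (at z within W)" for M g P
  proof -
    obtain G where "vanishing_primitive c M g G" using g b0 by (auto simp: end_target_def)
    then have G: "\<And>z. z \<in> W \<Longrightarrow> (G has_real_derivative g z) (at z within W)" "(G \<longlongrightarrow> 0) (end_filter m)" "\<And>z. z \<in> W \<Longrightarrow> \<bar>G z\<bar> \<le> M"
      by (auto simp: vanishing_primitive_def W ef)
    have Gc: "continuous_on W G" using G(1) by (rule deriv_continuous_on)
    obtain H where H: "\<And>z. z \<in> W \<Longrightarrow> (H has_real_derivative E z * B z * G z) (at z within W)" "(H \<longlongrightarrow> 0) (end_filter m)"
      "\<And>z. z \<in> W \<Longrightarrow> \<bar>H z\<bar> \<le> Q * K * M * small_int z"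
    proof (rule primitive_small)
      show "continuous_on W (\<lambda>z. E z * B z * G z)" by (intro continuous_intros E_cont B_cont Gc)
      fix z assume z: "z \<in> W"
      have "\<bar>E z * B z * G z\<bar> \<le> Q * (K * small z) * M"
        unfolding abs_mult using EQ[OF z] E_pos[OF z] B_near'[OF z] G(3)[OF z] b0 K small_nonneg(1)[OF z]
        by (intro mult_mono mult_nonneg_nonneg) auto
      then show "\<bar>E z * B z * G z\<bar> \<le> Q * K * M * small z / A z" using A[OF z] b0 by (simp add: mult_ac)
    qed (use Q K M in auto)
    \<comment> \<open>The constant of the partial integration. As \<open>E * G\<close> and
      \<open>H\<close> vanish at the end, it is the limit of \<open>P\<close>.\<close>
    define D where "D z = P z - (E z * G z - H z)" for z
    have D: "D z = D c" if "z \<in> W" for z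
    proof (rule deriv_zero_const[of W D])
      fix z assume z: "z \<in> W"
      show "(D has_real_derivative 0) (at z within W)"
        unfolding D_def using P[OF z] E[OF z] G(1)[OF z] H(1)[OF z] A[OF z] b0
        by (auto intro!: derivative_eq_intros simp: algebra_simps)
    qed (use that c in \<open>auto intro: end_int_self\<close>)
    have EG: "((\<lambda>z. E z * G z) \<longlongrightarrow> 0) (end_filter m)"
    proof (rule Lim_null_comparison)
      show "\<forall>\<^sub>F z in end_filter m. norm (E z * G z) \<le> Q * \<bar>G z\<bar>"
        using eventually_W by eventually_elim (use EQ E_pos in \<open>auto simp: abs_mult abs_of_pos intro!: mult_right_mono\<close>)
      show "((\<lambda>z. Q * \<bar>G z\<bar>) \<longlongrightarrow> 0) (end_filter m)" using G(2) tendsto_mult_right_zero tendsto_rabs_zero by blast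
    qed
    have "((\<lambda>z. D c + (E z * G z - H z)) \<longlongrightarrow> D c + (0 - 0)) (end_filter m)"
      by (intro tendsto_intros EG H(2))
    then have "((\<lambda>z. D c + (E z * G z - H z)) \<longlongrightarrow> D c) (end_filter m)" by simp
    then have "(P \<longlongrightarrow> D c) (end_filter m)"
    proof (rule Lim_transform_eventually)
      show "\<forall>\<^sub>F z in end_filter m. D c + (E z * G z - H z) = P z"
        using eventually_W
      proof eventually_elim
        case (elim z)
        then show ?case using D[OF elim] D_def[of z] by linarith
      qed
    qed
    moreover have "\<bar>P z - D c\<bar> \<le> (Q + Q * K * small_int c) * M" if z: "z \<in> W" for z
    proof -
      have "P z - D c = E z * G z - H z" using D[OF z] by (simp add: D_def)
      moreover have "\<bar>E z * G z\<bar> \<le> Q * M"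
        unfolding abs_mult using EQ[OF z] E_pos[OF z] G(3)[OF z] by (intro mult_mono) auto
      moreover have "Q * K * M * small_int z \<le> Q * K * M * small_int c"
        using small_mono(2)[OF z] Q K M by (intro mult_left_mono) auto
      then have "\<bar>H z\<bar> \<le> Q * K * M * small_int c" using H(3)[OF z] by linarith
      ultimately have "\<bar>P z - D c\<bar> \<le> Q * M + Q * K * M * small_int c" by linarith
      then show ?thesis by (simp add: algebra_simps)
    qed
    ultimately show ?thesis by blast
  qed
  have "0 \<le> Q + Q * K * small_int c" using Q K small_nonneg by simp
  then show ?thesis using C by blast
qed

text \<open>The heart is the bound \<open>\<bar>g - B * u\<bar> \<le> N * z powr \<gamma>\<close>.
  It says that \<open>z * u'\<close> tends to 0 and that \<open>u'\<close> is
  O(\<open>z powr (\<gamma> - 1)\<close>), and \<open>powr_diff_le\<close> turns the latter into a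
  Hoelder bound for \<open>u\<close>. If \<open>b > 0\<close>, it expresses that \<open>u\<close>
  approaches the equilibrium \<open>l / b\<close>, where \<open>l\<close> is the limit of
  \<open>g\<close>. If \<open>b = 0\<close>, both \<open>g\<close> and \<open>B\<close> vanish at
  the end and \<open>u\<close> is bounded.\<close>

lemma solve_kimura:
  assumes m: "m = 1" and M: "0 \<le> M" and g: "end_target m neutral \<gamma> c M g"
    and u: "\<And>z. z \<in> W \<Longrightarrow> (u has_real_derivative (g z - B z * u z) / A z) (at z within W)"
    and F: "\<And>z. z \<in> W \<Longrightarrow> (F has_real_derivative u z) (at z within W)"
    and Eu: "rejecting \<Longrightarrow> ((\<lambda>z. E z * u z) \<longlongrightarrow> 0) (end_filter m)"
    and g0: "m = 1 \<Longrightarrow> b = 0 \<Longrightarrow> (g \<longlongrightarrow> 0) (end_filter m)"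
  shows "\<exists>M'\<ge>0. end_domain m \<gamma> c M' F u (\<lambda>z. (g z - B z * u z) / A z)"
proof -
  have pos: "0 < z" "z \<le> c" "A z = z" if "z \<in> W" for z using W_pos[OF that m] end_int_le[OF that] A[OF that] m by auto
  have ef: "end_filter m = at_right 0" and c0: "0 < c" using m c by (auto simp: end_filter_def)
  have gh: "holder_bound \<gamma> W M g" using g by (simp add: end_target_def)
  obtain l where l: "(g \<longlongrightarrow> l) (end_filter m)" using g by (auto simp: end_target_def)
  obtain Q where "0 < Q" "\<forall>z\<in>W. E z \<le> Q * weight z \<and> weight z \<le> Q * E z" using E_weight by blast
  then have Q: "0 < Q" "\<And>z. z \<in> W \<Longrightarrow> E z \<le> Q * z powr b" "\<And>z. z \<in> W \<Longrightarrow> z powr b \<le> Q * E z"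
    unfolding weight_def using m by auto
  \<comment> \<open>The Hoelder estimate for \<open>g\<close>, with the second point moved into the
    end.\<close>
  have gl: "\<bar>g z - l\<bar> \<le> M * z powr \<gamma>" if z: "z \<in> W" for z
  proof (rule tendsto_upperbound)
    show "((\<lambda>y. \<bar>g z - g y\<bar>) \<longlongrightarrow> \<bar>g z - l\<bar>) (end_filter m)" by (intro tendsto_intros l)
    have "\<forall>\<^sub>F y in end_filter m. y \<in> end_int m z" using pos[OF z] by (intro eventually_end_filter) auto
    then show "\<forall>\<^sub>F y in end_filter m. \<bar>g z - g y\<bar> \<le> M * z powr \<gamma>"
    proof eventually_elim
      case (elim y)
      have y: "y \<in> W" "0 < y" "y \<le> z" using elim end_int_sub[OF z] pos end_int_le by blast+
      have "\<bar>g z - g y\<bar> \<le> M * \<bar>z - y\<bar> powr \<gamma>" using gh z y by (intro holder_boundD)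
      also have "\<dots> \<le> M * z powr \<gamma>" using M y \<gamma> by (intro mult_left_mono powr_mono2) auto
      finally show ?case .
    qed
  qed simp
  \<comment> \<open>On a bounded interval \<open>z\<close> is O(\<open>z powr \<gamma>\<close>), so
    linear errors such as \<open>K * z\<close> from \<open>B_near\<close> fit into the
    bound.\<close>
  have zg: "z \<le> c powr (1 - \<gamma>) * z powr \<gamma>" if z: "z \<in> W" for z
  proof -
    have "z = z powr (1 - \<gamma>) * z powr \<gamma>" using pos[OF z] by (simp add: powr_add[symmetric])
    also have "\<dots> \<le> c powr (1 - \<gamma>) * z powr \<gamma>" using pos[OF z] \<gamma> by (intro mult_right_mono powr_mono2) auto
    finally show ?thesis .
  qed
  define C where "C = c powr (1 - \<gamma>)"
  have C: "0 \<le> C" by (simp add: C_def)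
  have zN: "N * z \<le> N * C * z powr \<gamma>" if "z \<in> W" "0 \<le> N" for z N
    using mult_left_mono[OF zg[OF that(1)] that(2)] by (simp add: C_def mult_ac)
  have cont: "continuous_on W u" by (rule deriv_continuous_on[OF u])
  obtain N where N: "0 \<le> N" "\<And>z. z \<in> W \<Longrightarrow> \<bar>g z - B z * u z\<bar> \<le> N * z powr \<gamma>"
  proof (cases "0 < b")
    case True
    \<comment> \<open>The deviation from the equilibrium satisfies the same equation, with
      right-hand side \<open>h\<close> of size \<open>z powr \<gamma>\<close>.\<close>
    define v where "v z = u z - l / b" for z
    define h where "h z = g z - l - (B z - b) * (l / b)" for z
    have v: "(v has_real_derivative (h z - B z * v z) / z) (at z within W)" if z: "z \<in> W" for z
    proof -
      have "h z - B z * v z = g z - B z * u z" using True by (simp add: h_def v_def algebra_simps)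
      then show ?thesis unfolding v_def using u[OF z] pos(3)[OF z] by (auto intro!: derivative_eq_intros)
    qed
    define N1 where "N1 = M + K * \<bar>l / b\<bar> * C"
    have N1: "0 \<le> N1" using M K C by (simp add: N1_def)
    have h: "\<bar>h z\<bar> \<le> N1 * z powr \<gamma>" if z: "z \<in> W" for z
    proof -
      have "\<bar>(B z - b) * (l / b)\<bar> \<le> K * z * \<bar>l / b\<bar>"
        unfolding abs_mult using B_near[OF z] m by (intro mult_right_mono) auto
      also have "\<dots> \<le> K * \<bar>l / b\<bar> * C * z powr \<gamma>" using zN[OF z, of "K * \<bar>l / b\<bar>"] K by (simp add: mult_ac)
      finally show ?thesis using gl[OF z] unfolding h_def N1_def distrib_right by linarith
    qed
    have Ev: "((\<lambda>z. E z * v z) \<longlongrightarrow> 0) (end_filter m)"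
    proof -
      have rej: rejecting unfolding rejecting_def using True m by simp
      have "((\<lambda>z. E z * u z - E z * (l / b)) \<longlongrightarrow> 0 - 0 * (l / b)) (end_filter m)"
        by (intro tendsto_intros Eu[OF rej] E_tendsto[OF True])
      then show ?thesis by (simp add: v_def right_diff_distrib)
    qed
    have p: "0 < b + \<gamma>" using True \<gamma> by simp
    obtain l' where l': "((\<lambda>z. E z * v z) \<longlongrightarrow> l') (end_filter m)"
      "\<And>z. z \<in> W \<Longrightarrow> \<bar>E z * v z - l'\<bar> \<le> \<bar>Q * N1 / (b + \<gamma>) * z powr (b + \<gamma>)\<bar>"
    proof (rule dominated_deriv_tendsto[of m c "\<lambda>z. E z * v z" "\<lambda>z. E z * h z / z"
          "\<lambda>z. Q * N1 / (b + \<gamma>) * z powr (b + \<gamma>)" "\<lambda>z. Q * N1 * z powr (b + \<gamma> - 1)"])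
      fix z assume z: "z \<in> W"
      show "((\<lambda>z. E z * v z) has_real_derivative E z * h z / z) (at z within W)"
        using E[OF z] v[OF z] pos[OF z] by (auto intro!: derivative_eq_intros simp: field_simps)
      show "((\<lambda>z. Q * N1 / (b + \<gamma>) * z powr (b + \<gamma>)) has_real_derivative Q * N1 * z powr (b + \<gamma> - 1)) (at z within W)"
        by (rule powr_primitive(1)[OF p pos(1)[OF z]])
      have "E z * \<bar>h z\<bar> \<le> Q * z powr b * (N1 * z powr \<gamma>)"
        using Q(2)[OF z] h[OF z] E_pos[OF z] by (intro mult_mono) auto
      then have "E z * \<bar>h z\<bar> / z \<le> Q * z powr b * (N1 * z powr \<gamma>) / z" using pos[OF z] by (simp add: divide_right_mono)
      also have "\<dots> = Q * N1 * z powr (b + \<gamma> - 1)" using pos[OF z] by (simp add: powr_add powr_diff)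
      finally show "\<bar>E z * h z / z\<bar> \<le> Q * N1 * z powr (b + \<gamma> - 1)" using E_pos[OF z] pos[OF z] by (simp add: abs_mult)
    next
      show "((\<lambda>z. Q * N1 / (b + \<gamma>) * z powr (b + \<gamma>)) \<longlongrightarrow> 0) (end_filter m)" unfolding ef by (rule powr_primitive(2)[OF p])
    qed (use c in auto)
    \<comment> \<open>This is where the rejecting condition enters: without it \<open>v\<close>
      could contain a multiple of \<open>1 / E\<close>.\<close>
    have "l' = 0" using tendsto_unique[OF end_filter_neq_bot l'(1) Ev] .
    have v_le: "\<bar>v z\<bar> \<le> Q * (Q * N1 / (b + \<gamma>)) * z powr \<gamma>" if z: "z \<in> W" for z
    proof -
      have "z powr b * \<bar>v z\<bar> \<le> Q * E z * \<bar>v z\<bar>" using Q(3)[OF z] by (intro mult_right_mono) auto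
      also have "\<dots> = Q * \<bar>E z * v z\<bar>" using E_pos[OF z] by (simp add: abs_mult)
      also have "\<dots> \<le> Q * (Q * N1 / (b + \<gamma>) * z powr (b + \<gamma>))"
        using l'(2)[OF z] \<open>l' = 0\<close> Q(1) N1 p by (intro mult_left_mono) auto
      also have "\<dots> = z powr b * (Q * (Q * N1 / (b + \<gamma>)) * z powr \<gamma>)" by (simp add: powr_add)
      finally show ?thesis using pos[OF z] by (simp add: mult_le_cancel_left_pos del: times_divide_eq_right)
    qed
    define N2 where "N2 = Q * (Q * N1 / (b + \<gamma>))"
    have N2: "0 \<le> N2" using Q(1) N1 p by (simp add: N2_def)
    have B': "\<bar>B z\<bar> \<le> \<beta>" if "z \<in> W" for z using holder_boundD(1)[OF B_holder that] .
    have "\<bar>g z - B z * u z\<bar> \<le> (N1 + \<beta> * N2) * z powr \<gamma>" if z: "z \<in> W" for z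
    proof -
      have "g z - B z * u z = h z - B z * v z" using True by (simp add: h_def v_def algebra_simps)
      moreover have "\<bar>B z * v z\<bar> \<le> \<beta> * (N2 * z powr \<gamma>)"
        unfolding abs_mult using B'[OF z] v_le[OF z] \<beta>_nonneg by (intro mult_mono) (auto simp: N2_def)
      ultimately show ?thesis using h[OF z] by (simp add: distrib_right mult.assoc)
    qed
    then show ?thesis using N1 N2 \<beta>_nonneg that[of "N1 + \<beta> * N2"] by auto
  next
    case False
    then have b0: "b = 0" using b[OF m] by simp
    have "l = 0" using tendsto_unique[OF end_filter_neq_bot l g0[OF m b0]] .
    have g: "\<bar>g z\<bar> \<le> M * z powr \<gamma>" if "z \<in> W" for z using gl[OF that] \<open>l = 0\<close> by simp
    have E': "E z \<le> Q" "1 \<le> Q * E z" if "z \<in> W" for z using Q(2,3)[OF that] b0 pos[OF that] by auto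
    obtain l' where l': "((\<lambda>z. E z * u z) \<longlongrightarrow> l') (end_filter m)"
    proof (rule dominated_deriv_tendsto[of m c "\<lambda>z. E z * u z" "\<lambda>z. E z * g z / z"
          "\<lambda>z. Q * M / \<gamma> * z powr \<gamma>" "\<lambda>z. Q * M * z powr (\<gamma> - 1)"])
      fix z assume z: "z \<in> W"
      show "((\<lambda>z. E z * u z) has_real_derivative E z * g z / z) (at z within W)"
        using E[OF z] u[OF z] pos[OF z] by (auto intro!: derivative_eq_intros simp: field_simps)
      show "((\<lambda>z. Q * M / \<gamma> * z powr \<gamma>) has_real_derivative Q * M * z powr (\<gamma> - 1)) (at z within W)"
        by (rule powr_primitive(1)[OF \<gamma>(1) pos(1)[OF z]])
      have "E z * \<bar>g z\<bar> \<le> Q * (M * z powr \<gamma>)"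
        using E'(1)[OF z] g[OF z] E_pos[OF z] by (intro mult_mono) auto
      then have "E z * \<bar>g z\<bar> / z \<le> Q * (M * z powr \<gamma>) / z" using pos[OF z] by (simp add: divide_right_mono)
      also have "\<dots> = Q * M * z powr (\<gamma> - 1)" using pos[OF z] by (simp add: powr_diff)
      finally show "\<bar>E z * g z / z\<bar> \<le> Q * M * z powr (\<gamma> - 1)" using E_pos[OF z] pos[OF z] by (simp add: abs_mult)
    next
      show "((\<lambda>z. Q * M / \<gamma> * z powr \<gamma>) \<longlongrightarrow> 0) (end_filter m)" unfolding ef by (rule powr_primitive(2)[OF \<gamma>(1)])
    qed (use c in auto)
    have "continuous_on W (\<lambda>z. E z * u z)" by (intro continuous_intros E_cont cont)
    then obtain U where U: "0 \<le> U" "\<And>z. z \<in> W \<Longrightarrow> \<bar>E z * u z\<bar> \<le> U"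
      using end_int_bounded[OF _ l' c] by blast
    have "\<bar>g z - B z * u z\<bar> \<le> (M + K * (Q * U) * C) * z powr \<gamma>" if z: "z \<in> W" for z
    proof -
      have "\<bar>u z\<bar> \<le> Q * E z * \<bar>u z\<bar>" using mult_right_mono[OF E'(2)[OF z], of "\<bar>u z\<bar>"] by simp
      also have "\<dots> = Q * \<bar>E z * u z\<bar>" using E_pos[OF z] by (simp add: abs_mult)
      also have "\<dots> \<le> Q * U" using U(2)[OF z] Q(1) by (intro mult_left_mono) auto
      finally have "\<bar>B z * u z\<bar> \<le> K * z * (Q * U)"
        unfolding abs_mult using B_near[OF z] m b0 K pos(1)[OF z] by (intro mult_mono) auto
      also have "\<dots> \<le> K * (Q * U) * C * z powr \<gamma>" using zN[OF z, of "K * (Q * U)"] K Q(1) U(1) by (simp add: mult_ac)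
      finally show ?thesis using g[OF z] by (simp add: distrib_right)
    qed
    moreover have "0 \<le> M + K * (Q * U) * C" using M K Q(1) U(1) C by simp
    ultimately show ?thesis using that by blast
  qed
  have u': "\<bar>(g z - B z * u z) / A z\<bar> \<le> N * z powr (\<gamma> - 1)" if z: "z \<in> W" for z
  proof -
    have "\<bar>(g z - B z * u z) / A z\<bar> \<le> N * z powr \<gamma> / z"
      using N(2)[OF z] pos[OF z] by (simp add: divide_right_mono)
    then show ?thesis using pos[OF z] by (simp add: powr_diff)
  qed
  have kd: "((\<lambda>z. N / \<gamma> * z powr \<gamma>) has_real_derivative N * z powr (\<gamma> - 1)) (at z within W)" if z: "z \<in> W" for z
    by (rule powr_primitive(1)[OF \<gamma>(1) pos(1)[OF z]])
  have k0: "((\<lambda>z. N / \<gamma> * z powr \<gamma>) \<longlongrightarrow> 0) (end_filter m)" unfolding ef by (rule powr_primitive(2)[OF \<gamma>(1)])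
  obtain lu where lu: "(u \<longlongrightarrow> lu) (end_filter m)"
    using dominated_deriv_tendsto[OF u c kd u' k0] by blast
  obtain U where U: "0 \<le> U" "\<And>z. z \<in> W \<Longrightarrow> \<bar>u z\<bar> \<le> U" using end_int_bounded[OF cont lu c] by blast
  have uh: "holder_bound \<gamma> W (U + N / \<gamma>) u"
  proof (rule holder_boundI_less)
    have N0: "0 \<le> N / \<gamma>" using N(1) \<gamma> by simp
    show "\<bar>u z\<bar> \<le> U + N / \<gamma>" if "z \<in> W" for z using U(2)[OF that] N0 by simp
    fix y z assume yz: "y \<in> W" "z \<in> W" "z < y"
    have "\<bar>u y - u z\<bar> \<le> N / \<gamma> * y powr \<gamma> - N / \<gamma> * z powr \<gamma>"
      using deriv_dominated[OF is_interval_end_int u kd u'] yz by auto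
    also have "\<dots> = N / \<gamma> * (y powr \<gamma> - z powr \<gamma>)" by (simp add: right_diff_distrib)
    also have "\<dots> \<le> N / \<gamma> * (y - z) powr \<gamma>"
      using powr_diff_le[of z y \<gamma>] pos(1)[OF yz(2)] yz \<gamma> N0 by (intro mult_left_mono) auto
    also have "\<dots> \<le> (U + N / \<gamma>) * (y - z) powr \<gamma>" using U(1) by (intro mult_right_mono) auto
    finally show "\<bar>u y - u z\<bar> \<le> (U + N / \<gamma>) * (y - z) powr \<gamma>" .
  qed
  have eq: "z * ((g z - B z * u z) / A z) = g z - B z * u z" if "z \<in> W" for z using pos[OF that] by simp
  have F2h: "holder_bound \<gamma> W (M + 2 * \<beta> * (U + N / \<gamma>)) (\<lambda>z. z * ((g z - B z * u z) / A z))"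
    using eq by (subst holder_bound_cong[where g="\<lambda>z. g z - B z * u z"]) (auto intro!: holder_bound_diff holder_bound_mult gh B_holder uh)
  have F2l: "((\<lambda>z. z * ((g z - B z * u z) / A z)) \<longlongrightarrow> 0) (end_filter m)"
  proof (rule Lim_null_comparison)
    show "\<forall>\<^sub>F z in end_filter m. norm (z * ((g z - B z * u z) / A z)) \<le> N * z powr \<gamma>"
      using eventually_W by eventually_elim (use eq N(2) in auto)
    show "((\<lambda>z. N * z powr \<gamma>) \<longlongrightarrow> 0) (end_filter m)" using tendsto_mult_left[OF k0, of \<gamma>] \<gamma> by simp
  qed
  obtain lF where lF: "(F \<longlongrightarrow> lF) (end_filter m)"
  proof (rule dominated_deriv_tendsto[OF F c, of "\<lambda>z. U * z" "\<lambda>_. U"])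
    show "((\<lambda>z. U * z) \<longlongrightarrow> 0) (end_filter m)" unfolding ef by (auto intro!: tendsto_eq_intros)
  qed (use U c in \<open>auto intro!: derivative_eq_intros\<close>)
  obtain V where V: "0 \<le> V" "\<And>z. z \<in> W \<Longrightarrow> \<bar>F z\<bar> \<le> V"
    using end_int_bounded[OF deriv_continuous_on[OF F] lF c] by blast
  have Fh: "holder_bound \<gamma> W (2 * (U + V)) F"
    using U V \<gamma> F by (intro holder_bound_deriv[where f' = u]) (auto intro: add_increasing add_increasing2)
  define R where "R = M + 2 * \<beta> * (U + N / \<gamma>)"
  define M' where "M' = 2 * (U + V) + (U + N / \<gamma>) + R"
  have nn: "0 \<le> N / \<gamma>" "0 \<le> 2 * \<beta> * (U + N / \<gamma>)" using N(1) U(1) \<gamma> \<beta>_nonneg by auto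
  have "0 \<le> R" using nn M by (simp add: R_def)
  then have "0 \<le> M'" "2 * (U + V) \<le> M'" "U + N / \<gamma> \<le> M'" "R \<le> M'"
    using nn U(1) V(1) by (auto simp: M'_def)
  then show ?thesis
    using Fh uh F2h[folded R_def] F2l lF lu m unfolding end_domain_def
    by (intro exI[of _ M']) (auto intro: holder_bound_mono[OF _ subset_refl])
qed

text \<open>The primitive of \<open>E * g\<close> is compared with a small multiple of
  \<open>E\<close>, whose derivative is \<open>E * B\<close>. For \<open>b > 0\<close> the
  comparison starts at the end, where \<open>E * u\<close> vanishes. For \<open>b < 0\<close> it
  starts at a fixed point \<open>T\<close>, and the contribution of \<open>T\<close> decays because
  \<open>1 / E\<close> does.\<close>

lemma solution_tendsto_zero:
  assumes m: "m \<noteq> 1" and b: "b \<noteq> 0"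
    and u: "\<And>z. z \<in> W \<Longrightarrow> (u has_real_derivative (g z - B z * u z) / A z) (at z within W)"
    and g: "(g \<longlongrightarrow> 0) (end_filter m)"
    and Eu: "rejecting \<Longrightarrow> ((\<lambda>z. E z * u z) \<longlongrightarrow> 0) (end_filter m)"
  shows "(u \<longlongrightarrow> 0) (end_filter m)"
proof (rule tendstoI)
  fix e :: real assume e: "0 < e"
  \<comment> \<open>Near the end \<open>\<bar>B z\<bar>\<close> is at least
    \<open>\<bar>b\<bar> / 2\<close>, so \<open>\<bar>g z\<bar> < d\<close> implies
    \<open>\<bar>g z\<bar> \<le> e / 4 * \<bar>B z\<bar>\<close>.\<close>
  define d where "d = e * \<bar>b\<bar> / 8"
  have d: "0 < d" using e b by (simp add: d_def)
  have "eventually (\<lambda>z. dist (g z) 0 < d \<and> dist (B z) b < \<bar>b\<bar> / 2) (end_filter m)"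
    using tendstoD[OF g d] tendstoD[OF B_tendsto, of "\<bar>b\<bar> / 2"] b by (intro eventually_conj) auto
  then obtain T where T: "T \<in> W" "\<And>z. z \<in> end_int m T \<Longrightarrow> dist (g z) 0 < d \<and> dist (B z) b < \<bar>b\<bar> / 2"
    by (rule eventually_end_filterE[where c = c]) (use c in auto)
  let ?T = "end_int m T"
  have sub: "?T \<subseteq> W" using end_int_sub[OF T(1)] .
  have TT: "T \<in> ?T" using m by (simp add: end_int_def)
  have Ed: "(E has_real_derivative E z * B z) (at z within ?T)" if "z \<in> ?T" for z
    using DERIV_subset[OF E sub] A sub that m by auto
  have Eud: "((\<lambda>z. E z * u z) has_real_derivative E z * g z) (at z within ?T)" if "z \<in> ?T" for z
    using Ed[OF that] DERIV_subset[OF u sub] A sub that m by (auto intro!: derivative_eq_intros simp: algebra_simps)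
  show "\<forall>\<^sub>F z in end_filter m. dist (u z) 0 < e"
  proof (cases "0 < b")
    case True
    define k where "k z = e / 4 * E z" for z
    obtain l where l: "((\<lambda>z. E z * u z) \<longlongrightarrow> l) (end_filter m)" "\<And>z. z \<in> ?T \<Longrightarrow> \<bar>E z * u z - l\<bar> \<le> \<bar>k z\<bar>"
    proof (rule dominated_deriv_tendsto[of m T "\<lambda>z. E z * u z" "\<lambda>z. E z * g z" k "\<lambda>z. e / 4 * (E z * B z)"])
      fix z assume z: "z \<in> ?T"
      show "(k has_real_derivative e / 4 * (E z * B z)) (at z within ?T)"
        unfolding k_def using Ed[OF z] by (auto intro!: derivative_eq_intros)
      have "\<bar>B z - b\<bar> < b / 2" using T(2)[OF z] True by (simp add: dist_real_def)
      then have "b / 2 \<le> B z" by linarith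
      then have "e / 4 * (b / 2) \<le> e / 4 * B z" using e by (intro mult_left_mono) auto
      moreover have "\<bar>g z\<bar> \<le> e / 4 * (b / 2)" using T(2)[OF z] True by (simp add: d_def)
      ultimately have "\<bar>g z\<bar> \<le> e / 4 * B z" by linarith
      then have "E z * \<bar>g z\<bar> \<le> E z * (e / 4 * B z)" using E_pos z sub by (intro mult_left_mono) (auto intro: less_imp_le)
      then show "\<bar>E z * g z\<bar> \<le> e / 4 * (E z * B z)" using E_pos[of z] z sub by (auto simp: abs_mult mult_ac)
    next
      show "(k \<longlongrightarrow> 0) (end_filter m)" unfolding k_def using E_tendsto[OF True] tendsto_mult_right_zero by blast
    qed (use Eud m in auto)
    have rej: rejecting unfolding rejecting_def using True m by simp
    have "l = 0" using tendsto_unique[OF end_filter_neq_bot l(1) Eu[OF rej]] .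
    have "dist (u z) 0 < e" if z: "z \<in> ?T" for z
    proof -
      have Ez: "0 < E z" using E_pos z sub by auto
      have "E z * \<bar>u z\<bar> \<le> E z * (e / 4)" using l(2)[OF z] \<open>l = 0\<close> Ez e by (simp add: k_def abs_mult mult.commute)
      then have "\<bar>u z\<bar> \<le> e / 4" using Ez by (simp add: mult_le_cancel_left_pos del: times_divide_eq_right)
      then show ?thesis using e by simp
    qed
    moreover have "eventually (\<lambda>z. z \<in> ?T) (end_filter m)" using m by (intro eventually_end_filter) auto
    ultimately show ?thesis by (auto elim: eventually_mono)
  next
    case False
    then have bn: "b < 0" using b by simp
    obtain Q where Q: "0 < Q" "\<forall>z\<in>W. E z \<le> Q * weight z \<and> weight z \<le> Q * E z" using E_weight by blast
    define N where "N = \<bar>E T * u T\<bar>"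
    have le: "\<bar>u z\<bar> \<le> N * (Q * exp (- b * z)) + e / 4" if z: "z \<in> ?T" for z
    proof -
      have Ez: "0 < E z" using E_pos z sub by auto
      \<comment> \<open>Here \<open>B\<close> is negative, so \<open>- (e / 4) * E\<close> is the
        increasing comparison function.\<close>
      have "\<bar>E T * u T - E z * u z\<bar> \<le> (- (e / 4) * E T) - (- (e / 4) * E z)"
      proof (rule deriv_dominated[of ?T "\<lambda>z. E z * u z" "\<lambda>z. E z * g z" "\<lambda>z. - (e / 4) * E z" "\<lambda>z. - (e / 4) * (E z * B z)"])
        fix z assume z: "z \<in> ?T"
        show "((\<lambda>z. - (e / 4) * E z) has_real_derivative - (e / 4) * (E z * B z)) (at z within ?T)"
          using Ed[OF z] by (auto intro!: derivative_eq_intros)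
        have "\<bar>B z - b\<bar> < - b / 2" using T(2)[OF z] bn by (simp add: dist_real_def)
        then have "- b / 2 \<le> - B z" by linarith
        then have "e / 4 * (- b / 2) \<le> e / 4 * (- B z)" using e by (intro mult_left_mono) auto
        moreover have "\<bar>g z\<bar> \<le> e / 4 * (- b / 2)" using T(2)[OF z] bn by (simp add: d_def)
        ultimately have "\<bar>g z\<bar> \<le> e / 4 * (- B z)" by linarith
        then have "E z * \<bar>g z\<bar> \<le> E z * (e / 4 * (- B z))" using E_pos z sub by (intro mult_left_mono) (auto intro: less_imp_le)
        then show "\<bar>E z * g z\<bar> \<le> - (e / 4) * (E z * B z)" using E_pos[of z] z sub by (auto simp: abs_mult mult_ac)
      qed (use Eud TT z end_int_le[OF z] in auto)
      moreover have "0 \<le> e / 4 * E T" using e E_pos[OF T(1)] by simp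
      ultimately have "\<bar>E z * u z\<bar> \<le> N + e / 4 * E z" unfolding N_def by linarith
      then have "E z * \<bar>u z\<bar> \<le> N + e / 4 * E z" using Ez by (simp add: abs_mult)
      then have "\<bar>u z\<bar> \<le> (N + e / 4 * E z) / E z" using Ez by (simp add: pos_le_divide_eq mult.commute)
      also have "\<dots> = N * (1 / E z) + e / 4" using Ez by (simp add: field_simps)
      also have "1 / E z \<le> Q * exp (- b * z)"
      proof -
        have "exp (b * z) \<le> Q * E z" using Q(2) z sub unfolding weight_def using m by auto
        then have "exp (- b * z) * exp (b * z) \<le> exp (- b * z) * (Q * E z)" by (intro mult_left_mono) auto
        then have "1 \<le> Q * exp (- b * z) * E z" by (simp add: exp_add[symmetric] mult_ac)
        then show ?thesis using Ez by (simp add: pos_divide_le_eq)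
      qed
      finally show ?thesis by (simp add: N_def mult_left_mono)
    qed
    have "((\<lambda>z. (N * Q) / (- b) * exp (- b * z)) \<longlongrightarrow> 0) at_bot" using exp_primitive(2)[of "-b" "N * Q"] bn by simp
    then have "((\<lambda>z. (- b) * ((N * Q) / (- b) * exp (- b * z))) \<longlongrightarrow> 0) at_bot" by (rule tendsto_mult_right_zero)
    then have "((\<lambda>z. N * (Q * exp (- b * z))) \<longlongrightarrow> 0) (end_filter m)" using bn m by (simp add: end_filter_def mult.assoc)
    then have "\<forall>\<^sub>F z in end_filter m. dist (N * (Q * exp (- b * z))) 0 < e / 4" by (rule tendstoD) (use e in simp)
    moreover have "eventually (\<lambda>z. z \<in> ?T) (end_filter m)" using m by (intro eventually_end_filter) auto
    ultimately show ?thesis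
    proof eventually_elim
      case (elim z)
      then show ?case using le[of z] e by (auto simp: dist_real_def)
    qed
  qed
qed

text \<open>First \<open>u\<close> tends to 0: for \<open>b = 0\<close> because \<open>E\<close> is
  bounded below and \<open>E * u\<close> vanishes at the end, otherwise by the previous lemma. Then
  the integrated equation gives the limit of \<open>F\<close>. The Hoelder bound of
  \<open>u'\<close> follows from the equation, since \<open>u\<close> itself is Lipschitz.\<close>

lemma solve_quadratic:
  assumes m: "m \<noteq> 1" and M: "0 \<le> M" and g: "end_target m neutral \<gamma> c M g"
    and u: "\<And>z. z \<in> W \<Longrightarrow> (u has_real_derivative (g z - B z * u z) / A z) (at z within W)"
    and F: "\<And>z. z \<in> W \<Longrightarrow> (F has_real_derivative u z) (at z within W)"
    and Eu: "rejecting \<Longrightarrow> ((\<lambda>z. E z * u z) \<longlongrightarrow> 0) (end_filter m)"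
  shows "\<exists>M'\<ge>0. end_domain m \<gamma> c M' F u (\<lambda>z. (g z - B z * u z) / A z)"
proof -
  have W: "W = {..c}" and ef: "end_filter m = at_bot" using m by (auto simp: end_int_def end_filter_def)
  have A1: "A z = 1" if "z \<in> W" for z using A[OF that] m by simp
  have gh: "holder_bound \<gamma> W M g" using g by (simp add: end_target_def)
  obtain G where GV: "vanishing_primitive c M g G" "neutral \<longrightarrow> (\<exists>GG. vanishing_primitive c M G GG)" using g m by (auto simp: end_target_def)
  then have G: "\<And>z. z \<in> W \<Longrightarrow> (G has_real_derivative g z) (at z within W)" "(G \<longlongrightarrow> 0) (end_filter m)"
    by (auto simp: vanishing_primitive_def W ef)
  obtain l where "(g \<longlongrightarrow> l) (end_filter m)" using g by (auto simp: end_target_def)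
  then have gl: "(g \<longlongrightarrow> 0) (end_filter m)" using vanishing_primitive_limit_zero[OF GV(1)] ef by auto
  have u0: "(u \<longlongrightarrow> 0) (end_filter m)"
  proof (cases "b = 0")
    case True
    obtain Q where Q: "0 < Q" "\<forall>z\<in>W. E z \<le> Q * weight z \<and> weight z \<le> Q * E z" using E_weight by blast
    show ?thesis
    proof (rule Lim_null_comparison)
      show "\<forall>\<^sub>F z in end_filter m. norm (u z) \<le> Q * \<bar>E z * u z\<bar>"
        using eventually_W
      proof eventually_elim
        case (elim z)
        have "1 \<le> Q * E z" using Q(2) elim unfolding weight_def using m True by auto
        then have "1 * \<bar>u z\<bar> \<le> Q * E z * \<bar>u z\<bar>" by (intro mult_right_mono) auto
        then show ?case using E_pos[OF elim] by (simp add: abs_mult)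
      qed
      have "rejecting" unfolding rejecting_def using m True by simp
      then show "((\<lambda>z. Q * \<bar>E z * u z\<bar>) \<longlongrightarrow> 0) (end_filter m)" using Eu tendsto_mult_right_zero tendsto_rabs_zero by blast
    qed
  next
    case False
    then show ?thesis using solution_tendsto_zero[OF m False u gl Eu] by blast
  qed
  have uc: "continuous_on W u" by (rule deriv_continuous_on[OF u])
  obtain U where U: "0 \<le> U" "\<And>z. z \<in> W \<Longrightarrow> \<bar>u z\<bar> \<le> U" using end_int_bounded[OF uc u0 c] by blast
  obtain H where H: "\<And>z. z \<in> W \<Longrightarrow> (H has_real_derivative (B z - b) * u z) (at z within W)" "(H \<longlongrightarrow> 0) (end_filter m)"
    "\<And>z. z \<in> W \<Longrightarrow> \<bar>H z\<bar> \<le> K * U * small_int z"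
  proof (rule primitive_small)
    show "continuous_on W (\<lambda>z. (B z - b) * u z)" by (intro continuous_intros B_cont uc)
    fix z assume z: "z \<in> W"
    have "\<bar>(B z - b) * u z\<bar> \<le> K * small z * U"
      unfolding abs_mult using B_near'[OF z] U(2)[OF z] K small_nonneg(1)[OF z] by (intro mult_mono) auto
    then show "\<bar>(B z - b) * u z\<bar> \<le> K * U * small z / A z" using A1[OF z] by (simp add: mult_ac)
  qed (use K U in auto)
  have cW: "c \<in> W" using c by (rule end_int_self)
  have "\<exists>L. (F \<longlongrightarrow> L) (end_filter m)"
  proof (cases "b = 0")
    case False
    \<comment> \<open>The integrated equation. It can be solved for \<open>F\<close> because
      \<open>b\<close> is not 0, and all other terms converge.\<close>
    define D where "D z = u z + b * F z - G z + H z" for z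
    have D: "D z = D c" if "z \<in> W" for z
    proof (rule deriv_zero_const[of W D])
      fix z assume z: "z \<in> W"
      show "(D has_real_derivative 0) (at z within W)"
        unfolding D_def using u[OF z] F[OF z] G(1)[OF z] H(1)[OF z] A1[OF z]
        by (auto intro!: derivative_eq_intros simp: algebra_simps)
    qed (use that cW in auto)
    have "((\<lambda>z. (D c - u z + G z - H z) / b) \<longlongrightarrow> (D c - 0 + 0 - 0) / b) (end_filter m)"
      using False by (intro tendsto_intros u0 G H)
    then have "(F \<longlongrightarrow> (D c - 0 + 0 - 0) / b) (end_filter m)"
    proof (rule Lim_transform_eventually)
      show "\<forall>\<^sub>F z in end_filter m. (D c - u z + G z - H z) / b = F z"
        using eventually_W
      proof eventually_elim
        case (elim z)
        have "D c - u z + G z - H z = b * F z" using D[OF elim] D_def[of z] by linarith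
        then show ?case using False by simp
      qed
    qed
    then show ?thesis by blast
  next
    case True
    define D where "D z = u z - G z + H z" for z
    have D: "D z = D c" if "z \<in> W" for z
    proof (rule deriv_zero_const[of W D])
      fix z assume z: "z \<in> W"
      show "(D has_real_derivative 0) (at z within W)"
        unfolding D_def using u[OF z] G(1)[OF z] H(1)[OF z] A1[OF z] True
        by (auto intro!: derivative_eq_intros simp: algebra_simps)
    qed (use that cW in auto)
    have "(D \<longlongrightarrow> 0 - 0 + 0) (end_filter m)" unfolding D_def by (intro tendsto_intros u0 G H)
    moreover have "(D \<longlongrightarrow> D c) (end_filter m)"
    proof (rule tendsto_eventually)
      show "\<forall>\<^sub>F z in end_filter m. D z = D c" using eventually_W by eventually_elim (rule D)
    qed
    \<comment> \<open>The constant vanishes since \<open>u\<close>, \<open>G\<close> and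
      \<open>H\<close> do so at the end; hence \<open>u = G - H\<close>.\<close>
    ultimately have "D c = 0 - 0 + 0" using tendsto_unique[OF end_filter_neq_bot] by blast
    then have uGH: "u z = G z - H z" if "z \<in> W" for z using D[OF that] D_def[of z] by linarith
    have neutral unfolding neutral_def using m True by simp
    then obtain GG where "vanishing_primitive c M G GG" using GV by blast
    then have GG: "\<And>z. z \<in> W \<Longrightarrow> (GG has_real_derivative G z) (at z within W)" "(GG \<longlongrightarrow> 0) (end_filter m)"
      by (auto simp: vanishing_primitive_def W ef)
    have Hc: "continuous_on W H" using H(1) by (rule deriv_continuous_on)
    obtain HH where HH: "\<And>z. z \<in> W \<Longrightarrow> (HH has_real_derivative H z) (at z within W)" "(HH \<longlongrightarrow> 0) (end_filter m)"
      "\<And>z. z \<in> W \<Longrightarrow> \<bar>HH z\<bar> \<le> K * U / \<sigma> * small_int z"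
    proof (rule primitive_small[OF Hc])
      show "\<bar>H z\<bar> \<le> K * U / \<sigma> * small z / A z" if "z \<in> W" for z
        using H(3)[OF that] A1[OF that] unfolding small_int_def small_def using m by simp
    qed (use K U \<sigma> in auto)
    \<comment> \<open>Second integration, for the neutral end: \<open>GG\<close> exists by the
      iterated integral term of the norm, \<open>HH\<close> because \<open>H\<close> is
      exponentially small.\<close>
    define D' where "D' z = F z - GG z + HH z" for z
    have D': "D' z = D' c" if "z \<in> W" for z
    proof (rule deriv_zero_const[of W D'])
      fix z assume z: "z \<in> W"
      show "(D' has_real_derivative 0) (at z within W)"
        unfolding D'_def using F[OF z] GG(1)[OF z] HH(1)[OF z] uGH[OF z]
        by (auto intro!: derivative_eq_intros)
    qed (use that cW in auto)
    have "((\<lambda>z. D' c + GG z - HH z) \<longlongrightarrow> D' c + 0 - 0) (end_filter m)" by (intro tendsto_intros GG HH)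
    then have "(F \<longlongrightarrow> D' c + 0 - 0) (end_filter m)"
    proof (rule Lim_transform_eventually)
      show "\<forall>\<^sub>F z in end_filter m. D' c + GG z - HH z = F z"
        using eventually_W
      proof eventually_elim
        case (elim z)
        then show ?case using D'[OF elim] D'_def[of z] by linarith
      qed
    qed
    then show ?thesis by blast
  qed
  then obtain L where L: "(F \<longlongrightarrow> L) (end_filter m)" by blast
  obtain V where V: "0 \<le> V" "\<And>z. z \<in> W \<Longrightarrow> \<bar>F z\<bar> \<le> V"
    using end_int_bounded[OF deriv_continuous_on[OF F] L c] by blast
  define N where "N = M + \<beta> * U"
  have N: "0 \<le> N" using M \<beta>_nonneg U by (simp add: N_def)
  have u': "\<bar>(g z - B z * u z) / A z\<bar> \<le> N" if z: "z \<in> W" for z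
  proof -
    have "\<bar>B z * u z\<bar> \<le> \<beta> * U"
      unfolding abs_mult using holder_boundD(1)[OF B_holder z] U(2)[OF z] \<beta>_nonneg by (intro mult_mono) auto
    then show ?thesis using holder_boundD(1)[OF gh z] A1[OF z] by (simp add: N_def)
  qed
  have uh: "holder_bound \<gamma> W (2 * (U + N)) u"
  proof (rule holder_bound_deriv[OF is_interval_end_int u])
    show "\<bar>(g z - B z * u z) / A z\<bar> \<le> U + N" if "z \<in> W" for z using u'[OF that] U(1) by linarith
    show "\<bar>u z\<bar> \<le> U + N" if "z \<in> W" for z using U(2)[OF that] N by linarith
  qed (use \<gamma> in auto)
  have u'h: "holder_bound \<gamma> W (M + 2 * \<beta> * (2 * (U + N))) (\<lambda>z. (g z - B z * u z) / A z)"
  proof (subst holder_bound_cong[where g="\<lambda>z. g z - B z * u z"])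
    show "holder_bound \<gamma> W (M + 2 * \<beta> * (2 * (U + N))) (\<lambda>z. g z - B z * u z)"
      by (intro holder_bound_diff holder_bound_mult gh B_holder uh)
  qed (use A1 in auto)
  have "((\<lambda>z. g z - B z * u z) \<longlongrightarrow> 0 - b * 0) (end_filter m)" by (intro tendsto_intros gl B_tendsto u0)
  then have u'l: "((\<lambda>z. (g z - B z * u z) / A z) \<longlongrightarrow> 0 - b * 0) (end_filter m)"
  proof (rule Lim_transform_eventually)
    show "\<forall>\<^sub>F z in end_filter m. g z - B z * u z = (g z - B z * u z) / A z"
      using eventually_W by eventually_elim (use A1 in simp)
  qed
  define R where "R = M + 2 * \<beta> * (2 * (U + N))"
  define M' where "M' = U + V + R"
  have nn: "0 \<le> 2 * \<beta> * (2 * (U + N))" using N U(1) \<beta>_nonneg by simp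
  have "0 \<le> R" using nn M by (simp add: R_def)
  then have M': "0 \<le> M'" "U \<le> M'" "V \<le> M'" "R \<le> M'"
    using U(1) V(1) by (auto simp: M'_def)
  have "\<bar>F z\<bar> \<le> M' \<and> \<bar>u z\<bar> \<le> M'" if "z \<in> W" for z using U(2)[OF that] V(2)[OF that] M' by linarith
  then show ?thesis
    using holder_bound_mono[OF u'h[folded R_def] subset_refl M'(4)] u'l u0 L m M'(1) unfolding end_domain_def
    by (intro exI[of _ M']) auto
qed

lemma solve_end:
  assumes "0 \<le> M" "end_target m neutral \<gamma> c M g"
    and "\<And>z. z \<in> W \<Longrightarrow> (u has_real_derivative (g z - B z * u z) / A z) (at z within W)"
    and "\<And>z. z \<in> W \<Longrightarrow> (F has_real_derivative u z) (at z within W)"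
    and "rejecting \<Longrightarrow> ((\<lambda>z. E z * u z) \<longlongrightarrow> 0) (end_filter m)"
    and "m = 1 \<Longrightarrow> b = 0 \<Longrightarrow> (g \<longlongrightarrow> 0) (end_filter m)"
  shows "\<exists>M'\<ge>0. end_domain m \<gamma> c M' F u (\<lambda>z. (g z - B z * u z) / A z)"
  using solve_kimura[OF _ assms] solve_quadratic[OF _ assms(1-5)] by blast

end

section \<open>The first-order coefficient in heat coordinates near an end\<close>

text \<open>Makes derivatives within the interval unique also at the boundary point
  \<open>c\<close>.\<close>

lemma at_within_end_int_neq_bot: "z \<in> end_int m c \<Longrightarrow> at z within end_int m c \<noteq> bot"
proof -
  assume z: "z \<in> end_int m c"
  define y where "y = (if m = 1 then z / 2 else z - 1)"
  have y: "y < z" "{y..z} \<subseteq> end_int m c" using z by (auto simp: y_def end_int_def split: if_splits)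
  then have "at z within {y..z} \<noteq> bot" by (simp add: trivial_limit_within)
  then show ?thesis using at_le[OF y(2), of z] by (metis bot.extremum_uniqueI)
qed

lemma deriv_unique_end_int:
  fixes f :: "real \<Rightarrow> real"
  assumes "(f has_real_derivative a) (at z within end_int m c)" "(f has_real_derivative a') (at z within end_int m c)" "z \<in> end_int m c"
  shows "a = a'"
  using vector_derivative_unique_within[OF at_within_end_int_neq_bot[OF assms(3)]] assms
  by (auto simp: has_real_derivative_iff_has_vector_derivative)

lemma deriv_bound_upto_end:
  assumes "\<And>z. z \<in> end_int m c \<Longrightarrow> (f has_real_derivative f' z) (at z within end_int m c)" "m = 1 \<Longrightarrow> 0 < c"
    and "\<And>z. z \<in> end_int m c \<Longrightarrow> (k has_real_derivative k' z) (at z within end_int m c)"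
    and "\<And>z. z \<in> end_int m c \<Longrightarrow> \<bar>f' z\<bar> \<le> k' z"
    and "(k \<longlongrightarrow> 0) (end_filter m)" "(f \<longlongrightarrow> l) (end_filter m)" "z \<in> end_int m c"
  shows "\<bar>f z - l\<bar> \<le> \<bar>k z\<bar>"
proof -
  obtain l' where l': "(f \<longlongrightarrow> l') (end_filter m)" "\<And>z. z \<in> end_int m c \<Longrightarrow> \<bar>f z - l'\<bar> \<le> \<bar>k z\<bar>"
    using dominated_deriv_tendsto[OF assms(1-5)] by blast
  have "l' = l" using tendsto_unique[OF end_filter_neq_bot l'(1) assms(6)] .
  then show ?thesis using l'(2)[OF assms(7)] by simp
qed

lemma C1_lipschitz_compact:
  fixes f :: "real \<Rightarrow> real"
  assumes f: "\<And>x. x \<in> {a..b} \<Longrightarrow> (f has_real_derivative f' x) (at x within {a..b})" and f': "continuous_on {a..b} f'"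
  shows "\<exists>K\<ge>0. \<forall>x\<in>{a..b}. \<bar>f x\<bar> \<le> K \<and> \<bar>f' x\<bar> \<le> K \<and> (\<forall>y\<in>{a..b}. \<bar>f x - f y\<bar> \<le> K * \<bar>x - y\<bar>)"
proof -
  obtain K1 where K1: "0 \<le> K1" "\<And>x. x \<in> {a..b} \<Longrightarrow> \<bar>f x\<bar> \<le> K1"
    using continuous_on_compact_bound[OF deriv_continuous_on[OF f]] by blast
  obtain K2 where K2: "0 \<le> K2" "\<And>x. x \<in> {a..b} \<Longrightarrow> \<bar>f' x\<bar> \<le> K2"
    using continuous_on_compact_bound[OF f'] by blast
  show ?thesis
  proof (intro exI[of _ "K1 + K2"] conjI ballI)
    show "\<bar>f x - f y\<bar> \<le> (K1 + K2) * \<bar>x - y\<bar>" if "x \<in> {a..b}" "y \<in> {a..b}" for x y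
    proof -
      have "\<bar>f x - f y\<bar> \<le> K2 * \<bar>x - y\<bar>" by (rule lipschitz_of_deriv[OF is_interval_cc f K2(2) that])
      also have "\<dots> \<le> (K1 + K2) * \<bar>x - y\<bar>" using K1 by (intro mult_right_mono) auto
      finally show ?thesis .
    qed
  qed (use K1 K2 in \<open>auto intro: add_increasing add_increasing2\<close>)
qed

text \<open>At the left end \<open>\<alpha>\<close> and \<open>\<beta>\<close> are the coefficients \<open>a\<close> and \<open>b\<close> with the powers of \<open>1 - x\<close> absorbed;
  the right end is treated after the reflection \<open>x \<mapsto> 1 - x\<close>.\<close>

locale heat_end =
  fixes m :: nat and c :: real and \<phi> \<phi>1 \<phi>2 \<alpha> \<alpha>1 \<alpha>2 \<beta> \<beta>1 B :: "real \<Rightarrow> real"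
  assumes m: "m \<in> {1, 2}" and c: "m = 1 \<Longrightarrow> 0 < c"
    and \<phi>: "z \<in> end_int m c \<Longrightarrow> (\<phi> has_real_derivative \<phi>1 z) (at z within end_int m c)"
    and \<phi>1: "z \<in> end_int m c \<Longrightarrow> (\<phi>1 has_real_derivative \<phi>2 z) (at z within end_int m c)"
    and \<phi>_range: "z \<in> end_int m c \<Longrightarrow> 0 < \<phi> z \<and> \<phi> z \<le> 1/3" and \<phi>1_pos: "z \<in> end_int m c \<Longrightarrow> 0 < \<phi>1 z"
    and \<phi>_lim: "(\<phi> \<longlongrightarrow> 0) (end_filter m)"
    and heat: "z \<in> end_int m c \<Longrightarrow> \<phi> z ^ m * \<alpha> (\<phi> z) = (\<phi>1 z)\<^sup>2 * (if m = 1 then z else 1)"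
    and \<alpha>: "x \<in> {0..1/3} \<Longrightarrow> (\<alpha> has_real_derivative \<alpha>1 x) (at x within {0..1/3})"
    and \<alpha>1: "x \<in> {0..1/3} \<Longrightarrow> (\<alpha>1 has_real_derivative \<alpha>2 x) (at x within {0..1/3})"
    and \<alpha>2: "continuous_on {0..1/3} \<alpha>2"
    and \<alpha>_pos: "x \<in> {0..1/3} \<Longrightarrow> 0 < \<alpha> x"
    and \<beta>: "x \<in> {0..1/3} \<Longrightarrow> (\<beta> has_real_derivative \<beta>1 x) (at x within {0..1/3})"
    and \<beta>1: "continuous_on {0..1/3} \<beta>1"
    and B: "z \<in> end_int m c \<Longrightarrow> B z = \<beta> (\<phi> z) * \<phi> z ^ (m - 1) / \<phi>1 z - \<phi> z ^ m * \<alpha> (\<phi> z) * \<phi>2 z / \<phi>1 z ^ 3"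
begin

abbreviation W where "W \<equiv> end_int m c"
abbreviation J :: "real set" where "J \<equiv> {0..1/3}"

lemma \<phi>_J: "z \<in> W \<Longrightarrow> \<phi> z \<in> J" using \<phi>_range by force

lemma W_ev: "eventually (\<lambda>z. z \<in> W) (end_filter m)"
  using c by (rule eventually_end_filter)

lemma \<alpha>_cont: "continuous_on J \<alpha>" "continuous_on J \<alpha>1" "continuous_on J \<beta>"
  using deriv_continuous_on[OF \<alpha>] deriv_continuous_on[OF \<alpha>1] deriv_continuous_on[OF \<beta>] by auto

lemma chain:
  assumes "\<And>x. x \<in> J \<Longrightarrow> (f has_real_derivative f' x) (at x within J)" "z \<in> W"
  shows "((\<lambda>z. f (\<phi> z)) has_real_derivative f' (\<phi> z) * \<phi>1 z) (at z within W)"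
proof -
  have "(f has_real_derivative f' (\<phi> z)) (at (\<phi> z) within \<phi> ` W)"
    using assms(1)[OF \<phi>_J[OF assms(2)]] by (rule DERIV_subset) (use \<phi>_J in auto)
  from DERIV_image_chain[OF this \<phi>[OF assms(2)]] show ?thesis by (simp add: o_def)
qed

lemma lim_J:
  assumes "continuous_on J f" shows "((\<lambda>z. f (\<phi> z)) \<longlongrightarrow> f 0) (end_filter m)"
proof -
  have "eventually (\<lambda>z. \<phi> z \<in> J) (end_filter m)" using W_ev by eventually_elim (rule \<phi>_J)
  then show ?thesis using continuous_on_tendsto_compose[OF assms \<phi>_lim] by simp
qed

lemma \<alpha>_bounds: obtains \<kappa> \<Lambda> where "0 < \<kappa>" "\<kappa> \<le> \<Lambda>" "\<And>x. x \<in> J \<Longrightarrow> \<kappa> \<le> \<alpha> x \<and> \<alpha> x \<le> \<Lambda>"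
proof -
  have ne: "J \<noteq> {}" "compact J" by auto
  obtain x0 where x0: "x0 \<in> J" "\<forall>x\<in>J. \<alpha> x0 \<le> \<alpha> x" using continuous_attains_inf[OF ne(2,1) \<alpha>_cont(1)] by blast
  obtain x1 where x1: "x1 \<in> J" "\<forall>x\<in>J. \<alpha> x \<le> \<alpha> x1" using continuous_attains_sup[OF ne(2,1) \<alpha>_cont(1)] by blast
  show ?thesis using x0 x1 \<alpha>_pos by (intro that[of "\<alpha> x0" "\<alpha> x1"]) auto
qed

text \<open>The heat condition
  \<open>(\<phi>1 z)\<^sup>2 * z = \<phi> z * \<alpha> (\<phi> z)\<close> is singular at 0, but
  \<open>sqrt \<phi>\<close> has the derivative
  \<open>sqrt (\<alpha> (\<phi> z)) / (2 * sqrt z)\<close>, so it is nearly linear in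
  \<open>sqrt z\<close>. This gives \<open>\<phi>\<close> of order \<open>z\<close> and
  \<open>\<phi>1\<close> close to \<open>\<alpha> 0\<close> with error O(z). Differentiating the
  heat condition then bounds \<open>\<phi>2\<close>, and \<open>B\<close> becomes a quotient without
  singularity, whose derivative is bounded.\<close>

lemma coefficient_kimura:
  assumes m1: "m = 1"
  shows "\<exists>K\<ge>0. (\<forall>y\<in>W. \<forall>z\<in>W. \<bar>B y - B z\<bar> \<le> K * \<bar>y - z\<bar>) \<and> (\<forall>z\<in>W. \<bar>B z - \<beta> 0 / \<alpha> 0\<bar> \<le> K * z)"
proof -
  have z0: "0 < z" "z \<le> c" if "z \<in> W" for z using that m1 by (auto simp: end_int_def)
  have c0: "0 < c" using c m1 by simp
  have ef: "end_filter m = at_right 0" using m1 by (simp add: end_filter_def)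
  have heat': "(\<phi>1 z)\<^sup>2 * z = \<phi> z * \<alpha> (\<phi> z)" if "z \<in> W" for z using heat[OF that] m1 by simp
  obtain \<kappa> \<Lambda> where \<kappa>: "0 < \<kappa>" "\<kappa> \<le> \<Lambda>" "\<And>x. x \<in> J \<Longrightarrow> \<kappa> \<le> \<alpha> x \<and> \<alpha> x \<le> \<Lambda>" using \<alpha>_bounds by blast
  \<comment> \<open>With this \<open>h\<close> the heat condition is an equation for
    \<open>h\<close> whose right-hand side has only the integrable singularity
    \<open>1 / sqrt z\<close>.\<close>
  define h where "h z = sqrt (\<phi> z)" for z
  define S where "S z = sqrt (\<alpha> (\<phi> z))" for z
  have S: "sqrt \<kappa> \<le> S z" "S z \<le> sqrt \<Lambda>" "0 < S z" if "z \<in> W" for z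
    using \<kappa>(3)[OF \<phi>_J[OF that]] \<alpha>_pos[OF \<phi>_J[OF that]] by (auto simp: S_def)
  have \<phi>1_eq: "\<phi>1 z = h z / sqrt z * S z" if z: "z \<in> W" for z
  proof -
    have "(\<phi>1 z)\<^sup>2 = (h z / sqrt z * S z)\<^sup>2"
      using heat'[OF z] z0[OF z] \<phi>_range[OF z] \<alpha>_pos[OF \<phi>_J[OF z]]
      by (simp add: h_def S_def power_mult_distrib power_divide field_simps)
    moreover have "0 \<le> h z / sqrt z * S z" using S(3)[OF z] z0[OF z] \<phi>_range[OF z] by (auto simp: h_def)
    ultimately show ?thesis using \<phi>1_pos[OF z] by (simp add: power2_eq_iff_nonneg)
  qed
  have hd: "(h has_real_derivative S z * (1 / (2 * sqrt z))) (at z within W)" if z: "z \<in> W" for z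
  proof -
    have "(h has_real_derivative \<phi>1 z / (2 * sqrt (\<phi> z))) (at z within W)"
      unfolding h_def using \<phi>[OF z] \<phi>_range[OF z] by (auto intro!: derivative_eq_intros simp: field_simps)
    moreover have "\<phi>1 z / (2 * sqrt (\<phi> z)) = S z * (1 / (2 * sqrt z))"
      unfolding \<phi>1_eq[OF z] using z0[OF z] \<phi>_range[OF z] by (simp add: h_def)
    ultimately show ?thesis by simp
  qed
  have sd: "((\<lambda>z. a * sqrt z) has_real_derivative a * (1 / (2 * sqrt z))) (at z within W)" if "z \<in> W" for z a
    using z0[OF that] by (auto intro!: derivative_eq_intros simp: field_simps)
  have sq0: "((\<lambda>z. a * sqrt z) \<longlongrightarrow> 0) (end_filter m)" for a
  proof -
    have "((\<lambda>z. a * sqrt z) \<longlongrightarrow> a * sqrt 0) (end_filter m)" unfolding ef by (intro tendsto_intros)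
    then show ?thesis by simp
  qed
  have h0: "(h \<longlongrightarrow> 0) (end_filter m)"
  proof -
    have "(h \<longlongrightarrow> sqrt 0) (end_filter m)" unfolding h_def by (intro tendsto_intros \<phi>_lim)
    then show ?thesis by simp
  qed
  \<comment> \<open>A two-sided bound on the derivative of \<open>h\<close> in one application of
    the comparison lemma: \<open>S z\<close> lies between \<open>sqrt \<kappa>\<close> and
    \<open>sqrt \<Lambda>\<close>, so its distance from the upper bound is at most the length of
    this interval.\<close>
  have hb: "\<bar>sqrt \<Lambda> * sqrt z - h z\<bar> \<le> (sqrt \<Lambda> - sqrt \<kappa>) * sqrt z" if z: "z \<in> W" for z
  proof -
    have "\<bar>(sqrt \<Lambda> * sqrt z - h z) - 0\<bar> \<le> \<bar>(sqrt \<Lambda> - sqrt \<kappa>) * sqrt z\<bar>"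
    proof (rule deriv_bound_upto_end[where m=m and c=c and f="\<lambda>z. sqrt \<Lambda> * sqrt z - h z" and k="\<lambda>z. (sqrt \<Lambda> - sqrt \<kappa>) * sqrt z"])
      fix z assume z: "z \<in> W"
      show "((\<lambda>z. sqrt \<Lambda> * sqrt z - h z) has_real_derivative sqrt \<Lambda> * (1 / (2 * sqrt z)) - S z * (1 / (2 * sqrt z))) (at z within W)"
        by (intro DERIV_diff sd hd z)
      show "((\<lambda>z. (sqrt \<Lambda> - sqrt \<kappa>) * sqrt z) has_real_derivative (sqrt \<Lambda> - sqrt \<kappa>) * (1 / (2 * sqrt z))) (at z within W)"
        by (rule sd[OF z])
      have "\<bar>sqrt \<Lambda> - S z\<bar> * (1 / (2 * sqrt z)) \<le> (sqrt \<Lambda> - sqrt \<kappa>) * (1 / (2 * sqrt z))"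
        using S[OF z] z0[OF z] by (intro mult_right_mono) auto
      then show "\<bar>sqrt \<Lambda> * (1 / (2 * sqrt z)) - S z * (1 / (2 * sqrt z))\<bar> \<le> (sqrt \<Lambda> - sqrt \<kappa>) * (1 / (2 * sqrt z))"
        using z0[OF z] by (simp add: left_diff_distrib[symmetric] abs_mult diff_divide_distrib[symmetric])
    next
      have "((\<lambda>z. sqrt \<Lambda> * sqrt z - h z) \<longlongrightarrow> 0 - 0) (end_filter m)" by (intro tendsto_diff sq0 h0)
      then show "((\<lambda>z. sqrt \<Lambda> * sqrt z - h z) \<longlongrightarrow> 0) (end_filter m)" by simp
    qed (use c sq0 z in auto)
    then show ?thesis using \<kappa> z0[OF z] by simp
  qed
  have h_low: "sqrt \<kappa> * sqrt z \<le> h z" and h_up: "h z \<le> 2 * sqrt \<Lambda> * sqrt z" if z: "z \<in> W" for z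
  proof -
    have "0 \<le> sqrt \<kappa> * sqrt z" using \<kappa> z0[OF z] by simp
    then show "sqrt \<kappa> * sqrt z \<le> h z" "h z \<le> 2 * sqrt \<Lambda> * sqrt z"
      using hb[OF z] unfolding left_diff_distrib by linarith+
  qed
  have \<phi>_le: "\<phi> z \<le> 4 * \<Lambda> * z" if z: "z \<in> W" for z
  proof -
    have "(h z)\<^sup>2 \<le> (2 * sqrt \<Lambda> * sqrt z)\<^sup>2" using h_up[OF z] \<phi>_range[OF z] by (intro power_mono) (auto simp: h_def)
    then show ?thesis using \<phi>_range[OF z] z0[OF z] \<kappa> by (simp add: h_def power_mult_distrib)
  qed
  have \<phi>1_low: "\<kappa> \<le> \<phi>1 z" if z: "z \<in> W" for z
  proof -
    have "sqrt \<kappa> \<le> h z / sqrt z" using h_low[OF z] z0[OF z] by (simp add: pos_le_divide_eq)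
    then have "sqrt \<kappa> * sqrt \<kappa> \<le> h z / sqrt z * S z" using S(1)[OF z] \<kappa> by (intro mult_mono) (auto intro: order_trans[of _ "sqrt \<kappa>"])
    then show ?thesis using \<kappa> \<phi>1_eq[OF z] by simp
  qed
  obtain L where "0 \<le> L" "\<forall>x\<in>J. \<bar>\<alpha> x\<bar> \<le> L \<and> \<bar>\<alpha>1 x\<bar> \<le> L \<and> (\<forall>y\<in>J. \<bar>\<alpha> x - \<alpha> y\<bar> \<le> L * \<bar>x - y\<bar>)"
    using C1_lipschitz_compact[OF \<alpha> \<alpha>_cont(2)] by blast
  then have L: "0 \<le> L" "\<And>x y. x \<in> J \<Longrightarrow> y \<in> J \<Longrightarrow> \<bar>\<alpha> x - \<alpha> y\<bar> \<le> L * \<bar>x - y\<bar>" by blast+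
  define S0 where "S0 = sqrt (\<alpha> 0)"
  have \<alpha>0: "\<kappa> \<le> \<alpha> 0" "\<alpha> 0 \<le> \<Lambda>" using \<kappa>(3)[of 0] by auto
  have \<alpha>0_pos: "0 < \<alpha> 0" using \<alpha>0(1) \<kappa>(1) by linarith
  then have S0: "sqrt \<kappa> \<le> S0" "S0 \<le> sqrt \<Lambda>" "0 < S0" using \<alpha>0 by (auto simp: S0_def)
  \<comment> \<open>From the Lipschitz constant \<open>L\<close> of \<open>\<alpha>\<close>, the
    bound \<open>\<phi> z \<le> 4 * \<Lambda> * z\<close>, and \<open>sqrt \<kappa>\<close> as a
    lower bound of \<open>S z + S0\<close> in the difference of two square roots.\<close>
  define N where "N = 4 * L * \<Lambda> / sqrt \<kappa>"
  have N0: "0 \<le> N" using L \<kappa> by (simp add: N_def)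
  have SN: "\<bar>S z - S0\<bar> \<le> N * z" if z: "z \<in> W" for z
  proof -
    have "(S z - S0) * (S z + S0) = \<alpha> (\<phi> z) - \<alpha> 0"
      using \<alpha>_pos[OF \<phi>_J[OF z]] \<alpha>0_pos by (simp add: S_def S0_def algebra_simps)
    then have "\<bar>S z - S0\<bar> * (S z + S0) = \<bar>\<alpha> (\<phi> z) - \<alpha> 0\<bar>" using S(3)[OF z] S0 by (metis abs_mult abs_of_pos add_pos_pos)
    also have "\<dots> \<le> L * \<phi> z" using L(2)[OF \<phi>_J[OF z], of 0] \<phi>_range[OF z] by simp
    also have "\<dots> \<le> L * (4 * \<Lambda> * z)" using L \<phi>_le[OF z] by (intro mult_left_mono) auto
    finally have "\<bar>S z - S0\<bar> * sqrt \<kappa> \<le> 4 * L * \<Lambda> * z"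
      using S0 S[OF z] mult_left_mono[of "sqrt \<kappa>" "S z + S0" "\<bar>S z - S0\<bar>"] by (simp add: mult_ac)
    then show ?thesis using \<kappa> by (simp add: N_def pos_le_divide_eq)
  qed
  \<comment> \<open>The function \<open>h - S0 * sqrt z\<close> has a derivative of size
    \<open>sqrt z\<close> and vanishes at 0, hence is of size \<open>z * sqrt z\<close>.\<close>
  have hN: "\<bar>h z / sqrt z - S0\<bar> \<le> N * z" if z: "z \<in> W" for z
  proof -
    have "\<bar>(h z - S0 * sqrt z) - 0\<bar> \<le> \<bar>(N / 2) / (3/2) * z powr (3/2)\<bar>"
    proof (rule deriv_bound_upto_end[where m=m and c=c and f="\<lambda>z. h z - S0 * sqrt z" and k="\<lambda>z. (N / 2) / (3/2) * z powr (3/2)"])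
      fix z assume z: "z \<in> W"
      show "((\<lambda>z. h z - S0 * sqrt z) has_real_derivative S z * (1 / (2 * sqrt z)) - S0 * (1 / (2 * sqrt z))) (at z within W)"
        by (intro DERIV_diff sd hd z)
      show "((\<lambda>z. N / 2 / (3/2) * z powr (3/2)) has_real_derivative N / 2 * z powr (3/2 - 1)) (at z within W)"
        using z0[OF z] by (intro powr_primitive) auto
      have "\<bar>S z - S0\<bar> * (1 / (2 * sqrt z)) \<le> N * z * (1 / (2 * sqrt z))"
        using SN[OF z] z0[OF z] by (intro mult_right_mono) auto
      also have "\<dots> = N / 2 * z powr (3/2 - 1)" using z0[OF z] by (simp add: powr_half_sqrt field_simps)
      finally show "\<bar>S z * (1 / (2 * sqrt z)) - S0 * (1 / (2 * sqrt z))\<bar> \<le> N / 2 * z powr (3/2 - 1)"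
        using z0[OF z] by (simp add: left_diff_distrib[symmetric] abs_mult diff_divide_distrib[symmetric])
    next
      have "((\<lambda>z. h z - S0 * sqrt z) \<longlongrightarrow> 0 - 0) (end_filter m)" by (intro tendsto_diff sq0 h0)
      then show "((\<lambda>z. h z - S0 * sqrt z) \<longlongrightarrow> 0) (end_filter m)" by simp
      show "((\<lambda>z. N / 2 / (3/2) * z powr (3/2)) \<longlongrightarrow> 0) (end_filter m)" unfolding ef by (intro powr_primitive) auto
    qed (use c z in auto)
    then have "\<bar>h z - S0 * sqrt z\<bar> \<le> N / 3 * z powr (1 + 1/2)" using N0 by simp
    also have "\<dots> = N / 3 * z * sqrt z" using z0[OF z] unfolding powr_add by (simp add: powr_half_sqrt)
    also have "\<dots> \<le> N * z * sqrt z" using z0[OF z] N0 by (intro mult_right_mono) auto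
    finally have "\<bar>(h z / sqrt z - S0) * sqrt z\<bar> \<le> N * z * sqrt z" using z0[OF z] by (simp add: left_diff_distrib)
    then show ?thesis using z0[OF z] by (simp add: abs_mult)
  qed
  define N1 where "N1 = 2 * N * sqrt \<Lambda>"
  have \<phi>1N: "\<bar>\<phi>1 z - \<alpha> 0\<bar> \<le> N1 * z" if z: "z \<in> W" for z
  proof -
    have "\<phi>1 z - \<alpha> 0 = (h z / sqrt z - S0) * S z + S0 * (S z - S0)"
      unfolding \<phi>1_eq[OF z] using \<alpha>0_pos by (simp add: S0_def algebra_simps)
    also have "\<bar>\<dots>\<bar> \<le> \<bar>h z / sqrt z - S0\<bar> * \<bar>S z\<bar> + \<bar>S0\<bar> * \<bar>S z - S0\<bar>"
      by (metis abs_mult abs_triangle_ineq)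
    also have "\<dots> \<le> (N * z) * sqrt \<Lambda> + sqrt \<Lambda> * (N * z)"
      using hN[OF z] SN[OF z] S[OF z] S0 N0 z0[OF z] \<kappa> by (intro add_mono mult_mono) auto
    finally show ?thesis by (simp add: N1_def algebra_simps)
  qed
  \<comment> \<open>The derivative of \<open>x * \<alpha> x\<close>, which appears when the heat
    condition is differentiated.\<close>
  define p1 where "p1 x = \<alpha> x + x * \<alpha>1 x" for x
  define p2 where "p2 x = 2 * \<alpha>1 x + x * \<alpha>2 x" for x
  have p1: "(p1 has_real_derivative p2 x) (at x within J)" if "x \<in> J" for x
    unfolding p1_def p2_def using \<alpha>[OF that] \<alpha>1[OF that] by (auto intro!: derivative_eq_intros)
  have p2: "continuous_on J p2" unfolding p2_def by (intro continuous_intros \<alpha>_cont \<alpha>2)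
  have \<phi>2: "\<phi>1 z + 2 * z * \<phi>2 z = p1 (\<phi> z)" if z: "z \<in> W" for z
  proof -
    have "((\<lambda>z. \<phi> z * \<alpha> (\<phi> z)) has_real_derivative p1 (\<phi> z) * \<phi>1 z) (at z within W)"
      unfolding p1_def using \<phi>[OF z] chain[OF \<alpha> z] by (auto intro!: derivative_eq_intros simp: algebra_simps)
    then have "((\<lambda>z. (\<phi>1 z)\<^sup>2 * z) has_real_derivative p1 (\<phi> z) * \<phi>1 z) (at z within W)"
      by (rule has_field_derivative_transform_within[where d = 1]) (use heat' z in auto)
    moreover have "((\<lambda>z. (\<phi>1 z)\<^sup>2 * z) has_real_derivative (\<phi>1 z + 2 * z * \<phi>2 z) * \<phi>1 z) (at z within W)"
      using \<phi>1[OF z] by (auto intro!: derivative_eq_intros simp: algebra_simps power2_eq_square)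
    ultimately have "p1 (\<phi> z) * \<phi>1 z = (\<phi>1 z + 2 * z * \<phi>2 z) * \<phi>1 z" using z by (rule deriv_unique_end_int)
    then show ?thesis using \<phi>1_pos[OF z] by simp
  qed
  obtain L1 where "0 \<le> L1" "\<forall>x\<in>J. \<bar>p1 x\<bar> \<le> L1 \<and> \<bar>p2 x\<bar> \<le> L1 \<and> (\<forall>y\<in>J. \<bar>p1 x - p1 y\<bar> \<le> L1 * \<bar>x - y\<bar>)"
    using C1_lipschitz_compact[OF p1 p2] by blast
  then have L1: "0 \<le> L1" "\<And>x y. x \<in> J \<Longrightarrow> y \<in> J \<Longrightarrow> \<bar>p1 x - p1 y\<bar> \<le> L1 * \<bar>x - y\<bar>" by blast+
  \<comment> \<open>\<open>2 * z * \<phi>2 z\<close> is the difference of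
    \<open>p1 (\<phi> z)\<close> and \<open>\<phi>1 z\<close>. Both are O(z) away from
    \<open>\<alpha> 0\<close>, with these two constants, so the factor \<open>z\<close> can be
    cancelled.\<close>
  define N2 where "N2 = L1 * 4 * \<Lambda> + N1"
  have N1: "0 \<le> N1" using N0 \<kappa> by (simp add: N1_def)
  have N2: "0 \<le> N2" using L1 \<kappa> N1 by (simp add: N2_def)
  have \<phi>2N: "\<bar>\<phi>2 z\<bar> \<le> N2" if z: "z \<in> W" for z
  proof -
    have "\<bar>p1 (\<phi> z) - \<alpha> 0\<bar> \<le> L1 * \<phi> z" using L1(2)[OF \<phi>_J[OF z], of 0] \<phi>_range[OF z] by (simp add: p1_def)
    also have "\<dots> \<le> L1 * (4 * \<Lambda> * z)" using L1 \<phi>_le[OF z] by (intro mult_left_mono) auto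
    finally have "\<bar>2 * z * \<phi>2 z\<bar> \<le> N2 * z" using \<phi>2[OF z] \<phi>1N[OF z] unfolding N2_def distrib_right by linarith
    then have "z * (2 * \<bar>\<phi>2 z\<bar>) \<le> z * N2" using z0[OF z] by (simp add: abs_mult mult_ac)
    then have "2 * \<bar>\<phi>2 z\<bar> \<le> N2" using z0[OF z] by simp
    then show ?thesis by simp
  qed
  \<comment> \<open>Eliminating \<open>z * \<phi>2 z\<close> from \<open>B\<close> with the
    differentiated heat condition leaves \<open>B = 1/2 + r (\<phi> z) / \<phi>1 z\<close>.\<close>
  define r where "r x = \<beta> x - p1 x / 2" for x
  define r1 where "r1 x = \<beta>1 x - p2 x / 2" for x
  have r: "(r has_real_derivative r1 x) (at x within J)" if "x \<in> J" for x
    unfolding r_def r1_def using \<beta>[OF that] p1[OF that] by (auto intro!: derivative_eq_intros)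
  have r1: "continuous_on J r1" unfolding r1_def by (intro continuous_intros \<beta>1 p2) auto
  obtain R where "0 \<le> R" "\<forall>x\<in>J. \<bar>r x\<bar> \<le> R \<and> \<bar>r1 x\<bar> \<le> R \<and> (\<forall>y\<in>J. \<bar>r x - r y\<bar> \<le> R * \<bar>x - y\<bar>)"
    using C1_lipschitz_compact[OF r r1] by blast
  then have R: "0 \<le> R" "\<And>x. x \<in> J \<Longrightarrow> \<bar>r x\<bar> \<le> R" "\<And>x. x \<in> J \<Longrightarrow> \<bar>r1 x\<bar> \<le> R" by blast+
  have Beq: "B z = 1/2 + r (\<phi> z) / \<phi>1 z" if z: "z \<in> W" for z
  proof -
    have "B z = \<beta> (\<phi> z) / \<phi>1 z - (\<phi>1 z)\<^sup>2 * z * \<phi>2 z / \<phi>1 z ^ 3" using B[OF z] heat'[OF z] m1 by simp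
    also have "(\<phi>1 z)\<^sup>2 * z * \<phi>2 z / \<phi>1 z ^ 3 = z * \<phi>2 z / \<phi>1 z"
      using \<phi>1_pos[OF z] by (simp add: power2_eq_square power3_eq_cube)
    also have "z * \<phi>2 z = (p1 (\<phi> z) - \<phi>1 z) / 2" using \<phi>2[OF z] by simp
    finally show ?thesis using \<phi>1_pos[OF z] by (simp add: r_def field_simps)
  qed
  define K where "K = R + R * N2 / \<kappa>\<^sup>2"
  have K: "0 \<le> K" using R N2 by (simp add: K_def)
  have Bd: "(B has_real_derivative r1 (\<phi> z) - r (\<phi> z) * \<phi>2 z / (\<phi>1 z)\<^sup>2) (at z within W)" if z: "z \<in> W" for z
  proof -
    have "((\<lambda>z. 1/2 + r (\<phi> z) / \<phi>1 z) has_real_derivative r1 (\<phi> z) - r (\<phi> z) * \<phi>2 z / (\<phi>1 z)\<^sup>2) (at z within W)"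
      using chain[OF r z] \<phi>1[OF z] \<phi>1_pos[OF z]
      by (auto intro!: derivative_eq_intros simp: field_simps power2_eq_square)
    then show ?thesis by (rule has_field_derivative_transform_within[where d = 1]) (use Beq z in auto)
  qed
  have Bd_le: "\<bar>r1 (\<phi> z) - r (\<phi> z) * \<phi>2 z / (\<phi>1 z)\<^sup>2\<bar> \<le> K" if z: "z \<in> W" for z
  proof -
    have "\<bar>r (\<phi> z) * \<phi>2 z / (\<phi>1 z)\<^sup>2\<bar> \<le> R * N2 / \<kappa>\<^sup>2"
      unfolding abs_divide abs_mult using R(2)[OF \<phi>_J[OF z]] \<phi>2N[OF z] \<phi>1_low[OF z] \<kappa>(1) R(1) N2
      by (intro frac_le mult_mono) (auto intro!: power_mono)
    then show ?thesis using R(3)[OF \<phi>_J[OF z]] unfolding K_def by linarith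
  qed
  have lip: "\<bar>B y - B z\<bar> \<le> K * \<bar>y - z\<bar>" if "y \<in> W" "z \<in> W" for y z
    by (rule lipschitz_of_deriv[OF is_interval_end_int Bd Bd_le that])
  have \<phi>1lim: "(\<phi>1 \<longlongrightarrow> \<alpha> 0) (end_filter m)"
  proof (rule Lim_null[THEN iffD2], rule Lim_null_comparison)
    show "\<forall>\<^sub>F z in end_filter m. norm (\<phi>1 z - \<alpha> 0) \<le> N1 * z" using W_ev by eventually_elim (use \<phi>1N in auto)
    show "((\<lambda>z. N1 * z) \<longlongrightarrow> 0) (end_filter m)" unfolding ef by (auto intro!: tendsto_eq_intros)
  qed
  have "((\<lambda>z. 1/2 + r (\<phi> z) / \<phi>1 z) \<longlongrightarrow> 1/2 + r 0 / \<alpha> 0) (end_filter m)"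
    using \<alpha>0_pos by (intro tendsto_intros lim_J \<phi>1lim deriv_continuous_on[OF r]) auto
  moreover have "1/2 + r 0 / \<alpha> 0 = \<beta> 0 / \<alpha> 0" using \<alpha>0_pos by (simp add: r_def p1_def field_simps)
  ultimately have Blim: "(B \<longlongrightarrow> \<beta> 0 / \<alpha> 0) (end_filter m)"
    using Lim_transform_eventually[of "\<lambda>z. 1/2 + r (\<phi> z) / \<phi>1 z" _ "end_filter m" B]
      eventually_mono[OF W_ev, of "\<lambda>z. 1/2 + r (\<phi> z) / \<phi>1 z = B z"] Beq by auto
  have "\<bar>B z - \<beta> 0 / \<alpha> 0\<bar> \<le> K * z" if z: "z \<in> W" for z
  proof -
    have "\<bar>B z - \<beta> 0 / \<alpha> 0\<bar> \<le> \<bar>K * z\<bar>"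
    proof (rule deriv_bound_upto_end[OF Bd c, where k="\<lambda>z. K * z" and k'="\<lambda>_. K"])
      show "((\<lambda>z. K * z) \<longlongrightarrow> 0) (end_filter m)" unfolding ef by (auto intro!: tendsto_eq_intros)
    qed (use Blim Bd_le z in \<open>auto intro!: derivative_eq_intros\<close>)
    then show ?thesis using K z0[OF z] by simp
  qed
  then show ?thesis using lip K by blast
qed

text \<open>The heat condition now reads
  \<open>\<phi>1 = \<phi> * sqrt (\<alpha> (\<phi> z))\<close>, so \<open>\<phi>1\<close> and
  \<open>\<phi>2\<close> are functions of \<open>\<phi>\<close> and \<open>B\<close> is
  \<open>R (\<phi> z)\<close> with \<open>R\<close> continuously differentiable up to 0. The same
  equation shows that \<open>\<phi>\<close> decays exponentially towards the end, and
  \<open>B\<close> inherits this rate.\<close>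

lemma coefficient_quadratic:
  assumes m2: "m = 2"
  shows "\<exists>K\<ge>0. \<exists>\<sigma>>0. (\<forall>y\<in>W. \<forall>z\<in>W. \<bar>B y - B z\<bar> \<le> K * \<bar>y - z\<bar>) \<and>
     (\<forall>z\<in>W. \<bar>B z - (\<beta> 0 - \<alpha> 0) / sqrt (\<alpha> 0)\<bar> \<le> K * exp (\<sigma> * z))"
proof -
  have heat': "(\<phi>1 z)\<^sup>2 = (\<phi> z)\<^sup>2 * \<alpha> (\<phi> z)" if "z \<in> W" for z using heat[OF that] m2 by simp
  obtain \<kappa> \<Lambda> where \<kappa>: "0 < \<kappa>" "\<kappa> \<le> \<Lambda>" "\<And>x. x \<in> J \<Longrightarrow> \<kappa> \<le> \<alpha> x \<and> \<alpha> x \<le> \<Lambda>" using \<alpha>_bounds by blast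
  define S where "S x = sqrt (\<alpha> x)" for x
  have S: "sqrt \<kappa> \<le> S x" "S x \<le> sqrt \<Lambda>" "0 < S x" if "x \<in> J" for x
    using \<kappa>(3)[OF that] \<alpha>_pos[OF that] by (auto simp: S_def)
  have S2: "S x * S x = \<alpha> x" if "x \<in> J" for x using \<alpha>_pos[OF that] by (simp add: S_def)
  have \<phi>1_eq: "\<phi>1 z = \<phi> z * S (\<phi> z)" if z: "z \<in> W" for z
  proof -
    have "(\<phi>1 z)\<^sup>2 = (\<phi> z * S (\<phi> z))\<^sup>2"
      using heat'[OF z] S2[OF \<phi>_J[OF z]] by (simp add: power_mult_distrib power2_eq_square)
    moreover have "0 \<le> \<phi> z * S (\<phi> z)" using S(3)[OF \<phi>_J[OF z]] \<phi>_range[OF z] by auto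
    ultimately show ?thesis using \<phi>1_pos[OF z] by (simp add: power2_eq_iff_nonneg)
  qed
  have \<phi>2: "\<phi>2 z = \<phi> z * (\<alpha> (\<phi> z) + \<phi> z * \<alpha>1 (\<phi> z) / 2)" if z: "z \<in> W" for z
  proof -
    have "((\<lambda>z. (\<phi> z)\<^sup>2 * \<alpha> (\<phi> z)) has_real_derivative (2 * \<phi> z * (\<alpha> (\<phi> z) + \<phi> z * \<alpha>1 (\<phi> z) / 2)) * \<phi>1 z) (at z within W)"
      using \<phi>[OF z] chain[OF \<alpha> z] by (auto intro!: derivative_eq_intros simp: algebra_simps power2_eq_square)
    then have "((\<lambda>z. (\<phi>1 z)\<^sup>2) has_real_derivative (2 * \<phi> z * (\<alpha> (\<phi> z) + \<phi> z * \<alpha>1 (\<phi> z) / 2)) * \<phi>1 z) (at z within W)"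
      by (rule has_field_derivative_transform_within[where d = 1]) (use heat' z in auto)
    moreover have "((\<lambda>z. (\<phi>1 z)\<^sup>2) has_real_derivative (2 * \<phi>2 z) * \<phi>1 z) (at z within W)"
      using \<phi>1[OF z] by (auto intro!: derivative_eq_intros simp: algebra_simps power2_eq_square)
    ultimately have "(2 * \<phi> z * (\<alpha> (\<phi> z) + \<phi> z * \<alpha>1 (\<phi> z) / 2)) * \<phi>1 z = (2 * \<phi>2 z) * \<phi>1 z" using z by (rule deriv_unique_end_int)
    then show ?thesis using \<phi>1_pos[OF z] by simp
  qed
  define q where "q x = \<beta> x - \<alpha> x - x * \<alpha>1 x / 2" for x
  define q1 where "q1 x = \<beta>1 x - \<alpha>1 x - (\<alpha>1 x + x * \<alpha>2 x) / 2" for x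
  define R where "R x = q x / S x" for x
  define R1 where "R1 x = (q1 x * S x - q x * (\<alpha>1 x / (2 * S x))) / (S x * S x)" for x
  have Sd: "(S has_real_derivative \<alpha>1 x / (2 * S x)) (at x within J)" if "x \<in> J" for x
    unfolding S_def using \<alpha>[OF that] \<alpha>_pos[OF that] by (auto intro!: derivative_eq_intros simp: field_simps)
  have qd: "(q has_real_derivative q1 x) (at x within J)" if "x \<in> J" for x
    unfolding q_def q1_def using \<beta>[OF that] \<alpha>[OF that] \<alpha>1[OF that] by (auto intro!: derivative_eq_intros)
  have Rd: "(R has_real_derivative R1 x) (at x within J)" if "x \<in> J" for x
    unfolding R_def R1_def using S(3)[OF that] by (intro DERIV_divide Sd qd that) auto
  have Sc: "continuous_on J S" by (rule deriv_continuous_on[OF Sd])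
  have "continuous_on J R1"
    unfolding R1_def q1_def q_def using S(3) by (intro continuous_intros Sc \<alpha>_cont \<alpha>2 \<beta>1) force+
  then obtain L where "0 \<le> L" "\<forall>x\<in>J. \<bar>R x\<bar> \<le> L \<and> \<bar>R1 x\<bar> \<le> L \<and> (\<forall>y\<in>J. \<bar>R x - R y\<bar> \<le> L * \<bar>x - y\<bar>)"
    using C1_lipschitz_compact[OF Rd] by blast
  then have L: "0 \<le> L" "\<And>x. x \<in> J \<Longrightarrow> \<bar>R1 x\<bar> \<le> L" "\<And>x y. x \<in> J \<Longrightarrow> y \<in> J \<Longrightarrow> \<bar>R x - R y\<bar> \<le> L * \<bar>x - y\<bar>" by blast+
  have Beq: "B z = R (\<phi> z)" if z: "z \<in> W" for z
  proof -
    have p: "\<phi> z \<noteq> 0" "S (\<phi> z) \<noteq> 0" using \<phi>_range[OF z] S(3)[OF \<phi>_J[OF z]] by auto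
    have "B z = \<beta> (\<phi> z) * \<phi> z / \<phi>1 z - (\<phi>1 z)\<^sup>2 * \<phi>2 z / \<phi>1 z ^ 3" using B[OF z] heat'[OF z] m2 by simp
    also have "(\<phi>1 z)\<^sup>2 * \<phi>2 z / \<phi>1 z ^ 3 = \<phi>2 z / \<phi>1 z"
      using \<phi>1_pos[OF z] by (simp add: power2_eq_square power3_eq_cube)
    also have "\<beta> (\<phi> z) * \<phi> z / \<phi>1 z - \<phi>2 z / \<phi>1 z = (\<phi> z * q (\<phi> z)) / (\<phi> z * S (\<phi> z))"
      unfolding \<phi>2[OF z] \<phi>1_eq[OF z] q_def diff_divide_distrib[symmetric]
      by (intro arg_cong2[where f = "(/)"] refl) (simp add: algebra_simps)
    also have "\<dots> = R (\<phi> z)" using p by (simp add: R_def)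
    finally show ?thesis .
  qed
  \<comment> \<open>The logarithmic derivative of \<open>\<phi>\<close> is
    \<open>sqrt (\<alpha> (\<phi> z))\<close>, which is at least this number.\<close>
  define \<sigma> where "\<sigma> = sqrt \<kappa>"
  have \<sigma>: "0 < \<sigma>" using \<kappa> by (simp add: \<sigma>_def)
  define K where "K = L * (1 + sqrt \<Lambda>) + L * (\<phi> c * exp (- \<sigma> * c))"
  have cW: "c \<in> W" using m2 by (simp add: end_int_def)
  have K: "L * sqrt \<Lambda> \<le> K" "L * (\<phi> c * exp (- \<sigma> * c)) \<le> K" "0 \<le> K"
    using L(1) \<kappa> \<phi>_range[OF cW] by (auto simp: K_def algebra_simps)
  have lip: "\<bar>B y - B z\<bar> \<le> K * \<bar>y - z\<bar>" if yz: "y \<in> W" "z \<in> W" for y z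
  proof -
    have "\<bar>R (\<phi> y) - R (\<phi> z)\<bar> \<le> (L * sqrt \<Lambda>) * \<bar>y - z\<bar>"
    proof (rule lipschitz_of_deriv[OF is_interval_end_int chain[OF Rd] _ yz])
      fix z assume z: "z \<in> W"
      have "\<phi>1 z \<le> 1 * sqrt \<Lambda>" unfolding \<phi>1_eq[OF z] using S[OF \<phi>_J[OF z]] \<phi>_range[OF z] by (intro mult_mono) auto
      then show "\<bar>R1 (\<phi> z) * \<phi>1 z\<bar> \<le> L * sqrt \<Lambda>"
        unfolding abs_mult using L(1) L(2)[OF \<phi>_J[OF z]] \<phi>1_pos[OF z] by (intro mult_mono) auto
    qed
    also have "\<dots> \<le> K * \<bar>y - z\<bar>" using K by (intro mult_right_mono) auto
    finally show ?thesis using Beq yz by simp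
  qed
  have near: "\<bar>B z - (\<beta> 0 - \<alpha> 0) / sqrt (\<alpha> 0)\<bar> \<le> K * exp (\<sigma> * z)" if z: "z \<in> W" for z
  proof -
    have zc: "z \<le> c" using end_int_le[OF z] .
    \<comment> \<open>The subtraction from \<open>sqrt \<Lambda> * z\<close> brings the one-sided
      bound \<open>(ln \<phi>)' \<ge> \<sigma>\<close> into the two-sided form that
      \<open>deriv_dominated\<close> asks for.\<close>
    have "\<bar>(sqrt \<Lambda> * c - ln (\<phi> c)) - (sqrt \<Lambda> * z - ln (\<phi> z))\<bar> \<le> (sqrt \<Lambda> - \<sigma>) * c - (sqrt \<Lambda> - \<sigma>) * z"
    proof (rule deriv_dominated[where U = W and f = "\<lambda>z. sqrt \<Lambda> * z - ln (\<phi> z)" and f' = "\<lambda>z. sqrt \<Lambda> - S (\<phi> z)"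
          and k = "\<lambda>z. (sqrt \<Lambda> - \<sigma>) * z" and k' = "\<lambda>_. sqrt \<Lambda> - \<sigma>"])
      fix z assume z: "z \<in> W"
      show "((\<lambda>z. sqrt \<Lambda> * z - ln (\<phi> z)) has_real_derivative sqrt \<Lambda> - S (\<phi> z)) (at z within W)"
        using \<phi>[OF z] \<phi>_range[OF z] \<phi>1_eq[OF z] by (auto intro!: derivative_eq_intros)
      show "\<bar>sqrt \<Lambda> - S (\<phi> z)\<bar> \<le> sqrt \<Lambda> - \<sigma>" using S[OF \<phi>_J[OF z]] by (auto simp: \<sigma>_def)
    qed (use cW z zc in \<open>auto intro!: derivative_eq_intros\<close>)
    then have "ln (\<phi> z) \<le> ln (\<phi> c) + (- \<sigma> * c) + \<sigma> * z" by (simp add: algebra_simps abs_le_iff)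
    then have "exp (ln (\<phi> z)) \<le> exp (ln (\<phi> c) + (- \<sigma> * c) + \<sigma> * z)" by simp
    then have \<phi>z: "\<phi> z \<le> \<phi> c * exp (- \<sigma> * c) * exp (\<sigma> * z)" using \<phi>_range[OF z] \<phi>_range[OF cW] by (simp add: exp_add exp_diff exp_minus field_simps)
    have "(\<beta> 0 - \<alpha> 0) / sqrt (\<alpha> 0) = R 0" by (simp add: R_def q_def S_def)
    then have "\<bar>B z - (\<beta> 0 - \<alpha> 0) / sqrt (\<alpha> 0)\<bar> \<le> L * \<phi> z" using Beq[OF z] L(3)[OF \<phi>_J[OF z], of 0] \<phi>_range[OF z] by simp
    also have "\<dots> \<le> L * (\<phi> c * exp (- \<sigma> * c) * exp (\<sigma> * z))" using \<phi>z L by (intro mult_left_mono) auto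
    also have "\<dots> = L * (\<phi> c * exp (- \<sigma> * c)) * exp (\<sigma> * z)" by simp
    also have "\<dots> \<le> K * exp (\<sigma> * z)" using K by (intro mult_right_mono) auto
    finally show ?thesis .
  qed
  show ?thesis using lip near K(3) \<sigma> by blast
qed

definition b_end where "b_end = (if m = 1 then \<beta> 0 / \<alpha> 0 else (\<beta> 0 - \<alpha> 0) / sqrt (\<alpha> 0))"

lemma coefficient_end:
  "\<exists>K\<ge>0. \<exists>\<sigma>>0. (\<forall>y\<in>W. \<forall>z\<in>W. \<bar>B y - B z\<bar> \<le> K * \<bar>y - z\<bar>) \<and>
     (\<forall>z\<in>W. \<bar>B z - b_end\<bar> \<le> K * (if m = 1 then z else exp (\<sigma> * z)))"
proof (cases "m = 1")
  case True
  obtain K where "0 \<le> K" "\<forall>y\<in>W. \<forall>z\<in>W. \<bar>B y - B z\<bar> \<le> K * \<bar>y - z\<bar>" "\<forall>z\<in>W. \<bar>B z - \<beta> 0 / \<alpha> 0\<bar> \<le> K * z"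
    using coefficient_kimura[OF True] by blast
  then show ?thesis using True unfolding b_end_def by (intro exI[of _ K] conjI exI[of _ 1]) auto
next
  case False
  then have m2: "m = 2" using m by simp
  show ?thesis using coefficient_quadratic[OF m2] False unfolding b_end_def by simp
qed

end

section \<open>Local spaces\<close>

lemma end_target_nonneg: "end_target m nt \<gamma> c M g \<Longrightarrow> (m = 1 \<Longrightarrow> 0 < c) \<Longrightarrow> 0 \<le> M"
  using end_int_self[of m c] by (auto simp: end_target_def dest: holder_bound_nonneg)

lemma vanishing_primitive_mono:
  assumes "vanishing_primitive c M g G" "d \<le> c" "M \<le> N"
  shows "vanishing_primitive d N g G"
  unfolding vanishing_primitive_def
proof (intro conjI ballI)
  fix z assume "z \<in> {..d}"
  then have "z \<in> {..c}" using assms(2) by simp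
  then have "(G has_real_derivative g z) (at z within {..c})" "\<bar>G z\<bar> \<le> M" using assms(1) by (auto simp: vanishing_primitive_def)
  then show "(G has_real_derivative g z) (at z within {..d})" "\<bar>G z\<bar> \<le> N"
    using assms(2,3) by (auto intro: DERIV_subset[of G _ _ "{..c}"])
qed (use assms in \<open>auto simp: vanishing_primitive_def\<close>)

lemma vanishing_primitive_cong:
  assumes "vanishing_primitive c M g G" "\<And>z. z \<le> c \<Longrightarrow> g z = g' z"
  shows "vanishing_primitive c M g' G"
  using assms by (auto simp: vanishing_primitive_def)

lemma end_target_mono:
  assumes "end_target m nt \<gamma> c M g" "d \<le> c" "M \<le> N"
  shows "end_target m nt \<gamma> d N g"
  using assms vanishing_primitive_mono[OF _ assms(2,3)] vanishing_primitive_mono[OF _ assms(2,3)]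
    holder_bound_mono[OF _ end_int_mono[OF assms(2)] assms(3)]
  unfolding end_target_def by blast

lemma tendsto_end_cong:
  assumes "(g \<longlongrightarrow> l) (end_filter m)" "m = 1 \<Longrightarrow> 0 < c" "\<And>z. z \<in> end_int m c \<Longrightarrow> g z = g' z"
  shows "(g' \<longlongrightarrow> l) (end_filter m)"
proof (rule Lim_transform_eventually[OF assms(1)])
  show "\<forall>\<^sub>F z in end_filter m. g z = g' z"
    using eventually_end_filter[of m c] assms(2,3) by (auto elim: eventually_mono)
qed

lemma end_target_cong:
  assumes t: "end_target m nt \<gamma> c M g" and c: "m = 1 \<Longrightarrow> 0 < c" and eq: "\<And>z. z \<in> end_int m c \<Longrightarrow> g z = g' z"
  shows "end_target m nt \<gamma> c M g'"
proof -
  have "holder_bound \<gamma> (end_int m c) M g'" using t eq holder_bound_cong[of "end_int m c" g g'] by (simp add: end_target_def)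
  moreover obtain l where "(g \<longlongrightarrow> l) (end_filter m)" using t by (auto simp: end_target_def)
  then have "(g' \<longlongrightarrow> l) (end_filter m)" using c eq by (rule tendsto_end_cong)
  moreover have "\<exists>G. vanishing_primitive c M g' G \<and> (nt \<longrightarrow> (\<exists>GG. vanishing_primitive c M G GG))" if m: "m \<noteq> 1"
  proof -
    have "g z = g' z" if "z \<le> c" for z using eq[of z] that m by (simp add: end_int_def)
    then show ?thesis using t m vanishing_primitive_cong[of c M g _ g'] unfolding end_target_def by blast
  qed
  ultimately show ?thesis by (auto simp: end_target_def)
qed

text \<open>Any primitive on the larger half-line, shifted to agree with \<open>G\<close> at
  \<open>d\<close>, agrees with it on all of \<open>{..d}\<close>; beyond \<open>d\<close> it grows
  by at most \<open>N\<close> per unit length.\<close>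

lemma vanishing_primitive_extend:
  assumes G: "vanishing_primitive d M g G" and dc: "d \<le> c" and g: "continuous_on {..c} g"
    and N: "\<And>z. z \<in> {d..c} \<Longrightarrow> \<bar>g z\<bar> \<le> N"
  obtains G' where "vanishing_primitive c (M + (c - d) * N) g G'" "\<And>z. z \<le> d \<Longrightarrow> G' z = G z"
proof -
  have N0: "0 \<le> N" using N[of d] dc by (auto intro: order_trans[OF abs_ge_zero])
  obtain G0 where G0: "\<And>z. z \<in> {..c} \<Longrightarrow> (G0 has_real_derivative g z) (at z within {..c})"
    using ex_primitive_end[of 2 c g] g by (auto simp: end_int_def)
  define G' where "G' z = G0 z - G0 d + G d" for z
  have G': "(G' has_real_derivative g z) (at z within {..c})" if "z \<in> {..c}" for z
    unfolding G'_def using G0[OF that] by (auto intro!: derivative_eq_intros)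
  have eq: "G' z = G z" if z: "z \<le> d" for z
  proof -
    have "G' z - G z = G' d - G d"
    proof (rule deriv_zero_const[where U="{..d}" and f = "\<lambda>z. G' z - G z"])
      fix z assume z: "z \<in> {..d}"
      have "(G' has_real_derivative g z) (at z within {..d})" by (rule DERIV_subset[OF G'[of z]]) (use z dc in auto)
      moreover have "(G has_real_derivative g z) (at z within {..d})" using G z by (auto simp: vanishing_primitive_def)
      ultimately show "((\<lambda>z. G' z - G z) has_real_derivative 0) (at z within {..d})" by (auto intro!: derivative_eq_intros)
    qed (use z in \<open>auto simp: is_interval_1\<close>)
    then show ?thesis by (simp add: G'_def)
  qed
  have M: "\<bar>G z\<bar> \<le> M" if "z \<le> d" for z using G that by (auto simp: vanishing_primitive_def)
  have bound: "\<bar>G' z\<bar> \<le> M + (c - d) * N" if z: "z \<le> c" for z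
  proof (cases "z \<le> d")
    case True
    then show ?thesis using eq M[OF True] N0 dc by (simp add: add_increasing2)
  next
    case False
    have "\<bar>G' z - G' d\<bar> \<le> N * \<bar>z - d\<bar>"
    proof (rule lipschitz_of_deriv[of "{d..c}"])
      show "(G' has_real_derivative g x) (at x within {d..c})" if "x \<in> {d..c}" for x
        by (rule DERIV_subset[OF G'[of x]]) (use that in auto)
    qed (use N False z in \<open>auto simp: is_interval_cc\<close>)
    also have "\<dots> \<le> N * (c - d)" using False z N0 by (intro mult_left_mono) auto
    finally show ?thesis using M[of d] eq[of d] by (simp add: mult.commute)
  qed
  have "vanishing_primitive c (M + (c - d) * N) g G'"
    unfolding vanishing_primitive_def
  proof (intro conjI ballI)
    have "(G \<longlongrightarrow> 0) at_bot" using G by (simp add: vanishing_primitive_def)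
    then show "(G' \<longlongrightarrow> 0) at_bot"
      by (rule Lim_transform_eventually) (auto simp: eq eventually_at_bot_linorder intro!: exI[of _ d])
  qed (use G' bound in auto)
  then show ?thesis using eq that by blast
qed

text \<open>The three summands of the constant belong to \<open>g\<close>, its primitive and the
  primitive of that: each integration over \<open>{d..c}\<close> costs a further factor
  \<open>c - d\<close>.\<close>

lemma end_target_extend:
  assumes t: "end_target m nt \<gamma> d M g" and h: "holder_bound \<gamma> {d..c} N g"
    and d: "d \<in> end_int m c" and \<gamma>: "0 < \<gamma>"
  shows "end_target m nt \<gamma> c ((1 + (c - d) + (c - d)\<^sup>2) * (M + N)) g"
proof -
  have dc: "d \<le> c" using end_int_le[OF d] .
  have d0: "m = 1 \<Longrightarrow> 0 < d" using d by (simp add: end_int_def)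
  have M0: "0 \<le> M" using end_target_nonneg[OF t d0] .
  have N0: "0 \<le> N" using holder_bound_nonneg[OF h, of d] dc by simp
  define C where "C = 1 + (c - d) + (c - d)\<^sup>2"
  have hb: "holder_bound \<gamma> (end_int m c) (M + N) g"
    unfolding end_int_Un[OF d]
  proof (rule holder_bound_paste[where b = d])
    show "holder_bound \<gamma> (end_int m d) M g" using t by (simp add: end_target_def)
  qed (use h \<gamma> dc d0 end_int_self end_int_le in auto)
  have C1: "M + N \<le> C * (M + N)" using M0 N0 dc by (simp add: C_def distrib_right)
  have C2: "M + (c - d) * N \<le> C * (M + N)"
  proof -
    have "C * (M + N) = M + (c - d) * N + (N + (c - d) * M + (c - d)\<^sup>2 * (M + N))" by (simp add: C_def algebra_simps)
    then show ?thesis using M0 N0 dc by simp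
  qed
  have C3: "M + (c - d) * (M + (c - d) * N) \<le> C * (M + N)"
  proof -
    have "C * (M + N) = M + (c - d) * (M + (c - d) * N) + (N + (c - d) * N + (c - d)\<^sup>2 * M)"
      by (simp add: C_def algebra_simps power2_eq_square)
    then show ?thesis using M0 N0 dc by simp
  qed
  have "\<exists>G. vanishing_primitive c (C * (M + N)) g G \<and> (nt \<longrightarrow> (\<exists>GG. vanishing_primitive c (C * (M + N)) G GG))" if m: "m \<noteq> 1"
  proof -
    have W: "end_int m c = {..c}" using m by (simp add: end_int_def)
    have gc: "continuous_on {..c} g" using holder_bound_continuous_on[OF hb \<gamma>] by (simp add: W)
    have gN: "\<bar>g z\<bar> \<le> N" if "z \<in> {d..c}" for z using holder_boundD(1)[OF h that] .
    obtain G where G: "vanishing_primitive d M g G" "nt \<longrightarrow> (\<exists>GG. vanishing_primitive d M G GG)"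
      using t m by (auto simp: end_target_def)
    obtain G' where G': "vanishing_primitive c (M + (c - d) * N) g G'" "\<And>z. z \<le> d \<Longrightarrow> G' z = G z"
      using vanishing_primitive_extend[OF G(1) dc gc gN] by blast
    have "\<exists>GG. vanishing_primitive c (C * (M + N)) G' GG" if nt: nt
    proof -
      obtain GG where "vanishing_primitive d M G GG" using G(2) nt by blast
      then have GG: "vanishing_primitive d M G' GG" using vanishing_primitive_cong[of d M G GG G'] G'(2) by auto
      have G'c: "continuous_on {..c} G'" using G'(1) unfolding vanishing_primitive_def by (intro deriv_continuous_on) blast
      have G'N: "\<bar>G' z\<bar> \<le> M + (c - d) * N" if "z \<in> {d..c}" for z using G'(1) that by (auto simp: vanishing_primitive_def)
      obtain GG' where "vanishing_primitive c (M + (c - d) * (M + (c - d) * N)) G' GG'"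
        using vanishing_primitive_extend[OF GG dc G'c G'N] by blast
      then show ?thesis using vanishing_primitive_mono[OF _ order_refl C3] by blast
    qed
    then show ?thesis using vanishing_primitive_mono[OF G'(1) order_refl C2] by blast
  qed
  then show ?thesis using holder_bound_mono[OF hb subset_refl C1] t unfolding end_target_def C_def by blast
qed

section \<open>Restriction and extension of domain bounds\<close>

lemma end_domain_nonneg: "end_domain m \<gamma> c M F F1 F2 \<Longrightarrow> (m = 1 \<Longrightarrow> 0 < c) \<Longrightarrow> 0 \<le> M"
  using end_int_self[of m c] by (auto simp: end_domain_def split: if_splits dest: holder_bound_nonneg)

lemma end_domain_mono:
  assumes "end_domain m \<gamma> c M F F1 F2" "d \<le> c" "M \<le> N"
  shows "end_domain m \<gamma> d N F F1 F2"
  using assms holder_bound_mono[OF _ end_int_mono[OF assms(2)] assms(3)] end_int_mono[OF assms(2), of m] unfolding end_domain_def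
  by (auto split: if_splits intro: order_trans)

lemma end_domain_cong:
  assumes d: "end_domain m \<gamma> c M F F1 F2" and c: "m = 1 \<Longrightarrow> 0 < c"
    and eq: "\<And>z. z \<in> end_int m c \<Longrightarrow> F z = F' z" "\<And>z. z \<in> end_int m c \<Longrightarrow> F1 z = F1' z" "\<And>z. z \<in> end_int m c \<Longrightarrow> F2 z = F2' z"
  shows "end_domain m \<gamma> c M F' F1' F2'"
proof -
  have L: "(F \<longlongrightarrow> l) (end_filter m) \<Longrightarrow> (F' \<longlongrightarrow> l) (end_filter m)" "(F1 \<longlongrightarrow> l) (end_filter m) \<Longrightarrow> (F1' \<longlongrightarrow> l) (end_filter m)"
    "(F2 \<longlongrightarrow> l) (end_filter m) \<Longrightarrow> (F2' \<longlongrightarrow> l) (end_filter m)"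
    "((\<lambda>z. z * F2 z) \<longlongrightarrow> l) (end_filter m) \<Longrightarrow> ((\<lambda>z. z * F2' z) \<longlongrightarrow> l) (end_filter m)" for l
    by (erule tendsto_end_cong[where c = c]; use c eq in simp)+
  have H: "holder_bound \<gamma> (end_int m c) M F' = holder_bound \<gamma> (end_int m c) M F" "holder_bound \<gamma> (end_int m c) M F1' = holder_bound \<gamma> (end_int m c) M F1"
    "holder_bound \<gamma> (end_int m c) M F2' = holder_bound \<gamma> (end_int m c) M F2"
    "holder_bound \<gamma> (end_int m c) M (\<lambda>z. z * F2' z) = holder_bound \<gamma> (end_int m c) M (\<lambda>z. z * F2 z)"
    by (rule holder_bound_cong; simp add: eq)+
  show ?thesis using d unfolding end_domain_def H using L eq by (auto split: if_splits)
qed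

lemma holder_bound_id: "0 < \<gamma> \<Longrightarrow> \<gamma> \<le> 1 \<Longrightarrow> holder_bound \<gamma> {a..b} (2 * (\<bar>a\<bar> + \<bar>b\<bar> + 1)) (\<lambda>z. z)"
  by (rule holder_bound_lipschitz) (auto simp: abs_le_iff mult_le_cancel_right1)

text \<open>At a Kimura end the bound concerns \<open>z * F2 z\<close>. On \<open>{d..c}\<close> it
  follows from that of \<open>F2\<close> by multiplication with the identity, whose Hoelder constant
  enters \<open>N'\<close>.\<close>

lemma end_domain_extend:
  assumes t: "end_domain m \<gamma> d M F F1 F2" and h: "holder_bound \<gamma> {d..c} N F" "holder_bound \<gamma> {d..c} N F1" "holder_bound \<gamma> {d..c} N F2"
    and d: "d \<in> end_int m c" and \<gamma>: "0 < \<gamma>" "\<gamma> \<le> 1"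
  shows "\<exists>M'\<ge>0. end_domain m \<gamma> c M' F F1 F2"
proof -
  have dc: "d \<le> c" using end_int_le[OF d] .
  have d0: "m = 1 \<Longrightarrow> 0 < d" using d by (simp add: end_int_def)
  have M0: "0 \<le> M" using end_domain_nonneg[OF t d0] .
  have N0: "0 \<le> N" using holder_bound_nonneg[OF h(1), of d] dc by simp
  define N' where "N' = N + 2 * (2 * (\<bar>d\<bar> + \<bar>c\<bar> + 1)) * N"
  have N': "N \<le> N'" "2 * (2 * (\<bar>d\<bar> + \<bar>c\<bar> + 1)) * N \<le> N'" using N0 by (auto simp: N'_def)
  have "holder_bound \<gamma> {d..c} (2 * (2 * (\<bar>d\<bar> + \<bar>c\<bar> + 1)) * N) (\<lambda>z. z * F2 z)"
    by (intro holder_bound_mult holder_bound_id h \<gamma>)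
  then have h4: "holder_bound \<gamma> {d..c} N' (\<lambda>z. z * F2 z)" using N'(2) by (rule holder_bound_mono[OF _ subset_refl])
  have paste: "holder_bound \<gamma> (end_int m c) (M + N') f"
    if "holder_bound \<gamma> (end_int m d) M f" "holder_bound \<gamma> {d..c} N' f" for f
    unfolding end_int_Un[OF d] by (rule holder_bound_paste[where b = d]) (use that \<gamma> dc d0 end_int_self end_int_le in auto)
  note h' = h[THEN holder_bound_mono[OF _ subset_refl N'(1)]]
  have bd: "\<bar>F z\<bar> \<le> M + N' \<and> \<bar>F1 z\<bar> \<le> M + N'" if "z \<in> end_int m c" "m \<noteq> 1" for z
  proof -
    from that(1) consider "z \<in> end_int m d" | "z \<in> {d..c}" unfolding end_int_Un[OF d] by blast
    then show ?thesis
    proof cases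
      case 1
      then have "\<bar>F z\<bar> \<le> M" "\<bar>F1 z\<bar> \<le> M" using t that(2) by (auto simp: end_domain_def)
      then show ?thesis using N0 N' by linarith
    next
      case 2
      then show ?thesis using holder_boundD(1)[OF h'(1) 2] holder_boundD(1)[OF h'(2) 2] M0 by linarith
    qed
  qed
  have "end_domain m \<gamma> c (M + N') F F1 F2"
    using t h' h4 paste bd unfolding end_domain_def by auto
  then show ?thesis using M0 N0 N' by (intro exI[of _ "M + N'"]) auto
qed

section \<open>Derivatives within a set and the original second-order norms\<close>

lemma deriv_on_eq:
  assumes U: "\<And>z. z \<in> U \<Longrightarrow> at z within U \<noteq> bot" and P: "\<And>z. z \<in> U \<Longrightarrow> (P has_real_derivative P1 z) (at z within U)" and z: "z \<in> U"
  shows "deriv_on U P z = P1 z"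
  unfolding deriv_on_def using vector_derivative_within[OF U[OF z]] P[OF z]
  by (simp add: has_real_derivative_iff_has_vector_derivative)

lemma deriv_on_has_derivative:
  assumes U: "\<And>z. z \<in> U \<Longrightarrow> at z within U \<noteq> bot"
    and P: "\<And>z. z \<in> U \<Longrightarrow> (P has_real_derivative P1 z) (at z within U)"
    and P1: "\<And>z. z \<in> U \<Longrightarrow> (P1 has_real_derivative P2 z) (at z within U)" and z: "z \<in> U"
  shows "(deriv_on U P has_real_derivative P2 z) (at z within U)" "deriv_on U (deriv_on U P) z = P2 z"
proof -
  have *: "(deriv_on U P has_real_derivative P2 z) (at z within U)" if z: "z \<in> U" for z
    using P1[OF z] by (rule has_field_derivative_transform_within[where d = 1]) (use deriv_on_eq[OF U P] z in auto)
  then show "(deriv_on U P has_real_derivative P2 z) (at z within U)" using z by blast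
  show "deriv_on U (deriv_on U P) z = P2 z" by (rule deriv_on_eq[OF U * z])
qed

lemma C2_onI:
  assumes U: "\<And>z. z \<in> U \<Longrightarrow> at z within U \<noteq> bot"
    and P: "\<And>z. z \<in> U \<Longrightarrow> (P has_real_derivative P1 z) (at z within U)"
    and P1: "\<And>z. z \<in> U \<Longrightarrow> (P1 has_real_derivative P2 z) (at z within U)" and P2: "continuous_on U P2"
  shows "C2_on U P"
  unfolding C2_on_def
proof (intro conjI)
  show "P differentiable_on U" using P by (meson differentiable_on_def real_differentiable_def)
  show "deriv_on U P differentiable_on U"
    using deriv_on_has_derivative(1)[OF U P P1] by (meson differentiable_on_def real_differentiable_def)
  show "continuous_on U (deriv_on U (deriv_on U P))"
    using P2 by (rule continuous_on_eq) (use deriv_on_has_derivative(2)[OF U P P1] in auto)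
qed

lemma sup_norm_cong: "(\<And>z. z \<in> U \<Longrightarrow> f z = g z) \<Longrightarrow> sup_norm U f = sup_norm U g"
  unfolding sup_norm_def by (intro SUP_cong) auto

text \<open>At a quadratic end the limit of the first derivative is forced to be 0: \<open>P\<close>
  minus its limit is a vanishing primitive of \<open>P1\<close>.\<close>

lemma end_C2_imp_end_domain:
  assumes D: "end_C2 m nt \<gamma> c P" and n: "end_C2_norm m nt \<gamma> c P \<le> ennreal M" and M: "0 \<le> M" and c: "m = 1 \<Longrightarrow> 0 < c"
    and P: "\<And>z. z \<in> end_int m c \<Longrightarrow> (P has_real_derivative P1 z) (at z within end_int m c)"
    and P1: "\<And>z. z \<in> end_int m c \<Longrightarrow> (P1 has_real_derivative P2 z) (at z within end_int m c)"
  shows "end_domain m \<gamma> c M P P1 P2"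
proof -
  have eq: "deriv_on (end_int m c) P z = P1 z" "deriv_on (end_int m c) (deriv_on (end_int m c) P) z = P2 z" if "z \<in> end_int m c" for z
    using deriv_on_eq[OF at_within_end_int_neq_bot P that] deriv_on_has_derivative(2)[OF at_within_end_int_neq_bot P P1 that] by auto
  show ?thesis
  proof (cases "m = 1")
    case True
    then have W: "end_int m c = {0<..c}" by (simp add: end_int_def)
    note eq = eq[unfolded W]
    have D: "kim_C2 \<gamma> c P" and n: "kim_C2_norm \<gamma> c P \<le> ennreal M" using D n True by (auto simp: end_C2_def end_C2_norm_def)
    have e: "holder_norm \<gamma> {0<..c} (deriv_on {0<..c} P) = holder_norm \<gamma> {0<..c} P1"
      "holder_norm \<gamma> {0<..c} (\<lambda>z. z * deriv_on {0<..c} (deriv_on {0<..c} P) z) = holder_norm \<gamma> {0<..c} (\<lambda>z. z * P2 z)"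
      by (rule holder_norm_cong; simp add: eq)+
    have n': "holder_norm \<gamma> {0<..c} P + holder_norm \<gamma> {0<..c} P1 + holder_norm \<gamma> {0<..c} (\<lambda>z. z * P2 z) \<le> ennreal M"
      using n unfolding kim_C2_norm_def e .
    have "holder_norm \<gamma> {0<..c} P \<le> ennreal M" "holder_norm \<gamma> {0<..c} P1 \<le> ennreal M" "holder_norm \<gamma> {0<..c} (\<lambda>z. z * P2 z) \<le> ennreal M"
      by (rule order_trans[OF _ n'], simp add: add_increasing add_increasing2)+
    then have "holder_bound \<gamma> {0<..c} M P" "holder_bound \<gamma> {0<..c} M P1" "holder_bound \<gamma> {0<..c} M (\<lambda>z. z * P2 z)"
      using M by (auto intro: holder_norm_le_imp_bound)
    moreover obtain l where "(deriv_on {0<..c} P \<longlongrightarrow> l) (end_filter m)" using D True by (auto simp: kim_C2_def end_filter_def)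
    then have "(P1 \<longlongrightarrow> l) (end_filter m)" by (rule tendsto_end_cong[OF _ c]) (simp_all add: eq W)
    moreover have "((\<lambda>z. z * deriv_on {0<..c} (deriv_on {0<..c} P) z) \<longlongrightarrow> 0) (end_filter m)" using D True by (auto simp: kim_C2_def end_filter_def)
    then have "((\<lambda>z. z * P2 z) \<longlongrightarrow> 0) (end_filter m)" by (rule tendsto_end_cong[OF _ c]) (simp_all add: eq W)
    moreover have "\<exists>l. (P \<longlongrightarrow> l) (end_filter m)" using D True by (auto simp: kim_C2_def end_filter_def)
    ultimately show ?thesis using True unfolding end_domain_def W by auto
  next
    case False
    then have W: "end_int m c = {..c}" and ef: "end_filter m = at_bot" by (auto simp: end_int_def end_filter_def)
    note eq = eq[unfolded W]
    have D: "quad_C2 nt \<gamma> c P" and n: "quad_C2_norm nt \<gamma> c P \<le> ennreal M" using D n False by (auto simp: end_C2_def end_C2_norm_def)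
    have e: "sup_norm {..c} (deriv_on {..c} P) = sup_norm {..c} P1"
      "holder_norm \<gamma> {..c} (deriv_on {..c} (deriv_on {..c} P)) = holder_norm \<gamma> {..c} P2"
      by (rule sup_norm_cong holder_norm_cong; simp add: eq)+
    have n': "sup_norm {..c} P + sup_norm {..c} P1 + holder_norm \<gamma> {..c} P2 \<le> ennreal M"
      by (rule order_trans[OF _ n]) (simp add: quad_C2_norm_def holder2_norm_def e add_increasing2)
    have "sup_norm {..c} P \<le> ennreal M" "sup_norm {..c} P1 \<le> ennreal M" "holder_norm \<gamma> {..c} P2 \<le> ennreal M"
      by (rule order_trans[OF _ n'], simp add: add_increasing add_increasing2)+
    then have b: "\<forall>z\<in>{..c}. \<bar>P z\<bar> \<le> M" "\<forall>z\<in>{..c}. \<bar>P1 z\<bar> \<le> M" "holder_bound \<gamma> {..c} M P2"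
      using M by (auto intro: holder_norm_le_imp_bound simp: sup_norm_le_iff)
    obtain L where L: "(P \<longlongrightarrow> L) at_bot" using D by (auto simp: quad_C2_def)
    obtain l where "(deriv_on {..c} P \<longlongrightarrow> l) (end_filter m)" using D ef by (auto simp: quad_C2_def)
    then have l: "(P1 \<longlongrightarrow> l) (end_filter m)" by (rule tendsto_end_cong[OF _ c]) (simp_all add: eq W)
    obtain l2 where "(deriv_on {..c} (deriv_on {..c} P) \<longlongrightarrow> l2) (end_filter m)" using D ef by (auto simp: quad_C2_def)
    then have l2: "(P2 \<longlongrightarrow> l2) (end_filter m)" by (rule tendsto_end_cong[OF _ c]) (simp_all add: eq W)
    have "vanishing_primitive c (M + \<bar>L\<bar>) P1 (\<lambda>z. P z - L)"
      unfolding vanishing_primitive_def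
    proof (intro conjI ballI)
      fix z assume z: "z \<in> {..c}"
      show "((\<lambda>z. P z - L) has_real_derivative P1 z) (at z within {..c})"
        using P[of z] z unfolding W by (auto intro!: derivative_eq_intros)
      show "\<bar>P z - L\<bar> \<le> M + \<bar>L\<bar>" using bspec[OF b(1) z] by linarith
    qed (use L in \<open>simp add: LIM_zero\<close>)
    then have "l = 0" using vanishing_primitive_limit_zero l ef by auto
    then show ?thesis using b l l2 L False ef unfolding end_domain_def W by auto
  qed
qed

text \<open>At a quadratic end the integral terms for the second derivative must be supplied:
  \<open>P1\<close> and \<open>P\<close> minus its limit are the required vanishing primitives. Only
  finiteness of the norm is recorded; this suffices, since boundedness of the operator uses the
  opposite direction on the domain side.\<close>

lemma end_domain_imp_end_C2:
  assumes d: "end_domain m \<gamma> c M P P1 P2" and \<gamma>: "0 < \<gamma>" and c: "m = 1 \<Longrightarrow> 0 < c"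
    and P: "\<And>z. z \<in> end_int m c \<Longrightarrow> (P has_real_derivative P1 z) (at z within end_int m c)"
    and P1: "\<And>z. z \<in> end_int m c \<Longrightarrow> (P1 has_real_derivative P2 z) (at z within end_int m c)"
  shows "end_C2 m nt \<gamma> c P"
proof -
  have eq: "deriv_on (end_int m c) P z = P1 z" "deriv_on (end_int m c) (deriv_on (end_int m c) P) z = P2 z" if "z \<in> end_int m c" for z
    using deriv_on_eq[OF at_within_end_int_neq_bot P that] deriv_on_has_derivative(2)[OF at_within_end_int_neq_bot P P1 that] by auto
  have M: "0 \<le> M" using end_domain_nonneg[OF d c] .
  note fin = le_less_trans[OF _ ennreal_less_top]
  have P2c: "continuous_on (end_int m c) P2"
  proof (cases "m = 1")
    case True
    then have "continuous_on (end_int m c) (\<lambda>z. z * P2 z)" using d \<gamma> by (auto simp: end_domain_def intro: holder_bound_continuous_on)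
    then have "continuous_on (end_int m c) (\<lambda>z. (z * P2 z) / z)"
      by (rule continuous_on_divide[OF _ continuous_on_id]) (use True in \<open>auto simp: end_int_def\<close>)
    then show ?thesis by (rule continuous_on_eq) (use True in \<open>auto simp: end_int_def\<close>)
  next
    case False
    then show ?thesis using d \<gamma> by (auto simp: end_domain_def intro: holder_bound_continuous_on)
  qed
  have C2: "C2_on (end_int m c) P" by (rule C2_onI[OF at_within_end_int_neq_bot P P1 P2c])
  show ?thesis
  proof (cases "m = 1")
    case True
    then have W: "end_int m c = {0<..c}" and ef: "end_filter m = at_right 0" by (auto simp: end_int_def end_filter_def)
    have e: "holder_norm \<gamma> {0<..c} (deriv_on {0<..c} P) = holder_norm \<gamma> {0<..c} P1"
      "holder_norm \<gamma> {0<..c} (\<lambda>z. z * deriv_on {0<..c} (deriv_on {0<..c} P) z) = holder_norm \<gamma> {0<..c} (\<lambda>z. z * P2 z)"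
      by (rule holder_norm_cong; simp add: eq[unfolded W])+
    have hb: "holder_bound \<gamma> {0<..c} M P" "holder_bound \<gamma> {0<..c} M P1" "holder_bound \<gamma> {0<..c} M (\<lambda>z. z * P2 z)"
      using d True unfolding end_domain_def W by auto
    have "kim_C2_norm \<gamma> c P < \<infinity>"
      unfolding kim_C2_norm_def e using hb[THEN holder_bound_imp_norm_le[OF _ M], THEN fin] by simp
    moreover obtain l where "(P1 \<longlongrightarrow> l) (end_filter m)" using d True by (auto simp: end_domain_def)
    then have "(deriv_on {0<..c} P \<longlongrightarrow> l) (end_filter m)" by (rule tendsto_end_cong[OF _ c]) (simp_all add: eq[unfolded W] W)
    moreover have "((\<lambda>z. z * P2 z) \<longlongrightarrow> 0) (end_filter m)" using d True by (auto simp: end_domain_def)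
    then have "((\<lambda>z. z * deriv_on {0<..c} (deriv_on {0<..c} P) z) \<longlongrightarrow> 0) (end_filter m)"
      by (rule tendsto_end_cong[OF _ c]) (simp_all add: eq[unfolded W] W)
    moreover have "\<exists>l. (P \<longlongrightarrow> l) (end_filter m)" using d by (auto simp: end_domain_def)
    ultimately show ?thesis using C2 True unfolding end_C2_def kim_C2_def W ef by auto
  next
    case False
    then have W: "end_int m c = {..c}" and ef: "end_filter m = at_bot" by (auto simp: end_int_def end_filter_def)
    have e: "sup_norm {..c} (deriv_on {..c} P) = sup_norm {..c} P1"
      "holder_norm \<gamma> {..c} (deriv_on {..c} (deriv_on {..c} P)) = holder_norm \<gamma> {..c} P2"
      by (rule sup_norm_cong holder_norm_cong; simp add: eq[unfolded W])+
    have b: "\<forall>z\<in>{..c}. \<bar>P z\<bar> \<le> M" "\<forall>z\<in>{..c}. \<bar>P1 z\<bar> \<le> M" "holder_bound \<gamma> {..c} M P2" "(P1 \<longlongrightarrow> 0) (end_filter m)"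
      using d False unfolding end_domain_def W by auto
    obtain L where L: "(P \<longlongrightarrow> L) (end_filter m)" using d by (auto simp: end_domain_def)
    obtain l2 where l2: "(P2 \<longlongrightarrow> l2) (end_filter m)" using d False by (auto simp: end_domain_def)
    have "end_target m nt \<gamma> c (M + \<bar>L\<bar>) P2"
    proof -
      have "vanishing_primitive c (M + \<bar>L\<bar>) P2 P1"
        using P1 b ef unfolding vanishing_primitive_def W by (auto intro: add_increasing2)
      moreover have "vanishing_primitive c (M + \<bar>L\<bar>) P1 (\<lambda>z. P z - L)"
        unfolding vanishing_primitive_def
      proof (intro conjI ballI)
        fix z assume z: "z \<in> {..c}"
        show "((\<lambda>z. P z - L) has_real_derivative P1 z) (at z within {..c})"
          using P[of z] z unfolding W by (auto intro!: derivative_eq_intros)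
        show "\<bar>P z - L\<bar> \<le> M + \<bar>L\<bar>" using bspec[OF b(1) z] by linarith
      qed (use L ef in \<open>simp add: LIM_zero\<close>)
      ultimately show ?thesis using l2 False holder_bound_mono[OF b(3) subset_refl, of "M + \<bar>L\<bar>"] unfolding end_target_def W by auto
    qed
    then have "end_target m nt \<gamma> c (M + \<bar>L\<bar>) (deriv_on {..c} (deriv_on {..c} P))"
      by (rule end_target_cong[OF _ c]) (simp_all add: eq[unfolded W] W)
    then have "end_aD_norm m nt \<gamma> c (deriv_on {..c} (deriv_on {..c} P)) \<le> ennreal (6 * (M + \<bar>L\<bar>))"
      using M \<gamma> by (intro end_target_imp_end_aD) auto
    then have "quad_D_norm nt \<gamma> c (deriv_on {..c} (deriv_on {..c} P)) < \<infinity>"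
      using False fin by (auto simp: end_aD_norm_def)
    moreover have "sup_norm {..c} P < \<infinity>" "sup_norm {..c} P1 < \<infinity>" "holder_norm \<gamma> {..c} P2 < \<infinity>"
      using fin[of "sup_norm {..c} P" M] fin[of "sup_norm {..c} P1" M] b M holder_bound_imp_norm_le[OF b(3) M, THEN fin] by (auto simp: sup_norm_le_iff)
    ultimately have "quad_C2_norm nt \<gamma> c P < \<infinity>" unfolding quad_C2_norm_def holder2_norm_def e by simp
    moreover have "(deriv_on {..c} P \<longlongrightarrow> 0) (end_filter m)" using b(4) by (rule tendsto_end_cong[OF _ c]) (simp_all add: eq[unfolded W] W)
    moreover have "(deriv_on {..c} (deriv_on {..c} P) \<longlongrightarrow> l2) (end_filter m)" using l2 by (rule tendsto_end_cong[OF _ c]) (simp_all add: eq[unfolded W] W)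
    ultimately show ?thesis using C2 False L unfolding end_C2_def quad_C2_def W ef by auto
  qed
qed

lemma holder2_norm_imp_bounds:
  assumes n: "holder2_norm \<gamma> {a..b} P \<le> ennreal M" and M: "0 \<le> M" and ab: "a < b"
    and P: "\<And>z. z \<in> {a..b} \<Longrightarrow> (P has_real_derivative P1 z) (at z within {a..b})"
    and P1: "\<And>z. z \<in> {a..b} \<Longrightarrow> (P1 has_real_derivative P2 z) (at z within {a..b})"
  shows "z \<in> {a..b} \<Longrightarrow> \<bar>P z\<bar> \<le> M" "z \<in> {a..b} \<Longrightarrow> \<bar>P1 z\<bar> \<le> M" "holder_bound \<gamma> {a..b} M P2"
proof -
  have nb: "at z within {a..b} \<noteq> bot" if "z \<in> {a..b}" for z using ab that by (simp add: trivial_limit_within)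
  have e: "sup_norm {a..b} (deriv_on {a..b} P) = sup_norm {a..b} P1"
      "holder_norm \<gamma> {a..b} (deriv_on {a..b} (deriv_on {a..b} P)) = holder_norm \<gamma> {a..b} P2"
    using deriv_on_eq[OF nb P] deriv_on_has_derivative(2)[OF nb P P1] by (auto intro: sup_norm_cong holder_norm_cong)
  have n': "sup_norm {a..b} P + sup_norm {a..b} P1 + holder_norm \<gamma> {a..b} P2 \<le> ennreal M"
    using n unfolding holder2_norm_def e .
  have "sup_norm {a..b} P \<le> ennreal M" "sup_norm {a..b} P1 \<le> ennreal M" "holder_norm \<gamma> {a..b} P2 \<le> ennreal M"
    by (rule order_trans[OF _ n'], simp add: add_increasing add_increasing2)+
  then show "z \<in> {a..b} \<Longrightarrow> \<bar>P z\<bar> \<le> M" "z \<in> {a..b} \<Longrightarrow> \<bar>P1 z\<bar> \<le> M" "holder_bound \<gamma> {a..b} M P2"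
      using M by (auto intro: holder_norm_le_imp_bound simp: sup_norm_le_iff)
qed

lemma holder2_normI:
  assumes ab: "a < b" and \<gamma>: "0 < \<gamma>"
    and P: "\<And>z. z \<in> {a..b} \<Longrightarrow> (P has_real_derivative P1 z) (at z within {a..b})"
    and P1: "\<And>z. z \<in> {a..b} \<Longrightarrow> (P1 has_real_derivative P2 z) (at z within {a..b})"
    and P2: "holder_bound \<gamma> {a..b} M P2"
  shows "C2_on {a..b} P" "holder2_norm \<gamma> {a..b} P < \<infinity>"
proof -
  have nb: "at z within {a..b} \<noteq> bot" if "z \<in> {a..b}" for z using ab that by (simp add: trivial_limit_within)
  show "C2_on {a..b} P" by (rule C2_onI[OF nb P P1 holder_bound_continuous_on[OF P2 \<gamma>]])
  have e: "sup_norm {a..b} (deriv_on {a..b} P) = sup_norm {a..b} P1"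
      "holder_norm \<gamma> {a..b} (deriv_on {a..b} (deriv_on {a..b} P)) = holder_norm \<gamma> {a..b} P2"
    using deriv_on_eq[OF nb P] deriv_on_has_derivative(2)[OF nb P P1] by (auto intro: sup_norm_cong holder_norm_cong)
  have M: "0 \<le> M" using holder_bound_nonneg[OF P2, of a] ab by simp
  obtain K0 where "0 \<le> K0" "\<And>z. z \<in> {a..b} \<Longrightarrow> \<bar>P z\<bar> \<le> K0" using continuous_on_compact_bound[OF deriv_continuous_on[OF P]] by blast
  then have "sup_norm {a..b} P \<le> ennreal K0" by (simp add: sup_norm_le_iff)
  moreover obtain K1 where "0 \<le> K1" "\<And>z. z \<in> {a..b} \<Longrightarrow> \<bar>P1 z\<bar> \<le> K1" using continuous_on_compact_bound[OF deriv_continuous_on[OF P1]] by blast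
  then have "sup_norm {a..b} P1 \<le> ennreal K1" by (simp add: sup_norm_le_iff)
  ultimately show "holder2_norm \<gamma> {a..b} P < \<infinity>"
    unfolding holder2_norm_def e using holder_bound_imp_norm_le[OF P2 M] le_less_trans[OF _ ennreal_less_top] by auto
qed

section \<open>Continuously differentiable functions\<close>

text \<open>The regularity that yields Hoelder bounds on compact subintervals. Derivatives are
  two-sided, as the notion is applied on open intervals.\<close>

definition has_C1 :: "real set \<Rightarrow> (real \<Rightarrow> real) \<Rightarrow> bool" where
  "has_C1 S f \<longleftrightarrow> (\<exists>f'. (\<forall>t\<in>S. (f has_real_derivative f' t) (at t)) \<and> continuous_on S f')"

lemma has_C1I: "(\<And>t. t \<in> S \<Longrightarrow> (f has_real_derivative f' t) (at t)) \<Longrightarrow> continuous_on S f' \<Longrightarrow> has_C1 S f"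
  by (auto simp: has_C1_def)

lemma has_C1E:
  assumes "has_C1 S f"
  obtains f' where "\<And>t. t \<in> S \<Longrightarrow> (f has_real_derivative f' t) (at t)" "continuous_on S f'"
  using assms unfolding has_C1_def by blast

lemma has_C1_continuous: "has_C1 S f \<Longrightarrow> continuous_on S f"
  using has_C1E DERIV_isCont by (metis continuous_at_imp_continuous_on)

lemma has_C1_mult: assumes "has_C1 S f" "has_C1 S g" shows "has_C1 S (\<lambda>t. f t * g t)"
proof -
  obtain f' where f: "\<And>t. t \<in> S \<Longrightarrow> (f has_real_derivative f' t) (at t)" "continuous_on S f'"
    using has_C1E[OF assms(1)] by blast
  obtain g' where g: "\<And>t. t \<in> S \<Longrightarrow> (g has_real_derivative g' t) (at t)" "continuous_on S g'"
    using has_C1E[OF assms(2)] by blast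
  show ?thesis
  proof (rule has_C1I)
    show "((\<lambda>t. f t * g t) has_real_derivative f' t * g t + g' t * f t) (at t)" if "t \<in> S" for t
      using that by (intro DERIV_mult f g)
    show "continuous_on S (\<lambda>t. f' t * g t + g' t * f t)"
      by (intro continuous_intros f g has_C1_continuous assms)
  qed
qed

lemma has_C1_add: assumes "has_C1 S f" "has_C1 S g" shows "has_C1 S (\<lambda>t. f t + g t)"
proof -
  obtain f' where f: "\<And>t. t \<in> S \<Longrightarrow> (f has_real_derivative f' t) (at t)" "continuous_on S f'"
    using has_C1E[OF assms(1)] by blast
  obtain g' where g: "\<And>t. t \<in> S \<Longrightarrow> (g has_real_derivative g' t) (at t)" "continuous_on S g'"
    using has_C1E[OF assms(2)] by blast
  show ?thesis
    by (rule has_C1I[of _ _ "\<lambda>t. f' t + g' t"]) (use f g in \<open>auto intro!: DERIV_add continuous_intros\<close>)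
qed

lemma has_C1_const: "has_C1 S (\<lambda>_. a)"
  by (rule has_C1I[of _ _ "\<lambda>_. 0"]) auto

lemma has_C1_diff: "has_C1 S f \<Longrightarrow> has_C1 S g \<Longrightarrow> has_C1 S (\<lambda>t. f t - g t)"
  using has_C1_add[OF _ has_C1_mult[OF has_C1_const[of S "-1"]], of f g] by simp

lemma has_C1_power: "has_C1 S f \<Longrightarrow> has_C1 S (\<lambda>t. f t ^ n)"
  by (induction n) (auto intro: has_C1_mult has_C1_const)

lemma has_C1_inverse: assumes "has_C1 S f" "\<And>t. t \<in> S \<Longrightarrow> f t \<noteq> 0" shows "has_C1 S (\<lambda>t. inverse (f t))"
proof -
  obtain f' where f: "\<And>t. t \<in> S \<Longrightarrow> (f has_real_derivative f' t) (at t)" "continuous_on S f'"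
    using has_C1E[OF assms(1)] by blast
  show ?thesis
  proof (rule has_C1I)
    show "((\<lambda>t. inverse (f t)) has_real_derivative - (inverse (f t) * f' t * inverse (f t))) (at t)" if "t \<in> S" for t
      using that assms(2) by (intro DERIV_inverse' f)
    show "continuous_on S (\<lambda>t. - (inverse (f t) * f' t * inverse (f t)))"
      using assms(2) by (intro continuous_intros f has_C1_continuous assms(1)) auto
  qed
qed

lemma has_C1_divide: "has_C1 S f \<Longrightarrow> has_C1 S g \<Longrightarrow> (\<And>t. t \<in> S \<Longrightarrow> g t \<noteq> 0) \<Longrightarrow> has_C1 S (\<lambda>t. f t / g t)"
  unfolding divide_inverse by (intro has_C1_mult has_C1_inverse)

lemma has_C1_compose:
  assumes "has_C1 T f" "has_C1 S g" "\<And>t. t \<in> S \<Longrightarrow> g t \<in> T" shows "has_C1 S (\<lambda>t. f (g t))"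
proof -
  obtain f' where f: "\<And>t. t \<in> T \<Longrightarrow> (f has_real_derivative f' t) (at t)" "continuous_on T f'"
    using has_C1E[OF assms(1)] by blast
  obtain g' where g: "\<And>t. t \<in> S \<Longrightarrow> (g has_real_derivative g' t) (at t)" "continuous_on S g'"
    using has_C1E[OF assms(2)] by blast
  show ?thesis
  proof (rule has_C1I[of _ _ "\<lambda>t. f' (g t) * g' t"])
    show "((\<lambda>t. f (g t)) has_real_derivative f' (g t) * g' t) (at t)" if "t \<in> S" for t
      using DERIV_chain2[OF f(1) g(1)] assms(3) that by auto
    show "continuous_on S (\<lambda>t. f' (g t) * g' t)"
      using assms by (intro continuous_intros g(2) continuous_on_compose2[OF f(2) has_C1_continuous]) auto
  qed
qed

lemma has_C1_holder_compact:
  assumes "has_C1 S f" "{a..b} \<subseteq> S" "0 < \<gamma>" "\<gamma> \<le> 1"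
  obtains K where "0 \<le> K" "holder_bound \<gamma> {a..b} K f"
proof -
  obtain f' where f: "\<And>t. t \<in> S \<Longrightarrow> (f has_real_derivative f' t) (at t)" "continuous_on S f'"
    using has_C1E[OF assms(1)] by blast
  show ?thesis
  proof (rule holder_bound_C1_compact[of a b f f' \<gamma>])
    show "(f has_real_derivative f' z) (at z within {a..b})" if "z \<in> {a..b}" for z
      by (rule has_field_derivative_at_within[OF f(1)[OF subsetD[OF assms(2) that]]])
    show "continuous_on {a..b} f'" using f(2) assms(2) by (rule continuous_on_subset)
  qed (use assms that in auto)
qed

text \<open>Three derivatives are what is used: the first-order coefficient in heat coordinates
  contains the second derivative of the chart and has to be continuously differentiable.\<close>

lemma smooth_on_derivs:
  assumes "smooth_on S f"
  obtains f1 f2 f3 where "\<And>t. t \<in> S \<Longrightarrow> (f has_real_derivative f1 t) (at t within S)"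
    "\<And>t. t \<in> S \<Longrightarrow> (f1 has_real_derivative f2 t) (at t within S)"
    "\<And>t. t \<in> S \<Longrightarrow> (f2 has_real_derivative f3 t) (at t within S)" "continuous_on S f3"
proof -
  obtain D where D: "\<And>x. x \<in> S \<Longrightarrow> D 0 x = f x" "\<And>n x. x \<in> S \<Longrightarrow> (D n has_real_derivative D (Suc n) x) (at x within S)"
    using assms by (auto simp: smooth_on_def)
  have "(f has_real_derivative D 1 t) (at t within S)" if "t \<in> S" for t
    by (rule has_field_derivative_transform_within[where d = 1 and f = "D 0"]) (use D that in auto)
  moreover have "continuous_on S (D 3)" using D(2)[of _ 3] by (rule deriv_continuous_on)
  ultimately show ?thesis
    using D(2)[of _ 1] D(2)[of _ 2] by (intro that[of "D 1" "D 2" "D 3"]) (auto simp: numeral_eq_Suc)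
qed

lemma smooth_on_reflect:
  assumes "smooth_on {0..1} f" shows "smooth_on {0..1} (\<lambda>x. f (1 - x))"
proof -
  obtain D where D: "\<And>x. x \<in> {0..1} \<Longrightarrow> D 0 x = f x" "\<And>n x. x \<in> {0..1} \<Longrightarrow> (D n has_real_derivative D (Suc n) x) (at x within {0..1})"
    using assms unfolding smooth_on_def by blast
  have "((\<lambda>x. (-1) ^ n * D n (1 - x)) has_real_derivative (-1) ^ Suc n * D (Suc n) (1 - x)) (at x within {0..1})"
    if x: "x \<in> {0..1}" for n x
  proof -
    have im: "(\<lambda>x::real. 1 - x) ` {0..1} = {0..1}" by (simp add: image_diff_atLeastAtMost)
    have "(D n has_real_derivative D (Suc n) (1 - x)) (at (1 - x) within (\<lambda>x. 1 - x) ` {0..1})"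
      unfolding im using x by (intro D(2)) auto
    moreover have "((\<lambda>x. 1 - x) has_real_derivative -1) (at x within {0..1})" by (auto intro!: derivative_eq_intros)
    ultimately have "(D n \<circ> (\<lambda>x. 1 - x) has_real_derivative D (Suc n) (1 - x) * -1) (at x within {0..1})"
      by (rule DERIV_image_chain)
    then have "((\<lambda>x. D n (1 - x)) has_real_derivative - D (Suc n) (1 - x)) (at x within {0..1})" by (simp add: o_def)
    then show ?thesis using DERIV_cmult[of "\<lambda>x. D n (1 - x)" "- D (Suc n) (1 - x)" x "{0..1}" "(-1) ^ n"] by simp
  qed
  then show ?thesis using D(1) unfolding smooth_on_def
    by (intro exI[of _ "\<lambda>n x. (-1) ^ n * D n (1 - x)"]) auto
qed

lemma smooth_on_uminus: assumes "smooth_on S f" shows "smooth_on S (\<lambda>x. - f x)"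
proof -
  obtain D where "\<forall>x\<in>S. D 0 x = f x" "\<forall>n. \<forall>x\<in>S. (D n has_real_derivative D (Suc n) x) (at x within S)"
    using assms by (auto simp: smooth_on_def)
  then show ?thesis unfolding smooth_on_def
    by (intro exI[of _ "\<lambda>n x. - D n x"]) (auto intro!: DERIV_minus)
qed

lemma at_within_01: "x \<in> {0<..<1::real} \<Longrightarrow> at x within {0..1} = at x"
  by (rule at_within_interior) simp

lemma smooth_on_C1: assumes "smooth_on {0..1} f" shows "has_C1 {0<..<1} f"
proof -
  obtain f1 f2 f3 where f: "\<And>t. t \<in> {0..1} \<Longrightarrow> (f has_real_derivative f1 t) (at t within {0..1})"
    "\<And>t. t \<in> {0..1} \<Longrightarrow> (f1 has_real_derivative f2 t) (at t within {0..1})"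
    using smooth_on_derivs[OF assms] by metis
  have "continuous_on {0..1} f1" using f(2) by (rule deriv_continuous_on)
  then have "continuous_on {0<..<1} f1" by (rule continuous_on_subset) auto
  then show ?thesis
  proof (rule has_C1I[rotated])
    show "(f has_real_derivative f1 t) (at t)" if "t \<in> {0<..<1}" for t
      using f(1)[of t] at_within_01[OF that] that by simp
  qed
qed

text \<open>Here \<open>n\<close> is the order of the opposite end. On \<open>{0..1/3}\<close> the
  factor \<open>1 - x\<close> stays away from 0, so that the modified coefficient
  \<open>\<alpha>\<close> remains positive.\<close>

lemma heat_end_instance:
  assumes a: "smooth_on {0..1} a" and b: "smooth_on {0..1} b" and a_pos: "\<And>x. x \<in> {0..1} \<Longrightarrow> 0 < a x"
    and m: "m \<in> {1, 2}" and c: "m = 1 \<Longrightarrow> 0 < c"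
    and \<phi>: "\<And>z. z \<in> end_int m c \<Longrightarrow> (\<phi> has_real_derivative \<phi>' z) (at z within end_int m c)"
    and \<phi>': "\<And>z. z \<in> end_int m c \<Longrightarrow> (\<phi>' has_real_derivative \<phi>'' z) (at z within end_int m c)"
    and r: "\<And>z. z \<in> end_int m c \<Longrightarrow> 0 < \<phi> z \<and> \<phi> z \<le> 1/3" "\<And>z. z \<in> end_int m c \<Longrightarrow> 0 < \<phi>' z" "(\<phi> \<longlongrightarrow> 0) (end_filter m)"
    and heat: "\<And>z. z \<in> end_int m c \<Longrightarrow> \<phi> z ^ m * (a (\<phi> z) * (1 - \<phi> z) ^ n) = (\<phi>' z)\<^sup>2 * (if m = 1 then z else 1)"
    and B: "\<And>z. z \<in> end_int m c \<Longrightarrow> B z = b (\<phi> z) * (1 - \<phi> z) ^ (n - 1) * \<phi> z ^ (m - 1) / \<phi>' z - \<phi> z ^ m * (a (\<phi> z) * (1 - \<phi> z) ^ n) * \<phi>'' z / \<phi>' z ^ 3"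
  shows "\<exists>K\<ge>0. \<exists>\<sigma>>0. (\<forall>y\<in>end_int m c. \<forall>z\<in>end_int m c. \<bar>B y - B z\<bar> \<le> K * \<bar>y - z\<bar>) \<and>
     (\<forall>z\<in>end_int m c. \<bar>B z - (if m = 1 then b 0 / a 0 else (b 0 - a 0) / sqrt (a 0))\<bar> \<le> K * (if m = 1 then z else exp (\<sigma> * z)))"
proof -
  let ?J = "{0..1/3::real}"
  obtain a1 a2 a3 where a': "\<And>t. t \<in> {0..1} \<Longrightarrow> (a has_real_derivative a1 t) (at t within {0..1})"
    "\<And>t. t \<in> {0..1} \<Longrightarrow> (a1 has_real_derivative a2 t) (at t within {0..1})"
    "\<And>t. t \<in> {0..1} \<Longrightarrow> (a2 has_real_derivative a3 t) (at t within {0..1})"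
    using smooth_on_derivs[OF a] by metis
  obtain b1 b2 where b': "\<And>t. t \<in> {0..1} \<Longrightarrow> (b has_real_derivative b1 t) (at t within {0..1})"
    "\<And>t. t \<in> {0..1} \<Longrightarrow> (b1 has_real_derivative b2 t) (at t within {0..1})"
    using smooth_on_derivs[OF b] by metis
  have sub: "?J \<subseteq> {0..1}" by auto
  have a'': "(a has_real_derivative a1 t) (at t within ?J)" "(a1 has_real_derivative a2 t) (at t within ?J)"
    "(a2 has_real_derivative a3 t) (at t within ?J)" "(b has_real_derivative b1 t) (at t within ?J)"
    "(b1 has_real_derivative b2 t) (at t within ?J)" if "t \<in> ?J" for t
    using a'[of t] b'[of t] that by (auto intro!: DERIV_subset[OF _ sub])
  have cont: "continuous_on ?J a" "continuous_on ?J a1" "continuous_on ?J a2" "continuous_on ?J b" "continuous_on ?J b1"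
    by (rule deriv_continuous_on, erule a'')+
  define \<alpha> where "\<alpha> x = a x * (1 - x) ^ n" for x
  define \<alpha>1 where "\<alpha>1 x = a1 x * (1 - x) ^ n - a x * (real n * (1 - x) ^ (n - 1))" for x
  define \<alpha>2 where "\<alpha>2 x = a2 x * (1 - x) ^ n - 2 * (a1 x * (real n * (1 - x) ^ (n - 1)))
    + a x * (real n * (real (n - 1) * (1 - x) ^ (n - 1 - 1)))" for x
  define \<beta> where "\<beta> x = b x * (1 - x) ^ (n - 1)" for x
  define \<beta>1 where "\<beta>1 x = b1 x * (1 - x) ^ (n - 1) - b x * (real (n - 1) * (1 - x) ^ (n - 1 - 1))" for x
  interpret heat_end m c \<phi> \<phi>' \<phi>'' \<alpha> \<alpha>1 \<alpha>2 \<beta> \<beta>1 B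
  proof
    show "(\<alpha> has_real_derivative \<alpha>1 x) (at x within ?J)" if "x \<in> ?J" for x
      unfolding \<alpha>_def \<alpha>1_def using a''[OF that] by (auto intro!: derivative_eq_intros)
    show "(\<alpha>1 has_real_derivative \<alpha>2 x) (at x within ?J)" if "x \<in> ?J" for x
      unfolding \<alpha>1_def \<alpha>2_def using a''[OF that] by (auto intro!: derivative_eq_intros simp: algebra_simps)
    show "continuous_on ?J \<alpha>2" unfolding \<alpha>2_def by (intro continuous_intros cont)
    show "(\<beta> has_real_derivative \<beta>1 x) (at x within ?J)" if "x \<in> ?J" for x
      unfolding \<beta>_def \<beta>1_def using a''[OF that] by (auto intro!: derivative_eq_intros)
    show "continuous_on ?J \<beta>1" unfolding \<beta>1_def by (intro continuous_intros cont)
    show "0 < \<alpha> x" if "x \<in> ?J" for x using a_pos[of x] that by (simp add: \<alpha>_def)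
    show "\<phi> z ^ m * \<alpha> (\<phi> z) = (\<phi>' z)\<^sup>2 * (if m = 1 then z else 1)" if "z \<in> end_int m c" for z
      using heat[OF that] by (simp add: \<alpha>_def)
    show "B z = \<beta> (\<phi> z) * \<phi> z ^ (m - 1) / \<phi>' z - \<phi> z ^ m * \<alpha> (\<phi> z) * \<phi>'' z / \<phi>' z ^ 3" if "z \<in> end_int m c" for z
      using B[OF that] by (simp add: \<alpha>_def \<beta>_def)
  qed (use m c \<phi> \<phi>' r in auto)
  have eq: "b_end = (if m = 1 then b 0 / a 0 else (b 0 - a 0) / sqrt (a 0))"
    by (simp add: b_end_def \<alpha>_def \<beta>_def)
  show ?thesis using coefficient_end unfolding eq .
qed

section \<open>Heat coordinates\<close>

locale kimura_setting =
  fixes K :: kimura_op and H :: heat_chart and P :: cover and \<gamma> :: real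
  assumes K: "mixed_kimura K" and H: "heat_coordinate K H" and P: "partition_cover P"
    and \<gamma>: "0 < \<gamma>" "\<gamma> < 1"
begin

abbreviation "m0 \<equiv> ord0 K"
abbreviation "m1 \<equiv> ord1 K"
abbreviation "I \<equiv> heat_domain K H"
abbreviation "\<phi> \<equiv> phi H"
abbreviation "\<psi> \<equiv> heat_inv K H"
abbreviation "A \<equiv> heat_second K H"
abbreviation "B \<equiv> heat_first K H"
text \<open>The reflection \<open>t \<mapsto> e - t\<close> turns a right end into a left end; at a quadratic right end any \<open>e\<close> would do.\<close>

definition e where "e = (if m1 = 1 then right_end H else 0)"

section \<open>The heat chart as an increasing diffeomorphism\<close>

lemma refl_pt_eq: "refl_pt K H t = e - t" by (simp add: refl_pt_def e_def)

lemma orders: "m0 \<in> {1, 2}" "m1 \<in> {1, 2}" using K by (auto simp: mixed_kimura_def)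

lemma coefs: "smooth_on {0..1} (coef_a K)" "smooth_on {0..1} (coef_b K)" "x \<in> {0..1} \<Longrightarrow> 0 < coef_a K x"
  using K by (auto simp: mixed_kimura_def)

lemma I_open: "open I"
proof -
  have "I = {t. m0 = 1 \<longrightarrow> 0 < t} \<inter> {t. m1 = 1 \<longrightarrow> t < right_end H}" by (auto simp: heat_domain_def)
  moreover have "open {t::real. m0 = 1 \<longrightarrow> 0 < t}" by (cases "m0 = 1") (auto simp: greaterThan_def[symmetric])
  moreover have "open {t::real. m1 = 1 \<longrightarrow> t < right_end H}" by (cases "m1 = 1") (auto simp: lessThan_def[symmetric])
  ultimately show ?thesis by auto
qed

lemma I_between: "s \<in> I \<Longrightarrow> t \<in> I \<Longrightarrow> {s..t} \<subseteq> I" by (auto simp: heat_domain_def)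

lemma I_interval: "is_interval I" by (auto simp: is_interval_1 heat_domain_def)

lemma at_I: "t \<in> I \<Longrightarrow> at t within I = at t" using I_open by (rule at_within_open[rotated])

lemma left_sub: "c \<in> I \<Longrightarrow> end_int m0 c \<subseteq> I" by (auto simp: heat_domain_def end_int_def)

lemma right_sub: "c \<in> I \<Longrightarrow> s \<in> end_int m1 (e - c) \<Longrightarrow> e - s \<in> I"
  by (auto simp: heat_domain_def end_int_def e_def split: if_splits)

lemma left_pos: "c \<in> I \<Longrightarrow> m0 = 1 \<Longrightarrow> 0 < c" by (auto simp: heat_domain_def)
lemma right_pos: "c \<in> I \<Longrightarrow> m1 = 1 \<Longrightarrow> 0 < e - c" by (auto simp: heat_domain_def e_def)

definition \<phi>1 where "\<phi>1 = deriv \<phi>"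
definition \<phi>2 where "\<phi>2 = deriv \<phi>1"

lemma phi_smooth:
  shows \<phi>_deriv: "t \<in> I \<Longrightarrow> (\<phi> has_real_derivative \<phi>1 t) (at t)"
    and \<phi>1_deriv: "t \<in> I \<Longrightarrow> (\<phi>1 has_real_derivative \<phi>2 t) (at t)"
    and \<phi>2_C1: "has_C1 I \<phi>2"
proof -
  have "smooth_on I \<phi>" using H by (simp add: heat_coordinate_def)
  then obtain f1 f2 f3 where "\<And>t. t \<in> I \<Longrightarrow> (\<phi> has_real_derivative f1 t) (at t within I)"
    "\<And>t. t \<in> I \<Longrightarrow> (f1 has_real_derivative f2 t) (at t within I)"
    "\<And>t. t \<in> I \<Longrightarrow> (f2 has_real_derivative f3 t) (at t within I)" "continuous_on I f3"
    using smooth_on_derivs by metis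
  then have f: "\<And>t. t \<in> I \<Longrightarrow> (\<phi> has_real_derivative f1 t) (at t)" "\<And>t. t \<in> I \<Longrightarrow> (f1 has_real_derivative f2 t) (at t)"
    "\<And>t. t \<in> I \<Longrightarrow> (f2 has_real_derivative f3 t) (at t)" "continuous_on I f3" by (auto simp: at_I)
  have 1: "\<phi>1 t = f1 t" if "t \<in> I" for t using f(1)[OF that] by (simp add: \<phi>1_def DERIV_imp_deriv)
  have d1: "(\<phi>1 has_real_derivative f2 t) (at t)" if "t \<in> I" for t
    by (rule has_field_derivative_transform_within_open[OF f(2)[OF that] I_open that]) (simp add: 1)
  have 2: "\<phi>2 t = f2 t" if "t \<in> I" for t using d1[OF that] by (simp add: \<phi>2_def DERIV_imp_deriv)
  have d2: "(\<phi>2 has_real_derivative f3 t) (at t)" if "t \<in> I" for t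
    by (rule has_field_derivative_transform_within_open[OF f(3)[OF that] I_open that]) (simp add: 2)
  show "t \<in> I \<Longrightarrow> (\<phi> has_real_derivative \<phi>1 t) (at t)" using f(1) 1 by simp
  show "t \<in> I \<Longrightarrow> (\<phi>1 has_real_derivative \<phi>2 t) (at t)" using d1 2 by simp
  show "has_C1 I \<phi>2" using d2 f(4) by (rule has_C1I)
qed

lemma \<phi>1_C1: "has_C1 I \<phi>1" using \<phi>1_deriv has_C1_continuous[OF \<phi>2_C1] by (rule has_C1I)
lemma \<phi>_C1: "has_C1 I \<phi>" using \<phi>_deriv has_C1_continuous[OF \<phi>1_C1] by (rule has_C1I)

lemma \<phi>1_pos: "t \<in> I \<Longrightarrow> 0 < \<phi>1 t" using H by (simp add: heat_coordinate_def \<phi>1_def)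

lemma bij: "bij_betw \<phi> I {0<..<1}" using H by (simp add: heat_coordinate_def)

lemma \<phi>_range: "t \<in> I \<Longrightarrow> \<phi> t \<in> {0<..<1}" using bij by (auto simp: bij_betw_def)

lemma \<psi>_\<phi>: "t \<in> I \<Longrightarrow> \<psi> (\<phi> t) = t"
  using bij by (simp add: heat_inv_def bij_betw_def the_inv_into_f_f)

lemma \<psi>_I: "x \<in> {0<..<1} \<Longrightarrow> \<psi> x \<in> I" and \<phi>_\<psi>: "x \<in> {0<..<1} \<Longrightarrow> \<phi> (\<psi> x) = x"
proof -
  assume "x \<in> {0<..<1}"
  then obtain t where "t \<in> I" "x = \<phi> t" using bij unfolding bij_betw_def by (metis imageE)
  then show "\<psi> x \<in> I" "\<phi> (\<psi> x) = x" by (auto simp: \<psi>_\<phi>)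
qed

lemma \<phi>_less: assumes "s \<in> I" "t \<in> I" "s < t" shows "\<phi> s < \<phi> t"
  using assms(3)
proof (rule DERIV_pos_imp_increasing)
  fix x assume "s \<le> x" "x \<le> t"
  then have "x \<in> I" using I_between[OF assms(1,2)] by auto
  then show "\<exists>y. (\<phi> has_real_derivative y) (at x) \<and> 0 < y" using \<phi>_deriv \<phi>1_pos by blast
qed

lemma \<phi>_le_iff: "s \<in> I \<Longrightarrow> t \<in> I \<Longrightarrow> \<phi> s \<le> \<phi> t \<longleftrightarrow> s \<le> t"
  using \<phi>_less by (metis linorder_not_less order_le_less)

lemma \<phi>_less_iff: "s \<in> I \<Longrightarrow> t \<in> I \<Longrightarrow> \<phi> s < \<phi> t \<longleftrightarrow> s < t"
  using \<phi>_le_iff by (metis linorder_not_less)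

lemma \<psi>_less: "x \<in> {0<..<1} \<Longrightarrow> y \<in> {0<..<1} \<Longrightarrow> x < y \<Longrightarrow> \<psi> x < \<psi> y"
  using \<phi>_less_iff[OF \<psi>_I \<psi>_I] \<phi>_\<psi> by metis

lemma \<phi>_tendsto_left: "(\<phi> \<longlongrightarrow> 0) (end_filter m0)"
proof (rule tendstoI)
  fix \<epsilon> :: real assume \<epsilon>: "0 < \<epsilon>"
  define x where "x = min (\<epsilon> / 2) (1 / 2)"
  have x: "x \<in> {0<..<1}" "x < \<epsilon>" using \<epsilon> by (auto simp: x_def)
  note t = \<psi>_I[OF x(1)]
  have "eventually (\<lambda>z. z \<in> end_int m0 (\<psi> x)) (end_filter m0)" using left_pos[OF t] by (rule eventually_end_filter)
  then show "\<forall>\<^sub>F z in end_filter m0. dist (\<phi> z) 0 < \<epsilon>"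
  proof eventually_elim
    case (elim z)
    then have "z \<in> I" using left_sub[OF t] by blast
    moreover have "\<phi> z \<le> x" using \<phi>_le_iff[OF \<open>z \<in> I\<close> t] \<phi>_\<psi>[OF x(1)] end_int_le[OF elim] by simp
    ultimately show ?case using \<phi>_range[of z] x by (auto simp: dist_real_def)
  qed
qed

lemma \<phi>_tendsto_right: "((\<lambda>s. 1 - \<phi> (e - s)) \<longlongrightarrow> 0) (end_filter m1)"
proof (rule tendstoI)
  fix \<epsilon> :: real assume \<epsilon>: "0 < \<epsilon>"
  define x where "x = 1 - min (\<epsilon> / 2) (1 / 2)"
  have x: "x \<in> {0<..<1}" "1 - x < \<epsilon>" using \<epsilon> by (auto simp: x_def min_def)
  note t = \<psi>_I[OF x(1)]
  have "eventually (\<lambda>z. z \<in> end_int m1 (e - \<psi> x)) (end_filter m1)" using right_pos[OF t] by (rule eventually_end_filter)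
  then show "\<forall>\<^sub>F s in end_filter m1. dist (1 - \<phi> (e - s)) 0 < \<epsilon>"
  proof eventually_elim
    case (elim s)
    then have I: "e - s \<in> I" using right_sub[OF t] by blast
    moreover have "x \<le> \<phi> (e - s)" using \<phi>_le_iff[OF t I] \<phi>_\<psi>[OF x(1)] end_int_le[OF elim] by simp
    ultimately show ?case using \<phi>_range[of "e - s"] x by (auto simp: dist_real_def)
  qed
qed

text \<open>Translates limits in the heat coordinate into limits in \<open>x\<close>, in which
  \<open>b_minus\<close> is defined.\<close>

lemma filterlim_\<psi>_left: "filterlim \<psi> (end_filter m0) (at_right 0)"
proof -
  have "eventually (\<lambda>x. R (\<psi> x)) (at_right 0)" if R: "eventually R (end_filter m0)" for R
  proof -
    have h: "1/2 \<in> {0<..<1::real}" by simp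
    obtain d where d: "d \<in> end_int m0 (\<psi> (1/2))" "\<And>z. z \<in> end_int m0 d \<Longrightarrow> R z"
      using eventually_end_filterE[OF R left_pos[OF \<psi>_I[OF h]]] by metis
    have dI: "d \<in> I" using d(1) left_sub[OF \<psi>_I[OF h]] by blast
    have "R (\<psi> x)" if x: "0 < x" "x < \<phi> d" for x
    proof -
      have x1: "x \<in> {0<..<1}" using x \<phi>_range[OF dI] by auto
      have "\<psi> x < d" using \<phi>_less_iff[OF \<psi>_I[OF x1] dI] \<phi>_\<psi>[OF x1] x by simp
      moreover have "m0 = 1 \<Longrightarrow> 0 < \<psi> x" by (rule left_pos[OF \<psi>_I[OF x1]])
      ultimately show ?thesis by (intro d(2)) (auto simp: end_int_def)
    qed
    then show ?thesis using \<phi>_range[OF dI] by (auto simp: eventually_at_right_field intro!: exI[of _ "\<phi> d"])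
  qed
  then show ?thesis by (auto simp: filterlim_iff)
qed

lemma filterlim_\<psi>_right: "filterlim (\<lambda>x. e - \<psi> x) (end_filter m1) (at_left 1)"
proof -
  have "eventually (\<lambda>x. R (e - \<psi> x)) (at_left 1)" if R: "eventually R (end_filter m1)" for R
  proof -
    have h: "1/2 \<in> {0<..<1::real}" by simp
    obtain d where d: "d \<in> end_int m1 (e - \<psi> (1/2))" "\<And>z. z \<in> end_int m1 d \<Longrightarrow> R z"
      using eventually_end_filterE[OF R right_pos[OF \<psi>_I[OF h]]] by metis
    have dI: "e - d \<in> I" using d(1) right_sub[OF \<psi>_I[OF h]] by blast
    have "R (e - \<psi> x)" if x: "\<phi> (e - d) < x" "x < 1" for x
    proof -
      have x1: "x \<in> {0<..<1}" using x \<phi>_range[OF dI] by auto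
      have "e - d < \<psi> x" using \<phi>_less_iff[OF dI \<psi>_I[OF x1]] \<phi>_\<psi>[OF x1] x by simp
      moreover have "m1 = 1 \<Longrightarrow> 0 < e - \<psi> x" by (rule right_pos[OF \<psi>_I[OF x1]])
      ultimately show ?thesis by (intro d(2)) (auto simp: end_int_def)
    qed
    then show ?thesis using \<phi>_range[OF dI] by (auto simp: eventually_at_left_field intro!: exI[of _ "\<phi> (e - d)"])
  qed
  then show ?thesis by (auto simp: filterlim_iff)
qed

section \<open>The coefficients in heat coordinates\<close>

definition p where "p = second_coef K"
definition q where "q = first_coef K"

lemma A_eq: "A t = p (\<phi> t) / (\<phi>1 t)\<^sup>2" by (simp add: heat_second_def p_def \<phi>1_def)
lemma B_eq: "B t = q (\<phi> t) / \<phi>1 t - p (\<phi> t) * \<phi>2 t / \<phi>1 t ^ 3" by (simp add: heat_first_def p_def q_def \<phi>1_def \<phi>2_def)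

lemma p_C1: "has_C1 {0<..<1} p" and q_C1: "has_C1 {0<..<1} q"
proof -
  have id: "has_C1 {0<..<1::real} (\<lambda>x. x)" by (rule has_C1I[of _ _ "\<lambda>_. 1"]) auto
  show "has_C1 {0<..<1} p" unfolding p_def second_coef_def[abs_def]
    by (intro has_C1_mult has_C1_power has_C1_diff has_C1_const id smooth_on_C1 coefs)
  show "has_C1 {0<..<1} q" unfolding q_def first_coef_def[abs_def]
    by (intro has_C1_mult has_C1_power has_C1_diff has_C1_const id smooth_on_C1 coefs)
qed

lemma p_pos: "x \<in> {0<..<1} \<Longrightarrow> 0 < p x" using coefs(3)[of x] by (simp add: p_def second_coef_def)

lemma A_pos: "t \<in> I \<Longrightarrow> 0 < A t" using p_pos[OF \<phi>_range, of t] \<phi>1_pos[of t]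
  by (auto simp: A_eq intro!: divide_pos_pos zero_less_power)

lemma A_C1: "has_C1 I A"
proof -
  have "has_C1 I (\<lambda>t. p (\<phi> t) / (\<phi>1 t)\<^sup>2)"
    using \<phi>1_pos by (intro has_C1_divide has_C1_power has_C1_compose[OF p_C1 \<phi>_C1 \<phi>_range] \<phi>1_C1) force+
  then show ?thesis by (simp add: A_eq[abs_def])
qed

lemma B_C1: "has_C1 I B"
proof -
  have "has_C1 I (\<lambda>t. q (\<phi> t) / \<phi>1 t - p (\<phi> t) * \<phi>2 t / \<phi>1 t ^ 3)"
    using \<phi>1_pos by (intro has_C1_diff has_C1_divide has_C1_mult has_C1_power has_C1_compose[OF p_C1 \<phi>_C1 \<phi>_range]
       has_C1_compose[OF q_C1 \<phi>_C1 \<phi>_range] \<phi>1_C1 \<phi>2_C1) force+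
  then show ?thesis by (simp add: B_eq[abs_def])
qed

lemma A_left: "t \<in> I \<Longrightarrow> \<phi> t \<le> 1/3 \<Longrightarrow> A t = (if m0 = 1 then t else 1)"
  using H by (simp add: heat_coordinate_def)

lemma A_right: "t \<in> I \<Longrightarrow> 2/3 \<le> \<phi> t \<Longrightarrow> A t = (if m1 = 1 then e - t else 1)"
  using H by (simp add: heat_coordinate_def e_def)

lemma heat_eq: "t \<in> I \<Longrightarrow> p (\<phi> t) = (\<phi>1 t)\<^sup>2 * A t" using \<phi>1_pos[of t] by (simp add: A_eq)

text \<open>\<open>bL\<close> is the limit of \<open>B\<close> at the left end and \<open>bR\<close> that of \<open>- B\<close> at the right end, the sign
  coming from the reflection.\<close>

definition bL where "bL = (if m0 = 1 then coef_b K 0 / coef_a K 0 else (coef_b K 0 - coef_a K 0) / sqrt (coef_a K 0))"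
definition bR where "bR = (if m1 = 1 then - coef_b K 1 / coef_a K 1 else (- coef_b K 1 - coef_a K 1) / sqrt (coef_a K 1))"

lemma bL_nonneg: "m0 = 1 \<Longrightarrow> 0 \<le> bL" using K coefs(3)[of 0] by (auto simp: bL_def mixed_kimura_def intro!: divide_nonneg_pos)
lemma bR_nonneg: "m1 = 1 \<Longrightarrow> 0 \<le> bR" using K coefs(3)[of 1] by (auto simp: bR_def mixed_kimura_def intro!: divide_nonpos_pos)

lemma neutral_left: "neutral0 K \<longleftrightarrow> m0 \<noteq> 1 \<and> bL = 0"
  using orders(1) coefs(3)[of 0] by (auto simp: neutral0_def bL_def divide_eq_eq)

lemma neutral_right: "neutral1 K \<longleftrightarrow> m1 \<noteq> 1 \<and> bR = 0"
  using orders(2) coefs(3)[of 1] by (auto simp: neutral1_def bR_def divide_eq_eq)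

lemma left_coefficient:
  assumes c: "c \<in> I" "\<phi> c \<le> 1/3"
  shows "\<exists>N\<ge>0. \<exists>\<sigma>>0. (\<forall>y\<in>end_int m0 c. \<forall>z\<in>end_int m0 c. \<bar>B y - B z\<bar> \<le> N * \<bar>y - z\<bar>) \<and>
     (\<forall>z\<in>end_int m0 c. \<bar>B z - bL\<bar> \<le> N * (if m0 = 1 then z else exp (\<sigma> * z)))"
  unfolding bL_def
proof (rule heat_end_instance[where \<phi> = \<phi> and \<phi>' = \<phi>1 and \<phi>'' = \<phi>2 and n = m1])
  fix z assume z: "z \<in> end_int m0 c"
  then have zI: "z \<in> I" using left_sub[OF c(1)] by blast
  have le: "\<phi> z \<le> 1/3" using \<phi>_le_iff[OF zI c(1)] end_int_le[OF z] c(2) by linarith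
  show "(\<phi> has_real_derivative \<phi>1 z) (at z within end_int m0 c)" "(\<phi>1 has_real_derivative \<phi>2 z) (at z within end_int m0 c)"
    by (rule has_field_derivative_at_within, rule \<phi>_deriv[OF zI] \<phi>1_deriv[OF zI])+
  show "0 < \<phi> z \<and> \<phi> z \<le> 1/3" using le \<phi>_range[OF zI] by simp
  show "0 < \<phi>1 z" by (rule \<phi>1_pos[OF zI])
  show "\<phi> z ^ m0 * (coef_a K (\<phi> z) * (1 - \<phi> z) ^ m1) = (\<phi>1 z)\<^sup>2 * (if m0 = 1 then z else 1)"
    using heat_eq[OF zI] A_left[OF zI le] by (simp add: p_def second_coef_def mult_ac)
  show "B z = coef_b K (\<phi> z) * (1 - \<phi> z) ^ (m1 - 1) * \<phi> z ^ (m0 - 1) / \<phi>1 z - \<phi> z ^ m0 * (coef_a K (\<phi> z) * (1 - \<phi> z) ^ m1) * \<phi>2 z / \<phi>1 z ^ 3"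
    unfolding B_eq p_def q_def second_coef_def first_coef_def by (simp add: mult_ac)
qed (use coefs orders left_pos[OF c(1)] \<phi>_tendsto_left in auto)

text \<open>The reflection replaces \<open>x\<close> by \<open>1 - x\<close> and \<open>t\<close> by
  \<open>e - t\<close>. Both reverse the direction, so the chart stays increasing, while
  \<open>coef_b\<close>, the first-order coefficient and the second derivative of the chart change
  sign.\<close>

lemma right_coefficient:
  assumes c: "c \<in> I" "2/3 \<le> \<phi> c"
  shows "\<exists>N\<ge>0. \<exists>\<sigma>>0. (\<forall>y\<in>end_int m1 (e - c). \<forall>z\<in>end_int m1 (e - c). \<bar>- B (e - y) - (- B (e - z))\<bar> \<le> N * \<bar>y - z\<bar>) \<and>
     (\<forall>z\<in>end_int m1 (e - c). \<bar>- B (e - z) - bR\<bar> \<le> N * (if m1 = 1 then z else exp (\<sigma> * z)))"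
proof -
  have "\<exists>N\<ge>0. \<exists>\<sigma>>0. (\<forall>y\<in>end_int m1 (e - c). \<forall>z\<in>end_int m1 (e - c). \<bar>- B (e - y) - (- B (e - z))\<bar> \<le> N * \<bar>y - z\<bar>) \<and>
     (\<forall>z\<in>end_int m1 (e - c). \<bar>- B (e - z) - (if m1 = 1 then (- coef_b K (1 - 0)) / coef_a K (1 - 0)
        else (- coef_b K (1 - 0) - coef_a K (1 - 0)) / sqrt (coef_a K (1 - 0)))\<bar> \<le> N * (if m1 = 1 then z else exp (\<sigma> * z)))"
  proof (rule heat_end_instance[where \<phi> = "\<lambda>s. 1 - \<phi> (e - s)" and \<phi>' = "\<lambda>s. \<phi>1 (e - s)" and \<phi>'' = "\<lambda>s. - \<phi>2 (e - s)" and n = m0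
        and a = "\<lambda>x. coef_a K (1 - x)" and b = "\<lambda>x. - coef_b K (1 - x)"])
    fix z assume z: "z \<in> end_int m1 (e - c)"
    then have zI: "e - z \<in> I" using right_sub[OF c(1)] by blast
    have le: "2/3 \<le> \<phi> (e - z)" using \<phi>_le_iff[OF c(1) zI] end_int_le[OF z] c(2) by linarith
    have lin: "((\<lambda>s. e - s) has_real_derivative -1) (at z)" by (auto intro!: derivative_eq_intros)
    have "((\<lambda>s. \<phi> (e - s)) has_real_derivative \<phi>1 (e - z) * -1) (at z)" by (rule DERIV_chain2[OF \<phi>_deriv[OF zI] lin])
    then have "((\<lambda>s. 1 - \<phi> (e - s)) has_real_derivative \<phi>1 (e - z)) (at z)" by (auto intro!: derivative_eq_intros)
    then show "((\<lambda>s. 1 - \<phi> (e - s)) has_real_derivative \<phi>1 (e - z)) (at z within end_int m1 (e - c))"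
      by (rule has_field_derivative_at_within)
    have "((\<lambda>s. \<phi>1 (e - s)) has_real_derivative \<phi>2 (e - z) * -1) (at z)" by (rule DERIV_chain2[OF \<phi>1_deriv[OF zI] lin])
    then show "((\<lambda>s. \<phi>1 (e - s)) has_real_derivative - \<phi>2 (e - z)) (at z within end_int m1 (e - c))"
      by (simp add: has_field_derivative_at_within)
    show "0 < 1 - \<phi> (e - z) \<and> 1 - \<phi> (e - z) \<le> 1/3" using le \<phi>_range[OF zI] by simp
    show "0 < \<phi>1 (e - z)" by (rule \<phi>1_pos[OF zI])
    show "(1 - \<phi> (e - z)) ^ m1 * (coef_a K (1 - (1 - \<phi> (e - z))) * (1 - (1 - \<phi> (e - z))) ^ m0) = (\<phi>1 (e - z))\<^sup>2 * (if m1 = 1 then z else 1)"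
      using heat_eq[OF zI] A_right[OF zI le] by (simp add: p_def second_coef_def mult_ac)
    show "- B (e - z) = - coef_b K (1 - (1 - \<phi> (e - z))) * (1 - (1 - \<phi> (e - z))) ^ (m0 - 1) * (1 - \<phi> (e - z)) ^ (m1 - 1) / \<phi>1 (e - z)
       - (1 - \<phi> (e - z)) ^ m1 * (coef_a K (1 - (1 - \<phi> (e - z))) * (1 - (1 - \<phi> (e - z))) ^ m0) * - \<phi>2 (e - z) / \<phi>1 (e - z) ^ 3"
      unfolding B_eq p_def q_def second_coef_def first_coef_def by (simp add: mult_ac)
  qed (use coefs orders right_pos[OF c(1)] \<phi>_tendsto_right smooth_on_reflect smooth_on_uminus in auto)
  then show ?thesis unfolding bR_def diff_zero .
qed

lemma ex_antiderivative:
  assumes f: "continuous_on I f"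
  obtains F where "\<And>t. t \<in> I \<Longrightarrow> (F has_real_derivative f t) (at t)"
proof -
  define a :: ereal where "a = (if m0 = 1 then 0 else -\<infinity>)"
  define b :: ereal where "b = (if m1 = 1 then ereal (right_end H) else \<infinity>)"
  have I: "t \<in> I \<longleftrightarrow> a < ereal t \<and> ereal t < b" for t
    by (auto simp: heat_domain_def a_def b_def zero_ereal_def)
  have "\<psi> (1/2) \<in> I" by (intro \<psi>_I) simp
  then have "a < b" using I less_trans by blast
  moreover have "isCont f x" if "a < ereal x" "ereal x < b" for x
    using f I_open I that by (simp add: continuous_on_eq_continuous_at)
  ultimately obtain F where "\<forall>x. a < ereal x \<longrightarrow> ereal x < b \<longrightarrow> (F has_vector_derivative f x) (at x)"
    using einterval_antiderivative[of a b f] by blast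
  then show ?thesis using that[of F] I by (simp add: has_real_derivative_iff_has_vector_derivative)
qed

end

section \<open>Localisation\<close>

lemma holder_bound_reflect:
  assumes "holder_bound \<gamma> {a..b} M f" shows "holder_bound \<gamma> {k - b..k - a} M (\<lambda>s. f (k - s))"
proof (rule holder_boundI)
  show "\<bar>f (k - z)\<bar> \<le> M" if "z \<in> {k - b..k - a}" for z using holder_boundD(1)[OF assms, of "k - z"] that by auto
  show "\<bar>f (k - y) - f (k - z)\<bar> \<le> M * \<bar>y - z\<bar> powr \<gamma>" if "y \<in> {k - b..k - a}" "z \<in> {k - b..k - a}" for y z
    using holder_boundD(2)[OF assms, of "k - y" "k - z"] that by (auto simp: abs_minus_commute)
qed

lemma holder_bound_zero: "0 \<le> M \<Longrightarrow> (\<And>z. z \<in> U \<Longrightarrow> f z = 0) \<Longrightarrow> holder_bound \<gamma> U M f"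
  by (rule holder_boundI) auto

text \<open>Composition with the retraction \<open>r\<close> onto \<open>{a..b}\<close> keeps the
  constant, since \<open>r\<close> does not increase distances, and \<open>f\<close> is unchanged by
  it because it vanishes at the boundary and outside.\<close>

lemma holder_bound_extend_zero:
  assumes f: "holder_bound \<gamma> {a..b} M f" and ab: "a \<le> b" and \<gamma>: "0 < \<gamma>"
    and z: "\<And>t. t \<in> {a'..b'} \<Longrightarrow> t \<le> a \<or> b \<le> t \<Longrightarrow> f t = 0"
  shows "holder_bound \<gamma> {a'..b'} M f"
proof (cases "{a..b} \<inter> {a'..b'} = {}")
  case True
  then have "f t = 0" if "t \<in> {a'..b'}" for t
    using z[OF that] that by (metis IntI atLeastAtMost_iff empty_iff linear)
  moreover have "0 \<le> M" using holder_bound_nonneg[OF f, of a] ab by simp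
  ultimately show ?thesis by (intro holder_bound_zero)
next
  case False
  have M: "0 \<le> M" using holder_bound_nonneg[OF f, of a] ab by simp
  define r where "r t = max a (min b t)" for t
  have r: "r t \<in> {a..b}" "\<bar>r s - r t\<bar> \<le> \<bar>s - t\<bar>" for s t using ab by (auto simp: r_def)
  have f0: "f (r t) = f t" if t: "t \<in> {a'..b'}" for t
  proof -
    have "f a = 0" if "t < a" using z[of a] that t False by auto
    moreover have "f b = 0" if "b < t" using z[of b] that t False by auto
    ultimately show ?thesis using z[OF t] ab by (cases "t < a"; cases "b < t") (auto simp: r_def)
  qed
  show ?thesis
  proof (rule holder_boundI)
    show "\<bar>f t\<bar> \<le> M" if "t \<in> {a'..b'}" for t using holder_boundD(1)[OF f r(1)] f0[OF that] by metis
    fix s t assume st: "s \<in> {a'..b'}" "t \<in> {a'..b'}"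
    have "\<bar>f (r s) - f (r t)\<bar> \<le> M * \<bar>r s - r t\<bar> powr \<gamma>" using f r(1) r(1) by (rule holder_boundD(2))
    also have "\<dots> \<le> M * \<bar>s - t\<bar> powr \<gamma>" using M r(2) \<gamma> by (intro mult_left_mono powr_mono2) auto
    finally show "\<bar>f s - f t\<bar> \<le> M * \<bar>s - t\<bar> powr \<gamma>" using f0 st by simp
  qed
qed

text \<open>The constant depends on the cut-off only. Near the end the product is \<open>g\<close>
  itself, so its integral terms there are those of \<open>g\<close>; beyond \<open>d\<close> the
  product rule and \<open>end_target_extend\<close> take over.\<close>

lemma cutoff_target:
  assumes d: "d \<in> end_int m c" and one: "\<And>z. z \<in> end_int m d \<Longrightarrow> \<eta> z = 1" and \<eta>: "holder_bound \<gamma> {d..c} L \<eta>" and \<gamma>: "0 < \<gamma>"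
  shows "\<exists>C\<ge>0. \<forall>M g. end_target m nt \<gamma> d M g \<longrightarrow> holder_bound \<gamma> {d..c} M g \<longrightarrow> end_target m nt \<gamma> c (C * M) (\<lambda>z. \<eta> z * g z)"
proof -
  have dc: "d \<le> c" using end_int_le[OF d] .
  have d0: "m = 1 \<Longrightarrow> 0 < d" using d by (simp add: end_int_def)
  have L0: "0 \<le> L" using holder_bound_nonneg[OF \<eta>, of d] dc by simp
  define C where "C = (1 + (c - d) + (c - d)\<^sup>2) * (1 + 2 * L)"
  have "end_target m nt \<gamma> c (C * M) (\<lambda>z. \<eta> z * g z)"
    if t: "end_target m nt \<gamma> d M g" and h: "holder_bound \<gamma> {d..c} M g" for M g
  proof -
    have "end_target m nt \<gamma> d M (\<lambda>z. \<eta> z * g z)" by (rule end_target_cong[OF t d0]) (auto simp: one)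
    then have "end_target m nt \<gamma> c ((1 + (c - d) + (c - d)\<^sup>2) * (M + 2 * L * M)) (\<lambda>z. \<eta> z * g z)"
      using holder_bound_mult[OF \<eta> h] d \<gamma> by (rule end_target_extend)
    then show ?thesis by (simp add: C_def algebra_simps)
  qed
  moreover have "0 \<le> C" using L0 dc by (simp add: C_def)
  ultimately show ?thesis by blast
qed

lemma cutoff_domain:
  assumes d: "d \<in> end_int m c" and one: "\<And>z. z \<in> end_int m d \<Longrightarrow> \<eta> z = 1 \<and> \<eta>1 z = 0 \<and> \<eta>2 z = 0"
    and \<eta>: "holder_bound \<gamma> {d..c} L \<eta>" "holder_bound \<gamma> {d..c} L1 \<eta>1" "holder_bound \<gamma> {d..c} L2 \<eta>2" and \<gamma>: "0 < \<gamma>" "\<gamma> \<le> 1"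
    and F: "end_domain m \<gamma> d M F F1 F2" "holder_bound \<gamma> {d..c} M F" "holder_bound \<gamma> {d..c} M F1" "holder_bound \<gamma> {d..c} M F2"
  shows "\<exists>M'\<ge>0. end_domain m \<gamma> c M' (\<lambda>z. \<eta> z * F z) (\<lambda>z. \<eta>1 z * F z + \<eta> z * F1 z) (\<lambda>z. \<eta>2 z * F z + 2 * (\<eta>1 z * F1 z) + \<eta> z * F2 z)"
proof -
  have d0: "m = 1 \<Longrightarrow> 0 < d" using d by (simp add: end_int_def)
  have dom: "end_domain m \<gamma> d M (\<lambda>z. \<eta> z * F z) (\<lambda>z. \<eta>1 z * F z + \<eta> z * F1 z) (\<lambda>z. \<eta>2 z * F z + 2 * (\<eta>1 z * F1 z) + \<eta> z * F2 z)"
    by (rule end_domain_cong[OF F(1) d0]) (auto simp: one)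
  note h = holder_bound_mult[OF \<eta>(1) F(2)] holder_bound_add[OF holder_bound_mult[OF \<eta>(2) F(2)] holder_bound_mult[OF \<eta>(1) F(3)]]
    holder_bound_add[OF holder_bound_add[OF holder_bound_mult[OF \<eta>(3) F(2)] holder_bound_cmult[OF holder_bound_mult[OF \<eta>(2) F(3)], of 2]] holder_bound_mult[OF \<eta>(1) F(4)]]
  define N where "N = \<bar>2 * L * M\<bar> + \<bar>2 * L1 * M + 2 * L * M\<bar> + \<bar>2 * L2 * M + \<bar>2\<bar> * (2 * L1 * M) + 2 * L * M\<bar>"
  show ?thesis
    by (rule end_domain_extend[OF dom _ _ _ d \<gamma>, of N])
      (rule holder_bound_mono[OF h(1) subset_refl] holder_bound_mono[OF h(2) subset_refl] holder_bound_mono[OF h(3) subset_refl]; simp add: N_def)+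
qed

text \<open>Away from the end all three functions have ordinary Hoelder bounds: at a Kimura end the
  weight in \<open>z * P2 z\<close> can be divided out, and at a quadratic end, where
  \<open>P\<close> and \<open>P1\<close> have only sup bounds, each gets its Hoelder bound from the
  next derivative.\<close>

lemma end_domain_compact:
  assumes d: "d \<in> end_int m c" and \<gamma>: "0 < \<gamma>" "\<gamma> \<le> 1"
  shows "\<exists>C\<ge>1. \<forall>M P P1 P2. end_domain m \<gamma> c M P P1 P2 \<longrightarrow>
    (\<forall>z\<in>end_int m c. (P has_real_derivative P1 z) (at z within end_int m c) \<and> (P1 has_real_derivative P2 z) (at z within end_int m c)) \<longrightarrow>
    holder_bound \<gamma> {d..c} (C * M) P \<and> holder_bound \<gamma> {d..c} (C * M) P1 \<and> holder_bound \<gamma> {d..c} (C * M) P2"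
proof -
  have dc: "d \<le> c" using end_int_le[OF d] .
  have sub: "{d..c} \<subseteq> end_int m c" using end_int_Un[OF d] by blast
  have cc: "m = 1 \<Longrightarrow> 0 < c" using d by (auto simp: end_int_def)
  show ?thesis
  proof (cases "m = 1")
    case True
    have d0: "0 < d" using d True by (simp add: end_int_def)
    have "has_C1 {0<..} (\<lambda>z::real. inverse z)"
      by (rule has_C1_inverse, rule has_C1I[of _ _ "\<lambda>_. 1"]) auto
    then obtain L where L: "0 \<le> L" "holder_bound \<gamma> {d..c} L (\<lambda>z. inverse z)"
      by (rule has_C1_holder_compact[of _ _ d c \<gamma>]) (use d0 \<gamma> in auto)
    have "holder_bound \<gamma> {d..c} ((1 + 2 * L) * M) P \<and> holder_bound \<gamma> {d..c} ((1 + 2 * L) * M) P1 \<and> holder_bound \<gamma> {d..c} ((1 + 2 * L) * M) P2"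
      if e: "end_domain m \<gamma> c M P P1 P2" for M P P1 P2
    proof -
      have M: "0 \<le> M" using end_domain_nonneg[OF e cc] .
      have le: "M \<le> (1 + 2 * L) * M" "2 * L * M \<le> (1 + 2 * L) * M" using L M by (auto simp: distrib_right)
      have hb: "holder_bound \<gamma> (end_int m c) M P" "holder_bound \<gamma> (end_int m c) M P1" "holder_bound \<gamma> (end_int m c) M (\<lambda>z. z * P2 z)"
        using e True by (auto simp: end_domain_def)
      have "holder_bound \<gamma> {d..c} (2 * L * M) (\<lambda>z. inverse z * (z * P2 z))"
        using L(2) holder_bound_mono[OF hb(3) sub order_refl] by (rule holder_bound_mult)
      then have "holder_bound \<gamma> {d..c} (2 * L * M) P2"
        by (subst holder_bound_cong[where g = "\<lambda>z. inverse z * (z * P2 z)"]) (use d0 in auto)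
      then show ?thesis using holder_bound_mono[OF hb(1) sub le(1)] holder_bound_mono[OF hb(2) sub le(1)] holder_bound_mono[OF _ subset_refl le(2)] by blast
    qed
    then show ?thesis using L(1) by (intro exI[of _ "1 + 2 * L"]) auto
  next
    case False
    have "holder_bound \<gamma> {d..c} (2 * M) P \<and> holder_bound \<gamma> {d..c} (2 * M) P1 \<and> holder_bound \<gamma> {d..c} (2 * M) P2"
      if e: "end_domain m \<gamma> c M P P1 P2"
        and P: "\<And>z. z \<in> end_int m c \<Longrightarrow> (P has_real_derivative P1 z) (at z within end_int m c)"
        "\<And>z. z \<in> end_int m c \<Longrightarrow> (P1 has_real_derivative P2 z) (at z within end_int m c)" for M P P1 P2
    proof -
      have M: "0 \<le> M" using end_domain_nonneg[OF e cc] .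
      have b: "\<And>z. z \<in> end_int m c \<Longrightarrow> \<bar>P z\<bar> \<le> M" "\<And>z. z \<in> end_int m c \<Longrightarrow> \<bar>P1 z\<bar> \<le> M" "holder_bound \<gamma> (end_int m c) M P2"
        using e False by (auto simp: end_domain_def)
      have "holder_bound \<gamma> (end_int m c) (2 * M) P" by (rule holder_bound_deriv[OF is_interval_end_int P(1) b(2,1) \<gamma>])
      moreover have "holder_bound \<gamma> (end_int m c) (2 * M) P1"
        by (rule holder_bound_deriv[OF is_interval_end_int P(2) holder_boundD(1)[OF b(3)] b(2) \<gamma>])
      moreover have "holder_bound \<gamma> (end_int m c) (2 * M) P2" using b(3) subset_refl by (rule holder_bound_mono) (use M in simp)
      ultimately show ?thesis using holder_bound_mono[OF _ sub order_refl] by blast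
    qed
    then show ?thesis by (intro exI[of _ 2]) auto
  qed
qed

text \<open>The derivatives are left existential, so that the property can be checked on different
  open sets near different points and then glued in \<open>twice_diff_local\<close>.\<close>

definition twice_diff :: "real set \<Rightarrow> (real \<Rightarrow> real) \<Rightarrow> bool" where
  "twice_diff N F \<longleftrightarrow> (\<exists>F1 F2. \<forall>t\<in>N. (F has_real_derivative F1 t) (at t) \<and> (F1 has_real_derivative F2 t) (at t))"

lemma twice_diff_cong: assumes "twice_diff N F" "open N" "\<And>t. t \<in> N \<Longrightarrow> F t = G t" shows "twice_diff N G"
proof -
  obtain F1 F2 where F: "\<forall>t\<in>N. (F has_real_derivative F1 t) (at t) \<and> (F1 has_real_derivative F2 t) (at t)"
    using assms(1) by (auto simp: twice_diff_def)
  have "(G has_real_derivative F1 t) (at t)" if t: "t \<in> N" for t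
    by (rule has_field_derivative_transform_within_open[OF _ assms(2) t, of F]) (use F t assms(3) in auto)
  then show ?thesis using F unfolding twice_diff_def by blast
qed

lemma twice_diff_divide: assumes "twice_diff N F" "twice_diff N G" "\<And>t. t \<in> N \<Longrightarrow> G t \<noteq> 0" shows "twice_diff N (\<lambda>t. F t / G t)"
proof -
  obtain F1 F2 where F: "\<And>t. t \<in> N \<Longrightarrow> (F has_real_derivative F1 t) (at t)" "\<And>t. t \<in> N \<Longrightarrow> (F1 has_real_derivative F2 t) (at t)"
    using assms(1) unfolding twice_diff_def by blast
  obtain G1 G2 where G: "\<And>t. t \<in> N \<Longrightarrow> (G has_real_derivative G1 t) (at t)" "\<And>t. t \<in> N \<Longrightarrow> (G1 has_real_derivative G2 t) (at t)"
    using assms(2) unfolding twice_diff_def by blast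
  define h where "h t = (F1 t * G t - F t * G1 t) / (G t * G t)" for t
  have 1: "((\<lambda>t. F t / G t) has_real_derivative h t) (at t)" if "t \<in> N" for t
    unfolding h_def using that assms(3) by (intro DERIV_divide F G)
  have "\<exists>h'. (h has_real_derivative h') (at t)" if t: "t \<in> N" for t
    unfolding h_def
    by (rule exI, rule DERIV_divide[OF DERIV_diff[OF DERIV_mult[OF F(2)[OF t] G(1)[OF t]] DERIV_mult[OF F(1)[OF t] G(2)[OF t]]]
        DERIV_mult[OF G(1)[OF t] G(1)[OF t]]]) (use t assms(3) in simp)
  then obtain h' where "\<forall>t\<in>N. (h has_real_derivative h' t) (at t)" by metis
  then show ?thesis using 1 unfolding twice_diff_def by (intro exI[of _ h] exI[of _ h']) simp
qed

lemma twice_diff_reflect: assumes "twice_diff N (\<lambda>s. F (k - s))" shows "twice_diff ((\<lambda>s. k - s) ` N) F"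
proof -
  obtain G1 G2 where G: "\<And>t. t \<in> N \<Longrightarrow> ((\<lambda>s. F (k - s)) has_real_derivative G1 t) (at t)" "\<And>t. t \<in> N \<Longrightarrow> (G1 has_real_derivative G2 t) (at t)"
    using assms unfolding twice_diff_def by blast
  have lin: "((\<lambda>s. k - s) has_real_derivative -1) (at t)" for t by (auto intro!: derivative_eq_intros)
  have "(F has_real_derivative - G1 (k - t)) (at t) \<and> ((\<lambda>t. - G1 (k - t)) has_real_derivative G2 (k - t)) (at t)"
    if "t \<in> (\<lambda>s. k - s) ` N" for t
  proof -
    have N: "k - t \<in> N" using that by auto
    have "((\<lambda>t. F (k - (k - t))) has_real_derivative G1 (k - t) * -1) (at t)"
      by (rule DERIV_chain2[of "\<lambda>s. F (k - s)", OF G(1)[OF N] lin])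
    moreover have "((\<lambda>t. G1 (k - t)) has_real_derivative G2 (k - t) * -1) (at t)" by (rule DERIV_chain2[OF G(2)[OF N] lin])
    then have "((\<lambda>t. - G1 (k - t)) has_real_derivative - (G2 (k - t) * -1)) (at t)" by (rule DERIV_minus)
    ultimately show ?thesis by simp
  qed
  then show ?thesis unfolding twice_diff_def by (intro exI[of _ "\<lambda>t. - G1 (k - t)"] exI[of _ "\<lambda>t. G2 (k - t)"]) simp
qed

lemma C2_on_imp_twice_diff: assumes C: "C2_on U F" and N: "open N" "N \<subseteq> U" shows "twice_diff N F"
proof -
  have at: "at t within U = at t" if "t \<in> N" for t using at_within_open_subset[OF that N] .
  have d: "(G has_real_derivative deriv_on U G t) (at t)" if G: "G differentiable_on U" and t: "t \<in> N" for G t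
  proof -
    have "G differentiable (at t)" using G t N at[OF t] by (metis differentiable_on_def subsetD)
    then obtain D where D: "(G has_real_derivative D) (at t)" by (auto simp: real_differentiable_def)
    then have "deriv_on U G t = D"
      unfolding deriv_on_def at[OF t] by (simp add: has_real_derivative_iff_has_vector_derivative vector_derivative_at)
    then show ?thesis using D by simp
  qed
  show ?thesis using C d unfolding twice_diff_def C2_on_def by blast
qed

text \<open>The local choices of derivatives are all given by \<open>deriv\<close>, which therefore
  works globally.\<close>

lemma twice_diff_local:
  assumes "\<And>t. t \<in> I \<Longrightarrow> \<exists>N. open N \<and> t \<in> N \<and> twice_diff N F" "t \<in> I"
  shows "(F has_real_derivative deriv F t) (at t)" "(deriv F has_real_derivative deriv (deriv F) t) (at t)"
proof -
  obtain N where N: "open N" "t \<in> N" "twice_diff N F" using assms by blast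
  obtain F1 F2 where F: "\<And>t. t \<in> N \<Longrightarrow> (F has_real_derivative F1 t) (at t)" "\<And>t. t \<in> N \<Longrightarrow> (F1 has_real_derivative F2 t) (at t)"
    using N(3) unfolding twice_diff_def by blast
  have 1: "deriv F s = F1 s" if "s \<in> N" for s using F(1)[OF that] by (rule DERIV_imp_deriv)
  show "(F has_real_derivative deriv F t) (at t)" using F(1)[OF N(2)] 1[OF N(2)] by simp
  have "(deriv F has_real_derivative F2 t) (at t)"
    by (rule has_field_derivative_transform_within_open[OF F(2)[OF N(2)] N(1,2)]) (simp add: 1)
  then show "(deriv F has_real_derivative deriv (deriv F) t) (at t)" using DERIV_imp_deriv by metis
qed

lemma end_C2_imp_C2_on: "end_C2 m nt \<gamma> c F \<Longrightarrow> C2_on (end_int m c) F"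
  by (auto simp: end_C2_def kim_C2_def quad_C2_def end_int_def split: if_splits)

context kimura_setting
begin

lemma \<psi>_deriv: assumes x: "x \<in> {0<..<1}" shows "(\<psi> has_real_derivative inverse (\<phi>1 (\<psi> x))) (at x)"
proof -
  have t: "\<psi> x \<in> I" by (rule \<psi>_I[OF x])
  have "(\<phi> has_derivative (*) (\<phi>1 (\<psi> x))) (at (\<psi> x))" using \<phi>_deriv[OF t] by (simp add: has_field_derivative_def)
  moreover have "(*) (\<phi>1 (\<psi> x)) \<circ> (*) (inverse (\<phi>1 (\<psi> x))) = id"
    using \<phi>1_pos[OF t] by (auto simp: fun_eq_iff)
  ultimately have "(\<psi> has_derivative (*) (inverse (\<phi>1 (\<psi> x)))) (at (\<phi> (\<psi> x)))"
    using has_derivative_inverse_strong[OF I_open t has_C1_continuous[OF \<phi>_C1] \<psi>_\<phi>] by blast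
  then show ?thesis by (simp add: has_field_derivative_def \<phi>_\<psi>[OF x])
qed

text \<open>Differentiating \<open>F (\<psi> x)\<close> twice with respect to \<open>x\<close>
  produces a term with \<open>\<phi>2\<close>, which is exactly the correction in
  \<open>heat_first\<close>.\<close>

lemma kimura_L_heat:
  assumes F: "\<And>t. t \<in> I \<Longrightarrow> (F has_real_derivative F1 t) (at t)" "\<And>t. t \<in> I \<Longrightarrow> (F1 has_real_derivative F2 t) (at t)"
    and f: "\<And>t. t \<in> I \<Longrightarrow> f (\<phi> t) = F t" and t: "t \<in> I"
  shows "kimura_L K f (\<phi> t) = A t * F2 t + B t * F1 t"
proof -
  have opn: "open {0<..<1::real}" by simp
  have d1: "(f has_real_derivative F1 (\<psi> x) * inverse (\<phi>1 (\<psi> x))) (at x)" if x: "x \<in> {0<..<1}" for x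
  proof (rule has_field_derivative_transform_within_open[OF _ opn x])
    show "((\<lambda>x. F (\<psi> x)) has_real_derivative F1 (\<psi> x) * inverse (\<phi>1 (\<psi> x))) (at x)"
      by (rule DERIV_chain2[OF F(1)[OF \<psi>_I[OF x]] \<psi>_deriv[OF x]])
    show "F (\<psi> y) = f y" if "y \<in> {0<..<1}" for y using f[OF \<psi>_I[OF that]] \<phi>_\<psi>[OF that] by simp
  qed
  have df: "deriv f x = F1 (\<psi> x) * inverse (\<phi>1 (\<psi> x))" if "x \<in> {0<..<1}" for x
    using d1[OF that] by (rule DERIV_imp_deriv)
  define x where "x = \<phi> t"
  have x: "x \<in> {0<..<1}" and xt: "\<psi> x = t" using \<phi>_range[OF t] \<psi>_\<phi>[OF t] by (auto simp: x_def)
  have p1: "\<phi>1 t \<noteq> 0" using \<phi>1_pos[OF t] by simp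
  have "((\<lambda>x. F1 (\<psi> x) * inverse (\<phi>1 (\<psi> x))) has_real_derivative
     F2 t * inverse (\<phi>1 t) * inverse (\<phi>1 t) + - (inverse (\<phi>1 t) * (\<phi>2 t * inverse (\<phi>1 t)) * inverse (\<phi>1 t)) * F1 t) (at x)"
  proof -
    have a: "((\<lambda>x. F1 (\<psi> x)) has_real_derivative F2 (\<psi> x) * inverse (\<phi>1 (\<psi> x))) (at x)"
      by (rule DERIV_chain2[OF F(2)[OF \<psi>_I[OF x]] \<psi>_deriv[OF x]])
    have b: "((\<lambda>x. \<phi>1 (\<psi> x)) has_real_derivative \<phi>2 (\<psi> x) * inverse (\<phi>1 (\<psi> x))) (at x)"
      by (rule DERIV_chain2[OF \<phi>1_deriv[OF \<psi>_I[OF x]] \<psi>_deriv[OF x]])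
    show ?thesis using DERIV_mult[OF a DERIV_inverse'[OF b]] p1 by (simp add: xt)
  qed
  then have "(deriv f has_real_derivative
     F2 t * inverse (\<phi>1 t) * inverse (\<phi>1 t) + - (inverse (\<phi>1 t) * (\<phi>2 t * inverse (\<phi>1 t)) * inverse (\<phi>1 t)) * F1 t) (at x)"
    by (rule has_field_derivative_transform_within_open[OF _ opn x]) (simp add: df)
  then have d2: "deriv (deriv f) x = F2 t * inverse (\<phi>1 t) * inverse (\<phi>1 t) + - (inverse (\<phi>1 t) * (\<phi>2 t * inverse (\<phi>1 t)) * inverse (\<phi>1 t)) * F1 t"
    by (rule DERIV_imp_deriv)
  have "kimura_L K f x = p x * deriv (deriv f) x + q x * deriv f x" using x by (simp add: kimura_L_def p_def q_def)
  also have "\<dots> = A t * F2 t + B t * F1 t"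
    unfolding d2 df[OF x] A_eq B_eq xt x_def[symmetric] using p1
    by (simp add: field_simps power2_eq_square power3_eq_cube)
  finally show ?thesis by (simp add: x_def)
qed

text \<open>Left of \<open>cL\<close> and right of \<open>cR\<close> only one function of the partition of unity is nonzero, and \<open>A\<close> has
  its normal form.\<close>

definition xL where "xL = min (cov_p1 P) (min (cov_q0 P) (1/3)) / 2"
definition xR where "xR = (1 + max (cov_p0 P) (max (cov_q1 P) (2/3))) / 2"
definition cL where "cL = \<psi> xL"
definition cR where "cR = \<psi> xR"
definition c0 where "c0 = \<psi> (cov_p0 P)"
definition c1 where "c1 = \<psi> (cov_p1 P)"
definition d0 where "d0 = \<psi> (cov_q0 P)"
definition d1 where "d1 = \<psi> (cov_q1 P)"

lemma cov: "cov_p0 P \<in> {0<..<1}" "cov_p1 P \<in> {0<..<1}" "cov_q0 P \<in> {0<..<1}" "cov_q1 P \<in> {0<..<1}" "xL \<in> {0<..<1}" "xR \<in> {0<..<1}"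
  "xL < cov_p0 P" "xL < cov_p1 P" "xL < cov_q0 P" "cov_q0 P < cov_q1 P" "cov_p0 P < xR" "cov_p1 P < xR" "cov_q1 P < xR" "xL \<le> 1/3" "2/3 \<le> xR" "xL < xR"
  using P unfolding partition_cover_def xL_def xR_def by (auto simp: min_def max_def)

lemma points: "cL \<in> I" "cR \<in> I" "c0 \<in> I" "c1 \<in> I" "d0 \<in> I" "d1 \<in> I"
  and point_order: "cL < c0" "c0 < cR" "cL < c1" "c1 < cR" "cL < d0" "d0 < d1" "d1 < cR" "cL < cR"
  unfolding cL_def cR_def c0_def c1_def d0_def d1_def by (intro \<psi>_I \<psi>_less cov)+

lemma \<phi>_points: "\<phi> cL = xL" "\<phi> cR = xR" "\<phi> c0 = cov_p0 P" "\<phi> c1 = cov_p1 P" "\<phi> d0 = cov_q0 P" "\<phi> d1 = cov_q1 P"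
  unfolding cL_def cR_def c0_def c1_def d0_def d1_def by (intro \<phi>_\<psi> cov)+

lemma mid_I: "{cL..cR} \<subseteq> I" using I_between points by blast

section \<open>The partition of unity in heat coordinates\<close>

definition cut where "cut \<zeta> t = \<zeta> (\<phi> t)" for \<zeta> :: "real \<Rightarrow> real"
definition cut1 where "cut1 \<zeta> = deriv (cut \<zeta>)"
definition cut2 where "cut2 \<zeta> = deriv (cut1 \<zeta>)"

lemma cut_smooth:
  assumes "smooth_on {0..1} \<zeta>"
  shows cut_deriv: "t \<in> I \<Longrightarrow> (cut \<zeta> has_real_derivative cut1 \<zeta> t) (at t)"
    and cut1_deriv: "t \<in> I \<Longrightarrow> (cut1 \<zeta> has_real_derivative cut2 \<zeta> t) (at t)"
    and cut2_C1: "has_C1 I (cut2 \<zeta>)"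
proof -
  obtain x1 x2 x3 where x: "\<And>t. t \<in> {0..1} \<Longrightarrow> (\<zeta> has_real_derivative x1 t) (at t within {0..1})"
    "\<And>t. t \<in> {0..1} \<Longrightarrow> (x1 has_real_derivative x2 t) (at t within {0..1})"
    "\<And>t. t \<in> {0..1} \<Longrightarrow> (x2 has_real_derivative x3 t) (at t within {0..1})" "continuous_on {0..1} x3"
    using smooth_on_derivs[OF assms] by metis
  have x': "(\<zeta> has_real_derivative x1 t) (at t)" "(x1 has_real_derivative x2 t) (at t)" "(x2 has_real_derivative x3 t) (at t)" if "t \<in> {0<..<1}" for t
    using x(1-3)[of t] that at_within_01[OF that] by auto
  have "continuous_on {0<..<1} x3" using x(4) by (rule continuous_on_subset) auto
  then have x2: "has_C1 {0<..<1} x2" using x'(3) by (intro has_C1I) auto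
  have x1: "has_C1 {0<..<1} x1" using x'(2) has_C1_continuous[OF x2] by (rule has_C1I)
  define g1 where "g1 t = x1 (\<phi> t) * \<phi>1 t" for t
  define g2 where "g2 t = x2 (\<phi> t) * \<phi>1 t * \<phi>1 t + \<phi>2 t * x1 (\<phi> t)" for t
  have a: "(cut \<zeta> has_real_derivative g1 t) (at t)" if "t \<in> I" for t
    unfolding cut_def[abs_def] g1_def by (rule DERIV_chain2[OF x'(1)[OF \<phi>_range[OF that]] \<phi>_deriv[OF that]])
  have b: "(g1 has_real_derivative g2 t) (at t)" if "t \<in> I" for t
    unfolding g1_def[abs_def] g2_def by (rule DERIV_mult[OF DERIV_chain2[OF x'(2)[OF \<phi>_range[OF that]] \<phi>_deriv[OF that]] \<phi>1_deriv[OF that]])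
  have g2: "has_C1 I g2" unfolding g2_def[abs_def]
    by (intro has_C1_add has_C1_mult has_C1_compose[OF x2 \<phi>_C1 \<phi>_range] has_C1_compose[OF x1 \<phi>_C1 \<phi>_range] \<phi>1_C1 \<phi>2_C1)
  have e1: "cut1 \<zeta> t = g1 t" if "t \<in> I" for t unfolding cut1_def using a[OF that] by (rule DERIV_imp_deriv)
  have a': "(cut1 \<zeta> has_real_derivative g2 t) (at t)" if "t \<in> I" for t
    by (rule has_field_derivative_transform_within_open[OF b[OF that] I_open that]) (simp add: e1)
  have e2: "cut2 \<zeta> t = g2 t" if "t \<in> I" for t unfolding cut2_def using a'[OF that] by (rule DERIV_imp_deriv)
  obtain g3 where g3: "\<And>t. t \<in> I \<Longrightarrow> (g2 has_real_derivative g3 t) (at t)" "continuous_on I g3" using has_C1E[OF g2] by blast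
  have a'': "(cut2 \<zeta> has_real_derivative g3 t) (at t)" if "t \<in> I" for t
    by (rule has_field_derivative_transform_within_open[OF g3(1)[OF that] I_open that]) (simp add: e2)
  show "t \<in> I \<Longrightarrow> (cut \<zeta> has_real_derivative cut1 \<zeta> t) (at t)" using a e1 by simp
  show "t \<in> I \<Longrightarrow> (cut1 \<zeta> has_real_derivative cut2 \<zeta> t) (at t)" using a' e2 by simp
  show "has_C1 I (cut2 \<zeta>)" using a'' g3(2) by (rule has_C1I)
qed

lemma cut1_C1: "smooth_on {0..1} \<zeta> \<Longrightarrow> has_C1 I (cut1 \<zeta>)"
  by (rule has_C1I[OF cut1_deriv]) (auto intro: has_C1_continuous cut2_C1)

lemma cut_C1: "smooth_on {0..1} \<zeta> \<Longrightarrow> has_C1 I (cut \<zeta>)"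
  by (rule has_C1I[OF cut_deriv]) (auto intro: has_C1_continuous cut1_C1)

lemma cut_const_open:
  assumes \<zeta>: "smooth_on {0..1} \<zeta>" and S: "open S" "S \<subseteq> I" and k: "\<And>t. t \<in> S \<Longrightarrow> cut \<zeta> t = k" and t: "t \<in> S"
  shows "cut1 \<zeta> t = 0" "cut2 \<zeta> t = 0"
proof -
  have z: "cut1 \<zeta> t = 0" if t: "t \<in> S" for t
  proof -
    have "(cut \<zeta> has_real_derivative 0) (at t)"
      by (rule has_field_derivative_transform_within_open[OF DERIV_const S(1) t]) (simp add: k)
    then show ?thesis unfolding cut1_def by (rule DERIV_imp_deriv)
  qed
  then show "cut1 \<zeta> t = 0" using t by blast
  have "(cut1 \<zeta> has_real_derivative 0) (at t)"
    by (rule has_field_derivative_transform_within_open[OF DERIV_const S(1) t]) (simp add: z)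
  then show "cut2 \<zeta> t = 0" unfolding cut2_def by (rule DERIV_imp_deriv)
qed

lemma zero_right_closure:
  assumes f: "continuous_on I f" and z: "\<And>t. t \<in> I \<Longrightarrow> c < t \<Longrightarrow> f t = 0" and c: "c \<in> I" "d \<in> I" "c < d"
  shows "f c = (0::real)"
proof (rule tendsto_unique[of "at_right c"])
  have "isCont f c" using f I_open c by (simp add: continuous_on_eq_continuous_at)
  then show "(f \<longlongrightarrow> f c) (at_right c)" by (simp add: isCont_def filterlim_at_split)
  have "\<forall>\<^sub>F t in at_right c. f t = 0"
  proof -
    have "f s = 0" if "c < s" "s < d" for s using z[of s] subsetD[OF I_between[OF c(1,2)], of s] that by simp
    then show ?thesis using c(3) by (auto simp: eventually_at_right_field intro!: exI[of _ d])
  qed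
  then show "(f \<longlongrightarrow> 0) (at_right c)" by (rule tendsto_eventually)
qed simp

lemma zero_left_closure:
  assumes f: "continuous_on I f" and z: "\<And>t. t \<in> I \<Longrightarrow> t < c \<Longrightarrow> f t = 0" and c: "c \<in> I" "d \<in> I" "d < c"
  shows "f c = (0::real)"
proof (rule tendsto_unique[of "at_left c"])
  have "isCont f c" using f I_open c by (simp add: continuous_on_eq_continuous_at)
  then show "(f \<longlongrightarrow> f c) (at_left c)" by (simp add: isCont_def filterlim_at_split)
  have "\<forall>\<^sub>F t in at_left c. f t = 0"
  proof -
    have "f s = 0" if "d < s" "s < c" for s using z[of s] subsetD[OF I_between[OF c(2,1)], of s] that by simp
    then show ?thesis using c(3) by (auto simp: eventually_at_left_field intro!: exI[of _ d])
  qed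
  then show "(f \<longlongrightarrow> 0) (at_left c)" by (rule tendsto_eventually)
qed simp

text \<open>On the open set beyond \<open>c\<close> the cut-off is constant, so its derivatives
  vanish too; continuity extends this to \<open>c\<close> itself. The point \<open>cR\<close>
  guarantees that the open set reaches \<open>c\<close> from the right.\<close>

lemma cut_zero_right:
  assumes \<zeta>: "smooth_on {0..1} \<zeta>" and z: "\<And>x. x \<in> {0..1} \<Longrightarrow> \<phi> c < x \<Longrightarrow> \<zeta> x = 0" and c: "c \<in> I" "c < cR" and t: "t \<in> I" "c \<le> t"
  shows "cut \<zeta> t = 0" "cut1 \<zeta> t = 0" "cut2 \<zeta> t = 0"
proof -
  define S where "S = I \<inter> {c<..}"
  have S: "open S" "S \<subseteq> I" using I_open by (auto simp: S_def)
  have z0: "cut \<zeta> s = 0" if "s \<in> S" for s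
    using that \<phi>_less[OF c(1)] \<phi>_range[of s] z[of "\<phi> s"] by (auto simp: S_def cut_def)
  have z12: "cut1 \<zeta> s = 0" "cut2 \<zeta> s = 0" if "s \<in> S" for s using cut_const_open[OF \<zeta> S z0 that] by auto
  have in_S: "s \<in> S" if "s \<in> I" "c < s" for s using that by (simp add: S_def)
  have "cut \<zeta> c = 0"
    by (rule zero_right_closure[OF has_C1_continuous[OF cut_C1[OF \<zeta>]] z0[OF in_S] c(1) points(2) c(2)])
  moreover have "cut1 \<zeta> c = 0"
    by (rule zero_right_closure[OF has_C1_continuous[OF cut1_C1[OF \<zeta>]] z12(1)[OF in_S] c(1) points(2) c(2)])
  moreover have "cut2 \<zeta> c = 0"
    by (rule zero_right_closure[OF has_C1_continuous[OF cut2_C1[OF \<zeta>]] z12(2)[OF in_S] c(1) points(2) c(2)])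
  moreover have "t = c \<or> t \<in> S" using t by (auto simp: S_def)
  ultimately show "cut \<zeta> t = 0" "cut1 \<zeta> t = 0" "cut2 \<zeta> t = 0" using z0 z12 by auto
qed

lemma cut_zero_left:
  assumes \<zeta>: "smooth_on {0..1} \<zeta>" and z: "\<And>x. x \<in> {0..1} \<Longrightarrow> x < \<phi> c \<Longrightarrow> \<zeta> x = 0" and c: "c \<in> I" "cL < c" and t: "t \<in> I" "t \<le> c"
  shows "cut \<zeta> t = 0" "cut1 \<zeta> t = 0" "cut2 \<zeta> t = 0"
proof -
  define S where "S = I \<inter> {..<c}"
  have S: "open S" "S \<subseteq> I" using I_open by (auto simp: S_def)
  have z0: "cut \<zeta> s = 0" if "s \<in> S" for s
    using that \<phi>_less[OF _ c(1)] \<phi>_range[of s] z[of "\<phi> s"] by (auto simp: S_def cut_def)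
  have z12: "cut1 \<zeta> s = 0" "cut2 \<zeta> s = 0" if "s \<in> S" for s using cut_const_open[OF \<zeta> S z0 that] by auto
  have in_S: "s \<in> S" if "s \<in> I" "s < c" for s using that by (simp add: S_def)
  have "cut \<zeta> c = 0"
    by (rule zero_left_closure[OF has_C1_continuous[OF cut_C1[OF \<zeta>]] z0[OF in_S] c(1) points(1) c(2)])
  moreover have "cut1 \<zeta> c = 0"
    by (rule zero_left_closure[OF has_C1_continuous[OF cut1_C1[OF \<zeta>]] z12(1)[OF in_S] c(1) points(1) c(2)])
  moreover have "cut2 \<zeta> c = 0"
    by (rule zero_left_closure[OF has_C1_continuous[OF cut2_C1[OF \<zeta>]] z12(2)[OF in_S] c(1) points(1) c(2)])
  moreover have "t = c \<or> t \<in> S" using t by (auto simp: S_def)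
  ultimately show "cut \<zeta> t = 0" "cut1 \<zeta> t = 0" "cut2 \<zeta> t = 0" using z0 z12 by auto
qed

abbreviation "\<zeta>0 \<equiv> chi0 P"
abbreviation "\<zeta>1 \<equiv> chi1 P"
abbreviation "\<zeta>2 \<equiv> chi2 P"

lemma chi_smooth: "smooth_on {0..1} \<zeta>0" "smooth_on {0..1} \<zeta>1" "smooth_on {0..1} \<zeta>2"
  using P by (auto simp: partition_cover_def)

lemma chi_supp: "x \<in> {0..1} \<Longrightarrow> cov_p0 P < x \<Longrightarrow> \<zeta>0 x = 0" "x \<in> {0..1} \<Longrightarrow> x < cov_p1 P \<Longrightarrow> \<zeta>1 x = 0"
  "x \<in> {0..1} \<Longrightarrow> x < cov_q0 P \<Longrightarrow> \<zeta>2 x = 0" "x \<in> {0..1} \<Longrightarrow> cov_q1 P < x \<Longrightarrow> \<zeta>2 x = 0"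
  using P by (auto simp: partition_cover_def)

lemma chi_sum: "x \<in> {0..1} \<Longrightarrow> \<zeta>0 x + \<zeta>1 x + \<zeta>2 x = 1" "x \<in> {0..1} \<Longrightarrow> 0 \<le> \<zeta>0 x \<and> 0 \<le> \<zeta>1 x \<and> 0 \<le> \<zeta>2 x"
  using P by (auto simp: partition_cover_def)

lemma cut0_zero: "t \<in> I \<Longrightarrow> c0 \<le> t \<Longrightarrow> cut \<zeta>0 t = 0 \<and> cut1 \<zeta>0 t = 0 \<and> cut2 \<zeta>0 t = 0"
  using cut_zero_right[OF chi_smooth(1) _ points(3) point_order(2)] chi_supp(1) by (simp add: \<phi>_points)

lemma cut1_zero: "t \<in> I \<Longrightarrow> t \<le> c1 \<Longrightarrow> cut \<zeta>1 t = 0 \<and> cut1 \<zeta>1 t = 0 \<and> cut2 \<zeta>1 t = 0"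
  using cut_zero_left[OF chi_smooth(2) _ points(4) point_order(3)] chi_supp(2) by (simp add: \<phi>_points)

lemma cut2_zero: "t \<in> I \<Longrightarrow> t \<le> d0 \<or> d1 \<le> t \<Longrightarrow> cut \<zeta>2 t = 0 \<and> cut1 \<zeta>2 t = 0 \<and> cut2 \<zeta>2 t = 0"
  using cut_zero_left[OF chi_smooth(3) _ points(5) point_order(5)] chi_supp(3)
    cut_zero_right[OF chi_smooth(3) _ points(6) point_order(7)] chi_supp(4) by (auto simp: \<phi>_points)

lemma cut_sum:
  assumes t: "t \<in> I"
  shows "cut \<zeta>0 t + cut \<zeta>1 t + cut \<zeta>2 t = 1" "cut1 \<zeta>0 t + cut1 \<zeta>1 t + cut1 \<zeta>2 t = 0" "cut2 \<zeta>0 t + cut2 \<zeta>1 t + cut2 \<zeta>2 t = 0"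
proof -
  have 0: "cut \<zeta>0 t + cut \<zeta>1 t + cut \<zeta>2 t = 1" if "t \<in> I" for t
    using chi_sum(1)[of "\<phi> t"] \<phi>_range[OF that] by (simp add: cut_def)
  have 1: "cut1 \<zeta>0 t + cut1 \<zeta>1 t + cut1 \<zeta>2 t = 0" if t: "t \<in> I" for t
  proof (rule DERIV_unique)
    show "((\<lambda>t. cut \<zeta>0 t + cut \<zeta>1 t + cut \<zeta>2 t) has_real_derivative cut1 \<zeta>0 t + cut1 \<zeta>1 t + cut1 \<zeta>2 t) (at t)"
      by (intro DERIV_add cut_deriv chi_smooth t)
    show "((\<lambda>t. cut \<zeta>0 t + cut \<zeta>1 t + cut \<zeta>2 t) has_real_derivative 0) (at t)"
      by (rule has_field_derivative_transform_within_open[OF DERIV_const[of 1] I_open t]) (simp add: 0)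
  qed
  have 2: "cut2 \<zeta>0 t + cut2 \<zeta>1 t + cut2 \<zeta>2 t = 0" if t: "t \<in> I" for t
  proof (rule DERIV_unique)
    show "((\<lambda>t. cut1 \<zeta>0 t + cut1 \<zeta>1 t + cut1 \<zeta>2 t) has_real_derivative cut2 \<zeta>0 t + cut2 \<zeta>1 t + cut2 \<zeta>2 t) (at t)"
      by (intro DERIV_add cut1_deriv chi_smooth t)
    show "((\<lambda>t. cut1 \<zeta>0 t + cut1 \<zeta>1 t + cut1 \<zeta>2 t) has_real_derivative 0) (at t)"
      by (rule has_field_derivative_transform_within_open[OF DERIV_const[of 0] I_open t]) (simp add: 1)
  qed
  show "cut \<zeta>0 t + cut \<zeta>1 t + cut \<zeta>2 t = 1" "cut1 \<zeta>0 t + cut1 \<zeta>1 t + cut1 \<zeta>2 t = 0" "cut2 \<zeta>0 t + cut2 \<zeta>1 t + cut2 \<zeta>2 t = 0"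
    using 0 1 2 t by auto
qed

lemma cut_one_left: "t \<in> I \<Longrightarrow> t \<le> cL \<Longrightarrow> cut \<zeta>0 t = 1 \<and> cut1 \<zeta>0 t = 0 \<and> cut2 \<zeta>0 t = 0"
  using cut_sum[of t] cut1_zero[of t] cut2_zero[of t] point_order by simp

lemma cut_one_right: "t \<in> I \<Longrightarrow> cR \<le> t \<Longrightarrow> cut \<zeta>1 t = 1 \<and> cut1 \<zeta>1 t = 0 \<and> cut2 \<zeta>1 t = 0"
  using cut_sum[of t] cut0_zero[of t] cut2_zero[of t] point_order by simp

text \<open>The inequalities are strict, so that some neighbourhood of \<open>t\<close> lies inside
  the piece on which the product with that cut-off is known to be regular.\<close>

lemma cut_pos:
  assumes t: "t \<in> I"
  shows "(t < c0 \<and> 0 < cut \<zeta>0 t) \<or> (c1 < t \<and> 0 < cut \<zeta>1 t) \<or> (d0 < t \<and> t < d1 \<and> 0 < cut \<zeta>2 t)"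
proof -
  have "0 \<le> cut \<zeta>0 t" "0 \<le> cut \<zeta>1 t" "0 \<le> cut \<zeta>2 t" using chi_sum(2)[of "\<phi> t"] \<phi>_range[OF t] by (auto simp: cut_def)
  then have "0 < cut \<zeta>0 t \<or> 0 < cut \<zeta>1 t \<or> 0 < cut \<zeta>2 t" using cut_sum(1)[OF t] by linarith
  then show ?thesis using cut0_zero[OF t] cut1_zero[OF t] cut2_zero[OF t] by (metis less_irrefl not_le)
qed

lemma loc_eq: "loc H \<zeta> f t = cut \<zeta> t * f (\<phi> t)" by (simp add: loc_def cut_def)
lemma loc_refl_eq: "loc_refl K H \<zeta> f s = cut \<zeta> (e - s) * f (\<phi> (e - s))" by (simp add: loc_refl_def loc_eq refl_pt_eq)
lemma mid_eq: "mid_interval K H P = {d0..d1}" by (simp add: mid_interval_def d0_def d1_def)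

definition target_bound :: "real \<Rightarrow> (real \<Rightarrow> real) \<Rightarrow> bool" where
  "target_bound M g \<longleftrightarrow> end_target m0 (neutral0 K) \<gamma> cL M g \<and> end_target m1 (neutral1 K) \<gamma> (e - cR) M (\<lambda>s. g (e - s))
     \<and> holder_bound \<gamma> {cL..cR} M g"

text \<open>The corresponding description of the domain. The derivatives are carried as separate
  functions; under the reflection at the right end the first one changes sign.\<close>

definition domain_bound :: "real \<Rightarrow> (real \<Rightarrow> real) \<Rightarrow> (real \<Rightarrow> real) \<Rightarrow> (real \<Rightarrow> real) \<Rightarrow> bool" where
  "domain_bound M F F1 F2 \<longleftrightarrow>
     (\<forall>t\<in>I. (F has_real_derivative F1 t) (at t) \<and> (F1 has_real_derivative F2 t) (at t)) \<and>
     end_domain m0 \<gamma> cL M F F1 F2 \<and> end_domain m1 \<gamma> (e - cR) M (\<lambda>s. F (e - s)) (\<lambda>s. - F1 (e - s)) (\<lambda>s. F2 (e - s)) \<and>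
     holder_bound \<gamma> {cL..cR} M F \<and> holder_bound \<gamma> {cL..cR} M F1 \<and> holder_bound \<gamma> {cL..cR} M F2"

lemma end_points:
  shows cL_mem: "cL \<in> end_int m0 c0" and cR_mem: "e - cR \<in> end_int m1 (e - c1)"
  using left_pos[OF points(1)] right_pos[OF points(2)] point_order by (auto simp: end_int_def)

lemma end_pos: "m0 = 1 \<Longrightarrow> 0 < cL" "m0 = 1 \<Longrightarrow> 0 < c0" "m1 = 1 \<Longrightarrow> 0 < e - cR" "m1 = 1 \<Longrightarrow> 0 < e - c1"
  using left_pos points right_pos by auto

section \<open>Norms with the partition of unity against bounds without it\<close>

lemma cut_holder:
  assumes "smooth_on {0..1} \<zeta>" "{a..b} \<subseteq> I"
  shows "\<exists>L\<ge>0. holder_bound \<gamma> {a..b} L (cut \<zeta>) \<and> holder_bound \<gamma> {a..b} L (cut1 \<zeta>) \<and> holder_bound \<gamma> {a..b} L (cut2 \<zeta>)"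
proof -
  have g1: "\<gamma> \<le> 1" using \<gamma> by simp
  obtain L0 where L0: "0 \<le> L0" "holder_bound \<gamma> {a..b} L0 (cut \<zeta>)" using has_C1_holder_compact[OF cut_C1[OF assms(1)] assms(2) \<gamma>(1) g1] by blast
  obtain L1 where L1: "0 \<le> L1" "holder_bound \<gamma> {a..b} L1 (cut1 \<zeta>)" using has_C1_holder_compact[OF cut1_C1[OF assms(1)] assms(2) \<gamma>(1) g1] by blast
  obtain L2 where L2: "0 \<le> L2" "holder_bound \<gamma> {a..b} L2 (cut2 \<zeta>)" using has_C1_holder_compact[OF cut2_C1[OF assms(1)] assms(2) \<gamma>(1) g1] by blast
  show ?thesis
    using holder_bound_mono[OF L0(2) subset_refl, of "L0 + L1 + L2"] holder_bound_mono[OF L1(2) subset_refl, of "L0 + L1 + L2"]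
      holder_bound_mono[OF L2(2) subset_refl, of "L0 + L1 + L2"] L0(1) L1(1) L2(1) by (intro exI[of _ "L0 + L1 + L2"]) simp
qed

lemma left_in_I: "z \<in> end_int m0 c0 \<Longrightarrow> z \<in> I" using left_sub[OF points(3)] by blast
lemma right_in_I: "s \<in> end_int m1 (e - c1) \<Longrightarrow> e - s \<in> I" by (rule right_sub[OF points(4)])

lemma sub_intervals: "{cL..c0} \<subseteq> {cL..cR}" "{c1..cR} \<subseteq> {cL..cR}" "{d0..d1} \<subseteq> {cL..cR}"
  using point_order by auto

lemma sub_I: "{cL..c0} \<subseteq> I" "{c1..cR} \<subseteq> I" "{d0..d1} \<subseteq> I"
  using sub_intervals mid_I by blast+

lemma loc_funs: "loc H \<zeta> f = (\<lambda>t. cut \<zeta> t * f (\<phi> t))" "loc_refl K H \<zeta> f = (\<lambda>s. cut \<zeta> (e - s) * f (\<phi> (e - s)))"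
  by (simp_all add: fun_eq_iff loc_eq loc_refl_eq)

text \<open>The constant collects the three parts of the norm: a factor 6 at each end from
  \<open>end_target_imp_end_aD\<close>, and in the middle a 2 from the product and a 2 from the
  norm.\<close>

lemma target_imp_aD:
  "\<exists>C. \<forall>M g. 0 \<le> M \<longrightarrow> (\<forall>x. x \<notin> {0<..<1} \<longrightarrow> g x = 0) \<longrightarrow> target_bound M (\<lambda>t. g (\<phi> t)) \<longrightarrow>
     g \<in> aD_space K H P \<gamma> \<and> aD_norm K H P \<gamma> g \<le> ennreal (C * M)"
proof -
  obtain L0 where L0: "0 \<le> L0" "holder_bound \<gamma> {cL..c0} L0 (cut \<zeta>0)"
    using cut_holder[OF chi_smooth(1) sub_I(1)] by blast
  obtain L1 where L1: "0 \<le> L1" "holder_bound \<gamma> {c1..cR} L1 (cut \<zeta>1)"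
    using cut_holder[OF chi_smooth(2) sub_I(2)] by blast
  obtain L2 where L2: "0 \<le> L2" "holder_bound \<gamma> {d0..d1} L2 (cut \<zeta>2)"
    using cut_holder[OF chi_smooth(3) sub_I(3)] by blast
  have "cut \<zeta>0 z = 1" if "z \<in> end_int m0 cL" for z
    using cut_one_left[of z] left_sub[OF points(1)] end_int_le that by blast
  from cutoff_target[OF cL_mem this L0(2) \<gamma>(1), of "neutral0 K"] obtain C0 where C0: "0 \<le> C0"
    "\<forall>M g. end_target m0 (neutral0 K) \<gamma> cL M g \<longrightarrow> holder_bound \<gamma> {cL..c0} M g \<longrightarrow> end_target m0 (neutral0 K) \<gamma> c0 (C0 * M) (\<lambda>z. cut \<zeta>0 z * g z)"
    by blast
  have "cut \<zeta>1 (e - s) = 1" if "s \<in> end_int m1 (e - cR)" for s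
    using cut_one_right[of "e - s"] right_sub[OF points(2) that] end_int_le[OF that] by simp
  from cutoff_target[OF cR_mem this holder_bound_reflect[OF L1(2)] \<gamma>(1), of "neutral1 K"] obtain C1 where C1: "0 \<le> C1"
    "\<forall>M g. end_target m1 (neutral1 K) \<gamma> (e - cR) M g \<longrightarrow> holder_bound \<gamma> {e - cR..e - c1} M g \<longrightarrow> end_target m1 (neutral1 K) \<gamma> (e - c1) (C1 * M) (\<lambda>s. cut \<zeta>1 (e - s) * g s)"
    by blast
  have "g \<in> aD_space K H P \<gamma> \<and> aD_norm K H P \<gamma> g \<le> ennreal ((6 * C0 + 6 * C1 + 4 * L2) * M)"
    if M: "0 \<le> M" and g0: "\<forall>x. x \<notin> {0<..<1} \<longrightarrow> g x = 0" and t: "target_bound M (\<lambda>t. g (\<phi> t))" for M g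
  proof -
    have tL: "end_target m0 (neutral0 K) \<gamma> cL M (\<lambda>t. g (\<phi> t))" and tR: "end_target m1 (neutral1 K) \<gamma> (e - cR) M (\<lambda>s. g (\<phi> (e - s)))"
      and h: "holder_bound \<gamma> {cL..cR} M (\<lambda>t. g (\<phi> t))" using t by (auto simp: target_bound_def)
    note h' = holder_bound_mono[OF h _ order_refl]
    have 0: "end_target m0 (neutral0 K) \<gamma> c0 (C0 * M) (loc H \<zeta>0 g)" unfolding loc_funs using C0(2) tL h'[OF sub_intervals(1)] by blast
    have 1: "end_target m1 (neutral1 K) \<gamma> (e - c1) (C1 * M) (loc_refl K H \<zeta>1 g)"
      unfolding loc_funs using C1(2) tR holder_bound_reflect[OF h'[OF sub_intervals(2)], of e] by blast
    have 2: "holder_bound \<gamma> {d0..d1} (2 * L2 * M) (loc H \<zeta>2 g)" unfolding loc_funs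
      by (rule holder_bound_mult[OF L2(2) h'[OF sub_intervals(3)]])
    have nn: "0 \<le> C0 * M" "0 \<le> C1 * M" "0 \<le> 2 * L2 * M" using C0 C1 L2 M by auto
    note n0 = end_target_imp_end_aD[OF 0 nn(1) \<gamma>(1)] and n1 = end_target_imp_end_aD[OF 1 nn(2) \<gamma>(1)] and n2 = holder_bound_imp_norm_le[OF 2 nn(3)]
    have "holder_norm \<gamma> {d0..d1} (loc H \<zeta>2 g) < \<infinity>" using le_less_trans[OF n2 ennreal_less_top] by simp
    then have "g \<in> aD_space K H P \<gamma>"
      using n0 n1 g0 by (simp add: aD_space_def mid_eq refl_pt_eq c0_def c1_def)
    moreover have "aD_norm K H P \<gamma> g \<le> ennreal (6 * (C0 * M)) + ennreal (6 * (C1 * M)) + ennreal (2 * (2 * L2 * M))"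
      unfolding aD_norm_def mid_eq refl_pt_eq c0_def[symmetric] c1_def[symmetric] by (intro add_mono n0 n1 n2)
    moreover have "\<dots> = ennreal ((6 * C0 + 6 * C1 + 4 * L2) * M)"
      using nn by (simp add: ennreal_plus[symmetric] algebra_simps del: ennreal_plus)
    ultimately show ?thesis by simp
  qed
  then show ?thesis by blast
qed

lemma split_sum: "t \<in> I \<Longrightarrow> h t = cut \<zeta>0 t * h t + cut \<zeta>1 t * h t + cut \<zeta>2 t * h t"
  using cut_sum(1)[of t] by (metis distrib_right mult_1)

lemma holder_left_piece:
  assumes "holder_bound \<gamma> {cL..c0} M f" "\<And>t. t \<in> I \<Longrightarrow> c0 \<le> t \<Longrightarrow> f t = 0"
  shows "holder_bound \<gamma> {cL..cR} M f"
proof -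
  have "holder_bound \<gamma> ({cL..c0} \<union> {c0..cR}) (M + 0) f"
  proof (rule holder_bound_paste[OF assms(1) _ \<gamma>(1), of _ _ c0])
    show "holder_bound \<gamma> {c0..cR} 0 f"
    proof (rule holder_bound_zero)
      fix z assume z: "z \<in> {c0..cR}"
      then have "z \<in> I" using I_between[OF points(3,2)] by blast
      then show "f z = 0" using assms(2) z by simp
    qed simp
  qed (use point_order in auto)
  moreover have "{cL..c0} \<union> {c0..cR} = {cL..cR}" using point_order by auto
  ultimately show ?thesis by simp
qed

lemma holder_right_piece:
  assumes "holder_bound \<gamma> {c1..cR} M f" "\<And>t. t \<in> I \<Longrightarrow> t \<le> c1 \<Longrightarrow> f t = 0"
  shows "holder_bound \<gamma> {cL..cR} M f"
proof -
  have "holder_bound \<gamma> ({cL..c1} \<union> {c1..cR}) (0 + M) f"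
  proof (rule holder_bound_paste[OF _ assms(1) \<gamma>(1), of _ _ c1])
    show "holder_bound \<gamma> {cL..c1} 0 f"
    proof (rule holder_bound_zero)
      fix z assume z: "z \<in> {cL..c1}"
      then have "z \<in> I" using I_between[OF points(1,4)] by blast
      then show "f z = 0" using assms(2) z by simp
    qed simp
  qed (use point_order in auto)
  moreover have "{cL..c1} \<union> {c1..cR} = {cL..cR}" using point_order by auto
  ultimately show ?thesis by simp
qed

lemma holder_mid_piece:
  assumes "holder_bound \<gamma> {d0..d1} M f" "\<And>t. t \<in> I \<Longrightarrow> t \<le> d0 \<or> d1 \<le> t \<Longrightarrow> f t = 0"
  shows "holder_bound \<gamma> {cL..cR} M f"
proof (rule holder_bound_extend_zero[OF assms(1) _ \<gamma>(1)])
  show "f t = 0" if "t \<in> {cL..cR}" "t \<le> d0 \<or> d1 \<le> t" for t using assms(2)[of t] that mid_I by blast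
qed (use point_order in simp)

lemma sub_left: "{cL..c0} \<subseteq> end_int m0 c0" and sub_right: "{e - cR..e - c1} \<subseteq> end_int m1 (e - c1)"
  using end_int_Un[OF cL_mem] end_int_Un[OF cR_mem] by auto

text \<open>Near an end the cut-off is 1 and the function is its own localisation. On
  \<open>{cL..cR}\<close> it is the sum of three localisations, each continued by 0 with its own
  bound, which explains the 3.\<close>

lemma aD_imp_target:
  assumes g: "g \<in> aD_space K H P \<gamma>" and n: "aD_norm K H P \<gamma> g \<le> ennreal M" and M: "0 \<le> M"
  shows "target_bound (3 * M) (\<lambda>t. g (\<phi> t))"
proof -
  define h where "h t = g (\<phi> t)" for t
  have g': "end_aD m0 (neutral0 K) \<gamma> c0 (\<lambda>t. cut \<zeta>0 t * h t)" "end_aD m1 (neutral1 K) \<gamma> (e - c1) (\<lambda>s. cut \<zeta>1 (e - s) * h (e - s))"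
    using g unfolding aD_space_def mid_eq refl_pt_eq c0_def[symmetric] c1_def[symmetric] loc_funs h_def by auto
  have n': "end_aD_norm m0 (neutral0 K) \<gamma> c0 (\<lambda>t. cut \<zeta>0 t * h t)
     + end_aD_norm m1 (neutral1 K) \<gamma> (e - c1) (\<lambda>s. cut \<zeta>1 (e - s) * h (e - s))
     + holder_norm \<gamma> {d0..d1} (\<lambda>t. cut \<zeta>2 t * h t) \<le> ennreal M"
    using n unfolding aD_norm_def mid_eq refl_pt_eq c0_def[symmetric] c1_def[symmetric] loc_funs h_def .
  have n0: "end_aD_norm m0 (neutral0 K) \<gamma> c0 (\<lambda>t. cut \<zeta>0 t * h t) \<le> ennreal M"
    and n1: "end_aD_norm m1 (neutral1 K) \<gamma> (e - c1) (\<lambda>s. cut \<zeta>1 (e - s) * h (e - s)) \<le> ennreal M"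
    and n2: "holder_norm \<gamma> {d0..d1} (\<lambda>t. cut \<zeta>2 t * h t) \<le> ennreal M"
    by (rule order_trans[OF _ n'], simp add: add_increasing add_increasing2)+
  have t0: "end_target m0 (neutral0 K) \<gamma> c0 M (\<lambda>t. cut \<zeta>0 t * h t)" using end_aD_imp_end_target[OF g'(1) n0 M] end_pos by blast
  have t1: "end_target m1 (neutral1 K) \<gamma> (e - c1) M (\<lambda>s. cut \<zeta>1 (e - s) * h (e - s))" using end_aD_imp_end_target[OF g'(2) n1 M] end_pos by blast
  have le: "cL \<le> c0" "e - cR \<le> e - c1" "M \<le> 3 * M" using point_order M by auto
  have "end_target m0 (neutral0 K) \<gamma> cL (3 * M) h"
  proof (rule end_target_cong[OF end_target_mono[OF t0 le(1,3)] end_pos(1)])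
    fix z assume "z \<in> end_int m0 cL"
    then show "cut \<zeta>0 z * h z = h z" using cut_one_left[of z] left_sub[OF points(1)] end_int_le[of z m0 cL] by auto
  qed
  moreover have "end_target m1 (neutral1 K) \<gamma> (e - cR) (3 * M) (\<lambda>s. h (e - s))"
  proof (rule end_target_cong[OF end_target_mono[OF t1 le(2,3)] end_pos(3)])
    fix s assume s: "s \<in> end_int m1 (e - cR)"
    then show "cut \<zeta>1 (e - s) * h (e - s) = h (e - s)" using cut_one_right[of "e - s"] right_sub[OF points(2) s] end_int_le[OF s] by auto
  qed
  moreover have "holder_bound \<gamma> {cL..cR} (3 * M) h"
  proof -
    have "holder_bound \<gamma> {cL..c0} M (\<lambda>t. cut \<zeta>0 t * h t)"
      using t0 holder_bound_mono[OF _ sub_left order_refl] by (simp add: end_target_def)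
    then have 0: "holder_bound \<gamma> {cL..cR} M (\<lambda>t. cut \<zeta>0 t * h t)" by (rule holder_left_piece) (simp add: cut0_zero)
    have "holder_bound \<gamma> {e - cR..e - c1} M (\<lambda>s. cut \<zeta>1 (e - s) * h (e - s))"
      using t1 holder_bound_mono[OF _ sub_right order_refl] by (simp add: end_target_def)
    from holder_bound_reflect[OF this, of e] have "holder_bound \<gamma> {c1..cR} M (\<lambda>t. cut \<zeta>1 t * h t)" by simp
    then have 1: "holder_bound \<gamma> {cL..cR} M (\<lambda>t. cut \<zeta>1 t * h t)" by (rule holder_right_piece) (simp add: cut1_zero)
    have 2: "holder_bound \<gamma> {cL..cR} M (\<lambda>t. cut \<zeta>2 t * h t)"
      by (rule holder_mid_piece[OF holder_norm_le_imp_bound[OF n2 M]]) (simp add: cut2_zero)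
    have "holder_bound \<gamma> {cL..cR} (M + M + M) (\<lambda>t. cut \<zeta>0 t * h t + cut \<zeta>1 t * h t + cut \<zeta>2 t * h t)"
      by (intro holder_bound_add 0 1 2)
    then have "holder_bound \<gamma> {cL..cR} (M + M + M) h"
      by (subst holder_bound_cong[where g = "\<lambda>t. cut \<zeta>0 t * h t + cut \<zeta>1 t * h t + cut \<zeta>2 t * h t"]) (use split_sum mid_I in auto)
    then show ?thesis by (simp add: mult.commute[of 3])
  qed
  ultimately show ?thesis unfolding target_bound_def h_def[symmetric] by blast
qed

definition prod1 where "prod1 \<zeta> F F1 t = cut1 \<zeta> t * F t + cut \<zeta> t * F1 t"
definition prod2 where "prod2 \<zeta> F F1 F2 t = cut2 \<zeta> t * F t + 2 * (cut1 \<zeta> t * F1 t) + cut \<zeta> t * F2 t"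

lemma cut_prod_deriv:
  assumes \<zeta>: "smooth_on {0..1} \<zeta>" and F: "(F has_real_derivative F1 t) (at t)" "(F1 has_real_derivative F2 t) (at t)" and t: "t \<in> I"
  shows "((\<lambda>t. cut \<zeta> t * F t) has_real_derivative prod1 \<zeta> F F1 t) (at t)" "(prod1 \<zeta> F F1 has_real_derivative prod2 \<zeta> F F1 F2 t) (at t)"
  unfolding prod1_def[abs_def] prod2_def using F cut_deriv[OF \<zeta> t] cut1_deriv[OF \<zeta> t]
  by (auto intro!: derivative_eq_intros)

lemma reflect_deriv:
  assumes "(F has_real_derivative D) (at (e - s))" shows "((\<lambda>s. F (e - s)) has_real_derivative - D) (at s within S)"
proof -
  have "((\<lambda>s. e - s) has_real_derivative -1) (at s)" by (auto intro!: derivative_eq_intros)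
  from DERIV_chain2[OF assms this] show ?thesis by (simp add: has_field_derivative_at_within)
qed

lemma domain_imp_C2:
  assumes d: "domain_bound M (\<lambda>t. f (\<phi> t)) F1 F2" and f0: "\<And>x. x \<notin> {0<..<1} \<Longrightarrow> f x = 0"
  shows "f \<in> C2_space K H P \<gamma>"
proof -
  define F where "F t = f (\<phi> t)" for t
  have g1: "\<gamma> \<le> 1" using \<gamma> by simp
  have F: "\<And>t. t \<in> I \<Longrightarrow> (F has_real_derivative F1 t) (at t)" "\<And>t. t \<in> I \<Longrightarrow> (F1 has_real_derivative F2 t) (at t)"
    and dL: "end_domain m0 \<gamma> cL M F F1 F2" and dR: "end_domain m1 \<gamma> (e - cR) M (\<lambda>s. F (e - s)) (\<lambda>s. - F1 (e - s)) (\<lambda>s. F2 (e - s))"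
    and h: "holder_bound \<gamma> {cL..cR} M F" "holder_bound \<gamma> {cL..cR} M F1" "holder_bound \<gamma> {cL..cR} M F2"
    using d unfolding domain_bound_def F_def by auto
  obtain L0 where L0: "holder_bound \<gamma> {cL..c0} L0 (cut \<zeta>0)" "holder_bound \<gamma> {cL..c0} L0 (cut1 \<zeta>0)" "holder_bound \<gamma> {cL..c0} L0 (cut2 \<zeta>0)"
    using cut_holder[OF chi_smooth(1) sub_I(1)] by blast
  obtain L1 where L1: "holder_bound \<gamma> {c1..cR} L1 (cut \<zeta>1)" "holder_bound \<gamma> {c1..cR} L1 (cut1 \<zeta>1)" "holder_bound \<gamma> {c1..cR} L1 (cut2 \<zeta>1)"
    using cut_holder[OF chi_smooth(2) sub_I(2)] by blast
  obtain L2 where L2: "holder_bound \<gamma> {d0..d1} L2 (cut \<zeta>2)" "holder_bound \<gamma> {d0..d1} L2 (cut1 \<zeta>2)" "holder_bound \<gamma> {d0..d1} L2 (cut2 \<zeta>2)"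
    using cut_holder[OF chi_smooth(3) sub_I(3)] by blast
  note h0 = h[THEN holder_bound_mono, OF sub_intervals(1) order_refl]
  note h1 = h[THEN holder_bound_mono, OF sub_intervals(2) order_refl]
  note h2 = h[THEN holder_bound_mono, OF sub_intervals(3) order_refl]
  have "cut \<zeta>0 z = 1 \<and> cut1 \<zeta>0 z = 0 \<and> cut2 \<zeta>0 z = 0" if "z \<in> end_int m0 cL" for z
    using cut_one_left[of z] left_sub[OF points(1)] end_int_le that by blast
  from cutoff_domain[OF cL_mem this L0 \<gamma>(1) g1 dL h0] obtain M0 where
    M0: "end_domain m0 \<gamma> c0 M0 (\<lambda>z. cut \<zeta>0 z * F z) (prod1 \<zeta>0 F F1) (prod2 \<zeta>0 F F1 F2)"
    unfolding prod1_def[abs_def] prod2_def[abs_def] by blast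
  have 0: "end_C2 m0 (neutral0 K) \<gamma> c0 (\<lambda>z. cut \<zeta>0 z * F z)"
  proof (rule end_domain_imp_end_C2[OF M0 \<gamma>(1) end_pos(2)])
    fix z assume "z \<in> end_int m0 c0"
    then have z: "z \<in> I" by (rule left_in_I)
    show "((\<lambda>z. cut \<zeta>0 z * F z) has_real_derivative prod1 \<zeta>0 F F1 z) (at z within end_int m0 c0)"
      "(prod1 \<zeta>0 F F1 has_real_derivative prod2 \<zeta>0 F F1 F2 z) (at z within end_int m0 c0)"
      by (rule has_field_derivative_at_within, rule cut_prod_deriv[of \<zeta>0 F F1 z F2, OF chi_smooth(1) F(1)[OF z] F(2)[OF z] z])+
  qed
  have one: "cut \<zeta>1 (e - s) = 1 \<and> - cut1 \<zeta>1 (e - s) = 0 \<and> cut2 \<zeta>1 (e - s) = 0" if s: "s \<in> end_int m1 (e - cR)" for s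
    using cut_one_right[of "e - s"] right_sub[OF points(2) s] end_int_le[OF s] by simp
  have eqR: "(\<lambda>s. - cut1 \<zeta>1 (e - s) * F (e - s) + cut \<zeta>1 (e - s) * - F1 (e - s)) = (\<lambda>s. - prod1 \<zeta>1 F F1 (e - s))"
    "(\<lambda>s. cut2 \<zeta>1 (e - s) * F (e - s) + 2 * (- cut1 \<zeta>1 (e - s) * - F1 (e - s)) + cut \<zeta>1 (e - s) * F2 (e - s)) = (\<lambda>s. prod2 \<zeta>1 F F1 F2 (e - s))"
    by (auto simp: prod1_def prod2_def)
  obtain M1 where M1: "end_domain m1 \<gamma> (e - c1) M1 (\<lambda>s. cut \<zeta>1 (e - s) * F (e - s)) (\<lambda>s. - prod1 \<zeta>1 F F1 (e - s)) (\<lambda>s. prod2 \<zeta>1 F F1 F2 (e - s))"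
    using cutoff_domain[OF cR_mem one holder_bound_reflect[OF L1(1)] holder_bound_minus[OF holder_bound_reflect[OF L1(2)]] holder_bound_reflect[OF L1(3)] \<gamma>(1) g1
      dR holder_bound_reflect[OF h1(1)] holder_bound_minus[OF holder_bound_reflect[OF h1(2)]] holder_bound_reflect[OF h1(3)]]
    unfolding eqR by blast
  have 1: "end_C2 m1 (neutral1 K) \<gamma> (e - c1) (\<lambda>s. cut \<zeta>1 (e - s) * F (e - s))"
  proof (rule end_domain_imp_end_C2[OF M1 \<gamma>(1) end_pos(4)])
    fix s assume "s \<in> end_int m1 (e - c1)"
    then have z: "e - s \<in> I" by (rule right_in_I)
    show "((\<lambda>s. cut \<zeta>1 (e - s) * F (e - s)) has_real_derivative - prod1 \<zeta>1 F F1 (e - s)) (at s within end_int m1 (e - c1))"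
      by (rule reflect_deriv[OF cut_prod_deriv(1)[of \<zeta>1 F F1 "e - s" F2, OF chi_smooth(2) F(1)[OF z] F(2)[OF z] z]])
    show "((\<lambda>s. - prod1 \<zeta>1 F F1 (e - s)) has_real_derivative prod2 \<zeta>1 F F1 F2 (e - s)) (at s within end_int m1 (e - c1))"
      using DERIV_minus[OF reflect_deriv[OF cut_prod_deriv(2)[of \<zeta>1 F F1 "e - s" F2, OF chi_smooth(2) F(1)[OF z] F(2)[OF z] z]]] by simp
  qed
  have h2': "\<exists>N. holder_bound \<gamma> {d0..d1} N (prod2 \<zeta>2 F F1 F2)"
    unfolding prod2_def[abs_def]
    by (rule exI, rule holder_bound_add[OF holder_bound_add[OF holder_bound_mult[OF L2(3) h2(1)] holder_bound_cmult[OF holder_bound_mult[OF L2(2) h2(2)]]] holder_bound_mult[OF L2(1) h2(3)]])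
  then obtain N where N: "holder_bound \<gamma> {d0..d1} N (prod2 \<zeta>2 F F1 F2)" by blast
  have 2: "C2_on {d0..d1} (\<lambda>t. cut \<zeta>2 t * F t)" "holder2_norm \<gamma> {d0..d1} (\<lambda>t. cut \<zeta>2 t * F t) < \<infinity>"
  proof -
    have "((\<lambda>t. cut \<zeta>2 t * F t) has_real_derivative prod1 \<zeta>2 F F1 z) (at z within {d0..d1})"
      "(prod1 \<zeta>2 F F1 has_real_derivative prod2 \<zeta>2 F F1 F2 z) (at z within {d0..d1})" if "z \<in> {d0..d1}" for z
    proof -
      have z: "z \<in> I" using that mid_I sub_intervals(3) by blast
      show "((\<lambda>t. cut \<zeta>2 t * F t) has_real_derivative prod1 \<zeta>2 F F1 z) (at z within {d0..d1})"
        "(prod1 \<zeta>2 F F1 has_real_derivative prod2 \<zeta>2 F F1 F2 z) (at z within {d0..d1})"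
        by (rule has_field_derivative_at_within, rule cut_prod_deriv[of \<zeta>2 F F1 z F2, OF chi_smooth(3) F(1)[OF z] F(2)[OF z] z])+
    qed
    from holder2_normI[OF point_order(6) \<gamma>(1) this N]
    show "C2_on {d0..d1} (\<lambda>t. cut \<zeta>2 t * F t)" "holder2_norm \<gamma> {d0..d1} (\<lambda>t. cut \<zeta>2 t * F t) < \<infinity>" by auto
  qed
  show ?thesis
    using 0 1 2 f0 unfolding C2_space_def mid_eq refl_pt_eq c0_def[symmetric] c1_def[symmetric] loc_funs F_def by blast
qed

lemma cut_pos_open: "smooth_on {0..1} \<zeta> \<Longrightarrow> open {s \<in> I. 0 < cut \<zeta> s}"
  using continuous_open_preimage[OF has_C1_continuous[OF cut_C1] I_open open_greaterThan, of \<zeta> 0]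
  by (simp add: vimage_def Int_def)

text \<open>Where the cut-off is positive it can be divided out of the product.\<close>

lemma twice_diff_by_cut:
  assumes \<zeta>: "smooth_on {0..1} \<zeta>" and N: "open N" "N \<subseteq> I" "\<And>s. s \<in> N \<Longrightarrow> 0 < cut \<zeta> s" and F: "twice_diff N (\<lambda>t. cut \<zeta> t * F t)"
  shows "twice_diff N F"
proof -
  have "twice_diff N (cut \<zeta>)"
    unfolding twice_diff_def using cut_deriv[OF \<zeta>] cut1_deriv[OF \<zeta>] N(2) by blast
  with F have "twice_diff N (\<lambda>t. cut \<zeta> t * F t / cut \<zeta> t)" by (rule twice_diff_divide) (use N(3) in force)
  then show ?thesis by (rule twice_diff_cong[OF _ N(1)]) (use N(3) in force)
qed

lemma C2_space_parts:
  assumes "f \<in> C2_space K H P \<gamma>"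
  shows "end_C2 m0 (neutral0 K) \<gamma> c0 (\<lambda>t. cut \<zeta>0 t * f (\<phi> t))"
    "end_C2 m1 (neutral1 K) \<gamma> (e - c1) (\<lambda>s. cut \<zeta>1 (e - s) * f (\<phi> (e - s)))"
    "C2_on {d0..d1} (\<lambda>t. cut \<zeta>2 t * f (\<phi> t))"
  using assms unfolding C2_space_def mid_eq refl_pt_eq c0_def[symmetric] c1_def[symmetric] loc_funs by auto

text \<open>Membership in the space speaks only about products with cut-offs. At every point one of
  the cut-offs is positive, so the function itself is twice differentiable nearby.\<close>

lemma C2_space_twice_diff:
  assumes f: "f \<in> C2_space K H P \<gamma>" and t: "t \<in> I"
  shows "\<exists>N. open N \<and> t \<in> N \<and> twice_diff N (\<lambda>t. f (\<phi> t))"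
proof -
  note parts = C2_space_parts[OF f]
  consider "t < c0" "0 < cut \<zeta>0 t" | "c1 < t" "0 < cut \<zeta>1 t" | "d0 < t" "t < d1" "0 < cut \<zeta>2 t"
    using cut_pos[OF t] by blast
  then show ?thesis
  proof cases
    case 1
    define N where "N = {s \<in> I. 0 < cut \<zeta>0 s} \<inter> {..<c0}"
    have N: "open N" "N \<subseteq> I" using cut_pos_open[OF chi_smooth(1)] by (auto simp: N_def)
    have "N \<subseteq> end_int m0 c0" by (auto simp: N_def end_int_def left_pos)
    then have "twice_diff N (\<lambda>t. cut \<zeta>0 t * f (\<phi> t))" by (rule C2_on_imp_twice_diff[OF end_C2_imp_C2_on[OF parts(1)] N(1)])
    then have "twice_diff N (\<lambda>t. f (\<phi> t))" by (rule twice_diff_by_cut[OF chi_smooth(1) N, rotated]) (simp add: N_def)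
    then show ?thesis using N t 1 by (intro exI[of _ N]) (simp add: N_def)
  next
    case 2
    define N where "N = {s \<in> I. 0 < cut \<zeta>1 s} \<inter> {c1<..}"
    have N: "open N" "N \<subseteq> I" using cut_pos_open[OF chi_smooth(2)] by (auto simp: N_def)
    define N' where "N' = (\<lambda>s. e - s) -` N"
    have "open N'" unfolding N'_def by (intro open_vimage N continuous_intros)
    moreover have "N' \<subseteq> end_int m1 (e - c1)"
    proof
      fix s assume "s \<in> N'"
      then have "e - s \<in> I" "c1 < e - s" by (auto simp: N'_def N_def)
      then show "s \<in> end_int m1 (e - c1)" using right_pos[of "e - s"] by (auto simp: end_int_def)
    qed
    ultimately have "twice_diff N' (\<lambda>s. cut \<zeta>1 (e - s) * f (\<phi> (e - s)))"
      by (rule C2_on_imp_twice_diff[OF end_C2_imp_C2_on[OF parts(2)]])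
    then have "twice_diff ((\<lambda>s. e - s) ` N') (\<lambda>t. cut \<zeta>1 t * f (\<phi> t))"
      by (rule twice_diff_reflect[of N' "\<lambda>t. cut \<zeta>1 t * f (\<phi> t)" e])
    moreover have "(\<lambda>s. e - s) ` N' = N" by (auto simp: N'_def image_iff intro: bexI[of _ "e - _"])
    ultimately have "twice_diff N (\<lambda>t. cut \<zeta>1 t * f (\<phi> t))" by simp
    then have "twice_diff N (\<lambda>t. f (\<phi> t))" by (rule twice_diff_by_cut[OF chi_smooth(2) N, rotated]) (simp add: N_def)
    then show ?thesis using N t 2 by (intro exI[of _ N]) (simp add: N_def)
  next
    case 3
    define N where "N = {s \<in> I. 0 < cut \<zeta>2 s} \<inter> {d0<..<d1}"
    have N: "open N" "N \<subseteq> I" using cut_pos_open[OF chi_smooth(3)] by (auto simp: N_def)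
    have "N \<subseteq> {d0..d1}" by (auto simp: N_def)
    then have "twice_diff N (\<lambda>t. cut \<zeta>2 t * f (\<phi> t))" by (rule C2_on_imp_twice_diff[OF parts(3) N(1)])
    then have "twice_diff N (\<lambda>t. f (\<phi> t))" by (rule twice_diff_by_cut[OF chi_smooth(3) N, rotated]) (simp add: N_def)
    then show ?thesis using N t 3 by (intro exI[of _ N]) (simp add: N_def)
  qed
qed

text \<open>On \<open>{cL..cR}\<close> each function is the sum of its three localised versions,
  since the cut-offs add up to 1 and their derivatives to 0. The constants \<open>Ca\<close>,
  \<open>Cb\<close> of the end pieces and 2 of the middle piece add up to \<open>C\<close>.\<close>

lemma C2_imp_domain:
  "\<exists>C\<ge>0. \<forall>M f. 0 \<le> M \<longrightarrow> f \<in> C2_space K H P \<gamma> \<longrightarrow> C2_norm K H P \<gamma> f \<le> ennreal M \<longrightarrow>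
     domain_bound (C * M) (\<lambda>t. f (\<phi> t)) (deriv (\<lambda>t. f (\<phi> t))) (deriv (deriv (\<lambda>t. f (\<phi> t))))"
proof -
  have g1: "\<gamma> \<le> 1" using \<gamma> by simp
  obtain Ca where Ca: "1 \<le> Ca" "\<forall>M P P1 P2. end_domain m0 \<gamma> c0 M P P1 P2 \<longrightarrow>
    (\<forall>z\<in>end_int m0 c0. (P has_real_derivative P1 z) (at z within end_int m0 c0) \<and> (P1 has_real_derivative P2 z) (at z within end_int m0 c0)) \<longrightarrow>
    holder_bound \<gamma> {cL..c0} (Ca * M) P \<and> holder_bound \<gamma> {cL..c0} (Ca * M) P1 \<and> holder_bound \<gamma> {cL..c0} (Ca * M) P2"
    using end_domain_compact[OF cL_mem \<gamma>(1) g1] by blast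
  obtain Cb where Cb: "1 \<le> Cb" "\<forall>M P P1 P2. end_domain m1 \<gamma> (e - c1) M P P1 P2 \<longrightarrow>
    (\<forall>z\<in>end_int m1 (e - c1). (P has_real_derivative P1 z) (at z within end_int m1 (e - c1)) \<and> (P1 has_real_derivative P2 z) (at z within end_int m1 (e - c1))) \<longrightarrow>
    holder_bound \<gamma> {e - cR..e - c1} (Cb * M) P \<and> holder_bound \<gamma> {e - cR..e - c1} (Cb * M) P1 \<and> holder_bound \<gamma> {e - cR..e - c1} (Cb * M) P2"
    using end_domain_compact[OF cR_mem \<gamma>(1) g1] by blast
  define C where "C = Ca + Cb + 2"
  have "domain_bound (C * M) (\<lambda>t. f (\<phi> t)) (deriv (\<lambda>t. f (\<phi> t))) (deriv (deriv (\<lambda>t. f (\<phi> t))))"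
    if M: "0 \<le> M" and f: "f \<in> C2_space K H P \<gamma>" and n: "C2_norm K H P \<gamma> f \<le> ennreal M" for M f
  proof -
    define F where "F t = f (\<phi> t)" for t
    define F1 where "F1 = deriv F"
    define F2 where "F2 = deriv F1"
    have F: "(F has_real_derivative F1 t) (at t)" "(F1 has_real_derivative F2 t) (at t)" if "t \<in> I" for t
      using twice_diff_local[of I F, OF _ that] C2_space_twice_diff[OF f] unfolding F1_def F2_def F_def[abs_def] by blast+
    have n': "end_C2_norm m0 (neutral0 K) \<gamma> c0 (\<lambda>t. cut \<zeta>0 t * F t)
       + end_C2_norm m1 (neutral1 K) \<gamma> (e - c1) (\<lambda>s. cut \<zeta>1 (e - s) * F (e - s))
       + holder2_norm \<gamma> {d0..d1} (\<lambda>t. cut \<zeta>2 t * F t) \<le> ennreal M"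
      using n unfolding C2_norm_def mid_eq refl_pt_eq c0_def[symmetric] c1_def[symmetric] loc_funs F_def .
    have n0: "end_C2_norm m0 (neutral0 K) \<gamma> c0 (\<lambda>t. cut \<zeta>0 t * F t) \<le> ennreal M"
      and n1: "end_C2_norm m1 (neutral1 K) \<gamma> (e - c1) (\<lambda>s. cut \<zeta>1 (e - s) * F (e - s)) \<le> ennreal M"
      and n2: "holder2_norm \<gamma> {d0..d1} (\<lambda>t. cut \<zeta>2 t * F t) \<le> ennreal M"
      by (rule order_trans[OF _ n'], simp add: add_increasing add_increasing2)+
    note parts = C2_space_parts[OF f, folded F_def]
    have g: "((\<lambda>t. cut \<zeta> t * F t) has_real_derivative prod1 \<zeta> F F1 z) (at z)" "(prod1 \<zeta> F F1 has_real_derivative prod2 \<zeta> F F1 F2 z) (at z)"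
      if "smooth_on {0..1} \<zeta>" "z \<in> I" for \<zeta> z
      using cut_prod_deriv[of \<zeta> F F1 z F2] F that by auto
    have gL: "((\<lambda>t. cut \<zeta>0 t * F t) has_real_derivative prod1 \<zeta>0 F F1 z) (at z within end_int m0 c0)"
      "(prod1 \<zeta>0 F F1 has_real_derivative prod2 \<zeta>0 F F1 F2 z) (at z within end_int m0 c0)" if "z \<in> end_int m0 c0" for z
      by (rule has_field_derivative_at_within, rule g[OF chi_smooth(1) left_in_I[OF that]])+
    have gR: "((\<lambda>s. cut \<zeta>1 (e - s) * F (e - s)) has_real_derivative - prod1 \<zeta>1 F F1 (e - s)) (at s within end_int m1 (e - c1))"
      "((\<lambda>s. - prod1 \<zeta>1 F F1 (e - s)) has_real_derivative prod2 \<zeta>1 F F1 F2 (e - s)) (at s within end_int m1 (e - c1))" if "s \<in> end_int m1 (e - c1)" for s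
    proof -
      show "((\<lambda>s. cut \<zeta>1 (e - s) * F (e - s)) has_real_derivative - prod1 \<zeta>1 F F1 (e - s)) (at s within end_int m1 (e - c1))"
        by (rule reflect_deriv[OF g(1)[OF chi_smooth(2) right_in_I[OF that]]])
      show "((\<lambda>s. - prod1 \<zeta>1 F F1 (e - s)) has_real_derivative prod2 \<zeta>1 F F1 F2 (e - s)) (at s within end_int m1 (e - c1))"
        using DERIV_minus[OF reflect_deriv[OF g(2)[OF chi_smooth(2) right_in_I[OF that]]]] by simp
    qed
    have gM: "((\<lambda>t. cut \<zeta>2 t * F t) has_real_derivative prod1 \<zeta>2 F F1 z) (at z within {d0..d1})"
      "(prod1 \<zeta>2 F F1 has_real_derivative prod2 \<zeta>2 F F1 F2 z) (at z within {d0..d1})" if "z \<in> {d0..d1}" for z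
      by (rule has_field_derivative_at_within, rule g[OF chi_smooth(3) subsetD[OF sub_I(3) that]])+
    have e0: "end_domain m0 \<gamma> c0 M (\<lambda>t. cut \<zeta>0 t * F t) (prod1 \<zeta>0 F F1) (prod2 \<zeta>0 F F1 F2)"
      by (rule end_C2_imp_end_domain[OF parts(1) n0 M end_pos(2) gL])
    have e1: "end_domain m1 \<gamma> (e - c1) M (\<lambda>s. cut \<zeta>1 (e - s) * F (e - s)) (\<lambda>s. - prod1 \<zeta>1 F F1 (e - s)) (\<lambda>s. prod2 \<zeta>1 F F1 F2 (e - s))"
      by (rule end_C2_imp_end_domain[OF parts(2) n1 M end_pos(4) gR])
    have b2: "\<And>z. z \<in> {d0..d1} \<Longrightarrow> \<bar>cut \<zeta>2 z * F z\<bar> \<le> M" "\<And>z. z \<in> {d0..d1} \<Longrightarrow> \<bar>prod1 \<zeta>2 F F1 z\<bar> \<le> M" "holder_bound \<gamma> {d0..d1} M (prod2 \<zeta>2 F F1 F2)"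
      using holder2_norm_imp_bounds[OF n2 M point_order(6) gM] by auto
    have le: "cL \<le> c0" "e - cR \<le> e - c1" "M \<le> C * M" using point_order M Ca(1) Cb(1) by (auto simp: C_def mult_right_mono[of 1 _ M, simplified])
    have dL: "end_domain m0 \<gamma> cL (C * M) F F1 F2"
    proof (rule end_domain_cong[OF end_domain_mono[OF e0 le(1,3)] end_pos(1)])
      fix z assume z: "z \<in> end_int m0 cL"
      then have "cut \<zeta>0 z = 1 \<and> cut1 \<zeta>0 z = 0 \<and> cut2 \<zeta>0 z = 0" using cut_one_left[of z] left_sub[OF points(1)] end_int_le[OF z] by blast
      then show "cut \<zeta>0 z * F z = F z" "prod1 \<zeta>0 F F1 z = F1 z" "prod2 \<zeta>0 F F1 F2 z = F2 z" by (auto simp: prod1_def prod2_def)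
    qed
    have dR: "end_domain m1 \<gamma> (e - cR) (C * M) (\<lambda>s. F (e - s)) (\<lambda>s. - F1 (e - s)) (\<lambda>s. F2 (e - s))"
    proof (rule end_domain_cong[OF end_domain_mono[OF e1 le(2,3)] end_pos(3)])
      fix s assume s: "s \<in> end_int m1 (e - cR)"
      have "cR \<le> e - s" using end_int_le[OF s] by simp
      then have "cut \<zeta>1 (e - s) = 1 \<and> cut1 \<zeta>1 (e - s) = 0 \<and> cut2 \<zeta>1 (e - s) = 0" using cut_one_right[of "e - s"] right_sub[OF points(2) s] by blast
      then show "cut \<zeta>1 (e - s) * F (e - s) = F (e - s)" "- prod1 \<zeta>1 F F1 (e - s) = - F1 (e - s)" "prod2 \<zeta>1 F F1 F2 (e - s) = F2 (e - s)" by (auto simp: prod1_def prod2_def)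
    qed
    have "holder_bound \<gamma> {cL..c0} (Ca * M) (\<lambda>t. cut \<zeta>0 t * F t) \<and> holder_bound \<gamma> {cL..c0} (Ca * M) (prod1 \<zeta>0 F F1) \<and> holder_bound \<gamma> {cL..c0} (Ca * M) (prod2 \<zeta>0 F F1 F2)"
      using Ca(2) e0 gL by blast
    then have h0: "holder_bound \<gamma> {cL..cR} (Ca * M) (\<lambda>t. cut \<zeta>0 t * F t)" "holder_bound \<gamma> {cL..cR} (Ca * M) (prod1 \<zeta>0 F F1)" "holder_bound \<gamma> {cL..cR} (Ca * M) (prod2 \<zeta>0 F F1 F2)"
      using cut0_zero by (auto intro!: holder_left_piece simp: prod1_def prod2_def)
    have "holder_bound \<gamma> {e - cR..e - c1} (Cb * M) (\<lambda>s. cut \<zeta>1 (e - s) * F (e - s)) \<and> holder_bound \<gamma> {e - cR..e - c1} (Cb * M) (\<lambda>s. - prod1 \<zeta>1 F F1 (e - s))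
      \<and> holder_bound \<gamma> {e - cR..e - c1} (Cb * M) (\<lambda>s. prod2 \<zeta>1 F F1 F2 (e - s))"
      using Cb(2) e1 gR by blast
    then have "holder_bound \<gamma> {c1..cR} (Cb * M) (\<lambda>t. cut \<zeta>1 t * F t)" "holder_bound \<gamma> {c1..cR} (Cb * M) (prod1 \<zeta>1 F F1)" "holder_bound \<gamma> {c1..cR} (Cb * M) (prod2 \<zeta>1 F F1 F2)"
      using holder_bound_reflect[of \<gamma> "e - cR" "e - c1" "Cb * M" _ e] holder_bound_minus[OF holder_bound_reflect[of \<gamma> "e - cR" "e - c1" "Cb * M" "\<lambda>s. - prod1 \<zeta>1 F F1 (e - s)" e]] by force+
    then have h1: "holder_bound \<gamma> {cL..cR} (Cb * M) (\<lambda>t. cut \<zeta>1 t * F t)" "holder_bound \<gamma> {cL..cR} (Cb * M) (prod1 \<zeta>1 F F1)" "holder_bound \<gamma> {cL..cR} (Cb * M) (prod2 \<zeta>1 F F1 F2)"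
      using cut1_zero by (auto intro!: holder_right_piece simp: prod1_def prod2_def)
    have "holder_bound \<gamma> {d0..d1} (2 * M) (\<lambda>t. cut \<zeta>2 t * F t)" by (rule holder_bound_deriv[OF is_interval_cc gM(1) b2(2,1) \<gamma>(1) g1])
    moreover have "holder_bound \<gamma> {d0..d1} (2 * M) (prod1 \<zeta>2 F F1)" by (rule holder_bound_deriv[OF is_interval_cc gM(2) holder_boundD(1)[OF b2(3)] b2(2) \<gamma>(1) g1])
    moreover have "holder_bound \<gamma> {d0..d1} (2 * M) (prod2 \<zeta>2 F F1 F2)" by (rule holder_bound_mono[OF b2(3) subset_refl]) (use M in simp)
    ultimately have h2: "holder_bound \<gamma> {cL..cR} (2 * M) (\<lambda>t. cut \<zeta>2 t * F t)" "holder_bound \<gamma> {cL..cR} (2 * M) (prod1 \<zeta>2 F F1)" "holder_bound \<gamma> {cL..cR} (2 * M) (prod2 \<zeta>2 F F1 F2)"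
      using cut2_zero by (auto intro!: holder_mid_piece simp: prod1_def prod2_def)
    have CM: "Ca * M + Cb * M + 2 * M = C * M" by (simp add: C_def algebra_simps)
    have s: "F t = cut \<zeta>0 t * F t + cut \<zeta>1 t * F t + cut \<zeta>2 t * F t"
      "F1 t = prod1 \<zeta>0 F F1 t + prod1 \<zeta>1 F F1 t + prod1 \<zeta>2 F F1 t"
      "F2 t = prod2 \<zeta>0 F F1 F2 t + prod2 \<zeta>1 F F1 F2 t + prod2 \<zeta>2 F F1 F2 t" if t: "t \<in> {cL..cR}" for t
    proof -
      have tI: "t \<in> I" using t mid_I by blast
      note cs = cut_sum[OF tI]
      show "F t = cut \<zeta>0 t * F t + cut \<zeta>1 t * F t + cut \<zeta>2 t * F t" by (rule split_sum[OF tI])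
      have "prod1 \<zeta>0 F F1 t + prod1 \<zeta>1 F F1 t + prod1 \<zeta>2 F F1 t = (cut1 \<zeta>0 t + cut1 \<zeta>1 t + cut1 \<zeta>2 t) * F t + (cut \<zeta>0 t + cut \<zeta>1 t + cut \<zeta>2 t) * F1 t"
        by (simp add: prod1_def algebra_simps)
      then show "F1 t = prod1 \<zeta>0 F F1 t + prod1 \<zeta>1 F F1 t + prod1 \<zeta>2 F F1 t" using cs by simp
      have "prod2 \<zeta>0 F F1 F2 t + prod2 \<zeta>1 F F1 F2 t + prod2 \<zeta>2 F F1 F2 t = (cut2 \<zeta>0 t + cut2 \<zeta>1 t + cut2 \<zeta>2 t) * F t
         + 2 * ((cut1 \<zeta>0 t + cut1 \<zeta>1 t + cut1 \<zeta>2 t) * F1 t) + (cut \<zeta>0 t + cut \<zeta>1 t + cut \<zeta>2 t) * F2 t"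
        by (simp add: prod2_def algebra_simps)
      then show "F2 t = prod2 \<zeta>0 F F1 F2 t + prod2 \<zeta>1 F F1 F2 t + prod2 \<zeta>2 F F1 F2 t" using cs by simp
    qed
    have hc: "holder_bound \<gamma> {cL..cR} (C * M) u" if "holder_bound \<gamma> {cL..cR} (Ca * M + Cb * M + 2 * M) v" "\<And>t. t \<in> {cL..cR} \<Longrightarrow> u t = v t" for u v
      using that holder_bound_cong[of "{cL..cR}" u v] CM by simp
    have "holder_bound \<gamma> {cL..cR} (C * M) F"
      by (rule hc[OF holder_bound_add[OF holder_bound_add[OF h0(1) h1(1)] h2(1)] s(1)])
    moreover have "holder_bound \<gamma> {cL..cR} (C * M) F1"
      by (rule hc[OF holder_bound_add[OF holder_bound_add[OF h0(2) h1(2)] h2(2)] s(2)])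
    moreover have "holder_bound \<gamma> {cL..cR} (C * M) F2"
      by (rule hc[OF holder_bound_add[OF holder_bound_add[OF h0(3) h1(3)] h2(3)] s(3)])
    ultimately have "domain_bound (C * M) F F1 F2" using F dL dR unfolding domain_bound_def by blast
    then show ?thesis unfolding F2_def F1_def F_def[abs_def] .
  qed
  moreover have "0 \<le> C" using Ca(1) Cb(1) by (simp add: C_def)
  ultimately show ?thesis by blast
qed

text \<open>All choices are gathered in one existential statement so that they can be fixed as
  parameters of the next locale. \<open>E\<close> is the exponential of a primitive of
  \<open>B / A\<close>.\<close>

lemma ex_solver_data:
  "\<exists>KL sL KR sR E. 0 \<le> KL \<and> 0 < sL \<and> 0 \<le> KR \<and> 0 < sR \<and>
    (\<forall>t\<in>I. (E has_real_derivative E t * B t / A t) (at t) \<and> 0 < E t) \<and>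
    (\<forall>y\<in>end_int m0 cL. \<forall>z\<in>end_int m0 cL. \<bar>B y - B z\<bar> \<le> KL * \<bar>y - z\<bar>) \<and>
    (\<forall>z\<in>end_int m0 cL. \<bar>B z - bL\<bar> \<le> KL * (if m0 = 1 then z else exp (sL * z))) \<and>
    (\<forall>y\<in>end_int m1 (e - cR). \<forall>z\<in>end_int m1 (e - cR). \<bar>- B (e - y) - (- B (e - z))\<bar> \<le> KR * \<bar>y - z\<bar>) \<and>
    (\<forall>z\<in>end_int m1 (e - cR). \<bar>- B (e - z) - bR\<bar> \<le> KR * (if m1 = 1 then z else exp (sR * z)))"
proof -
  have "continuous_on I (\<lambda>t. B t / A t)"
    using A_pos by (intro continuous_intros has_C1_continuous A_C1 B_C1) force
  then obtain \<Phi> where \<Phi>: "\<And>t. t \<in> I \<Longrightarrow> (\<Phi> has_real_derivative B t / A t) (at t)" using ex_antiderivative by blast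
  define E where "E t = exp (\<Phi> t)" for t
  have E: "\<forall>t\<in>I. (E has_real_derivative E t * B t / A t) (at t) \<and> 0 < E t"
  proof
    fix t assume "t \<in> I"
    then show "(E has_real_derivative E t * B t / A t) (at t) \<and> 0 < E t"
      unfolding E_def using \<Phi>[of t] by (auto intro!: derivative_eq_intros)
  qed
  show ?thesis
    using E left_coefficient[OF points(1)] right_coefficient[OF points(2)] cov(14,15) unfolding \<phi>_points by blast
qed

end

section \<open>Global solvability\<close>

text \<open>Fixing one global \<open>E\<close> and the rates at both ends makes the two ends
  instances \<open>L\<close> and \<open>R\<close> of \<open>end_model\<close> that share the
  integrating factor.\<close>

locale kimura_solver = kimura_setting +
  fixes KL sL KR sR :: real and E :: "real \<Rightarrow> real"
  assumes rates: "0 \<le> KL" "0 < sL" "0 \<le> KR" "0 < sR"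
    and E: "t \<in> heat_domain K H \<Longrightarrow> (E has_real_derivative E t * B t / A t) (at t)" "t \<in> heat_domain K H \<Longrightarrow> 0 < E t"
    and left: "y \<in> end_int m0 cL \<Longrightarrow> z \<in> end_int m0 cL \<Longrightarrow> \<bar>B y - B z\<bar> \<le> KL * \<bar>y - z\<bar>"
      "z \<in> end_int m0 cL \<Longrightarrow> \<bar>B z - bL\<bar> \<le> KL * (if m0 = 1 then z else exp (sL * z))"
    and right: "y \<in> end_int m1 (e - cR) \<Longrightarrow> z \<in> end_int m1 (e - cR) \<Longrightarrow> \<bar>- B (e - y) - (- B (e - z))\<bar> \<le> KR * \<bar>y - z\<bar>"
      "z \<in> end_int m1 (e - cR) \<Longrightarrow> \<bar>- B (e - z) - bR\<bar> \<le> KR * (if m1 = 1 then z else exp (sR * z))"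
begin

sublocale L: end_model m0 \<gamma> cL bL KL sL A B E
proof
  show "m0 = 1 \<Longrightarrow> 0 < cL" by (rule end_pos(1))
  fix z assume z: "z \<in> end_int m0 cL"
  have zI: "z \<in> I" using left_sub[OF points(1)] z by blast
  show "A z = (if m0 = 1 then z else 1)"
    using A_left[OF zI] \<phi>_le_iff[OF zI points(1)] end_int_le[OF z] cov(14) \<phi>_points(1) by simp
  show "\<bar>B z - bL\<bar> \<le> KL * (if m0 = 1 then z else exp (sL * z))" by (rule left(2)[OF z])
  show "(E has_real_derivative E z * B z / A z) (at z within end_int m0 cL)" "0 < E z"
    using E[OF zI] by (auto simp: has_field_derivative_at_within)
qed (use \<gamma> rates left(1) bL_nonneg in auto)

text \<open>The variable \<open>s = e - t\<close> reverses the derivative, hence the sign of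
  \<open>B\<close>; \<open>E\<close> is simply transported.\<close>

sublocale R: end_model m1 \<gamma> "e - cR" bR KR sR "\<lambda>s. A (e - s)" "\<lambda>s. - B (e - s)" "\<lambda>s. E (e - s)"
proof
  show "m1 = 1 \<Longrightarrow> 0 < e - cR" by (rule end_pos(3))
  fix z assume z: "z \<in> end_int m1 (e - cR)"
  have zI: "e - z \<in> I" using right_sub[OF points(2)] z by blast
  show "A (e - z) = (if m1 = 1 then z else 1)"
    using A_right[OF zI] \<phi>_le_iff[OF points(2) zI] end_int_le[OF z] cov(15) \<phi>_points(2) by simp
  show "\<bar>- B (e - z) - bR\<bar> \<le> KR * (if m1 = 1 then z else exp (sR * z))" by (rule right(2)[OF z])
  show "((\<lambda>s. E (e - s)) has_real_derivative E (e - z) * - B (e - z) / A (e - z)) (at z within end_int m1 (e - cR))"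
    using reflect_deriv[OF E(1)[OF zI]] by simp
  show "0 < E (e - z)" by (rule E(2)[OF zI])
qed (use \<gamma> rates right(1) bR_nonneg in auto)

lemma neutral_eq: "neutral0 K = L.neutral" "neutral1 K = R.neutral"
  by (simp_all add: neutral_left neutral_right L.neutral_def R.neutral_def)

end

lemma end_target_zero: "0 \<le> M \<Longrightarrow> end_target m nt \<gamma> c M (\<lambda>_. 0)"
  unfolding end_target_def vanishing_primitive_def
  by (auto intro!: holder_bound_zero exI[of _ "\<lambda>_. 0"])

context kimura_setting
begin

lemma domain_bound_cong:
  assumes d: "domain_bound M F F1 F2" and eq: "\<And>t. t \<in> I \<Longrightarrow> F t = G t" "\<And>t. t \<in> I \<Longrightarrow> F1 t = G1 t" "\<And>t. t \<in> I \<Longrightarrow> F2 t = G2 t"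
  shows "domain_bound M G G1 G2"
proof -
  have dd: "(F has_real_derivative F1 t) (at t)" "(F1 has_real_derivative F2 t) (at t)" if "t \<in> I" for t
    using d that by (auto simp: domain_bound_def)
  have "(G has_real_derivative G1 t) (at t)" if t: "t \<in> I" for t
    unfolding eq(2)[OF t, symmetric] by (rule has_field_derivative_transform_within_open[OF dd(1)[OF t] I_open t]) (rule eq)
  moreover have "(G1 has_real_derivative G2 t) (at t)" if t: "t \<in> I" for t
    unfolding eq(3)[OF t, symmetric] by (rule has_field_derivative_transform_within_open[OF dd(2)[OF t] I_open t]) (rule eq)
  moreover have "end_domain m0 \<gamma> cL M G G1 G2"
  proof (rule end_domain_cong[of m0 \<gamma> cL M F F1 F2, OF _ end_pos(1)])
    show "end_domain m0 \<gamma> cL M F F1 F2" using d by (simp add: domain_bound_def)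
  qed (use eq left_sub[OF points(1)] in auto)
  moreover have "end_domain m1 \<gamma> (e - cR) M (\<lambda>s. G (e - s)) (\<lambda>s. - G1 (e - s)) (\<lambda>s. G2 (e - s))"
  proof (rule end_domain_cong[of m1 \<gamma> "e - cR" M "\<lambda>s. F (e - s)" "\<lambda>s. - F1 (e - s)" "\<lambda>s. F2 (e - s)", OF _ end_pos(3)])
    show "end_domain m1 \<gamma> (e - cR) M (\<lambda>s. F (e - s)) (\<lambda>s. - F1 (e - s)) (\<lambda>s. F2 (e - s))" using d by (simp add: domain_bound_def)
  qed (use eq right_sub[OF points(2)] in auto)
  moreover have "holder_bound \<gamma> {cL..cR} M G" "holder_bound \<gamma> {cL..cR} M G1" "holder_bound \<gamma> {cL..cR} M G2"
    using d holder_bound_cong[of "{cL..cR}" F G, OF eq(1)[OF subsetD[OF mid_I]]] holder_bound_cong[of "{cL..cR}" F1 G1, OF eq(2)[OF subsetD[OF mid_I]]]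
      holder_bound_cong[of "{cL..cR}" F2 G2, OF eq(3)[OF subsetD[OF mid_I]]] unfolding domain_bound_def by auto
  ultimately show ?thesis unfolding domain_bound_def by blast
qed

text \<open>Pasting three adjacent pieces gives three times the constant. What is needed later is
  the continuity of \<open>g\<close> on the whole interval.\<close>

lemma target_bound_holder:
  assumes "target_bound M g" shows "holder_bound \<gamma> I (M + M + M) g"
proof -
  have h: "holder_bound \<gamma> (end_int m0 cL) M g" "holder_bound \<gamma> {cL..cR} M g" "holder_bound \<gamma> (end_int m1 (e - cR)) M (\<lambda>s. g (e - s))"
    using assms by (auto simp: target_bound_def end_target_def)
  let ?R = "{t \<in> I. cR \<le> t}"
  have mem: "e - t \<in> end_int m1 (e - cR)" if "t \<in> ?R" for t
    using that right_pos[of t] by (auto simp: end_int_def)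
  have R: "holder_bound \<gamma> ?R M g"
  proof (rule holder_boundI)
    show "\<bar>g z\<bar> \<le> M" if "z \<in> ?R" for z using holder_boundD(1)[OF h(3) mem[OF that]] by simp
    show "\<bar>g y - g z\<bar> \<le> M * \<bar>y - z\<bar> powr \<gamma>" if "y \<in> ?R" "z \<in> ?R" for y z
      using holder_boundD(2)[OF h(3) mem[OF that(1)] mem[OF that(2)]] by (simp add: abs_minus_commute)
  qed
  have LM: "holder_bound \<gamma> (end_int m0 cL \<union> {cL..cR}) (M + M) g"
    by (rule holder_bound_paste[OF h(1,2) \<gamma>(1), of cL]) (use end_int_self[OF end_pos(1)] end_int_le point_order in auto)
  have "holder_bound \<gamma> ((end_int m0 cL \<union> {cL..cR}) \<union> ?R) (M + M + M) g"
    by (rule holder_bound_paste[OF LM R \<gamma>(1), of cR]) (use end_int_le[of _ m0 cL] point_order points in force)+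
  moreover have "I \<subseteq> (end_int m0 cL \<union> {cL..cR}) \<union> ?R" using left_pos by (auto simp: end_int_def)
  ultimately show ?thesis by (rule holder_bound_mono[OF _ _ order_refl])
qed

lemma target_continuous: "target_bound M g \<Longrightarrow> continuous_on I g"
  using target_bound_holder holder_bound_continuous_on \<gamma>(1) by blast

lemma target_nonneg: "target_bound M g \<Longrightarrow> 0 \<le> M"
  using holder_bound_nonneg[of \<gamma> "{cL..cR}" M g cL] point_order by (simp add: target_bound_def)

lemma const_on_I:
  assumes "\<And>t. t \<in> I \<Longrightarrow> (f has_real_derivative 0) (at t)" "s \<in> I" "t \<in> I" shows "f s = f t"
  by (rule deriv_zero_const[OF I_interval _ assms(2,3)]) (simp add: assms(1) has_field_derivative_at_within)

lemma eventually_left: "eventually (\<lambda>z. z \<in> I) (end_filter m0)"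
  using eventually_end_filter[of m0 cL, OF end_pos(1)] left_sub[OF points(1)] by (auto elim: eventually_mono)

lemma eventually_right: "eventually (\<lambda>s. e - s \<in> I) (end_filter m1)"
  using eventually_end_filter[of m1 "e - cR", OF end_pos(3)] right_sub[OF points(2)] by (auto elim: eventually_mono)

end

context kimura_solver
begin

text \<open>At the right end \<open>B\<close> and \<open>F1\<close> both change sign under the
  reflection, so the operator keeps its form.\<close>

lemma operator_bound:
  "\<exists>C\<ge>0. \<forall>M F F1 F2. 0 \<le> M \<longrightarrow> domain_bound M F F1 F2 \<longrightarrow> target_bound (C * M) (\<lambda>t. A t * F2 t + B t * F1 t)"
proof -
  have g1: "\<gamma> \<le> 1" using \<gamma> by simp
  obtain LA where LA: "0 \<le> LA" "holder_bound \<gamma> {cL..cR} LA A" using has_C1_holder_compact[OF A_C1 mid_I \<gamma>(1) g1] by blast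
  obtain LB where LB: "0 \<le> LB" "holder_bound \<gamma> {cL..cR} LB B" using has_C1_holder_compact[OF B_C1 mid_I \<gamma>(1) g1] by blast
  define C where "C = L.op_bound + R.op_bound + (2 * LA + 2 * LB)"
  have C: "L.op_bound \<le> C" "R.op_bound \<le> C" "2 * LA + 2 * LB \<le> C" "0 \<le> C"
    using L.op_bound_ge(1) R.op_bound_ge(1) LA(1) LB(1) by (auto simp: C_def)
  have "target_bound (C * M) (\<lambda>t. A t * F2 t + B t * F1 t)" if M: "0 \<le> M" and d: "domain_bound M F F1 F2" for M F F1 F2
  proof -
    have F: "\<And>t. t \<in> I \<Longrightarrow> (F has_real_derivative F1 t) (at t)" "\<And>t. t \<in> I \<Longrightarrow> (F1 has_real_derivative F2 t) (at t)"
      and dL: "end_domain m0 \<gamma> cL M F F1 F2" and dR: "end_domain m1 \<gamma> (e - cR) M (\<lambda>s. F (e - s)) (\<lambda>s. - F1 (e - s)) (\<lambda>s. F2 (e - s))"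
      and h: "holder_bound \<gamma> {cL..cR} M F1" "holder_bound \<gamma> {cL..cR} M F2"
      using d by (auto simp: domain_bound_def)
    have "end_target m0 L.neutral \<gamma> cL (L.op_bound * M) (\<lambda>t. A t * F2 t + B t * F1 t)"
    proof (rule L.operator_maps[OF dL M])
      fix z assume "z \<in> end_int m0 cL"
      then have z: "z \<in> I" using left_sub[OF points(1)] by blast
      show "(F has_real_derivative F1 z) (at z within end_int m0 cL)" "(F1 has_real_derivative F2 z) (at z within end_int m0 cL)"
        by (rule has_field_derivative_at_within, rule F[OF z])+
    qed
    then have 0: "end_target m0 (neutral0 K) \<gamma> cL (C * M) (\<lambda>t. A t * F2 t + B t * F1 t)"
      unfolding neutral_eq by (rule end_target_mono[OF _ order_refl]) (use C M in \<open>simp add: mult_right_mono\<close>)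
    have "end_target m1 R.neutral \<gamma> (e - cR) (R.op_bound * M) (\<lambda>s. A (e - s) * F2 (e - s) + - B (e - s) * - F1 (e - s))"
    proof (rule R.operator_maps[OF dR M])
      fix s assume "s \<in> end_int m1 (e - cR)"
      then have z: "e - s \<in> I" by (rule right_sub[OF points(2)])
      show "((\<lambda>s. F (e - s)) has_real_derivative - F1 (e - s)) (at s within end_int m1 (e - cR))" by (rule reflect_deriv[OF F(1)[OF z]])
      show "((\<lambda>s. - F1 (e - s)) has_real_derivative F2 (e - s)) (at s within end_int m1 (e - cR))"
        using DERIV_minus[OF reflect_deriv[OF F(2)[OF z]]] by simp
    qed
    then have 1: "end_target m1 (neutral1 K) \<gamma> (e - cR) (C * M) (\<lambda>s. A (e - s) * F2 (e - s) + B (e - s) * F1 (e - s))"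
      unfolding neutral_eq minus_mult_minus by (rule end_target_mono[OF _ order_refl]) (use C M in \<open>simp add: mult_right_mono\<close>)
    have "holder_bound \<gamma> {cL..cR} (2 * LA * M + 2 * LB * M) (\<lambda>t. A t * F2 t + B t * F1 t)"
      by (intro holder_bound_add holder_bound_mult LA LB h)
    then have 2: "holder_bound \<gamma> {cL..cR} (C * M) (\<lambda>t. A t * F2 t + B t * F1 t)"
      by (rule holder_bound_mono[OF _ subset_refl]) (use mult_right_mono[OF C(3) M] in \<open>simp add: distrib_right\<close>)
    show ?thesis using 0 1 2 by (simp add: target_bound_def)
  qed
  then show ?thesis using C(4) by blast
qed

section \<open>Primitives of \<open>E g / A\<close> and their total increment\<close>

definition primitive where "primitive g V \<longleftrightarrow> (\<forall>t\<in>I. (V has_real_derivative E t * g t / A t) (at t))"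

lemma E_cont: "continuous_on I E"
  using E(1) I_open by (auto intro!: continuous_at_imp_continuous_on DERIV_isCont)

lemma ex_primitive: assumes "continuous_on I g" obtains V where "primitive g V"
proof -
  have "continuous_on I (\<lambda>t. E t * g t / A t)"
    using A_pos by (intro continuous_intros E_cont assms has_C1_continuous[OF A_C1]) force
  then obtain V where "\<And>t. t \<in> I \<Longrightarrow> (V has_real_derivative E t * g t / A t) (at t)" using ex_antiderivative by blast
  then show ?thesis using that[of V] by (simp add: primitive_def)
qed

lemma primitive_left: "primitive g V \<Longrightarrow> z \<in> end_int m0 cL \<Longrightarrow> (V has_real_derivative E z * g z / A z) (at z within end_int m0 cL)"
  using subsetD[OF left_sub[OF points(1)]] unfolding primitive_def by (blast intro: has_field_derivative_at_within)

lemma primitive_right: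
  assumes "primitive g V" "s \<in> end_int m1 (e - cR)"
  shows "((\<lambda>s. - V (e - s)) has_real_derivative E (e - s) * g (e - s) / A (e - s)) (at s within end_int m1 (e - cR))"
proof -
  have "(V has_real_derivative E (e - s) * g (e - s) / A (e - s)) (at (e - s))"
    using assms right_sub[OF points(2)] by (auto simp: primitive_def)
  from DERIV_minus[OF reflect_deriv[OF this]] show ?thesis by simp
qed

text \<open>The value \<open>l\<close> is the integral of \<open>E g / A\<close> over the whole
  line. It is a relation because the integral is only known to converge when both ends
  reject.\<close>

definition total :: "(real \<Rightarrow> real) \<Rightarrow> real \<Rightarrow> bool" where
  "total g l \<longleftrightarrow> (\<exists>V. primitive g V \<and> (V \<longlongrightarrow> 0) (end_filter m0) \<and> ((\<lambda>s. V (e - s)) \<longlongrightarrow> l) (end_filter m1))"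

lemma total_unique: assumes "total g l" "total g l'" shows "l = l'"
proof -
  obtain V where V: "primitive g V" "(V \<longlongrightarrow> 0) (end_filter m0)" "((\<lambda>s. V (e - s)) \<longlongrightarrow> l) (end_filter m1)"
    using assms(1) by (auto simp: total_def)
  obtain Q where Q: "primitive g Q" "(Q \<longlongrightarrow> 0) (end_filter m0)" "((\<lambda>s. Q (e - s)) \<longlongrightarrow> l') (end_filter m1)"
    using assms(2) by (auto simp: total_def)
  have "((\<lambda>t. V t - Q t) has_real_derivative 0) (at t)" if "t \<in> I" for t
    using DERIV_diff[of V "E t * g t / A t" t UNIV Q "E t * g t / A t"] V(1) Q(1) that by (simp add: primitive_def)
  then have k: "V t - Q t = V cL - Q cL" if "t \<in> I" for t using const_on_I[of "\<lambda>t. V t - Q t"] that points(1) by blast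
  have "((\<lambda>t. V t - Q t) \<longlongrightarrow> 0 - 0) (end_filter m0)" by (intro tendsto_diff V Q)
  moreover have "((\<lambda>t. V t - Q t) \<longlongrightarrow> V cL - Q cL) (end_filter m0)"
    by (rule tendsto_eventually) (use eventually_left k in \<open>auto elim: eventually_mono\<close>)
  ultimately have k0: "V cL - Q cL = 0" using tendsto_unique[OF end_filter_neq_bot] by fastforce
  have "((\<lambda>s. V (e - s) - Q (e - s)) \<longlongrightarrow> l - l') (end_filter m1)" by (intro tendsto_diff V Q)
  moreover have "((\<lambda>s. V (e - s) - Q (e - s)) \<longlongrightarrow> 0) (end_filter m1)"
    by (rule tendsto_eventually) (use eventually_right k k0 in \<open>auto elim: eventually_mono\<close>)
  ultimately show ?thesis using tendsto_unique[OF end_filter_neq_bot] by fastforce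
qed

lemma total_linear: assumes "total g l" "total h k" shows "total (\<lambda>t. g t + a * h t) (l + a * k)"
proof -
  obtain V where V: "primitive g V" "(V \<longlongrightarrow> 0) (end_filter m0)" "((\<lambda>s. V (e - s)) \<longlongrightarrow> l) (end_filter m1)"
    using assms(1) by (auto simp: total_def)
  obtain Q where Q: "primitive h Q" "(Q \<longlongrightarrow> 0) (end_filter m0)" "((\<lambda>s. Q (e - s)) \<longlongrightarrow> k) (end_filter m1)"
    using assms(2) by (auto simp: total_def)
  have "((\<lambda>t. V t + a * Q t) has_real_derivative E t * (g t + a * h t) / A t) (at t)" if "t \<in> I" for t
  proof -
    have "((\<lambda>t. V t + a * Q t) has_real_derivative E t * g t / A t + a * (E t * h t / A t)) (at t)"
      using V(1) Q(1) that by (intro DERIV_add DERIV_cmult) (auto simp: primitive_def)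
    then show ?thesis by (simp add: add_divide_distrib distrib_left mult.left_commute)
  qed
  moreover have "((\<lambda>t. V t + a * Q t) \<longlongrightarrow> 0 + a * 0) (end_filter m0)" by (intro tendsto_intros V Q)
  moreover have "((\<lambda>s. V (e - s) + a * Q (e - s)) \<longlongrightarrow> l + a * k) (end_filter m1)" by (intro tendsto_intros V Q)
  ultimately show ?thesis unfolding total_def primitive_def by (intro exI[of _ "\<lambda>t. V t + a * Q t"]) simp
qed

text \<open>The increment is split at \<open>cL\<close> and \<open>cR\<close>: the outer parts are
  controlled by the constants of the two ends, the middle part by the maximum of
  \<open>E / A\<close> times the length.\<close>

lemma total_bounded:
  assumes rej: L.rejecting R.rejecting
  shows "\<exists>C. \<forall>M g. target_bound M g \<longrightarrow> (\<exists>l. total g l \<and> \<bar>l\<bar> \<le> C * M)"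
proof -
  obtain C1 where C1: "\<forall>M g V. 0 \<le> M \<longrightarrow> end_target m0 L.neutral \<gamma> cL M g \<longrightarrow>
    (\<forall>z\<in>end_int m0 cL. (V has_real_derivative E z * g z / A z) (at z within end_int m0 cL)) \<longrightarrow>
    (\<exists>l. (V \<longlongrightarrow> l) (end_filter m0) \<and> (\<forall>z\<in>end_int m0 cL. \<bar>V z - l\<bar> \<le> C1 * M))"
    using L.rejecting_primitive_tendsto[OF rej(1)] by blast
  obtain C2 where C2: "\<forall>M g V. 0 \<le> M \<longrightarrow> end_target m1 R.neutral \<gamma> (e - cR) M g \<longrightarrow>
    (\<forall>z\<in>end_int m1 (e - cR). (V has_real_derivative E (e - z) * g z / A (e - z)) (at z within end_int m1 (e - cR))) \<longrightarrow>
    (\<exists>l. (V \<longlongrightarrow> l) (end_filter m1) \<and> (\<forall>z\<in>end_int m1 (e - cR). \<bar>V z - l\<bar> \<le> C2 * M))"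
    using R.rejecting_primitive_tendsto[OF rej(2)] by blast
  have "continuous_on {cL..cR} (\<lambda>t. E t / A t)"
    using A_pos mid_I by (intro continuous_intros continuous_on_subset[OF E_cont mid_I] continuous_on_subset[OF has_C1_continuous[OF A_C1] mid_I]) force
  then obtain C3 where C3: "0 \<le> C3" "\<And>z. z \<in> {cL..cR} \<Longrightarrow> \<bar>E z / A z\<bar> \<le> C3" using continuous_on_compact_bound by blast
  have "\<exists>l. total g l \<and> \<bar>l\<bar> \<le> (C1 + C2 + C3 * (cR - cL)) * M" if t: "target_bound M g" for M g
  proof -
    have M: "0 \<le> M" using target_nonneg[OF t] .
    obtain V where V: "primitive g V" using ex_primitive[OF target_continuous[OF t]] by blast
    have tL: "end_target m0 L.neutral \<gamma> cL M g" and tR: "end_target m1 R.neutral \<gamma> (e - cR) M (\<lambda>s. g (e - s))"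
      and h: "holder_bound \<gamma> {cL..cR} M g" using t by (auto simp: target_bound_def neutral_eq)
    obtain l where l: "(V \<longlongrightarrow> l) (end_filter m0)" "\<forall>z\<in>end_int m0 cL. \<bar>V z - l\<bar> \<le> C1 * M"
      using C1 M tL primitive_left[OF V] by blast
    obtain l' where l': "((\<lambda>s. - V (e - s)) \<longlongrightarrow> l') (end_filter m1)" "\<forall>z\<in>end_int m1 (e - cR). \<bar>- V (e - z) - l'\<bar> \<le> C2 * M"
      using C2[rule_format, OF M tR, of "\<lambda>s. - V (e - s)"] primitive_right[OF V] by blast
    have "((\<lambda>s. - (- V (e - s)) - l) \<longlongrightarrow> - l' - l) (end_filter m1)" by (intro tendsto_intros l')
    moreover have "((\<lambda>t. V t - l) \<longlongrightarrow> 0) (end_filter m0)" using l(1) by (simp add: LIM_zero)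
    moreover have "primitive g (\<lambda>t. V t - l)"
      unfolding primitive_def
    proof
      fix t assume "t \<in> I"
      then have "(V has_real_derivative E t * g t / A t) (at t)" using V by (simp add: primitive_def)
      then show "((\<lambda>t. V t - l) has_real_derivative E t * g t / A t) (at t)" using DERIV_diff[OF _ DERIV_const] by fastforce
    qed
    ultimately have tot: "total g (- l' - l)" unfolding total_def by auto
    have "\<bar>V cL - l\<bar> \<le> C1 * M" using l(2) end_int_self[of m0 cL] end_pos(1) by blast
    moreover have "\<bar>- V cR - l'\<bar> \<le> C2 * M" using bspec[OF l'(2) end_int_self[of m1 "e - cR", OF end_pos(3)]] by simp
    moreover have "\<bar>V cR - V cL\<bar> \<le> C3 * M * \<bar>cR - cL\<bar>"
    proof (rule lipschitz_of_deriv[OF is_interval_cc])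
      fix z assume z: "z \<in> {cL..cR}"
      show "(V has_real_derivative E z * g z / A z) (at z within {cL..cR})"
        using V subsetD[OF mid_I z] unfolding primitive_def by (blast intro: has_field_derivative_at_within)
      have "\<bar>E z / A z\<bar> * \<bar>g z\<bar> \<le> C3 * M" using C3 z holder_boundD(1)[OF h z] by (intro mult_mono) auto
      then show "\<bar>E z * g z / A z\<bar> \<le> C3 * M" by (simp add: abs_mult)
    qed (use point_order in auto)
    ultimately have "\<bar>- l' - l\<bar> \<le> C1 * M + C2 * M + C3 * M * (cR - cL)" using point_order by (simp add: abs_le_iff)
    then show ?thesis using tot by (intro exI[of _ "- l' - l"]) (simp add: algebra_simps)
  qed
  then show ?thesis by blast
qed

text \<open>With \<open>u = V / E\<close> the equation holds on the whole interval, and a primitive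
  of \<open>u\<close> is the solution. The conditions on \<open>V\<close> are the conditions on
  \<open>E u\<close> that the local solvability at a rejecting end requires.\<close>

lemma solve_primitive:
  assumes t: "target_bound M g" and V: "primitive g V"
    and PL: "L.rejecting \<Longrightarrow> (V \<longlongrightarrow> 0) (end_filter m0)" and PR: "R.rejecting \<Longrightarrow> ((\<lambda>s. V (e - s)) \<longlongrightarrow> 0) (end_filter m1)"
    and gL: "m0 = 1 \<Longrightarrow> bL = 0 \<Longrightarrow> (g \<longlongrightarrow> 0) (end_filter m0)" and gR: "m1 = 1 \<Longrightarrow> bR = 0 \<Longrightarrow> ((\<lambda>s. g (e - s)) \<longlongrightarrow> 0) (end_filter m1)"
  shows "\<exists>M' F F2. domain_bound M' F (\<lambda>t. V t / E t) F2 \<and> (\<forall>t\<in>I. A t * F2 t + B t * (V t / E t) = g t)"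
proof -
  have g1: "\<gamma> \<le> 1" using \<gamma> by simp
  have M: "0 \<le> M" using target_nonneg[OF t] .
  define u where "u t = V t / E t" for t
  define F2 where "F2 t = (g t - B t * u t) / A t" for t
  have pos: "E t \<noteq> 0" "A t \<noteq> 0" if "t \<in> I" for t using E(2)[OF that] A_pos[OF that] by auto
  have Eu: "E t * u t = V t" if "t \<in> I" for t using pos[OF that] by (simp add: u_def)
  have u: "(u has_real_derivative F2 t) (at t)" if I: "t \<in> I" for t
  proof -
    have Pd: "(V has_real_derivative E t * g t / A t) (at t)" using V I by (simp add: primitive_def)
    have "(u has_real_derivative (E t * g t / A t * E t - V t * (E t * B t / A t)) / (E t * E t)) (at t)"
      unfolding u_def[abs_def] using DERIV_divide[OF Pd E(1)[OF I] pos(1)[OF I]] .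
    also have "(E t * g t / A t * E t - V t * (E t * B t / A t)) / (E t * E t) = F2 t"
      using pos[OF I] by (simp add: F2_def u_def field_simps)
    finally show ?thesis .
  qed
  have ucont: "continuous_on I u" by (intro continuous_at_imp_continuous_on ballI DERIV_isCont[OF u])
  obtain F where F: "\<And>t. t \<in> I \<Longrightarrow> (F has_real_derivative u t) (at t)" using ex_antiderivative[OF ucont] by blast
  have gc: "continuous_on I g" by (rule target_continuous[OF t])
  have F2c: "continuous_on I F2" unfolding F2_def[abs_def]
    using A_pos by (intro continuous_intros gc has_C1_continuous[OF A_C1] has_C1_continuous[OF B_C1] ucont) force
  have uC1: "has_C1 I u" using u F2c by (rule has_C1I)
  have FC1: "has_C1 I F" using F ucont by (rule has_C1I)
  have tL: "end_target m0 L.neutral \<gamma> cL M g" and tR: "end_target m1 R.neutral \<gamma> (e - cR) M (\<lambda>s. g (e - s))"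
    and h: "holder_bound \<gamma> {cL..cR} M g" using t by (auto simp: target_bound_def neutral_eq)
  have "\<exists>M'\<ge>0. end_domain m0 \<gamma> cL M' F u (\<lambda>z. (g z - B z * u z) / A z)"
  proof (rule L.solve_end[OF M tL])
    fix z assume "z \<in> end_int m0 cL"
    then have z: "z \<in> I" using left_sub[OF points(1)] by blast
    show "(u has_real_derivative (g z - B z * u z) / A z) (at z within end_int m0 cL)"
      using u[OF z] by (simp add: F2_def has_field_derivative_at_within)
    show "(F has_real_derivative u z) (at z within end_int m0 cL)" using F[OF z] by (rule has_field_derivative_at_within)
  next
    assume "L.rejecting"
    from PL[OF this] show "((\<lambda>z. E z * u z) \<longlongrightarrow> 0) (end_filter m0)"
      by (rule Lim_transform_eventually) (use eventually_left Eu in \<open>auto elim: eventually_mono\<close>)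
  qed (rule gL)
  then obtain NL where NL: "end_domain m0 \<gamma> cL NL F u F2" by (auto simp: F2_def[abs_def])
  have "\<exists>M'\<ge>0. end_domain m1 \<gamma> (e - cR) M' (\<lambda>s. F (e - s)) (\<lambda>s. - u (e - s)) (\<lambda>z. (g (e - z) - - B (e - z) * - u (e - z)) / A (e - z))"
  proof (rule R.solve_end[OF M tR])
    fix s assume "s \<in> end_int m1 (e - cR)"
    then have z: "e - s \<in> I" by (rule right_sub[OF points(2)])
    show "((\<lambda>s. - u (e - s)) has_real_derivative (g (e - s) - - B (e - s) * - u (e - s)) / A (e - s)) (at s within end_int m1 (e - cR))"
      using DERIV_minus[OF reflect_deriv[OF u[OF z]]] by (simp add: F2_def)
    show "((\<lambda>s. F (e - s)) has_real_derivative - u (e - s)) (at s within end_int m1 (e - cR))" by (rule reflect_deriv[OF F[OF z]])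
  next
    assume "R.rejecting"
    then have "((\<lambda>s. - V (e - s)) \<longlongrightarrow> - 0) (end_filter m1)" by (intro tendsto_minus PR)
    then have "((\<lambda>s. - V (e - s)) \<longlongrightarrow> 0) (end_filter m1)" by simp
    then show "((\<lambda>z. E (e - z) * - u (e - z)) \<longlongrightarrow> 0) (end_filter m1)"
      by (rule Lim_transform_eventually) (use eventually_right Eu in \<open>auto elim: eventually_mono\<close>)
  qed (rule gR)
  then obtain NR where NR: "end_domain m1 \<gamma> (e - cR) NR (\<lambda>s. F (e - s)) (\<lambda>s. - u (e - s)) (\<lambda>s. F2 (e - s))"
    unfolding minus_mult_minus F2_def[symmetric] by blast
  obtain N0 where N0: "0 \<le> N0" "holder_bound \<gamma> {cL..cR} N0 F" using has_C1_holder_compact[OF FC1 mid_I \<gamma>(1) g1] by blast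
  obtain N1 where N1: "0 \<le> N1" "holder_bound \<gamma> {cL..cR} N1 u" using has_C1_holder_compact[OF uC1 mid_I \<gamma>(1) g1] by blast
  obtain LB where LB: "0 \<le> LB" "holder_bound \<gamma> {cL..cR} LB B" using has_C1_holder_compact[OF B_C1 mid_I \<gamma>(1) g1] by blast
  obtain LA where LA: "0 \<le> LA" "holder_bound \<gamma> {cL..cR} LA (\<lambda>t. inverse (A t))"
    using has_C1_holder_compact[OF has_C1_inverse[OF A_C1 pos(2)] mid_I \<gamma>(1) g1] by blast
  define N2 where "N2 = 2 * (M + 2 * LB * N1) * LA"
  have N2: "holder_bound \<gamma> {cL..cR} N2 F2"
    unfolding N2_def F2_def[abs_def] divide_inverse by (intro holder_bound_mult holder_bound_diff h LB N1 LA)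
  have nn: "0 \<le> N2" "0 \<le> NL" "0 \<le> NR" using M LB(1) N1(1) LA(1) end_domain_nonneg[OF NL end_pos(1)] end_domain_nonneg[OF NR end_pos(3)] by (auto simp: N2_def)
  define M' where "M' = NL + NR + N0 + N1 + N2"
  have le: "NL \<le> M'" "NR \<le> M'" "N0 \<le> M'" "N1 \<le> M'" "N2 \<le> M'" using nn N0(1) N1(1) by (auto simp: M'_def)
  have "domain_bound M' F u F2"
    unfolding domain_bound_def
    using u F end_domain_mono[OF NL order_refl le(1)] end_domain_mono[OF NR order_refl le(2)]
      holder_bound_mono[OF N0(2) subset_refl le(3)] holder_bound_mono[OF N1(2) subset_refl le(4)] holder_bound_mono[OF N2 subset_refl le(5)] by blast
  moreover have "A t * F2 t + B t * u t = g t" if "t \<in> I" for t using pos[OF that] by (simp add: F2_def)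
  ultimately show ?thesis unfolding u_def[abs_def] by blast
qed

text \<open>A primitive \<open>V\<close> has one free constant. A single rejecting end uses it up;
  if both reject, one normalisation has to serve both, which is what \<open>total g 0\<close>
  says.\<close>

lemma solve:
  assumes t: "target_bound M g" and tot: "L.rejecting \<Longrightarrow> R.rejecting \<Longrightarrow> total g 0"
    and gL: "m0 = 1 \<Longrightarrow> bL = 0 \<Longrightarrow> (g \<longlongrightarrow> 0) (end_filter m0)" and gR: "m1 = 1 \<Longrightarrow> bR = 0 \<Longrightarrow> ((\<lambda>s. g (e - s)) \<longlongrightarrow> 0) (end_filter m1)"
  shows "\<exists>M' F F1 F2. domain_bound M' F F1 F2 \<and> (\<forall>t\<in>I. A t * F2 t + B t * F1 t = g t)"
proof -
  have M: "0 \<le> M" using target_nonneg[OF t] .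
  obtain V0 where V0: "primitive g V0" using ex_primitive[OF target_continuous[OF t]] by blast
  have shift: "primitive g (\<lambda>t. V0 t - k)" for k
    unfolding primitive_def
  proof
    fix t assume "t \<in> I"
    then have "(V0 has_real_derivative E t * g t / A t) (at t)" using V0 by (simp add: primitive_def)
    then show "((\<lambda>t. V0 t - k) has_real_derivative E t * g t / A t) (at t)" using DERIV_diff[OF _ DERIV_const] by fastforce
  qed
  have "\<exists>V. primitive g V \<and> (L.rejecting \<longrightarrow> (V \<longlongrightarrow> 0) (end_filter m0)) \<and> (R.rejecting \<longrightarrow> ((\<lambda>s. V (e - s)) \<longlongrightarrow> 0) (end_filter m1))"
  proof (cases "L.rejecting")
    case L: True
    show ?thesis
    proof (cases "R.rejecting")
      case True then show ?thesis using tot[OF L True] unfolding total_def by blast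
    next
      case False
      have "end_target m0 L.neutral \<gamma> cL M g" using t by (auto simp: target_bound_def neutral_eq)
      then obtain l where "(V0 \<longlongrightarrow> l) (end_filter m0)"
        using L.rejecting_primitive_tendsto[OF L] M primitive_left[OF V0] by blast
      then have "((\<lambda>t. V0 t - l) \<longlongrightarrow> 0) (end_filter m0)" by (simp add: LIM_zero)
      then show ?thesis using False shift by blast
    qed
  next
    case L: False
    show ?thesis
    proof (cases "R.rejecting")
      case True
      have "end_target m1 R.neutral \<gamma> (e - cR) M (\<lambda>s. g (e - s))" using t by (auto simp: target_bound_def neutral_eq)
      then obtain l where "((\<lambda>s. - V0 (e - s)) \<longlongrightarrow> l) (end_filter m1)"
        using R.rejecting_primitive_tendsto[OF True] M primitive_right[OF V0] by blast
      then have "((\<lambda>s. - (- V0 (e - s)) - - l) \<longlongrightarrow> - l - - l) (end_filter m1)" by (intro tendsto_intros)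
      then have "((\<lambda>s. V0 (e - s) - - l) \<longlongrightarrow> 0) (end_filter m1)" by simp
      then show ?thesis using L shift by blast
    next
      case False then show ?thesis using L V0 by blast
    qed
  qed
  then show ?thesis using solve_primitive[OF t _ _ _ gL gR] by blast
qed

text \<open>\<open>E * F1\<close> is itself a primitive of \<open>E g / A\<close>, so its behaviour
  at rejecting ends translates into conditions on \<open>g\<close>.\<close>

lemma domain_necessary:
  assumes d: "domain_bound M F F1 F2" and g: "\<And>t. t \<in> I \<Longrightarrow> g t = A t * F2 t + B t * F1 t"
  shows "L.rejecting \<Longrightarrow> ((\<lambda>t. E t * F1 t) \<longlongrightarrow> 0) (end_filter m0)"
    and "R.rejecting \<Longrightarrow> ((\<lambda>s. E (e - s) * F1 (e - s)) \<longlongrightarrow> 0) (end_filter m1)"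
    and "primitive g (\<lambda>t. E t * F1 t)"
    and "m0 = 1 \<Longrightarrow> bL = 0 \<Longrightarrow> (g \<longlongrightarrow> 0) (end_filter m0)"
    and "m1 = 1 \<Longrightarrow> bR = 0 \<Longrightarrow> ((\<lambda>s. g (e - s)) \<longlongrightarrow> 0) (end_filter m1)"
proof -
  have F: "\<And>t. t \<in> I \<Longrightarrow> (F1 has_real_derivative F2 t) (at t)"
    and dL: "end_domain m0 \<gamma> cL M F F1 F2" and dR: "end_domain m1 \<gamma> (e - cR) M (\<lambda>s. F (e - s)) (\<lambda>s. - F1 (e - s)) (\<lambda>s. F2 (e - s))"
    using d by (auto simp: domain_bound_def)
  show "L.rejecting \<Longrightarrow> ((\<lambda>t. E t * F1 t) \<longlongrightarrow> 0) (end_filter m0)" by (rule L.rejecting_deriv_tendsto[OF _ dL])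
  show "((\<lambda>s. E (e - s) * F1 (e - s)) \<longlongrightarrow> 0) (end_filter m1)" if "R.rejecting"
    using tendsto_minus[OF R.rejecting_deriv_tendsto[OF that dR]] by simp
  show "primitive g (\<lambda>t. E t * F1 t)"
    unfolding primitive_def
  proof
    fix t assume t: "t \<in> I"
    have "((\<lambda>t. E t * F1 t) has_real_derivative E t * B t / A t * F1 t + F2 t * E t) (at t)"
      by (rule DERIV_mult[OF E(1)[OF t] F[OF t]])
    then show "((\<lambda>t. E t * F1 t) has_real_derivative E t * g t / A t) (at t)"
      using A_pos[OF t] by (simp add: g[OF t] field_simps)
  qed
  show "(g \<longlongrightarrow> 0) (end_filter m0)" if "m0 = 1" "bL = 0"
    using L.operator_zero_at_end[OF that dL]
    by (rule Lim_transform_eventually) (use eventually_left g in \<open>auto elim: eventually_mono\<close>)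
  show "((\<lambda>s. g (e - s)) \<longlongrightarrow> 0) (end_filter m1)" if "m1 = 1" "bR = 0"
    using R.operator_zero_at_end[OF that dR]
    by (rule Lim_transform_eventually) (use eventually_right g in \<open>auto elim: eventually_mono\<close>)
qed

end

section \<open>The global spaces\<close>

lemma holder_bound_linear:
  "holder_bound \<gamma> U M f \<Longrightarrow> holder_bound \<gamma> U N g \<Longrightarrow> holder_bound \<gamma> U (M + \<bar>a\<bar> * N) (\<lambda>z. f z + a * g z)"
  by (intro holder_bound_add holder_bound_cmult)

lemma vanishing_primitive_linear:
  assumes F: "vanishing_primitive c M f F" and G: "vanishing_primitive c N g G"
  shows "vanishing_primitive c (M + \<bar>a\<bar> * N) (\<lambda>z. f z + a * g z) (\<lambda>z. F z + a * G z)"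
  unfolding vanishing_primitive_def
proof (intro conjI ballI)
  fix z assume z: "z \<in> {..c}"
  show "((\<lambda>z. F z + a * G z) has_real_derivative f z + a * g z) (at z within {..c})"
    using F G z by (intro DERIV_add DERIV_cmult) (auto simp: vanishing_primitive_def)
  have "\<bar>a * G z\<bar> \<le> \<bar>a\<bar> * N" unfolding abs_mult using G z by (intro mult_left_mono) (auto simp: vanishing_primitive_def)
  moreover have "\<bar>F z\<bar> \<le> M" using F z by (simp add: vanishing_primitive_def)
  ultimately show "\<bar>F z + a * G z\<bar> \<le> M + \<bar>a\<bar> * N" by linarith
next
  have "((\<lambda>z. F z + a * G z) \<longlongrightarrow> 0 + a * 0) at_bot"
    using F G by (intro tendsto_intros) (auto simp: vanishing_primitive_def)
  then show "((\<lambda>z. F z + a * G z) \<longlongrightarrow> 0) at_bot" by simp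
qed

lemma end_target_linear:
  assumes f: "end_target m nt \<gamma> c M f" and g: "end_target m nt \<gamma> c N g"
  shows "end_target m nt \<gamma> c (M + \<bar>a\<bar> * N) (\<lambda>z. f z + a * g z)"
proof -
  have "holder_bound \<gamma> (end_int m c) (M + \<bar>a\<bar> * N) (\<lambda>z. f z + a * g z)"
    using f g by (intro holder_bound_linear) (auto simp: end_target_def)
  moreover obtain l k where "(f \<longlongrightarrow> l) (end_filter m)" "(g \<longlongrightarrow> k) (end_filter m)" using f g by (auto simp: end_target_def)
  then have "((\<lambda>z. f z + a * g z) \<longlongrightarrow> l + a * k) (end_filter m)" by (intro tendsto_intros)
  moreover have "\<exists>G. vanishing_primitive c (M + \<bar>a\<bar> * N) (\<lambda>z. f z + a * g z) G \<and> (nt \<longrightarrow> (\<exists>GG. vanishing_primitive c (M + \<bar>a\<bar> * N) G GG))" if "m \<noteq> 1"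
  proof -
    obtain F G where FG: "vanishing_primitive c M f F" "nt \<longrightarrow> (\<exists>FF. vanishing_primitive c M F FF)"
      "vanishing_primitive c N g G" "nt \<longrightarrow> (\<exists>GG. vanishing_primitive c N G GG)"
      using f g \<open>m \<noteq> 1\<close> unfolding end_target_def by blast
    have "nt \<longrightarrow> (\<exists>GG. vanishing_primitive c (M + \<bar>a\<bar> * N) (\<lambda>z. F z + a * G z) GG)"
      using FG(2,4) vanishing_primitive_linear[where a=a] by blast
    then show ?thesis using vanishing_primitive_linear[OF FG(1,3)] by blast
  qed
  ultimately show ?thesis unfolding end_target_def by blast
qed

lemma end_domain_linear:
  assumes F: "end_domain m \<gamma> c M F F1 F2" and G: "end_domain m \<gamma> c N G G1 G2"
  shows "end_domain m \<gamma> c (M + \<bar>a\<bar> * N) (\<lambda>z. F z + a * G z) (\<lambda>z. F1 z + a * G1 z) (\<lambda>z. F2 z + a * G2 z)"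
proof -
  have lim: "\<exists>l. ((\<lambda>z. f z + a * g z) \<longlongrightarrow> l) (end_filter m)" if h: "\<exists>l. (f \<longlongrightarrow> l) (end_filter m)" "\<exists>l. (g \<longlongrightarrow> l) (end_filter m)" for f g :: "real \<Rightarrow> real"
  proof -
    obtain l k where "(f \<longlongrightarrow> l) (end_filter m)" "(g \<longlongrightarrow> k) (end_filter m)" using h by blast
    then have "((\<lambda>z. f z + a * g z) \<longlongrightarrow> l + a * k) (end_filter m)" by (intro tendsto_intros)
    then show ?thesis by blast
  qed
  have lim0: "((\<lambda>z. f z + a * g z) \<longlongrightarrow> 0) (end_filter m)" if "(f \<longlongrightarrow> 0) (end_filter m)" "(g \<longlongrightarrow> 0) (end_filter m)" for f g :: "real \<Rightarrow> real"
    using tendsto_add[OF that(1) tendsto_mult_left[OF that(2), of a]] by simp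
  show ?thesis
  proof (cases "m = 1")
    case True
    have eq: "(\<lambda>z. z * (F2 z + a * G2 z)) = (\<lambda>z. z * F2 z + a * (z * G2 z))" by (auto simp: algebra_simps)
    show ?thesis using F G unfolding end_domain_def eq if_P[OF True]
      by (intro conjI lim lim0 holder_bound_linear) auto
  next
    case False
    have "\<bar>f z + a * g z\<bar> \<le> M + \<bar>a\<bar> * N" if "\<bar>f z\<bar> \<le> M" "\<bar>g z\<bar> \<le> N" for f g :: "real \<Rightarrow> real" and z
    proof -
      have "\<bar>a * g z\<bar> \<le> \<bar>a\<bar> * N" unfolding abs_mult using that by (intro mult_left_mono) auto
      then show ?thesis using that by linarith
    qed
    then show ?thesis using F G False unfolding end_domain_def by (simp add: holder_bound_linear lim lim0)
  qed
qed

context kimura_setting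
begin

definition ext where "ext h x = (if x \<in> {0<..<1} then h (\<psi> x) else 0)" for h :: "real \<Rightarrow> real"

lemma ext_\<phi>: "t \<in> I \<Longrightarrow> ext h (\<phi> t) = h t" using \<phi>_range[of t] by (simp add: ext_def \<psi>_\<phi>)

lemma fun_eq_by_\<phi>:
  assumes "\<And>x. x \<notin> {0<..<1} \<Longrightarrow> f x = g x" "\<And>t. t \<in> I \<Longrightarrow> f (\<phi> t) = g (\<phi> t)" shows "f = g"
proof
  fix x show "f x = g x" using assms(1)[of x] assms(2)[OF \<psi>_I, of x] \<phi>_\<psi>[of x] by (cases "x \<in> {0<..<1}") auto
qed

lemma target_bound_cong:
  assumes t: "target_bound M g" and eq: "\<And>t. t \<in> I \<Longrightarrow> g t = h t" shows "target_bound M h"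
proof -
  have "end_target m0 (neutral0 K) \<gamma> cL M h"
    by (rule end_target_cong[of m0 "neutral0 K" \<gamma> cL M g, OF _ end_pos(1)]) (use t eq left_sub[OF points(1)] in \<open>auto simp: target_bound_def\<close>)
  moreover have "end_target m1 (neutral1 K) \<gamma> (e - cR) M (\<lambda>s. h (e - s))"
    by (rule end_target_cong[of m1 "neutral1 K" \<gamma> "e - cR" M "\<lambda>s. g (e - s)", OF _ end_pos(3)]) (use t eq right_sub[OF points(2)] in \<open>auto simp: target_bound_def\<close>)
  moreover have "holder_bound \<gamma> {cL..cR} M h"
    using t holder_bound_cong[of "{cL..cR}" g h, OF eq[OF subsetD[OF mid_I]]] by (simp add: target_bound_def)
  ultimately show ?thesis by (simp add: target_bound_def)
qed

lemma target_bound_linear: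
  assumes "target_bound M g" "target_bound N h" shows "target_bound (M + \<bar>a\<bar> * N) (\<lambda>t. g t + a * h t)"
  using assms unfolding target_bound_def by (auto intro!: end_target_linear holder_bound_linear)

lemma domain_bound_linear:
  assumes "domain_bound M F F1 F2" "domain_bound N G G1 G2"
  shows "domain_bound (M + \<bar>a\<bar> * N) (\<lambda>t. F t + a * G t) (\<lambda>t. F1 t + a * G1 t) (\<lambda>t. F2 t + a * G2 t)"
proof -
  have "end_domain m1 \<gamma> (e - cR) (M + \<bar>a\<bar> * N) (\<lambda>s. F (e - s) + a * G (e - s)) (\<lambda>s. - F1 (e - s) + a * - G1 (e - s)) (\<lambda>s. F2 (e - s) + a * G2 (e - s))"
    using assms by (intro end_domain_linear) (auto simp: domain_bound_def)
  then show ?thesis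
    using assms unfolding domain_bound_def by (auto intro!: end_domain_linear holder_bound_linear DERIV_add DERIV_cmult)
qed

section \<open>The global spaces in terms of bounds, and their linear structure\<close>

abbreviation "X \<equiv> C2_space K H P \<gamma>"
abbreviation "Y \<equiv> aD_space K H P \<gamma>"
abbreviation "T \<equiv> kimura_L K"

lemma aD_finite: "g \<in> Y \<Longrightarrow> aD_norm K H P \<gamma> g < \<infinity>"
  by (auto simp: aD_space_def aD_norm_def end_aD_def end_aD_norm_def kim_D_def quad_D_def split: if_splits)

lemma C2_finite: "f \<in> X \<Longrightarrow> C2_norm K H P \<gamma> f < \<infinity>"
  by (auto simp: C2_space_def C2_norm_def end_C2_def end_C2_norm_def kim_C2_def quad_C2_def split: if_splits)

lemma ex_real_bound: assumes "n < (\<infinity>::ennreal)" obtains M where "0 \<le> M" "n = ennreal M"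
  using assms by (cases n) auto

text \<open>From here on membership in the two spaces is only used in this form, in which the
  partition of unity no longer occurs.\<close>

lemma Y_iff: "g \<in> Y \<longleftrightarrow> (\<forall>x. x \<notin> {0<..<1} \<longrightarrow> g x = 0) \<and> (\<exists>M. target_bound M (\<lambda>t. g (\<phi> t)))"
proof
  assume g: "g \<in> Y"
  obtain M where M: "0 \<le> M" "aD_norm K H P \<gamma> g = ennreal M" using ex_real_bound[OF aD_finite[OF g]] by blast
  then show "(\<forall>x. x \<notin> {0<..<1} \<longrightarrow> g x = 0) \<and> (\<exists>M. target_bound M (\<lambda>t. g (\<phi> t)))"
    using aD_imp_target[OF g, of M] g by (auto simp: aD_space_def)
next
  assume "(\<forall>x. x \<notin> {0<..<1} \<longrightarrow> g x = 0) \<and> (\<exists>M. target_bound M (\<lambda>t. g (\<phi> t)))"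
  then show "g \<in> Y" using target_imp_aD target_nonneg by blast
qed

lemma X_iff: "f \<in> X \<longleftrightarrow> (\<forall>x. x \<notin> {0<..<1} \<longrightarrow> f x = 0) \<and> (\<exists>M F1 F2. domain_bound M (\<lambda>t. f (\<phi> t)) F1 F2)"
proof
  assume f: "f \<in> X"
  obtain M where M: "0 \<le> M" "C2_norm K H P \<gamma> f = ennreal M" using ex_real_bound[OF C2_finite[OF f]] by blast
  then have "\<exists>M F1 F2. domain_bound M (\<lambda>t. f (\<phi> t)) F1 F2" using C2_imp_domain f by (metis order_refl)
  then show "(\<forall>x. x \<notin> {0<..<1} \<longrightarrow> f x = 0) \<and> (\<exists>M F1 F2. domain_bound M (\<lambda>t. f (\<phi> t)) F1 F2)"
    using f by (auto simp: C2_space_def)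
qed (use domain_imp_C2 in blast)

lemma T_\<phi>:
  assumes "domain_bound M (\<lambda>t. f (\<phi> t)) F1 F2" "t \<in> I" shows "T f (\<phi> t) = A t * F2 t + B t * F1 t"
  by (rule kimura_L_heat[of "\<lambda>t. f (\<phi> t)"]) (use assms in \<open>auto simp: domain_bound_def\<close>)

lemma T_outside: "x \<notin> {0<..<1} \<Longrightarrow> T f x = 0" unfolding kimura_L_def by (rule if_not_P)

lemma ext_outside: "x \<notin> {0<..<1} \<Longrightarrow> ext h x = 0" unfolding ext_def by (rule if_not_P)

lemma domain_bound_ext: "domain_bound M F F1 F2 \<Longrightarrow> domain_bound M (\<lambda>t. ext F (\<phi> t)) F1 F2"
  by (rule domain_bound_cong) (auto simp: ext_\<phi>)

lemma target_bound_ext: "target_bound M h \<Longrightarrow> target_bound M (\<lambda>t. ext h (\<phi> t))"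
  by (rule target_bound_cong) (auto simp: ext_\<phi>)

lemma ext_X: "domain_bound M F F1 F2 \<Longrightarrow> ext F \<in> X"
  unfolding X_iff using domain_bound_ext ext_outside by blast

lemma ext_Y: "target_bound M h \<Longrightarrow> ext h \<in> Y"
  unfolding Y_iff using target_bound_ext ext_outside by blast

lemma domain_bound_const: "domain_bound \<bar>k\<bar> (\<lambda>_. k) (\<lambda>_. 0) (\<lambda>_. 0)"
  unfolding domain_bound_def end_domain_def
  by (auto intro!: holder_bound_const holder_bound_zero)

lemma X_linear:
  assumes "f \<in> X" "g \<in> X" shows "f + a *\<^sub>R g \<in> X" "T (f + a *\<^sub>R g) = T f + a *\<^sub>R T g"
proof -
  obtain M F1 F2 where F: "domain_bound M (\<lambda>t. f (\<phi> t)) F1 F2" using assms(1) by (auto simp: X_iff)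
  obtain N G1 G2 where G: "domain_bound N (\<lambda>t. g (\<phi> t)) G1 G2" using assms(2) by (auto simp: X_iff)
  have FG: "domain_bound (M + \<bar>a\<bar> * N) (\<lambda>t. (f + a *\<^sub>R g) (\<phi> t)) (\<lambda>t. F1 t + a * G1 t) (\<lambda>t. F2 t + a * G2 t)"
    using domain_bound_linear[OF F G, of a] by (simp add: scaleR_fun_def)
  then show "f + a *\<^sub>R g \<in> X" using assms by (auto simp: X_iff scaleR_fun_def)
  show "T (f + a *\<^sub>R g) = T f + a *\<^sub>R T g"
  proof (rule fun_eq_by_\<phi>)
    fix t assume t: "t \<in> I"
    show "T (f + a *\<^sub>R g) (\<phi> t) = (T f + a *\<^sub>R T g) (\<phi> t)"
      unfolding T_\<phi>[OF FG t] unfolding plus_fun_apply scaleR_fun_def T_\<phi>[OF F t] T_\<phi>[OF G t] by (simp add: algebra_simps)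
  qed (simp add: T_outside scaleR_fun_def)
qed

lemma zero_X: "0 \<in> X" and T_zero: "T 0 = 0"
proof -
  have d: "domain_bound \<bar>0\<bar> (\<lambda>t. (0 :: real \<Rightarrow> real) (\<phi> t)) (\<lambda>_. 0) (\<lambda>_. 0)" using domain_bound_const[of 0] by simp
  then show "0 \<in> X" by (auto simp: X_iff)
  show "T 0 = 0" by (rule fun_eq_by_\<phi>) (simp_all add: T_outside T_\<phi>[OF d])
qed

lemma subspace_X: "subspace X"
  using X_linear(1)[of _ _ 1] X_linear(1)[OF zero_X] zero_X by (intro subspaceI) auto

lemma Y_linear: assumes "f \<in> Y" "g \<in> Y" shows "f + a *\<^sub>R g \<in> Y"
proof -
  obtain M where M: "target_bound M (\<lambda>t. f (\<phi> t))" using assms by (auto simp: Y_iff)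
  obtain N where N: "target_bound N (\<lambda>t. g (\<phi> t))" using assms by (auto simp: Y_iff)
  have "target_bound (M + \<bar>a\<bar> * N) (\<lambda>t. (f + a *\<^sub>R g) (\<phi> t))" using target_bound_linear[OF M N, of a] by (simp add: scaleR_fun_def)
  then show ?thesis using assms by (auto simp: Y_iff scaleR_fun_def)
qed

lemma zero_target: "target_bound 0 (\<lambda>_. 0)"
  by (simp add: target_bound_def end_target_zero holder_bound_zero)

lemma zero_Y: "0 \<in> Y" unfolding Y_iff using zero_target by auto

lemma subspace_Y: "subspace Y"
  using Y_linear[of _ _ 1] Y_linear[OF zero_Y] zero_Y by (intro subspaceI) auto

lemma target_bound_C1:
  assumes h: "has_C1 I h" and left: "\<And>t. t \<in> I \<Longrightarrow> t \<le> cL \<Longrightarrow> h t = k" "k = 0 \<or> m0 = 1"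
    and right: "\<And>t. t \<in> I \<Longrightarrow> cR \<le> t \<Longrightarrow> h t = k'" "k' = 0 \<or> m1 = 1"
  shows "\<exists>M. target_bound M h"
proof -
  have g1: "\<gamma> \<le> 1" using \<gamma> by simp
  obtain N where N: "0 \<le> N" "holder_bound \<gamma> {cL..cR} N h" using has_C1_holder_compact[OF h mid_I \<gamma>(1) g1] by blast
  have const: "end_target m nt \<gamma> c \<bar>k\<bar> (\<lambda>_. k)" if "k = 0 \<or> m = 1" for m nt c k
    using that end_target_zero[of 0] by (auto simp: end_target_def intro!: holder_bound_const)
  define M where "M = \<bar>k\<bar> + \<bar>k'\<bar> + N"
  have "end_target m0 (neutral0 K) \<gamma> cL M h"
    by (rule end_target_cong[OF end_target_mono[OF const[OF left(2)] order_refl] end_pos(1)])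
      (use left(1) left_sub[OF points(1)] end_int_le N(1) in \<open>auto simp: M_def\<close>)
  moreover have "end_target m1 (neutral1 K) \<gamma> (e - cR) M (\<lambda>s. h (e - s))"
  proof (rule end_target_cong[OF end_target_mono[OF const[OF right(2)] order_refl] end_pos(3)])
    show "k' = h (e - s)" if "s \<in> end_int m1 (e - cR)" for s
      using right(1)[OF right_sub[OF points(2) that]] end_int_le[OF that] by simp
  qed (use N(1) in \<open>auto simp: M_def\<close>)
  moreover have "holder_bound \<gamma> {cL..cR} M h" by (rule holder_bound_mono[OF N(2) subset_refl]) (simp add: M_def)
  ultimately show ?thesis unfolding target_bound_def by blast
qed

end

section \<open>Kernel, range and index\<close>

lemma end_target_limit:
  assumes t: "end_target m nt \<gamma> c M g" and c: "m = 1 \<Longrightarrow> 0 < c"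
  shows "\<exists>l. (g \<longlongrightarrow> l) (end_filter m) \<and> \<bar>l\<bar> \<le> M"
proof -
  obtain l where l: "(g \<longlongrightarrow> l) (end_filter m)" and h: "holder_bound \<gamma> (end_int m c) M g"
    using t by (auto simp: end_target_def)
  have "eventually (\<lambda>z. \<bar>g z\<bar> \<le> M) (end_filter m)"
    using eventually_end_filter[OF c] holder_boundD(1)[OF h] by (rule eventually_mono)
  then have "\<bar>l\<bar> \<le> M" using tendsto_upperbound[OF tendsto_rabs[OF l] _ end_filter_neq_bot] by blast
  then show ?thesis using l by blast
qed

context kimura_solver
begin

text \<open>The conditions on the range: \<open>0\<close> and \<open>1\<close> stand for vanishing at the left and right Kimura end,
  \<open>2\<close> for the vanishing of \<open>\<integral> E g / A\<close>.\<close>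

definition obstructions :: "nat set" where
  "obstructions = {i. i = 0 \<and> m0 = 1 \<and> bL = 0 \<or> i = 1 \<and> m1 = 1 \<and> bR = 0 \<or> i = 2 \<and> L.rejecting \<and> R.rejecting}"

definition obstruction :: "nat \<Rightarrow> (real \<Rightarrow> real) \<Rightarrow> real \<Rightarrow> bool" where
  "obstruction i h l \<longleftrightarrow> (if i = 0 then (h \<longlongrightarrow> l) (end_filter m0)
     else if i = 1 then ((\<lambda>s. h (e - s)) \<longlongrightarrow> l) (end_filter m1) else total h l)"

text \<open>Turns the relation into a functional; on \<open>Y\<close> and for an index in
  \<open>obstructions\<close> the value exists by \<open>obstruction_bounded\<close>.\<close>

definition \<Lambda> :: "nat \<Rightarrow> (real \<Rightarrow> real) \<Rightarrow> real" where
  "\<Lambda> i g = (THE l. obstruction i (\<lambda>t. g (\<phi> t)) l)"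

lemma obstruction_unique: "obstruction i h l \<Longrightarrow> obstruction i h k \<Longrightarrow> l = k"
  unfolding obstruction_def using tendsto_unique[OF end_filter_neq_bot] total_unique by (metis (full_types))

lemma \<Lambda>_eq: "obstruction i (\<lambda>t. g (\<phi> t)) l \<Longrightarrow> \<Lambda> i g = l"
  unfolding \<Lambda>_def using obstruction_unique by (intro the_equality) auto

lemma obstruction_linear:
  assumes "obstruction i g l" "obstruction i h k" shows "obstruction i (\<lambda>t. g t + a * h t) (l + a * k)"
proof -
  consider "i = 0" | "i = 1" | "i \<noteq> 0" "i \<noteq> 1" by blast
  then show ?thesis
    using assms by cases (auto simp: obstruction_def total_linear intro!: tendsto_add tendsto_mult_left)
qed

lemma obstruction_cong:
  assumes g: "obstruction i g l" and eq: "\<And>t. t \<in> I \<Longrightarrow> g t = h t" shows "obstruction i h l"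
proof -
  have "(h \<longlongrightarrow> l) (end_filter m0)" if "(g \<longlongrightarrow> l) (end_filter m0)"
    using that by (rule Lim_transform_eventually) (use eventually_left eq in \<open>auto elim: eventually_mono\<close>)
  moreover have "((\<lambda>s. h (e - s)) \<longlongrightarrow> l) (end_filter m1)" if "((\<lambda>s. g (e - s)) \<longlongrightarrow> l) (end_filter m1)"
    using that by (rule Lim_transform_eventually) (use eventually_right eq in \<open>auto elim: eventually_mono\<close>)
  moreover have "total h l" if "total g l"
  proof -
    have "primitive h V" if "primitive g V" for V using that eq by (simp add: primitive_def)
    then show ?thesis using that unfolding total_def by blast
  qed
  ultimately show ?thesis using g by (simp add: obstruction_def split: if_splits)
qed

lemma obstruction_bounded:
  assumes i: "i \<in> obstructions"
  shows "\<exists>C. \<forall>M g. target_bound M g \<longrightarrow> (\<exists>l. obstruction i g l \<and> \<bar>l\<bar> \<le> C * M)"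
proof -
  consider "i = 0" | "i = 1" | "i = 2" L.rejecting R.rejecting using i by (auto simp: obstructions_def)
  then show ?thesis
  proof cases
    case 1
    have "\<exists>l. obstruction i g l \<and> \<bar>l\<bar> \<le> 1 * M" if "target_bound M g" for M g
      using that end_target_limit[of m0 "neutral0 K" \<gamma> cL M g, OF _ end_pos(1)] unfolding 1(1) target_bound_def obstruction_def by simp
    then show ?thesis by blast
  next
    case 2
    have "\<exists>l. obstruction i g l \<and> \<bar>l\<bar> \<le> 1 * M" if "target_bound M g" for M g
      using that end_target_limit[of m1 "neutral1 K" \<gamma> "e - cR" M "\<lambda>s. g (e - s)", OF _ end_pos(3)] unfolding 2(1) target_bound_def obstruction_def by simp
    then show ?thesis by blast
  next
    case 3
    then show ?thesis using total_bounded by (simp add: obstruction_def)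
  qed
qed

lemma obstruction_\<Lambda>: assumes i: "i \<in> obstructions" and g: "g \<in> Y" shows "obstruction i (\<lambda>t. g (\<phi> t)) (\<Lambda> i g)"
proof -
  obtain M where "target_bound M (\<lambda>t. g (\<phi> t))" using g by (auto simp: Y_iff)
  then obtain l where "obstruction i (\<lambda>t. g (\<phi> t)) l" using obstruction_bounded[OF i] by blast
  then show ?thesis using \<Lambda>_eq by metis
qed

text \<open>The last function is chosen such that \<open>E g / A\<close> is the derivative of a cut-off that rises from 0 to 1.\<close>

definition dual_fun :: "nat \<Rightarrow> real \<Rightarrow> real" where
  "dual_fun i = (if i = 0 then cut \<zeta>0 else if i = 1 then cut \<zeta>1 else (\<lambda>t. A t * cut1 \<zeta>1 t / E t))"

lemma E_C1: "has_C1 I E"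
  by (rule has_C1I[OF E(1)])
    (use A_pos in \<open>force intro!: continuous_intros E_cont has_C1_continuous[OF A_C1] has_C1_continuous[OF B_C1]\<close>)+

lemma dual_target: assumes i: "i \<in> obstructions" shows "\<exists>M. target_bound M (dual_fun i)"
proof -
  consider "i = 0" "m0 = 1" | "i = 1" "m1 = 1" | "i = 2" using i by (auto simp: obstructions_def)
  then show ?thesis
  proof cases
    case 1
    have "\<exists>M. target_bound M (cut \<zeta>0)"
      by (rule target_bound_C1[OF cut_C1[OF chi_smooth(1)], of 1 0]) (use 1 cut_one_left cut0_zero point_order in auto)
    then show ?thesis using 1 by (simp add: dual_fun_def)
  next
    case 2
    have "\<exists>M. target_bound M (cut \<zeta>1)"
      by (rule target_bound_C1[OF cut_C1[OF chi_smooth(2)], of 0 1]) (use 2 cut_one_right cut1_zero point_order in auto)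
    then show ?thesis using 2 by (simp add: dual_fun_def)
  next
    case 3
    have "has_C1 I (\<lambda>t. A t * cut1 \<zeta>1 t / E t)"
      by (intro has_C1_divide has_C1_mult A_C1 E_C1 cut1_C1 chi_smooth) (use E(2) in force)
    then have "\<exists>M. target_bound M (\<lambda>t. A t * cut1 \<zeta>1 t / E t)"
      by (rule target_bound_C1[of _ 0 0]) (use cut_one_right cut1_zero point_order in auto)
    then show ?thesis using 3 by (simp add: dual_fun_def)
  qed
qed

lemma limit_left_const: "(\<And>t. t \<in> I \<Longrightarrow> t \<le> cL \<Longrightarrow> f t = k) \<Longrightarrow> (f \<longlongrightarrow> k) (end_filter m0)"
  by (rule tendsto_eventually, rule eventually_mono[OF eventually_end_filter[of m0 cL, OF end_pos(1)]])
    (use left_sub[OF points(1)] end_int_le in blast)+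

lemma limit_right_const:
  assumes "\<And>t. t \<in> I \<Longrightarrow> cR \<le> t \<Longrightarrow> f t = k" shows "((\<lambda>s. f (e - s)) \<longlongrightarrow> k) (end_filter m1)"
proof (rule tendsto_eventually, rule eventually_mono[OF eventually_end_filter[of m1 "e - cR", OF end_pos(3)]])
  fix s assume s: "s \<in> end_int m1 (e - cR)"
  show "f (e - s) = k" using assms[OF right_sub[OF points(2) s]] end_int_le[OF s] by simp
qed

lemma dual_obstruction:
  assumes i: "i \<in> obstructions" and j: "j \<in> obstructions"
  shows "obstruction i (dual_fun j) (if i = j then 1 else 0)"
proof -
  have 0: "obstruction 0 (dual_fun 0) 1" "obstruction 1 (dual_fun 0) 0"
    using limit_left_const[of "cut \<zeta>0" 1] limit_right_const[of "cut \<zeta>0" 0] cut_one_left cut0_zero point_order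
    by (auto simp: obstruction_def dual_fun_def)
  have 1: "obstruction 0 (dual_fun 1) 0" "obstruction 1 (dual_fun 1) 1"
    using limit_left_const[of "cut \<zeta>1" 0] limit_right_const[of "cut \<zeta>1" 1] cut_one_right cut1_zero point_order
    by (auto simp: obstruction_def dual_fun_def)
  have "primitive (\<lambda>t. A t * cut1 \<zeta>1 t / E t) (cut \<zeta>1)"
    unfolding primitive_def
  proof
    fix t assume t: "t \<in> I"
    have "E t * (A t * cut1 \<zeta>1 t / E t) / A t = cut1 \<zeta>1 t" using E(2)[OF t] A_pos[OF t] by simp
    then show "(cut \<zeta>1 has_real_derivative E t * (A t * cut1 \<zeta>1 t / E t) / A t) (at t)"
      using cut_deriv[OF chi_smooth(2) t] by simp
  qed
  then have "total (\<lambda>t. A t * cut1 \<zeta>1 t / E t) 1"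
    using 1 unfolding total_def obstruction_def dual_fun_def by auto
  then have 2: "obstruction 2 (dual_fun 2) 1" by (simp add: obstruction_def dual_fun_def)
  \<comment> \<open>The index 2 never occurs together with 0 or 1: a Kimura end with
    \<open>b = 0\<close> does not reject. So the integral of the first two dual functions need not
    be known.\<close>
  have "L.rejecting \<Longrightarrow> \<not> (m0 = 1 \<and> bL = 0)" "R.rejecting \<Longrightarrow> \<not> (m1 = 1 \<and> bR = 0)"
    unfolding L.rejecting_def R.rejecting_def by auto
  then consider "i = 0" "j = 0" | "i = 0" "j = 1" | "i = 1" "j = 0" | "i = 1" "j = 1" | "i = 2" "j = 2"
    using i j unfolding obstructions_def by blast
  then show ?thesis using 0 1 2 by cases auto
qed

lemma domain_nonneg: "domain_bound M F F1 F2 \<Longrightarrow> 0 \<le> M"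
  using holder_bound_nonneg[of \<gamma> "{cL..cR}" M F cL] point_order by (simp add: domain_bound_def)

lemma T_X: assumes f: "f \<in> X" shows "T f \<in> Y" "i \<in> obstructions \<Longrightarrow> \<Lambda> i (T f) = 0"
proof -
  obtain M F1 F2 where d: "domain_bound M (\<lambda>t. f (\<phi> t)) F1 F2" using f by (auto simp: X_iff)
  obtain C where C: "target_bound (C * M) (\<lambda>t. A t * F2 t + B t * F1 t)" using operator_bound d domain_nonneg[OF d] by blast
  note eq = T_\<phi>[OF d]
  have "target_bound (C * M) (\<lambda>t. T f (\<phi> t))" by (rule target_bound_cong[OF C]) (simp add: eq)
  then show "T f \<in> Y" unfolding Y_iff using T_outside by blast
  note n = domain_necessary[OF d, of "\<lambda>t. T f (\<phi> t)", OF eq]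
  assume i: "i \<in> obstructions"
  have "obstruction i (\<lambda>t. T f (\<phi> t)) 0"
  proof -
    have "total (\<lambda>t. T f (\<phi> t)) 0" if "L.rejecting" "R.rejecting"
      unfolding total_def using n(1)[OF _ that(1)] n(2)[OF _ that(2)] n(3) by blast
    then show ?thesis using i n(4,5) unfolding obstructions_def obstruction_def by auto
  qed
  then show "\<Lambda> i (T f) = 0" by (rule \<Lambda>_eq)
qed

text \<open>The vanishing of the functionals is a restatement of the three hypotheses of
  \<open>solve\<close>.\<close>

lemma range_T: "T ` X = {g \<in> Y. \<forall>i\<in>obstructions. \<Lambda> i g = 0}"
proof (intro equalityI subsetI)
  fix g assume "g \<in> {g \<in> Y. \<forall>i\<in>obstructions. \<Lambda> i g = 0}"
  then have g: "g \<in> Y" and \<Lambda>: "\<And>i. i \<in> obstructions \<Longrightarrow> \<Lambda> i g = 0" by auto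
  obtain M where M: "target_bound M (\<lambda>t. g (\<phi> t))" and g0: "\<And>x. x \<notin> {0<..<1} \<Longrightarrow> g x = 0" using g by (auto simp: Y_iff)
  have ob: "obstruction i (\<lambda>t. g (\<phi> t)) 0" if "i \<in> obstructions" for i
    using obstruction_\<Lambda>[OF that g] \<Lambda>[OF that] by simp
  have "total (\<lambda>t. g (\<phi> t)) 0" if "L.rejecting" "R.rejecting"
    using ob[of 2] that by (simp add: obstructions_def obstruction_def)
  moreover have "((\<lambda>t. g (\<phi> t)) \<longlongrightarrow> 0) (end_filter m0)" if "m0 = 1" "bL = 0"
    using ob[of 0] that unfolding obstructions_def obstruction_def by auto
  moreover have "((\<lambda>s. g (\<phi> (e - s))) \<longlongrightarrow> 0) (end_filter m1)" if "m1 = 1" "bR = 0"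
    using ob[of 1] that unfolding obstructions_def obstruction_def by auto
  ultimately obtain M' F F1 F2 where d: "domain_bound M' F F1 F2" and eq: "\<forall>t\<in>I. A t * F2 t + B t * F1 t = g (\<phi> t)"
    using solve[OF M] by blast
  have "T (ext F) = g"
    by (rule fun_eq_by_\<phi>) (use eq T_\<phi>[OF domain_bound_ext[OF d]] g0 T_outside in auto)
  then show "g \<in> T ` X" using ext_X[OF d] by blast
qed (use T_X in auto)

lemma T_bounded: "\<exists>C. \<forall>f\<in>X. aD_norm K H P \<gamma> (T f) \<le> ennreal C * C2_norm K H P \<gamma> f"
proof -
  obtain C1 where C1: "0 \<le> C1" "\<And>M f. 0 \<le> M \<Longrightarrow> f \<in> X \<Longrightarrow> C2_norm K H P \<gamma> f \<le> ennreal M \<Longrightarrow>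
     domain_bound (C1 * M) (\<lambda>t. f (\<phi> t)) (deriv (\<lambda>t. f (\<phi> t))) (deriv (deriv (\<lambda>t. f (\<phi> t))))" using C2_imp_domain by blast
  obtain C2 where C2: "0 \<le> C2" "\<And>M F F1 F2. 0 \<le> M \<Longrightarrow> domain_bound M F F1 F2 \<Longrightarrow> target_bound (C2 * M) (\<lambda>t. A t * F2 t + B t * F1 t)"
    using operator_bound by blast
  obtain C3 where C3: "\<And>M g. 0 \<le> M \<Longrightarrow> (\<forall>x. x \<notin> {0<..<1} \<longrightarrow> g x = 0) \<Longrightarrow> target_bound M (\<lambda>t. g (\<phi> t)) \<Longrightarrow> aD_norm K H P \<gamma> g \<le> ennreal (C3 * M)"
    using target_imp_aD by blast
  \<comment> \<open>The constant \<open>C3\<close> comes without a sign, hence the maximum with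
    0.\<close>
  have "aD_norm K H P \<gamma> (T f) \<le> ennreal (max 0 C3 * C2 * C1) * C2_norm K H P \<gamma> f" if f: "f \<in> X" for f
  proof -
    obtain M where M: "0 \<le> M" "C2_norm K H P \<gamma> f = ennreal M" using ex_real_bound[OF C2_finite[OF f]] by blast
    note d = C1(2)[OF M(1) f eq_refl[OF M(2)]]
    have nn: "0 \<le> C1 * M" "0 \<le> C2 * (C1 * M)" using C1(1) C2(1) M(1) by auto
    have "target_bound (C2 * (C1 * M)) (\<lambda>t. T f (\<phi> t))"
      by (rule target_bound_cong[OF C2(2)[OF nn(1) d]]) (simp add: T_\<phi>[OF d])
    then have "aD_norm K H P \<gamma> (T f) \<le> ennreal (C3 * (C2 * (C1 * M)))" using C3[OF nn(2)] T_outside by blast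
    also have "\<dots> \<le> ennreal (max 0 C3 * (C2 * (C1 * M)))" using nn by (intro ennreal_leI mult_right_mono) auto
    also have "\<dots> = ennreal (max 0 C3 * C2 * C1) * ennreal M"
      using C1(1) C2(1) M(1) by (simp add: ennreal_mult[symmetric] mult.assoc)
    finally show ?thesis using M(2) by simp
  qed
  then show ?thesis by blast
qed

section \<open>The kernel\<close>

lemma subspace_ker: "subspace (ker_on X T)"
proof (rule subspaceI)
  show "0 \<in> ker_on X T" using zero_X T_zero by (simp add: ker_on_def)
  fix f g c assume f: "f \<in> ker_on X T"
  show "f + g \<in> ker_on X T" if "g \<in> ker_on X T"
    using X_linear[of f g 1] f that by (simp add: ker_on_def)
  show "c *\<^sub>R f \<in> ker_on X T"
    using X_linear[of 0 f c] f zero_X T_zero by (simp add: ker_on_def)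
qed

lemma ext_ker:
  assumes "domain_bound M F F1 F2" "\<And>t. t \<in> I \<Longrightarrow> A t * F2 t + B t * F1 t = 0" shows "ext F \<in> ker_on X T"
proof -
  have "T (ext F) = 0" by (rule fun_eq_by_\<phi>) (use T_\<phi>[OF domain_bound_ext[OF assms(1)]] assms(2) T_outside in auto)
  then show ?thesis using ext_X[OF assms(1)] by (simp add: ker_on_def)
qed

text \<open>For \<open>g = 0\<close> the primitive \<open>E * F1\<close> is constant, and at a
  rejecting end it tends to 0.\<close>

lemma ker_deriv:
  assumes "f \<in> ker_on X T"
  obtains k where "\<And>t. t \<in> I \<Longrightarrow> ((\<lambda>t. f (\<phi> t)) has_real_derivative k / E t) (at t)" "L.rejecting \<or> R.rejecting \<Longrightarrow> k = 0"
proof -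
  obtain M F1 F2 where d: "domain_bound M (\<lambda>t. f (\<phi> t)) F1 F2" using assms by (auto simp: X_iff ker_on_def)
  have "T f = 0" using assms by (simp add: ker_on_def)
  then have eq: "0 = A t * F2 t + B t * F1 t" if "t \<in> I" for t using T_\<phi>[OF d that] by simp
  note n = domain_necessary[OF d, of "\<lambda>_. 0", OF eq]
  define k where "k = E cL * F1 cL"
  have "((\<lambda>t. E t * F1 t) has_real_derivative 0) (at t)" if "t \<in> I" for t
    using n(3) that by (simp add: primitive_def)
  then have k: "E t * F1 t = k" if "t \<in> I" for t unfolding k_def using const_on_I[of "\<lambda>t. E t * F1 t"] points(1) that by blast
  have "k = 0" if "L.rejecting"
  proof (rule tendsto_unique[OF end_filter_neq_bot])
    show "((\<lambda>t. E t * F1 t) \<longlongrightarrow> k) (end_filter m0)" by (rule limit_left_const) (rule k)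
    show "((\<lambda>t. E t * F1 t) \<longlongrightarrow> 0) (end_filter m0)" by (rule n(1)[OF _ that])
  qed
  moreover have "k = 0" if "R.rejecting"
  proof (rule tendsto_unique[OF end_filter_neq_bot])
    show "((\<lambda>s. E (e - s) * F1 (e - s)) \<longlongrightarrow> k) (end_filter m1)" by (rule limit_right_const) (rule k)
    show "((\<lambda>s. E (e - s) * F1 (e - s)) \<longlongrightarrow> 0) (end_filter m1)" by (rule n(2)[OF _ that])
  qed
  moreover have "((\<lambda>t. f (\<phi> t)) has_real_derivative k / E t) (at t)" if t: "t \<in> I" for t
  proof -
    have "F1 t = k / E t" using k[OF t] E(2)[OF t] by (simp add: field_simps)
    moreover have "((\<lambda>t. f (\<phi> t)) has_real_derivative F1 t) (at t)" using d t by (simp add: domain_bound_def)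
    ultimately show ?thesis by simp
  qed
  ultimately show ?thesis using that by blast
qed

lemma one_ker: "ext (\<lambda>_. 1) \<in> ker_on X T"
  by (rule ext_ker[OF domain_bound_const]) simp

lemma one_nonzero: "ext (\<lambda>_. 1) \<noteq> 0"
proof
  assume "ext (\<lambda>_. 1) = 0"
  then have "ext (\<lambda>_. 1) (\<phi> cL) = 0" by simp
  then show False using ext_\<phi>[OF points(1)] by simp
qed

lemma kernel:
  "\<exists>B. ker_on X T = span B \<and> finite B \<and> independent B \<and> card B = (if L.rejecting \<or> R.rejecting then 1 else 2)"
proof (cases "L.rejecting \<or> R.rejecting")
  case True
  have "ker_on X T = span {ext (\<lambda>_. 1)}"
  proof (rule equalityI)
    show "span {ext (\<lambda>_. 1)} \<subseteq> ker_on X T" using one_ker by (intro span_minimal subspace_ker) auto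
    show "ker_on X T \<subseteq> span {ext (\<lambda>_. 1)}"
    proof
      fix f assume f: "f \<in> ker_on X T"
      have d: "((\<lambda>t. f (\<phi> t)) has_real_derivative 0) (at t)" if "t \<in> I" for t
        using ker_deriv[OF f] True that by (metis div_0)
      have c: "f (\<phi> t) = f (\<phi> cL)" if "t \<in> I" for t
        using const_on_I[of "\<lambda>t. f (\<phi> t)", OF d that points(1)] by simp
      have "f = f (\<phi> cL) *\<^sub>R ext (\<lambda>_. 1)"
      proof (rule fun_eq_by_\<phi>)
        show "f x = (f (\<phi> cL) *\<^sub>R ext (\<lambda>_. 1)) x" if "x \<notin> {0<..<1}" for x
          using that f ext_outside[OF that] unfolding ker_on_def X_iff scaleR_fun_def by auto
        show "f (\<phi> t) = (f (\<phi> cL) *\<^sub>R ext (\<lambda>_. 1)) (\<phi> t)" if "t \<in> I" for t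
          using c[OF that] by (simp add: scaleR_fun_def ext_\<phi>[OF that])
      qed
      then show "f \<in> span {ext (\<lambda>_. 1)}" by (metis span_base span_scale singletonI)
    qed
  qed
  moreover have "independent {ext (\<lambda>_. 1)}" using one_nonzero by simp
  ultimately show ?thesis using True by (intro exI[of _ "{ext (\<lambda>_. 1)}"]) simp
next
  case False
  \<comment> \<open>The constant 1 is a primitive for \<open>g = 0\<close>. As no end rejects,
    \<open>solve_primitive\<close> accepts it and returns the kernel element with derivative
    \<open>1 / E\<close>.\<close>
  have "primitive (\<lambda>_. 0) (\<lambda>_. 1)" by (simp add: primitive_def)
  then obtain M F F2 where d: "domain_bound M F (\<lambda>t. 1 / E t) F2" and eq: "\<forall>t\<in>I. A t * F2 t + B t * (1 / E t) = 0"
    using solve_primitive[OF zero_target, of "\<lambda>_. 1"] False by auto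
  have F: "(F has_real_derivative 1 / E t) (at t)" if "t \<in> I" for t using d that by (simp add: domain_bound_def)
  have Fker: "ext F \<in> ker_on X T" by (rule ext_ker[OF d]) (use eq in blast)
  have notin: "ext F \<notin> span {ext (\<lambda>_. 1)}"
  proof
    assume "ext F \<in> span {ext (\<lambda>_. 1)}"
    then obtain a where a: "ext F = a *\<^sub>R ext (\<lambda>_. 1)" by (auto simp: span_singleton)
    \<comment> \<open>If \<open>F\<close> were a constant, its derivative \<open>1 / E\<close> would
      vanish, whereas \<open>E\<close> is positive.\<close>
    have "F t = a" if "t \<in> I" for t
      using fun_cong[OF a, of "\<phi> t"] by (simp add: scaleR_fun_def ext_\<phi>[OF that])
    then have "(F has_real_derivative 0) (at cL)"
      by (intro has_field_derivative_transform_within_open[OF DERIV_const I_open points(1)]) simp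
    then have "1 / E cL = 0" using F[OF points(1)] DERIV_unique by blast
    then show False using E(2)[OF points(1)] by simp
  qed
  then have ne: "ext F \<noteq> ext (\<lambda>_. 1)" using span_base[of "ext (\<lambda>_. 1)" "{ext (\<lambda>_. 1)}"] by auto
  let ?B = "{ext F, ext (\<lambda>_. 1)}"
  have "ker_on X T = span ?B"
  proof (rule equalityI)
    show "span ?B \<subseteq> ker_on X T" using one_ker Fker by (intro span_minimal subspace_ker) auto
    show "ker_on X T \<subseteq> span ?B"
    proof
      fix f assume f: "f \<in> ker_on X T"
      obtain k where k: "\<And>t. t \<in> I \<Longrightarrow> ((\<lambda>t. f (\<phi> t)) has_real_derivative k / E t) (at t)" using ker_deriv[OF f] by blast
      have d0: "((\<lambda>t. f (\<phi> t) - k * F t) has_real_derivative 0) (at t)" if "t \<in> I" for t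
        using DERIV_diff[OF k[OF that] DERIV_cmult[OF F[OF that], of k]] by simp
      define c where "c = f (\<phi> cL) - k * F cL"
      have c: "f (\<phi> t) = k * F t + c" if "t \<in> I" for t
        using const_on_I[of "\<lambda>t. f (\<phi> t) - k * F t", OF d0 that points(1)] by (simp add: c_def)
      have "f = k *\<^sub>R ext F + c *\<^sub>R ext (\<lambda>_. 1)"
      proof (rule fun_eq_by_\<phi>)
        show "f x = (k *\<^sub>R ext F + c *\<^sub>R ext (\<lambda>_. 1)) x" if "x \<notin> {0<..<1}" for x
          using that f ext_outside[OF that] unfolding ker_on_def X_iff scaleR_fun_def plus_fun_def by auto
        show "f (\<phi> t) = (k *\<^sub>R ext F + c *\<^sub>R ext (\<lambda>_. 1)) (\<phi> t)" if "t \<in> I" for t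
          using c[OF that] by (simp add: scaleR_fun_def ext_\<phi>[OF that])
      qed
      moreover have "k *\<^sub>R ext F + c *\<^sub>R ext (\<lambda>_. 1) \<in> span ?B" by (intro span_add span_scale span_base) auto
      ultimately show "f \<in> span ?B" by simp
    qed
  qed
  moreover have "independent ?B" using notin one_nonzero ne by (simp add: independent_insert)
  ultimately show ?thesis using False ne by (intro exI[of _ ?B]) simp
qed

section \<open>The index\<close>

lemma card_obstructions:
  "card obstructions = of_bool (m0 = 1 \<and> bL = 0) + of_bool (m1 = 1 \<and> bR = 0) + of_bool (L.rejecting \<and> R.rejecting)"
proof -
  have "obstructions = (if m0 = 1 \<and> bL = 0 then {0} else {}) \<union> (if m1 = 1 \<and> bR = 0 then {1} else {})
    \<union> (if L.rejecting \<and> R.rejecting then {2} else {})" unfolding obstructions_def by auto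
  then show ?thesis by (simp split del: if_split) (simp split: if_split)
qed

lemma b_minus_eq: "b_minus K H = bL"
  unfolding b_minus_def
  by (rule tendsto_Lim[OF trivial_limit_at_right_real filterlim_compose[OF L.B_tendsto filterlim_\<psi>_left]])

lemma b_plus_eq: "b_plus K H = - bR"
  unfolding b_plus_def
proof (rule tendsto_Lim[OF trivial_limit_at_left_real])
  show "((\<lambda>x. B (\<psi> x)) \<longlongrightarrow> - bR) (at_left 1)"
    using tendsto_minus[OF filterlim_compose[OF R.B_tendsto filterlim_\<psi>_right]] by simp
qed

text \<open>The dimension of the kernel minus the condition for two rejecting ends is 2 minus the
  number of rejecting ends. A Kimura end either rejects or contributes its pointwise condition,
  since \<open>b \<ge> 0\<close> there; a quadratic end rejects unless \<open>b < 0\<close>. What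
  remains of the 2 is the number of ends with \<open>b < 0\<close>, where \<open>b\<close> is
  \<open>b_minus\<close> at the left and \<open>- b_plus\<close> at the right.\<close>

lemma index_count:
  "(if L.rejecting \<or> R.rejecting then 1 else 2) - int (card obstructions) = kappa_plus K H + kappa_minus K H"
proof -
  define p q where "p \<longleftrightarrow> m0 = 1" and "q \<longleftrightarrow> m1 = 1"
  have "p \<Longrightarrow> 0 \<le> bL" "q \<Longrightarrow> 0 \<le> bR" using bL_nonneg bR_nonneg by (auto simp: p_def q_def)
  then show ?thesis
    unfolding card_obstructions kappa_plus_def kappa_minus_def b_minus_eq b_plus_eq L.rejecting_def R.rejecting_def
      p_def[symmetric] q_def[symmetric]
    by (cases p; cases q) auto
qed

lemma kimura_fredholm:
  "fredholm X (C2_norm K H P \<gamma>) Y (aD_norm K H P \<gamma>) T \<and> fredholm_index X Y T = kappa_plus K H + kappa_minus K H"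
proof -
  obtain B where B: "ker_on X T = span B" "finite B" "independent B" "card B = (if L.rejecting \<or> R.rejecting then 1 else 2)"
    using kernel by blast
  have TY: "T ` X \<subseteq> Y" using T_X(1) by blast
  have add: "T (f + g) = T f + T g" if "f \<in> X" "g \<in> X" for f g using X_linear(2)[OF that, of 1] by simp
  have sc: "T (c *\<^sub>R f) = c *\<^sub>R T f" if "f \<in> X" for c f using X_linear(2)[OF zero_X that, of c] T_zero by simp
  have fin: "finite obstructions" by (rule finite_subset[of _ "{0, 1, 2}"]) (auto simp: obstructions_def)
  have dualY: "ext (dual_fun i) \<in> Y" if "i \<in> obstructions" for i using dual_target[OF that] ext_Y by blast
  have lin: "\<Lambda> i (g + c *\<^sub>R h) = \<Lambda> i g + c * \<Lambda> i h" if "i \<in> obstructions" "g \<in> Y" "h \<in> Y" for i g h c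
    using \<Lambda>_eq[of i "g + c *\<^sub>R h"] obstruction_linear[OF obstruction_\<Lambda>[OF that(1,2)] obstruction_\<Lambda>[OF that(1,3)], of c]
    by (simp add: scaleR_fun_def plus_fun_def)
  have dual: "\<Lambda> i (ext (dual_fun j)) = (if i = j then 1 else 0)" if "i \<in> obstructions" "j \<in> obstructions" for i j
    by (rule \<Lambda>_eq, rule obstruction_cong[OF dual_obstruction[OF that]]) (simp add: ext_\<phi>)
  have cont: "\<exists>C. \<forall>g\<in>Y. \<forall>M>0. aD_norm K H P \<gamma> g \<le> ennreal M \<longrightarrow> \<bar>\<Lambda> i g\<bar> \<le> C * M" if i: "i \<in> obstructions" for i
  proof -
    obtain C where C: "\<And>M g. target_bound M g \<Longrightarrow> \<exists>l. obstruction i g l \<and> \<bar>l\<bar> \<le> C * M" using obstruction_bounded[OF i] by blast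
    have "\<bar>\<Lambda> i g\<bar> \<le> (C * 3) * M" if g: "g \<in> Y" "0 < M" "aD_norm K H P \<gamma> g \<le> ennreal M" for g M
    proof -
      obtain l where "obstruction i (\<lambda>t. g (\<phi> t)) l" "\<bar>l\<bar> \<le> C * (3 * M)" using C[OF aD_imp_target[OF g(1,3)]] g(2) by auto
      then show ?thesis using \<Lambda>_eq by (simp add: mult.assoc)
    qed
    then show ?thesis by blast
  qed
  have fredholm: "fredholm X (C2_norm K H P \<gamma>) Y (aD_norm K H P \<gamma>) T" "fredholm_index X Y T = int (card B) - int (card obstructions)"
    using fredholm_by_functionals[where X = X and Y = Y and T = T and B = B and S = obstructions and L = \<Lambda> and e = "\<lambda>i. ext (dual_fun i)",
      OF subspace_X subspace_Y TY add sc T_bounded B(1-3) fin dualY lin dual cont range_T] by blast+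
  have "int (card B) = (if L.rejecting \<or> R.rejecting then 1 else 2)" using B(4) by simp
  then show ?thesis using fredholm(1) unfolding fredholm(2) index_count[symmetric] by (intro conjI) simp_all
qed

end

lemma (in kimura_setting) ex_kimura_solver: "\<exists>KL sL KR sR E. kimura_solver K H P \<gamma> KL sL KR sR E"
proof -
  obtain KL sL KR sR E where d:
    "0 \<le> KL \<and> 0 < sL \<and> 0 \<le> KR \<and> 0 < sR \<and>
    (\<forall>t\<in>I. (E has_real_derivative E t * B t / A t) (at t) \<and> 0 < E t) \<and>
    (\<forall>y\<in>end_int m0 cL. \<forall>z\<in>end_int m0 cL. \<bar>B y - B z\<bar> \<le> KL * \<bar>y - z\<bar>) \<and>
    (\<forall>z\<in>end_int m0 cL. \<bar>B z - bL\<bar> \<le> KL * (if m0 = 1 then z else exp (sL * z))) \<and>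
    (\<forall>y\<in>end_int m1 (e - cR). \<forall>z\<in>end_int m1 (e - cR). \<bar>- B (e - y) - (- B (e - z))\<bar> \<le> KR * \<bar>y - z\<bar>) \<and>
    (\<forall>z\<in>end_int m1 (e - cR). \<bar>- B (e - z) - bR\<bar> \<le> KR * (if m1 = 1 then z else exp (sR * z)))"
    using ex_solver_data by (elim exE)
  have "kimura_solver K H P \<gamma> KL sL KR sR E"
    unfolding kimura_solver_def kimura_solver_axioms_def using kimura_setting_axioms d by (intro conjI) (elim conjE, (assumption | blast))+
  then show ?thesis by (intro exI)
qed

theorem theorem3p1:
  fixes K :: kimura_op and H :: heat_chart and P :: cover and \<gamma> :: real
  assumes "mixed_kimura K"
    and "heat_coordinate K H"
    and "partition_cover P"
    and "0 < \<gamma>" and "\<gamma> < 1"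
  shows "fredholm (C2_space K H P \<gamma>) (C2_norm K H P \<gamma>)
                  (aD_space K H P \<gamma>) (aD_norm K H P \<gamma>) (kimura_L K)
       \<and> fredholm_index (C2_space K H P \<gamma>) (aD_space K H P \<gamma>) (kimura_L K)
           = kappa_plus K H + kappa_minus K H"
proof -
  obtain KL sL KR sR E where "kimura_solver K H P \<gamma> KL sL KR sR E"
    using kimura_setting.ex_kimura_solver[OF kimura_setting.intro[OF assms]] by (elim exE)
  then show ?thesis by (rule kimura_solver.kimura_fredholm)
qed

end
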